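(* If $M$ is an (oriented integral) homology $3$-sphere then every knot in $M$ is good.
   Context: For a knot $K$ in a compact oriented $3$-manifold $M$, $U(K)$ is a closed tubular neighbourhood and $E(K)=\overline{M\setminus U(K)}$. Here $M$ is closed. A field is a nowhere-zero vector field. A framing $F$ of $K$ (a vector field along $K$ transverse to $K$) determines a pattern $\mathcal P(K^F)$ on $\partial E(K)=\partial U(K)$ as follows: extend $F$ to a field near $K$; for $U(K)$ small this field, viewed from $E(K)$, points strictly into $E(K)$ on an open annulus (white), strictly out of $E(K)$ on an open annulus (black), and is tangent to $\partial U(K)$ along the two common boundary curves, which are parallel to the longitude determined by $F$; these tangencies are simple of concave type (the orbit of the field through the tangency point locally lies in $\mathrm{Int}(E(K))$ except at that point). $\mathrm{Eul}(E(K),\mathcal P(K^F))$ is the set of fields on $E(K)$ which point strictly inside on the white annulus, strictly outside on the black annulus and have simple concave tangency along the two curves, up to homotopy through such fields and modifications supported in balls contained in $\mathrm{Int}(E(K))$. $G(K)$ is the group of self-diffeomorphisms $f$ of $E(K)$ which are the identity near $\partial E(K)$ and whose extension to $M$ by the identity on $U(K)$ is isotopic to the identity on $M$; elements of $G(K)$ are regarded up to isotopy relative to $\partial E(K)$. $G(K)$ acts on $\mathrm{Eul}(E(K),\mathcal P(K^F))$ by push-forward of fields. $K^F$ is good if this action is trivial, and $K$ is good if $K^F$ is good for all framings $F$. *)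

theory Defs
  imports "HOL-Analysis.Analysis" "HOL-Homology.Homology"
begin

section \<open>Smooth maps and diffeomorphisms\<close>

text \<open>
  Manifolds are smooth submanifolds of a Euclidean space of arbitrary dimension, as in the books of
  Milnor and of Guillemin and Pollack. By Whitney's theorem every closed manifold is of this form
  up to diffeomorphism. Tangent vectors of \<open>M\<close> are then vectors of the ambient space.
\<close>

fun Ck_on :: "nat \<Rightarrow> 'a::real_normed_vector set \<Rightarrow> ('a \<Rightarrow> 'b::real_normed_vector) \<Rightarrow> bool" where
  "Ck_on 0 U f \<longleftrightarrow> continuous_on U f"
| "Ck_on (Suc k) U f \<longleftrightarrow>
     (\<forall>x\<in>U. f differentiable (at x)) \<and> (\<forall>u. Ck_on k U (\<lambda>x. frechet_derivative f (at x) u))"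

text \<open>Smoothness on an \<^emph>\<open>open\<close> set.\<close>

definition smooth_on_open :: "'a::real_normed_vector set \<Rightarrow> ('a \<Rightarrow> 'b::real_normed_vector) \<Rightarrow> bool" where
  "smooth_on_open U f \<longleftrightarrow> open U \<and> (\<forall>k. Ck_on k U f)"

text \<open>
  Smoothness on an arbitrary set: local extendability to smooth maps on open sets. It depends only
  on the restriction of \<open>f\<close> to \<open>X\<close>, and also covers manifolds with boundary or corners.
\<close>

definition smooth_map_on :: "'a::euclidean_space set \<Rightarrow> ('a \<Rightarrow> 'b::euclidean_space) \<Rightarrow> bool" where
  "smooth_map_on X f \<longleftrightarrow>
     (\<forall>x\<in>X. \<exists>U g. x \<in> U \<and> smooth_on_open U g \<and> (\<forall>y\<in>U \<inter> X. g y = f y))"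

definition diffeomorphism ::
    "'a::euclidean_space set \<Rightarrow> 'b::euclidean_space set \<Rightarrow> ('a \<Rightarrow> 'b) \<Rightarrow> bool" where
  "diffeomorphism X Y f \<longleftrightarrow>
     bij_betw f X Y \<and> smooth_map_on X f \<and> smooth_map_on Y (inv_into X f)"


section \<open>Closed oriented 3-manifolds and homology spheres\<close>

definition parametrization ::
    "'a::euclidean_space set \<Rightarrow> (real^3) set \<Rightarrow> (real^3 \<Rightarrow> 'a) \<Rightarrow> bool" where
  "parametrization M D \<psi> \<longleftrightarrow>
     open D \<and> openin (top_of_set M) (\<psi> ` D) \<and> diffeomorphism D (\<psi> ` D) \<psi>"

definition closed_3manifold :: "'a::euclidean_space set \<Rightarrow> bool" where
  "closed_3manifold M \<longleftrightarrow>
     compact M \<and> (\<forall>x\<in>M. \<exists>D \<psi>. parametrization M D \<psi> \<and> x \<in> \<psi> ` D)"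

definition oriented_atlas ::
    "'a::euclidean_space set \<Rightarrow> ((real^3) set \<times> (real^3 \<Rightarrow> 'a)) set \<Rightarrow> bool" where
  "oriented_atlas M \<A> \<longleftrightarrow>
     (\<forall>(D, \<psi>)\<in>\<A>. parametrization M D \<psi>) \<and>
     M = (\<Union>(D, \<psi>)\<in>\<A>. \<psi> ` D) \<and>
     (\<forall>(D, \<psi>)\<in>\<A>. \<forall>(D', \<psi>')\<in>\<A>. \<forall>p\<in>D. \<psi> p \<in> \<psi>' ` D' \<longrightarrow>
        det (matrix (frechet_derivative (inv_into D' \<psi>' \<circ> \<psi>) (at p))) > 0)"

definition integral_homology_3sphere :: "'a::euclidean_space set \<Rightarrow> bool" where
  "integral_homology_3sphere M \<longleftrightarrow>
     closed_3manifold M \<and>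
     (\<forall>p::int. homology_group p (top_of_set M) \<cong> homology_group p (nsphere 3))"


section \<open>Tangent vectors and fields\<close>

text \<open>
  The space of velocities of smooth curves. It is used only for manifolds without boundary; on a
  3-dimensional submanifold with boundary of \<open>M\<close>, the tangent space at \<open>x\<close> is \<open>tangent_space M x\<close>.
\<close>

definition tangent_space :: "'a::euclidean_space set \<Rightarrow> 'a \<Rightarrow> 'a set" where
  "tangent_space X x = {u. \<exists>\<epsilon>>0. \<exists>\<gamma>::real \<Rightarrow> 'a.
     smooth_on_open {-\<epsilon><..<\<epsilon>} \<gamma> \<and> \<gamma> ` {-\<epsilon><..<\<epsilon>} \<subseteq> X \<and>
     \<gamma> 0 = x \<and> (\<gamma> has_vector_derivative u) (at 0)}"

definition vector_field_along :: "'a::euclidean_space set \<Rightarrow> 'a set \<Rightarrow> ('a \<Rightarrow> 'a) \<Rightarrow> bool" where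
  "vector_field_along M X v \<longleftrightarrow> smooth_map_on X v \<and> (\<forall>x\<in>X. v x \<in> tangent_space M x)"

text \<open>Here a \<^emph>\<open>field\<close> is a nowhere-zero vector field.\<close>

definition field_on :: "'a::euclidean_space set \<Rightarrow> 'a set \<Rightarrow> ('a \<Rightarrow> 'a) \<Rightarrow> bool" where
  "field_on M X v \<longleftrightarrow> vector_field_along M X v \<and> (\<forall>x\<in>X. v x \<noteq> 0)"

text \<open>
  From here up to the action on Euler structures, \<open>E \<subseteq> M\<close> is a compact 3-dimensional submanifold of \<open>M\<close> and \<open>B\<close> is
  its boundary surface.
\<close>

definition points_strictly_into ::
    "'a::euclidean_space set \<Rightarrow> 'a set \<Rightarrow> 'a set \<Rightarrow> 'a \<Rightarrow> 'a \<Rightarrow> bool" where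
  "points_strictly_into M E B x u \<longleftrightarrow>
     u \<notin> tangent_space B x \<and>
     (\<exists>\<epsilon>>0. \<exists>\<gamma>::real \<Rightarrow> 'a. smooth_on_open {-\<epsilon><..<\<epsilon>} \<gamma> \<and>
        \<gamma> ` {-\<epsilon><..<\<epsilon>} \<subseteq> M \<and> \<gamma> ` {0..<\<epsilon>} \<subseteq> E \<and>
        \<gamma> 0 = x \<and> (\<gamma> has_vector_derivative u) (at 0))"

definition points_strictly_out_of ::
    "'a::euclidean_space set \<Rightarrow> 'a set \<Rightarrow> 'a set \<Rightarrow> 'a \<Rightarrow> 'a \<Rightarrow> bool" where
  "points_strictly_out_of M E B x u \<longleftrightarrow> points_strictly_into M E B x (- u)"

text \<open>
  Concavity: the orbit of \<open>v\<close> through \<open>x\<close> locally lies in the interior of \<open>E\<close> except at \<open>x\<close>.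
  Simplicity: the contact of this orbit with \<open>B\<close> is of second order exactly, where \<open>\<rho>\<close> is a
  local equation of \<open>B\<close>.
\<close>

definition simple_concave_tangency ::
    "'a::euclidean_space set \<Rightarrow> 'a set \<Rightarrow> 'a set \<Rightarrow> ('a \<Rightarrow> 'a) \<Rightarrow> 'a \<Rightarrow> bool" where
  "simple_concave_tangency M E B v x \<longleftrightarrow>
     v x \<in> tangent_space B x \<and>
     (\<exists>\<epsilon>>0. \<exists>\<gamma>::real \<Rightarrow> 'a.
        \<gamma> 0 = x \<and>
        (\<forall>t\<in>{-\<epsilon><..<\<epsilon>}. \<gamma> t \<in> E \<and> (\<gamma> has_vector_derivative v (\<gamma> t)) (at t)) \<and>
        (\<forall>t\<in>{-\<epsilon><..<\<epsilon>} - {0}. \<gamma> t \<in> E - B) \<and>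
        (\<exists>N. \<exists>\<rho>::'a \<Rightarrow> real. x \<in> N \<and> smooth_on_open N \<rho> \<and>
           (\<exists>u\<in>tangent_space M x. frechet_derivative \<rho> (at x) u \<noteq> 0) \<and>
           E \<inter> N = {y \<in> M \<inter> N. \<rho> y \<ge> 0} \<and>
           deriv (deriv (\<rho> \<circ> \<gamma>)) 0 \<noteq> 0))"


section \<open>Boundary patterns and Euler structures\<close>

text \<open>A pattern is a triple of subsets of \<open>B\<close>: white region, black region, tangency curves.\<close>

type_synonym 'a pattern = "'a set \<times> 'a set \<times> 'a set"

definition pattern_of ::
    "'a::euclidean_space set \<Rightarrow> 'a set \<Rightarrow> 'a set \<Rightarrow> ('a \<Rightarrow> 'a) \<Rightarrow> 'a pattern" where
  "pattern_of M E B v =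
     ({x \<in> B. points_strictly_into M E B x (v x)},
      {x \<in> B. points_strictly_out_of M E B x (v x)},
      {x \<in> B. v x \<in> tangent_space B x})"

definition pattern_fields ::
    "'a::euclidean_space set \<Rightarrow> 'a set \<Rightarrow> 'a set \<Rightarrow> 'a pattern \<Rightarrow> ('a \<Rightarrow> 'a) set" where
  "pattern_fields M E B P = {v. field_on M E v \<and>
     (case P of (W, Bl, C) \<Rightarrow>
        (\<forall>x\<in>W. points_strictly_into M E B x (v x)) \<and>
        (\<forall>x\<in>Bl. points_strictly_out_of M E B x (v x)) \<and>
        (\<forall>x\<in>C. simple_concave_tangency M E B v x))}"

definition homotopic_fields ::
    "'a::euclidean_space set \<Rightarrow> 'a set \<Rightarrow> 'a set \<Rightarrow> 'a pattern \<Rightarrow> ('a \<Rightarrow> 'a) \<Rightarrow> ('a \<Rightarrow> 'a) \<Rightarrow> bool" where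
  "homotopic_fields M E B P v w \<longleftrightarrow>
     (\<exists>H::real \<Rightarrow> 'a \<Rightarrow> 'a.
        smooth_map_on ({0..1} \<times> E) (\<lambda>(s, x). H s x) \<and>
        (\<forall>s\<in>{0..1}. H s \<in> pattern_fields M E B P) \<and>
        (\<forall>x\<in>E. H 0 x = v x) \<and> (\<forall>x\<in>E. H 1 x = w x))"

definition ball_modification ::
    "'a::euclidean_space set \<Rightarrow> 'a set \<Rightarrow> ('a \<Rightarrow> 'a) \<Rightarrow> ('a \<Rightarrow> 'a) \<Rightarrow> bool" where
  "ball_modification E B v w \<longleftrightarrow>
     (\<exists>\<beta>::real^3 \<Rightarrow> 'a. diffeomorphism (cball 0 1) (\<beta> ` cball 0 1) \<beta> \<and>
        \<beta> ` cball 0 1 \<subseteq> E - B \<and> (\<forall>x\<in>E - \<beta> ` cball 0 1. v x = w x))"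

definition euler_equiv ::
    "'a::euclidean_space set \<Rightarrow> 'a set \<Rightarrow> 'a set \<Rightarrow> 'a pattern \<Rightarrow> (('a \<Rightarrow> 'a) \<times> ('a \<Rightarrow> 'a)) set" where
  "euler_equiv M E B P =
     {(v, w). v \<in> pattern_fields M E B P \<and> w \<in> pattern_fields M E B P \<and>
        equivclp (\<lambda>a b. a \<in> pattern_fields M E B P \<and> b \<in> pattern_fields M E B P \<and>
                        (homotopic_fields M E B P a b \<or> ball_modification E B a b)) v w}"

definition Eul ::
    "'a::euclidean_space set \<Rightarrow> 'a set \<Rightarrow> 'a set \<Rightarrow> 'a pattern \<Rightarrow> ('a \<Rightarrow> 'a) set set" where
  "Eul M E B P = pattern_fields M E B P // euler_equiv M E B P"


section \<open>The mapping classes acting on Euler structures\<close>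

definition isotopic_to_identity :: "'a::euclidean_space set \<Rightarrow> ('a \<Rightarrow> 'a) \<Rightarrow> bool" where
  "isotopic_to_identity M f \<longleftrightarrow>
     (\<exists>H::real \<Rightarrow> 'a \<Rightarrow> 'a.
        smooth_map_on ({0..1} \<times> M) (\<lambda>(s, x). H s x) \<and>
        (\<forall>s\<in>{0..1}. diffeomorphism M M (H s)) \<and>
        (\<forall>x\<in>M. H 0 x = x) \<and> (\<forall>x\<in>M. H 1 x = f x))"

definition G_diffeos :: "'a::euclidean_space set \<Rightarrow> 'a set \<Rightarrow> 'a set \<Rightarrow> ('a \<Rightarrow> 'a) set" where
  "G_diffeos M E B = {f. diffeomorphism E E f \<and>
     (\<exists>N. open N \<and> B \<subseteq> N \<and> (\<forall>x\<in>E \<inter> N. f x = x)) \<and>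
     isotopic_to_identity M (\<lambda>x. if x \<in> E then f x else x)}"

definition isotopic_rel_boundary ::
    "'a::euclidean_space set \<Rightarrow> 'a set \<Rightarrow> ('a \<Rightarrow> 'a) \<Rightarrow> ('a \<Rightarrow> 'a) \<Rightarrow> bool" where
  "isotopic_rel_boundary E B f g \<longleftrightarrow>
     (\<exists>H::real \<Rightarrow> 'a \<Rightarrow> 'a.
        smooth_map_on ({0..1} \<times> E) (\<lambda>(s, x). H s x) \<and>
        (\<forall>s\<in>{0..1}. diffeomorphism E E (H s) \<and> (\<forall>x\<in>B. H s x = x)) \<and>
        (\<forall>x\<in>E. H 0 x = f x) \<and> (\<forall>x\<in>E. H 1 x = g x))"

definition G_group :: "'a::euclidean_space set \<Rightarrow> 'a set \<Rightarrow> 'a set \<Rightarrow> ('a \<Rightarrow> 'a) set set" where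
  "G_group M E B = G_diffeos M E B //
     {(f, g). f \<in> G_diffeos M E B \<and> g \<in> G_diffeos M E B \<and> isotopic_rel_boundary E B f g}"

text \<open>
  \<open>frechet_derivative f (at y within E)\<close> is some derivative of \<open>f\<close> along \<open>E\<close>. Any two of them agree
  on the tangent space of \<open>E\<close> at \<open>y\<close>, so on \<open>v y\<close>.
\<close>

definition push_forward ::
    "'a::euclidean_space set \<Rightarrow> ('a \<Rightarrow> 'a) \<Rightarrow> ('a \<Rightarrow> 'a) \<Rightarrow> 'a \<Rightarrow> 'a" where
  "push_forward E f v x =
     (let y = inv_into E f x in frechet_derivative f (at y within E) (v y))"

definition euler_action ::
    "'a::euclidean_space set \<Rightarrow> 'a set \<Rightarrow> 'a set \<Rightarrow> 'a pattern \<Rightarrow>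
      ('a \<Rightarrow> 'a) set \<Rightarrow> ('a \<Rightarrow> 'a) set \<Rightarrow> ('a \<Rightarrow> 'a) set" where
  "euler_action M E B P g e = euler_equiv M E B P `` {push_forward E f v | f v. f \<in> g \<and> v \<in> e}"


section \<open>Knots, tubular neighbourhoods, exteriors and framings\<close>

definition knot :: "'a::euclidean_space set \<Rightarrow> 'a set \<Rightarrow> bool" where
  "knot M K \<longleftrightarrow> K \<subseteq> M \<and> (\<exists>c. diffeomorphism (sphere (0::complex) 1) K c)"

text \<open>
  A parametrized closed tubular neighbourhood. It is a solid torus since \<open>M\<close> is orientable. The
  radius \<open>r \<in> (0,1]\<close> below gives the closed tubular neighbourhoods shrinking to \<open>K\<close>.
\<close>

definition tubular_param ::
    "'a::euclidean_space set \<Rightarrow> 'a set \<Rightarrow> (complex \<times> complex \<Rightarrow> 'a) \<Rightarrow> bool" where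
  "tubular_param M K \<phi> \<longleftrightarrow>
     diffeomorphism (sphere 0 1 \<times> cball 0 1) (\<phi> ` (sphere 0 1 \<times> cball 0 1)) \<phi> \<and>
     \<phi> ` (sphere 0 1 \<times> cball 0 1) \<subseteq> M \<and> \<phi> ` (sphere 0 1 \<times> {0}) = K"

definition tube :: "(complex \<times> complex \<Rightarrow> 'a::euclidean_space) \<Rightarrow> real \<Rightarrow> 'a set" where
  "tube \<phi> r = \<phi> ` (sphere 0 1 \<times> cball 0 r)"

definition exterior ::
    "'a::euclidean_space set \<Rightarrow> (complex \<times> complex \<Rightarrow> 'a) \<Rightarrow> real \<Rightarrow> 'a set" where
  "exterior M \<phi> r = closure (M - tube \<phi> r)"

text \<open>The torus bounding both the tube and the exterior.\<close>

definition boundary_torus ::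
    "'a::euclidean_space set \<Rightarrow> (complex \<times> complex \<Rightarrow> 'a) \<Rightarrow> real \<Rightarrow> 'a set" where
  "boundary_torus M \<phi> r = exterior M \<phi> r \<inter> tube \<phi> r"

definition framing :: "'a::euclidean_space set \<Rightarrow> 'a set \<Rightarrow> ('a \<Rightarrow> 'a) \<Rightarrow> bool" where
  "framing M K F \<longleftrightarrow> vector_field_along M K F \<and> (\<forall>x\<in>K. F x \<notin> tangent_space K x)"

definition extends_framing ::
    "'a::euclidean_space set \<Rightarrow> 'a set \<Rightarrow> ('a \<Rightarrow> 'a) \<Rightarrow> ('a \<Rightarrow> 'a) \<Rightarrow> bool" where
  "extends_framing M K F v \<longleftrightarrow>
     (\<exists>N. open N \<and> K \<subseteq> N \<and> field_on M (M \<inter> N) v) \<and> (\<forall>x\<in>K. v x = F x)"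


section \<open>Good knots\<close>

text \<open>
  The pattern of the framed knot is read off the extended field \<open>v\<close> on the boundary of a small tube
  (the white and black regions are then open annuli, and the tangencies are simple and concave along
  two parallels of the longitude given by \<open>F\<close>). It does not depend, up to diffeomorphism, on the
  choice of tube and of \<open>v\<close>; all choices are quantified over, with \<^emph>\<open>small\<close> expressed by the filter.
\<close>

definition good_framed_knot :: "'a::euclidean_space set \<Rightarrow> 'a set \<Rightarrow> ('a \<Rightarrow> 'a) \<Rightarrow> bool" where
  "good_framed_knot M K F \<longleftrightarrow>
     (\<forall>\<phi> v. tubular_param M K \<phi> \<and> extends_framing M K F v \<longrightarrow>
        (\<forall>\<^sub>F r in at_right 0.
           let E = exterior M \<phi> r; B = boundary_torus M \<phi> r; P = pattern_of M E B v in
           \<forall>g\<in>G_group M E B. \<forall>e\<in>Eul M E B P. euler_action M E B P g e = e))"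

definition good_knot :: "'a::euclidean_space set \<Rightarrow> 'a set \<Rightarrow> bool" where
  "good_knot M K \<longleftrightarrow> (\<forall>F. framing M K F \<longrightarrow> good_framed_knot M K F)"

end

theory Submission
  imports Defs
begin

text \<open>
  Let \<open>v\<close> be adapted to the pattern and let the diffeomorphism \<open>f\<close> be the end of an isotopy \<open>H\<close> of \<open>M\<close>. On the boundary
  torus the push-forward of \<open>v\<close> is never opposite to the field that defines the pattern, so it extends to a field \<open>V\<close> on \<open>M\<close>.
  The fields \<open>W s\<close>, obtained by pulling \<open>V\<close> back along \<open>H s\<close>, lead from \<open>V\<close> to a field that extends \<open>v\<close>. They are not
  adapted to the pattern near the boundary, but on a tube around the knot they form a loop. It remains to contract
  this loop, that is, a map from the solid torus times the circle to the sphere. The only obstruction is the degree of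
  its restriction to the product of the core of the tube and the circle.

  The degree is half the value, on the torus \<open>(t, s) \<mapsto> H s (k t)\<close> swept out by the knot \<open>k\<close>, of the Euler class of the plane bundle
  normal to \<open>V\<close>. This value is zero because the second homology of \<open>M\<close> vanishes. The class is represented by a cochain on singular simplices
  that measures how sections rotate along edges. Lifts to unit quaternions of maps to the sphere replace homotopy groups, and
  the Weierstrass approximation theorem makes the resulting homotopy of fields smooth.
\<close>

section \<open>Calculus of smooth maps\<close>

text \<open>The isotopy already supplies a homotopy of fields on all of \<open>M\<close>; only its
  behaviour near the boundary is at fault. A concave tangency is a condition on the germ of the
  field at the boundary and does not survive approximation, so the homotopy has to become literally
  constant near the boundary torus, while its two ends must stay as they are. The solid torus times
  the circle retracts to the torus formed by the core and the circle, which is why a single number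
  obstructs. If it vanishes, the field at time \<open>s\<close> arises from the field at time
  \<open>0\<close> by a map from this torus to the unit quaternions; these form a sphere of
  dimension three, so the map is null-homotopic. The factor one half comes from the quaternions as
  well: a right factor \<open>cis a\<close> turns the plane normal to the axis by
  \<open>2 * a\<close>. The isotopy does not act by isometries, so rotations along the edges are
  known only up to an error. The degree is an integer, and the estimates are just sharp enough to
  determine it. Opposite fields are excluded because a convex combination with the field defining
  the pattern has to extend the push-forward over the tube.\<close>

lemma Ck_on_cong:
  assumes "open U" "\<And>x. x \<in> U \<Longrightarrow> f x = g x" "Ck_on k U f"
  shows "Ck_on k U g"
  using assms(2,3)
proof (induction k arbitrary: f g)
  case 0
  then show ?case by (simp cong: continuous_on_cong)
next
  case (Suc k)
  have D: "(g has_derivative frechet_derivative f (at x)) (at x)" if "x \<in> U" for x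
    using Suc.prems that \<open>open U\<close> frechet_derivative_works has_derivative_transform_within_open
    by (metis (no_types, lifting) Ck_on.simps(2))
  then have E: "frechet_derivative f (at x) = frechet_derivative g (at x)" if "x \<in> U" for x
    using that frechet_derivative_at by blast
  show ?case
    unfolding Ck_on.simps
  proof (intro conjI ballI allI)
    fix x assume "x \<in> U" then show "g differentiable (at x)"
      using D differentiable_def by blast
  next
    fix u show "Ck_on k U (\<lambda>x. frechet_derivative g (at x) u)"
      by (rule Suc.IH[of "\<lambda>x. frechet_derivative f (at x) u"]) (use E Suc.prems in auto)
  qed
qed

text \<open>On an open set every derivative agrees with \<open>frechet_derivative\<close>, so an
  explicit one may be used in inductions. It is examined in each fixed direction \<open>u\<close>
  only, which keeps the recursion among maps with the same codomain.\<close>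

lemma Ck_on_SucI:
  assumes "open U" "\<And>x. x \<in> U \<Longrightarrow> (f has_derivative f' x) (at x)"
    and "\<And>u. Ck_on k U (\<lambda>x. f' x u)"
  shows "Ck_on (Suc k) U f"
  unfolding Ck_on.simps
proof (intro conjI ballI allI)
  fix x assume "x \<in> U" then show "f differentiable (at x)"
    using assms(2) differentiable_def by blast
next
  fix u show "Ck_on k U (\<lambda>x. frechet_derivative f (at x) u)"
    by (rule Ck_on_cong[OF assms(1) _ assms(3)[of u]]) (metis assms(2) frechet_derivative_at)
qed

lemma Ck_on_SucD:
  assumes "Ck_on (Suc k) U f"
  shows "\<And>x. x \<in> U \<Longrightarrow> (f has_derivative frechet_derivative f (at x)) (at x)"
    and "\<And>u. Ck_on k U (\<lambda>x. frechet_derivative f (at x) u)"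
  using assms by (auto simp: frechet_derivative_works)

lemma Ck_on_continuous: "Ck_on k U f \<Longrightarrow> continuous_on U f"
  by (cases k) (auto simp: continuous_at_imp_continuous_on differentiable_imp_continuous_within)

lemma Ck_on_Suc_imp: "Ck_on (Suc k) U f \<Longrightarrow> Ck_on k U f"
proof (induction k arbitrary: f)
  case 0 then show ?case using Ck_on_continuous[OF 0] by simp
next
  case (Suc k)
  show ?case
    unfolding Ck_on.simps(2)[of k] using Suc.IH Suc.prems unfolding Ck_on.simps(2)[of "Suc k"] by blast
qed

lemma Ck_on_subset: "Ck_on k U f \<Longrightarrow> V \<subseteq> U \<Longrightarrow> Ck_on k V f"
  by (induction k arbitrary: f) (auto intro: continuous_on_subset)

lemma Ck_on_Un:
  assumes "open U" "open V" "Ck_on k U f" "Ck_on k V f"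
  shows "Ck_on k (U \<union> V) f"
  using assms(3,4) by (induction k arbitrary: f) (auto intro: continuous_on_open_Un assms(1,2))

lemma Ck_on_const: "open U \<Longrightarrow> Ck_on k U (\<lambda>x. c)"
proof (induction k arbitrary: c)
  case (Suc k) show ?case
    by (rule Ck_on_SucI[where f'="\<lambda>x u. 0"]) (use Suc in \<open>auto intro!: derivative_eq_intros\<close>)
qed auto

lemma Ck_on_bounded_linear:
  assumes "bounded_linear L" "open U" "Ck_on k U f"
  shows "Ck_on k U (\<lambda>x. L (f x))"
  using assms(3)
proof (induction k arbitrary: f)
  case 0 then show ?case
    by (auto intro: bounded_linear.continuous_on[OF assms(1)])
next
  case (Suc k)
  show ?case
    by (rule Ck_on_SucI[OF assms(2), where f'="\<lambda>x u. L (frechet_derivative f (at x) u)"])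
      (use Suc Ck_on_SucD[OF Suc.prems] in \<open>auto intro: bounded_linear.has_derivative[OF assms(1)]\<close>)
qed

lemma Ck_on_linear: "bounded_linear L \<Longrightarrow> open U \<Longrightarrow> Ck_on k U L"
proof (cases k)
  case 0 assume "bounded_linear L" then show ?thesis
    using 0 by (simp add: linear_continuous_on)
next
  case (Suc m)
  assume "bounded_linear L" "open U"
  then show ?thesis unfolding Suc
    by (intro Ck_on_SucI[where f'="\<lambda>x. L"]) (auto intro: bounded_linear_imp_has_derivative Ck_on_const)
qed

lemma Ck_on_add:
  assumes "open U" "Ck_on k U f" "Ck_on k U g"
  shows "Ck_on k U (\<lambda>x. f x + g x)"
  using assms(2,3)
proof (induction k arbitrary: f g)
  case 0 then show ?case by (auto intro: continuous_intros)
next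
  case (Suc k)
  show ?case
    by (rule Ck_on_SucI[OF assms(1), where f'="\<lambda>x u. frechet_derivative f (at x) u + frechet_derivative g (at x) u"])
      (use Suc Ck_on_SucD[OF Suc.prems(1)] Ck_on_SucD[OF Suc.prems(2)] in \<open>auto intro: has_derivative_add\<close>)
qed

lemma Ck_on_bilinear:
  assumes h: "bounded_bilinear h" and "open U" "Ck_on k U f" "Ck_on k U g"
  shows "Ck_on k U (\<lambda>x. h (f x) (g x))"
  using assms(3,4)
proof (induction k arbitrary: f g)
  case 0 then show ?case by (auto intro: bounded_bilinear.continuous_on[OF h])
next
  case (Suc k)
  show ?case
    by (rule Ck_on_SucI[OF assms(2), where f'="\<lambda>x u. h (f x) (frechet_derivative g (at x) u) + h (frechet_derivative f (at x) u) (g x)"])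
      (use Suc Ck_on_SucD[OF Suc.prems(1)] Ck_on_SucD[OF Suc.prems(2)] assms(2)
          Ck_on_Suc_imp[OF Suc.prems(1)] Ck_on_Suc_imp[OF Suc.prems(2)] in
        \<open>auto intro!: bounded_bilinear.FDERIV[OF h] Ck_on_add\<close>)
qed

lemma Ck_on_sum:
  assumes "open U" "\<And>i. i \<in> I \<Longrightarrow> Ck_on k U (f i)"
  shows "Ck_on k U (\<lambda>x. \<Sum>i\<in>I. f i x)"
  using assms(2)
  by (induction I rule: infinite_finite_induct) (auto intro: Ck_on_const Ck_on_add assms(1))

lemma Ck_on_Pair:
  assumes "open U" "Ck_on k U f" "Ck_on k U g"
  shows "Ck_on k U (\<lambda>x. (f x, g x))"
proof -
  have "Ck_on k U (\<lambda>x. (f x, 0) + (0, g x))"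
    by (intro Ck_on_add Ck_on_bounded_linear[where L="\<lambda>a. (a, 0)"]
        Ck_on_bounded_linear[where L="\<lambda>a. (0, a)"] assms)
      (auto intro!: bounded_linear_Pair bounded_linear_ident bounded_linear_zero)
  then show ?thesis by simp
qed

lemma linear_expand_Basis:
  fixes x :: "'b::euclidean_space"
  assumes "linear L"
  shows "L x = (\<Sum>b\<in>Basis. (x \<bullet> b) *\<^sub>R L b)"
  by (metis (no_types, lifting) assms euclidean_representation linear_scale linear_sum sum.cong)

lemma Ck_on_compose:
  fixes f :: "'a::real_normed_vector \<Rightarrow> 'b::euclidean_space"
  assumes "open U" "open V" "Ck_on k V g" "Ck_on k U f" "f ` U \<subseteq> V"
  shows "Ck_on k U (\<lambda>x. g (f x))"
  using assms(3,4)
proof (induction k arbitrary: g)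
  case 0 then show ?case using assms(5) by (auto intro: continuous_on_compose2)
next
  case (Suc k)
  note Dg = Ck_on_SucD[OF Suc.prems(1)] and Df = Ck_on_SucD[OF Suc.prems(2)]
  show ?case
  proof (rule Ck_on_SucI[OF assms(1), where f'="\<lambda>x u. frechet_derivative g (at (f x)) (frechet_derivative f (at x) u)"])
    show "((\<lambda>x. g (f x)) has_derivative (\<lambda>u. frechet_derivative g (at (f x)) (frechet_derivative f (at x) u))) (at x)" if "x \<in> U" for x
      using that assms(5) Dg(1) Df(1) has_derivative_compose[of f _ x UNIV g] by blast
    fix u
    \<comment> \<open>\<open>Ck_on\<close> controls the derivative of \<open>g\<close> in fixed
      directions, but the chain rule applies it to a moving vector. Expanding that vector in a basis
      reduces the one to the other.\<close>
    have "Ck_on k U (\<lambda>x. \<Sum>b\<in>Basis. (frechet_derivative f (at x) u \<bullet> b) *\<^sub>R frechet_derivative g (at (f x)) b)"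
      by (intro Ck_on_sum Ck_on_bilinear[OF bounded_bilinear_scaleR] assms(1) Suc.IH Dg
          Ck_on_Suc_imp[OF Suc.prems(2)] Ck_on_bounded_linear[where L="\<lambda>y. y \<bullet> _"] bounded_linear_inner_left Df)
    then show "Ck_on k U (\<lambda>x. frechet_derivative g (at (f x)) (frechet_derivative f (at x) u))"
    proof (rule Ck_on_cong[OF assms(1), rotated])
      fix x assume "x \<in> U"
      then have "linear (frechet_derivative g (at (f x)))"
        using Dg(1) assms(5) has_derivative_linear by blast
      then show "(\<Sum>b\<in>Basis. (frechet_derivative f (at x) u \<bullet> b) *\<^sub>R frechet_derivative g (at (f x)) b) =
          frechet_derivative g (at (f x)) (frechet_derivative f (at x) u)"
        by (simp only: linear_expand_Basis[symmetric])
    qed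
  qed
qed

section \<open>Smooth maps on open sets\<close>

lemma smooth_on_open_cong:
  "smooth_on_open U f \<Longrightarrow> (\<And>x. x \<in> U \<Longrightarrow> f x = g x) \<Longrightarrow> smooth_on_open U g"
  unfolding smooth_on_open_def using Ck_on_cong by blast

lemma smooth_on_open_subset: "smooth_on_open U f \<Longrightarrow> open V \<Longrightarrow> V \<subseteq> U \<Longrightarrow> smooth_on_open V f"
  unfolding smooth_on_open_def using Ck_on_subset by blast

lemma smooth_on_open_Un: "smooth_on_open U f \<Longrightarrow> smooth_on_open V f \<Longrightarrow> smooth_on_open (U \<union> V) f"
  unfolding smooth_on_open_def using Ck_on_Un by blast

lemma smooth_on_open_const [simp]: "open U \<Longrightarrow> smooth_on_open U (\<lambda>x. c)"
  unfolding smooth_on_open_def using Ck_on_const by blast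

lemma smooth_on_open_linear: "bounded_linear L \<Longrightarrow> open U \<Longrightarrow> smooth_on_open U L"
  unfolding smooth_on_open_def using Ck_on_linear by blast

lemma smooth_on_open_ident: "open U \<Longrightarrow> smooth_on_open U (\<lambda>x. x)"
  by (rule smooth_on_open_linear) auto

lemma smooth_on_open_bounded_linear:
  "bounded_linear L \<Longrightarrow> smooth_on_open U f \<Longrightarrow> smooth_on_open U (\<lambda>x. L (f x))"
  unfolding smooth_on_open_def using Ck_on_bounded_linear by blast

lemma smooth_on_open_add:
  "smooth_on_open U f \<Longrightarrow> smooth_on_open U g \<Longrightarrow> smooth_on_open U (\<lambda>x. f x + g x)"
  unfolding smooth_on_open_def using Ck_on_add by blast

lemma smooth_on_open_bilinear:
  "bounded_bilinear h \<Longrightarrow> smooth_on_open U f \<Longrightarrow> smooth_on_open U g \<Longrightarrow> smooth_on_open U (\<lambda>x. h (f x) (g x))"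
  unfolding smooth_on_open_def using Ck_on_bilinear by blast

lemmas smooth_on_open_scaleR = smooth_on_open_bilinear[OF bounded_bilinear_scaleR]
  and smooth_on_open_mult = smooth_on_open_bilinear[OF bounded_bilinear_mult]
  and smooth_on_open_inner = smooth_on_open_bilinear[OF bounded_bilinear_inner]

lemma smooth_on_open_minus:
  "smooth_on_open U f \<Longrightarrow> smooth_on_open U (\<lambda>x. - f x)"
  by (rule smooth_on_open_bounded_linear[OF bounded_linear_minus[OF bounded_linear_ident]])

lemma smooth_on_open_diff:
  "smooth_on_open U f \<Longrightarrow> smooth_on_open U g \<Longrightarrow> smooth_on_open U (\<lambda>x. f x - g x)"
  using smooth_on_open_add[of U f "\<lambda>x. - g x"] smooth_on_open_minus by auto

lemma smooth_on_open_sum: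
  "open U \<Longrightarrow> (\<And>i. i \<in> I \<Longrightarrow> smooth_on_open U (f i)) \<Longrightarrow> smooth_on_open U (\<lambda>x. \<Sum>i\<in>I. f i x)"
  unfolding smooth_on_open_def by (simp add: Ck_on_sum)

lemma smooth_on_open_Pair:
  "smooth_on_open U f \<Longrightarrow> smooth_on_open U g \<Longrightarrow> smooth_on_open U (\<lambda>x. (f x, g x))"
  unfolding smooth_on_open_def using Ck_on_Pair by blast

lemma smooth_on_open_compose:
  fixes f :: "'a::real_normed_vector \<Rightarrow> 'b::euclidean_space"
  shows "smooth_on_open V g \<Longrightarrow> smooth_on_open U f \<Longrightarrow> f ` U \<subseteq> V \<Longrightarrow> smooth_on_open U (\<lambda>x. g (f x))"
  unfolding smooth_on_open_def using Ck_on_compose by blast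

lemma smooth_on_open_has_derivative:
  "smooth_on_open U f \<Longrightarrow> x \<in> U \<Longrightarrow> (f has_derivative frechet_derivative f (at x)) (at x)"
  unfolding smooth_on_open_def using Ck_on_SucD(1) by blast

lemma smooth_on_open_linear_derivative:
  "smooth_on_open U f \<Longrightarrow> x \<in> U \<Longrightarrow> linear (frechet_derivative f (at x))"
  using smooth_on_open_has_derivative has_derivative_linear by blast

lemma smooth_on_open_continuous: "smooth_on_open U f \<Longrightarrow> continuous_on U f"
  unfolding smooth_on_open_def using Ck_on_continuous by blast

lemma smooth_on_open_derivative:
  "smooth_on_open U f \<Longrightarrow> smooth_on_open U (\<lambda>x. frechet_derivative f (at x) u)"
  unfolding smooth_on_open_def using Ck_on_SucD(2) by blast

lemma smooth_on_open_derivative_field: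
  fixes f :: "'a::euclidean_space \<Rightarrow> 'b::euclidean_space"
  assumes "smooth_on_open U f" "smooth_on_open U v"
  shows "smooth_on_open U (\<lambda>x. frechet_derivative f (at x) (v x))"
proof -
  have "open U" using assms smooth_on_open_def by blast
  then have "smooth_on_open U (\<lambda>x. \<Sum>b\<in>Basis. (v x \<bullet> b) *\<^sub>R frechet_derivative f (at x) b)"
    by (intro smooth_on_open_sum smooth_on_open_scaleR smooth_on_open_derivative assms smooth_on_open_inner) auto
  then show ?thesis
    by (rule smooth_on_open_cong)
      (simp only: linear_expand_Basis[OF smooth_on_open_linear_derivative[OF assms(1)], symmetric])
qed

lemma continuous_on_derivative:
  fixes f :: "'a::euclidean_space \<Rightarrow> 'b::euclidean_space"
  assumes "smooth_on_open U f"
  shows "continuous_on (U \<times> UNIV) (\<lambda>(x, u). frechet_derivative f (at x) u)"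
proof -
  have "continuous_on (U \<times> UNIV) (\<lambda>p. \<Sum>b\<in>Basis. (snd p \<bullet> b) *\<^sub>R frechet_derivative f (at (fst p)) b)"
    by (intro continuous_intros continuous_on_compose2[OF smooth_on_open_continuous[OF smooth_on_open_derivative[OF assms]]]) auto
  moreover have "(\<Sum>b\<in>Basis. (snd p \<bullet> b) *\<^sub>R frechet_derivative f (at (fst p)) b) = (case p of (x, u) \<Rightarrow> frechet_derivative f (at x) u)" if "p \<in> U \<times> UNIV" for p
    using that linear_expand_Basis[OF smooth_on_open_linear_derivative[OF assms], of "fst p" "snd p"] by (auto split: prod.splits)
  ultimately show ?thesis by (metis (no_types, lifting) continuous_on_cong)
qed

section \<open>Smooth maps on arbitrary subsets\<close>

lemma smooth_map_onI:
  assumes "\<And>x. x \<in> X \<Longrightarrow> \<exists>U g. x \<in> U \<and> smooth_on_open U g \<and> (\<forall>y\<in>U \<inter> X. g y = f y)"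
  shows "smooth_map_on X f"
  unfolding smooth_map_on_def using assms by blast

lemma smooth_map_onE:
  assumes "smooth_map_on X f" "x \<in> X"
  obtains U g where "open U" "x \<in> U" "smooth_on_open U g" "\<forall>y\<in>U \<inter> X. g y = f y"
  using assms unfolding smooth_map_on_def smooth_on_open_def by (metis IntI)

lemma smooth_map_on_cong: "smooth_map_on X f \<Longrightarrow> (\<And>x. x \<in> X \<Longrightarrow> f x = g x) \<Longrightarrow> smooth_map_on X g"
  unfolding smooth_map_on_def by (metis IntE)

lemma smooth_on_open_imp_map: "smooth_on_open U f \<Longrightarrow> X \<subseteq> U \<Longrightarrow> smooth_map_on X f"
  unfolding smooth_map_on_def by blast

text \<open>Over an open set a local extension agrees with \<open>f\<close> on a smaller open set,
  so \<open>f\<close> itself is \<open>Ck_on\<close> there; the pieces are glued because this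
  property is local.\<close>

lemma smooth_map_on_imp_open:
  assumes "smooth_map_on U f" "open U"
  shows "smooth_on_open U f"
  unfolding smooth_on_open_def
proof (intro conjI allI)
  fix k
  have *: "\<exists>V. open V \<and> x \<in> V \<and> V \<subseteq> U \<and> Ck_on k V f" if "x \<in> U" for x
  proof -
    obtain V g where V: "open V" "x \<in> V" "smooth_on_open V g" "\<forall>y\<in>V \<inter> U. g y = f y"
      using assms(1) \<open>x \<in> U\<close> by (rule smooth_map_onE)
    have "Ck_on k (V \<inter> U) f"
      by (rule Ck_on_cong[of _ g]) (use V assms in \<open>auto simp: smooth_on_open_def intro: Ck_on_subset\<close>)
    then show ?thesis using V that assms(2) by (intro exI[of _ "V \<inter> U"]) auto
  qed
  then obtain V where V: "\<And>x. x \<in> U \<Longrightarrow> open (V x) \<and> x \<in> V x \<and> V x \<subseteq> U \<and> Ck_on k (V x) f" by metis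
  have "Ck_on k (\<Union>x\<in>U. V x) f"
  proof -
    have "Ck_on k (\<Union>x\<in>U. V x) f" if "\<And>x. x \<in> U \<Longrightarrow> Ck_on k (V x) f" for f :: "'a \<Rightarrow> 'b"
      using that
    proof (induction k arbitrary: f)
      case 0 then show ?case using V by (auto intro!: continuous_on_open_UN)
    qed auto
    then show ?thesis using V by blast
  qed
  moreover have "(\<Union>x\<in>U. V x) = U" using V by blast
  ultimately show "Ck_on k U f" by simp
qed (fact assms(2))

lemma smooth_map_on_open_iff: "open U \<Longrightarrow> smooth_map_on U f \<longleftrightarrow> smooth_on_open U f"
  using smooth_map_on_imp_open smooth_on_open_imp_map by blast

lemma smooth_map_on_compose:
  assumes "smooth_map_on Y g" "smooth_map_on X f" "f ` X \<subseteq> Y"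
  shows "smooth_map_on X (\<lambda>x. g (f x))"
proof (rule smooth_map_onI)
  fix x assume x: "x \<in> X"
  obtain U F where U: "open U" "x \<in> U" "smooth_on_open U F" "\<forall>y\<in>U \<inter> X. F y = f y"
    using assms(2) x by (rule smooth_map_onE)
  have "f x \<in> Y" using x assms(3) by blast
  from assms(1) this obtain V G where V: "open V" "f x \<in> V" "smooth_on_open V G" "\<forall>y\<in>V \<inter> Y. G y = g y"
    by (rule smooth_map_onE)
  have op: "open (U \<inter> F -` V)"
    using U V smooth_on_open_continuous continuous_on_open_vimage by (metis Int_commute)
  have "smooth_on_open (U \<inter> F -` V) (\<lambda>x. G (F x))"
    by (rule smooth_on_open_compose[OF V(3)]) (use op U in \<open>auto intro: smooth_on_open_subset\<close>)
  then show "\<exists>U h. x \<in> U \<and> smooth_on_open U h \<and> (\<forall>y\<in>U \<inter> X. h y = g (f y))"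
    using U V x assms(3) by (intro exI[of _ "U \<inter> F -` V"] exI[of _ "\<lambda>x. G (F x)"]) auto
qed

lemma smooth_map_on_Pair:
  assumes "smooth_map_on X f" "smooth_map_on X g"
  shows "smooth_map_on X (\<lambda>x. (f x, g x))"
proof (rule smooth_map_onI)
  fix x assume x: "x \<in> X"
  obtain U F where U: "open U" "x \<in> U" "smooth_on_open U F" "\<forall>y\<in>U \<inter> X. F y = f y"
    using assms(1) x by (rule smooth_map_onE)
  obtain V G where V: "open V" "x \<in> V" "smooth_on_open V G" "\<forall>y\<in>V \<inter> X. G y = g y"
    using assms(2) x by (rule smooth_map_onE)
  show "\<exists>U h. x \<in> U \<and> smooth_on_open U h \<and> (\<forall>y\<in>U \<inter> X. h y = (f y, g y))"
    using U V x
    by (intro exI[of _ "U \<inter> V"] exI[of _ "\<lambda>x. (F x, G x)"] conjI smooth_on_open_Pair)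
      (auto intro: smooth_on_open_subset)
qed

lemma smooth_map_on_compose_open:
  "smooth_on_open UNIV g \<Longrightarrow> smooth_map_on X f \<Longrightarrow> smooth_map_on X (\<lambda>x. g (f x))"
  using smooth_map_on_compose[of UNIV g X f] by (simp add: smooth_map_on_open_iff)

lemma smooth_map_on_linear: "bounded_linear L \<Longrightarrow> smooth_map_on X L"
  by (rule smooth_on_open_imp_map[of UNIV]) (auto intro: smooth_on_open_linear)

lemma smooth_map_on_const [simp]: "smooth_map_on X (\<lambda>x. c)"
  by (rule smooth_on_open_imp_map[of UNIV]) auto

lemma smooth_map_on_ident: "smooth_map_on X (\<lambda>x. x)"
  by (rule smooth_map_on_linear) auto

lemma smooth_map_on_bilinear:
  fixes h :: "'b::euclidean_space \<Rightarrow> 'c::euclidean_space \<Rightarrow> 'd::euclidean_space"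
  assumes "bounded_bilinear h" "smooth_map_on X f" "smooth_map_on X g"
  shows "smooth_map_on X (\<lambda>x. h (f x) (g x))"
proof -
  have "smooth_on_open UNIV (\<lambda>p. h (fst p) (snd p))"
    by (rule smooth_on_open_bilinear[OF assms(1)]; rule smooth_on_open_linear) (auto intro: bounded_linear_fst bounded_linear_snd)
  from smooth_map_on_compose_open[OF this smooth_map_on_Pair[OF assms(2,3)]] show ?thesis by simp
qed

lemmas smooth_map_on_scaleR = smooth_map_on_bilinear[OF bounded_bilinear_scaleR]

lemma smooth_map_on_add:
  assumes "smooth_map_on X f" "smooth_map_on X g"
  shows "smooth_map_on X (\<lambda>x. f x + g x)"
  using smooth_map_on_compose[OF smooth_map_on_linear[where L="\<lambda>p. fst p + snd p" and X=UNIV] smooth_map_on_Pair[OF assms]]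
  by (simp add: bounded_linear_add bounded_linear_fst bounded_linear_snd)

lemma smooth_map_on_diff:
  assumes "smooth_map_on X f" "smooth_map_on X g"
  shows "smooth_map_on X (\<lambda>x. f x - g x)"
  using smooth_map_on_compose[OF smooth_map_on_linear[where L="\<lambda>p. fst p - snd p" and X=UNIV] smooth_map_on_Pair[OF assms]]
  by (simp add: bounded_linear_sub bounded_linear_fst bounded_linear_snd)

lemma smooth_map_on_continuous: 
  assumes "smooth_map_on X f" shows "continuous_on X f"
  unfolding continuous_on_eq_continuous_within
proof
  fix x assume x: "x \<in> X"
  obtain U g where U: "open U" "x \<in> U" "smooth_on_open U g" "\<forall>y\<in>U \<inter> X. g y = f y"
    using assms x by (rule smooth_map_onE)
  have "isCont g x" using U smooth_on_open_continuous continuous_on_eq_continuous_at by blast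
  then have "continuous (at x within X) g" by (rule continuous_at_imp_continuous_within)
  then show "continuous (at x within X) f"
    by (rule continuous_transform_within_openin[of _ _ _ "X \<inter> U"]) (use U x in \<open>auto simp: openin_open_Int\<close>)
qed

subsection \<open>Cutoff functions and polynomials\<close>

lemma Ck_on_real_SucI:
  fixes f :: "real \<Rightarrow> real"
  assumes "open U" "\<And>x. x \<in> U \<Longrightarrow> (f has_real_derivative f' x) (at x)" "Ck_on k U f'"
  shows "Ck_on (Suc k) U f"
proof (rule Ck_on_SucI[OF assms(1), where f'="\<lambda>x u. f' x * u"])
  show "(f has_derivative (\<lambda>u. f' x * u)) (at x)" if "x \<in> U" for x
    using assms(2)[OF that] by (simp add: has_field_derivative_def)
  show "Ck_on k U (\<lambda>x. f' x * u)" for u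
    by (rule Ck_on_bilinear[OF bounded_bilinear_mult assms(1,3) Ck_on_const[OF assms(1)]])
qed

lemma smooth_on_open_inverse: "smooth_on_open (- {0::real}) inverse"
proof -
  have "Ck_on k (- {0::real}) inverse" for k
  proof (induction k)
    case 0 show ?case by (auto intro!: continuous_intros)
  next
    case (Suc k)
    show ?case
    proof (rule Ck_on_real_SucI[where f'="\<lambda>x. - (inverse x * inverse x)"])
      show "(inverse has_real_derivative - (inverse x * inverse x)) (at x)" if "x \<in> - {0}" for x :: real
        using that by (auto intro!: derivative_eq_intros)
      show "Ck_on k (- {0}) (\<lambda>x::real. - (inverse x * inverse x))"
        by (intro Ck_on_bounded_linear[OF bounded_linear_minus[OF bounded_linear_ident]]
            Ck_on_bilinear[OF bounded_bilinear_mult] Suc) auto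
    qed auto
  qed
  then show ?thesis by (auto simp: smooth_on_open_def)
qed

text \<open>The powers of \<open>inverse t\<close> are included because the family is then closed
  under differentiation, also at 0, so that smoothness follows by induction on \<open>k\<close> for
  all \<open>n\<close> at once.\<close>

definition flat_exp :: "nat \<Rightarrow> real \<Rightarrow> real" where
  "flat_exp n t = (if t > 0 then inverse t ^ n * exp (- inverse t) else 0)"

lemma flat_exp_tendsto: "(flat_exp n \<longlongrightarrow> 0) (at 0)"
proof -
  have "((\<lambda>t. t ^ n * exp (- t)) \<longlongrightarrow> 0) (at_top :: real filter)"
    using tendsto_power_div_exp_0[of n] by (simp add: exp_minus field_simps)
  then have "((\<lambda>t. inverse t ^ n * exp (- inverse t)) \<longlongrightarrow> 0) (at_right (0::real))"
    using filterlim_inverse_at_top_right filterlim_compose by fastforce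
  then have R: "(flat_exp n \<longlongrightarrow> 0) (at_right 0)"
    by (rule Lim_transform_eventually) (auto simp: flat_exp_def eventually_at_filter)
  have L: "(flat_exp n \<longlongrightarrow> 0) (at_left 0)"
    by (rule Lim_transform_eventually[OF tendsto_const]) (auto simp: flat_exp_def eventually_at_filter)
  show ?thesis using R L filterlim_split_at_real by blast
qed

lemma flat_exp_derivative:
  "(flat_exp n has_real_derivative (flat_exp (n + 2) t - n * flat_exp (n + 1) t)) (at t)"
proof -
  consider "t > 0" | "t < 0" | "t = 0" by linarith
  then show ?thesis
  proof cases
    case 1
    have e: "(\<lambda>t. inverse t ^ n * exp (- inverse t)) t = flat_exp n t" if "t \<in> {0<..}" for t
      using that by (auto simp: flat_exp_def)
    have "((\<lambda>t. inverse t ^ n * exp (- inverse t)) has_real_derivative (flat_exp (n + 2) t - n * flat_exp (n + 1) t)) (at t)"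
      using 1 by (auto intro!: derivative_eq_intros simp: flat_exp_def power_Suc power2_eq_square)
        (cases n; simp add: field_simps)
    then show ?thesis
      by (rule has_field_derivative_transform_within_open[of _ _ _ "{0<..}"]) (use 1 e in auto)
  next
    case 2
    have "((\<lambda>t. 0) has_real_derivative 0) (at t)" by simp
    then have "(flat_exp n has_real_derivative 0) (at t)"
      by (rule has_field_derivative_transform_within_open[of _ _ _ "{..<0}"]) (use 2 in \<open>auto simp: flat_exp_def\<close>)
    then show ?thesis using 2 by (simp add: flat_exp_def)
  next
    case 3
    have "(\<lambda>h. (flat_exp n (0 + h) - flat_exp n 0) / h) = flat_exp (Suc n)"
      by (auto simp: flat_exp_def fun_eq_iff field_simps)
    then show ?thesis
      using flat_exp_tendsto[of "Suc n"] 3 by (simp add: has_field_derivative_def DERIV_def flip: has_field_derivative_def) (simp add: flat_exp_def)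
  qed
qed

lemma smooth_flat_exp: "smooth_on_open UNIV (flat_exp n)"
proof -
  have "Ck_on k UNIV (flat_exp n)" for k
  proof (induction k arbitrary: n)
    case 0 show ?case
      using flat_exp_derivative DERIV_isCont continuous_at_imp_continuous_on by (metis Ck_on.simps(1))
  next
    case (Suc k)
    have "Ck_on k UNIV (\<lambda>t. flat_exp (n + 2) t + (- real n) * flat_exp (n + 1) t)"
      by (intro Ck_on_add Ck_on_bilinear[OF bounded_bilinear_mult] Suc Ck_on_const) auto
    then show ?case
      by (intro Ck_on_real_SucI[OF _ flat_exp_derivative]) auto
  qed
  then show ?thesis by (auto simp: smooth_on_open_def)
qed

lemma flat_exp_pos [simp]: "flat_exp n t > 0 \<longleftrightarrow> t > 0" and flat_exp_nonneg [simp]: "flat_exp n t \<ge> 0"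
  by (auto simp: flat_exp_def)

definition smooth_step :: "real \<Rightarrow> real" where
  "smooth_step t = flat_exp 0 t * inverse (flat_exp 0 t + flat_exp 0 (1 - t))"

lemma smooth_step_denominator: "flat_exp 0 t + flat_exp 0 (1 - t) > 0"
  by (cases "t > 0") (auto intro: add_pos_nonneg add_nonneg_pos)

lemma smooth_step_eq: "t \<le> 0 \<Longrightarrow> smooth_step t = 0" "t \<ge> 1 \<Longrightarrow> smooth_step t = 1"
  using smooth_step_denominator[of t] by (auto simp: smooth_step_def flat_exp_def)

lemma smooth_step_range: "0 \<le> smooth_step t" "smooth_step t \<le> 1"
  using smooth_step_denominator[of t]
  unfolding smooth_step_def divide_inverse[symmetric] by (simp_all add: divide_le_eq)

lemma smooth_smooth_step: "smooth_on_open UNIV smooth_step"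
proof -
  have 1: "smooth_on_open UNIV (\<lambda>t. flat_exp 0 (1 - t))"
    by (rule smooth_on_open_compose[OF smooth_flat_exp]) (auto intro!: smooth_on_open_diff smooth_on_open_ident)
  have "smooth_on_open UNIV (\<lambda>t. inverse (flat_exp 0 t + flat_exp 0 (1 - t)))"
    by (rule smooth_on_open_compose[OF smooth_on_open_inverse smooth_on_open_add[OF smooth_flat_exp 1]])
      (use smooth_step_denominator in \<open>auto simp: less_le\<close>)
  then show ?thesis
    unfolding smooth_step_def[abs_def] by (intro smooth_on_open_mult smooth_flat_exp)
qed

text \<open>The closed set \<open>C\<close> inside \<open>U\<close> is recorded for
  \<open>smooth_on_open_extend_zero\<close>: a map that is smooth on \<open>U\<close> only becomes
  globally smooth after multiplication by \<open>b\<close>.\<close>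

lemma smooth_bump:
  fixes x :: "'a::euclidean_space"
  assumes "open U" "x \<in> U"
  obtains b :: "'a \<Rightarrow> real" and C where "smooth_on_open UNIV b" "\<And>y. b y \<ge> 0" "b x > 0"
    "closed C" "C \<subseteq> U" "\<And>y. y \<notin> C \<Longrightarrow> b y = 0"
proof -
  obtain e where e: "e > 0" "cball x e \<subseteq> U" using assms open_contains_cball by blast
  define b where "b y = flat_exp 0 (e\<^sup>2 - (y - x) \<bullet> (y - x))" for y
  show thesis
  proof (rule that[of b "cball x e"])
    show "smooth_on_open UNIV b"
      unfolding b_def
      by (rule smooth_on_open_compose[OF smooth_flat_exp])
        (auto intro!: smooth_on_open_diff smooth_on_open_ident smooth_on_open_inner)
    show "b y = 0" if "y \<notin> cball x e" for y
    proof -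
      have "e\<^sup>2 \<le> (norm (y - x))\<^sup>2" using that e by (intro power_mono) (auto simp: dist_norm norm_minus_commute)
      then show ?thesis by (simp add: b_def flat_exp_def power2_norm_eq_inner)
    qed
  qed (use e in \<open>auto simp: b_def\<close>)
qed

lemma smooth_cutoff:
  fixes K :: "'a::euclidean_space set"
  assumes "compact K" "open U" "K \<subseteq> U"
  obtains h :: "'a \<Rightarrow> real" and V C where "smooth_on_open UNIV h" "\<And>y. 0 \<le> h y \<and> h y \<le> 1"
    "open V" "K \<subseteq> V" "\<And>y. y \<in> V \<Longrightarrow> h y = 1" "closed C" "C \<subseteq> U" "\<And>y. y \<notin> C \<Longrightarrow> h y = 0"
proof -
  have "\<exists>b C. smooth_on_open UNIV b \<and> (\<forall>y. b y \<ge> (0::real)) \<and> b x > 0 \<and> closed C \<and> C \<subseteq> U \<and> (\<forall>y. y \<notin> C \<longrightarrow> b y = 0)"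
    if "x \<in> K" for x
    using smooth_bump[of U x] assms that by (metis subsetD)
  then obtain b C where b: "\<And>x. x \<in> K \<Longrightarrow> smooth_on_open UNIV (b x) \<and> (\<forall>y. b x y \<ge> (0::real)) \<and> b x x > 0
      \<and> closed (C x) \<and> C x \<subseteq> U \<and> (\<forall>y. y \<notin> C x \<longrightarrow> b x y = 0)" by metis
  have "\<exists>S\<subseteq>K. finite S \<and> K \<subseteq> (\<Union>x\<in>S. {y. b x y > 0})"
  proof (rule compactE_image[OF assms(1), of K "\<lambda>x. {y. b x y > 0}"])
    show "open {y. b x y > 0}" if "x \<in> K" for x
      using smooth_on_open_continuous[of UNIV "b x"] b[OF that] by (auto intro!: open_Collect_less)
    show "K \<subseteq> (\<Union>x\<in>K. {y. b x y > 0})" using b by blast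
  qed blast
  then obtain S where S: "S \<subseteq> K" "finite S" "K \<subseteq> (\<Union>x\<in>S. {y. b x y > 0})" by blast
  define s where "s y = (\<Sum>x\<in>S. b x y)" for y
  have ss: "smooth_on_open UNIV s" unfolding s_def using S b by (intro smooth_on_open_sum) auto
  have spos: "s y > 0" if y: "y \<in> K" for y
  proof -
    obtain x where "x \<in> S" "b x y > 0" using S(3) y by blast
    then show ?thesis unfolding s_def using S(1,2) b by (intro sum_pos2) auto
  qed
  \<comment> \<open>Half the minimum of \<open>s\<close> on \<open>K\<close>. Then
    \<open>smooth_step\<close> of \<open>s / c\<close> equals 1 on the whole open set where
    \<open>s > c\<close>, which contains \<open>K\<close>.\<close>
  obtain c where c: "c > 0" "\<And>y. y \<in> K \<Longrightarrow> c < s y"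
  proof (cases "K = {}")
    case False
    then obtain y0 where "y0 \<in> K" "\<And>y. y \<in> K \<Longrightarrow> s y0 \<le> s y"
      using continuous_attains_inf[OF assms(1) False] continuous_on_subset[OF smooth_on_open_continuous[OF ss]] by blast
    then show thesis using spos[of y0] that[of "s y0 / 2"] by fastforce
  qed (use that[of 1] in auto)
  define h where "h y = smooth_step (inverse c * s y)" for y
  show thesis
  proof (rule that[of h "{y. s y > c}" "\<Union>x\<in>S. C x"])
    show "smooth_on_open UNIV h" unfolding h_def
      by (rule smooth_on_open_compose[OF smooth_smooth_step]) (auto intro!: smooth_on_open_mult ss)
    show "open {y. s y > c}"
      using smooth_on_open_continuous[OF ss] by (auto intro!: open_Collect_less)
    show "h y = 1" if "y \<in> {y. s y > c}" for y
      using that c unfolding h_def by (intro smooth_step_eq) (auto simp: field_simps)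
    show "h y = 0" if "y \<notin> (\<Union>x\<in>S. C x)" for y
    proof -
      have "s y = 0" unfolding s_def using that b S by (intro sum.neutral) auto
      then show ?thesis unfolding h_def by (intro smooth_step_eq) simp
    qed
    show "closed (\<Union>x\<in>S. C x)" using S b by (intro closed_UN) auto
  qed (use b S c smooth_step_range in \<open>auto simp: h_def\<close>)
qed

lemma smooth_real_polynomial_function:
  fixes p :: "'a::euclidean_space \<Rightarrow> real"
  shows "real_polynomial_function p \<Longrightarrow> smooth_on_open UNIV p"
  by (induction p rule: real_polynomial_function.induct)
    (auto intro: smooth_on_open_linear smooth_on_open_add smooth_on_open_mult)

lemma smooth_polynomial_function:
  fixes p :: "'a::euclidean_space \<Rightarrow> 'b::euclidean_space"
  assumes "polynomial_function p"
  shows "smooth_on_open UNIV p"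
proof -
  have "smooth_on_open UNIV (\<lambda>x. \<Sum>b\<in>Basis. (p x \<bullet> b) *\<^sub>R b)"
    using assms smooth_real_polynomial_function
    by (intro smooth_on_open_sum smooth_on_open_scaleR) (auto simp: polynomial_function_iff_Basis_inner)
  then show ?thesis by (simp add: euclidean_representation)
qed

section \<open>Tangent maps\<close>

text \<open>A derivative within a set of lower dimension is not unique. For smooth \<open>f\<close>
  the values on vectors tangent to \<open>X\<close> do not depend on the choice
  (\<open>dmap_eq\<close>); on other vectors the chosen map is merely linear.\<close>

abbreviation dmap :: "('a::euclidean_space \<Rightarrow> 'b::euclidean_space) \<Rightarrow> 'a set \<Rightarrow> 'a \<Rightarrow> 'a \<Rightarrow> 'b" where
  "dmap f X x \<equiv> frechet_derivative f (at x within X)"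

lemma has_derivative_cong_open:
  assumes "(f has_derivative f') (at x within X)" "open U" "x \<in> U" "x \<in> X" "\<And>y. y \<in> U \<Longrightarrow> y \<in> X \<Longrightarrow> f y = g y"
  shows "(g has_derivative f') (at x within X)"
proof -
  obtain d where "d > 0" "ball x d \<subseteq> U" using assms(2,3) openE by blast
  then show ?thesis
    using assms(5) by (intro has_derivative_transform_within[OF assms(1) _ assms(4)]) (auto simp: subset_iff dist_commute)
qed

lemma derivative_along_half_curve:
  fixes \<gamma> :: "real \<Rightarrow> 'a::real_normed_vector"
  assumes f: "(f has_derivative D) (at x within X)"
    and \<gamma>: "(\<gamma> has_vector_derivative u) (at 0 within {0..<\<epsilon>})" "\<gamma> ` {0..<\<epsilon>} \<subseteq> X" "\<gamma> 0 = x"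
  shows "((\<lambda>t. f (\<gamma> t)) has_vector_derivative D u) (at 0 within {0..<\<epsilon>})"
proof -
  have "(f has_derivative D) (at (\<gamma> 0) within \<gamma> ` {0..<\<epsilon>})"
    using f \<gamma>(2,3) has_derivative_subset by blast
  from has_derivative_in_compose[OF \<gamma>(1)[unfolded has_vector_derivative_def] this]
  have "((\<lambda>t. f (\<gamma> t)) has_derivative (\<lambda>t. D (t *\<^sub>R u))) (at 0 within {0..<\<epsilon>})" .
  then show ?thesis
    unfolding has_vector_derivative_def
    by (rule has_derivative_eq_rhs) (simp add: fun_eq_iff has_derivative_linear[OF f] linear_scale)
qed

text \<open>A curve that stays in \<open>X\<close> for nonnegative times already determines the
  derivative along its velocity. This form serves at boundary points of an exterior, where a
  transverse vector has no two-sided curve.\<close>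

lemma derivative_unique_half_curve:
  fixes \<gamma> :: "real \<Rightarrow> 'a::real_normed_vector"
  assumes "(f has_derivative D1) (at x within X)" "(f has_derivative D2) (at x within X)"
    and "(\<gamma> has_vector_derivative u) (at 0 within {0..<\<epsilon>})" "\<gamma> ` {0..<\<epsilon>} \<subseteq> X" "\<gamma> 0 = x" "\<epsilon> > 0"
  shows "D1 u = D2 u"
proof (rule vector_derivative_unique_within)
  show "at 0 within {0..<\<epsilon>} \<noteq> bot"
    using assms(6) by (simp add: trivial_limit_within islimpt_Ico)
qed (rule derivative_along_half_curve[OF assms(1,3-5)], rule derivative_along_half_curve[OF assms(2,3-5)])

section \<open>Tangent spaces as spaces of velocities\<close>

lemma tangent_spaceI:
  assumes "\<epsilon> > 0" "smooth_on_open {-\<epsilon><..<\<epsilon>} \<gamma>" "\<gamma> ` {-\<epsilon><..<\<epsilon>} \<subseteq> X" "\<gamma> 0 = x" "(\<gamma> has_vector_derivative u) (at 0)"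
  shows "u \<in> tangent_space X x"
  using assms unfolding tangent_space_def by blast

lemma tangent_spaceE:
  assumes "u \<in> tangent_space X x"
  obtains \<epsilon> \<gamma> where "\<epsilon> > 0" "smooth_on_open {-\<epsilon><..<\<epsilon>} \<gamma>" "\<gamma> ` {-\<epsilon><..<\<epsilon>} \<subseteq> X" "\<gamma> 0 = x" "(\<gamma> has_vector_derivative u) (at 0)"
  using assms unfolding tangent_space_def by blast

lemma tangent_space_base: "u \<in> tangent_space X x \<Longrightarrow> x \<in> X"
  by (erule tangent_spaceE) force

lemma shrink_curve:
  fixes \<gamma> :: "real \<Rightarrow> 'a::real_normed_vector"
  assumes "\<epsilon> > 0" "continuous_on {-\<epsilon><..<\<epsilon>} \<gamma>" "\<gamma> 0 \<in> U" "open U"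
  obtains \<delta> where "\<delta> > 0" "\<delta> \<le> \<epsilon>" "\<gamma> ` {-\<delta><..<\<delta>} \<subseteq> U"
proof -
  have "open ({-\<epsilon><..<\<epsilon>} \<inter> \<gamma> -` U)"
    using assms by (intro continuous_open_preimage) auto
  then obtain d where d: "d > 0" "ball 0 d \<subseteq> {-\<epsilon><..<\<epsilon>} \<inter> \<gamma> -` U"
    using assms openE[of "{-\<epsilon><..<\<epsilon>} \<inter> \<gamma> -` U" 0] by auto
  show thesis
  proof (rule that[of "min d \<epsilon>"])
    have "{- (min d \<epsilon>)<..<min d \<epsilon>} \<subseteq> ball 0 d" by (auto simp: dist_real_def)
    then show "\<gamma> ` {- (min d \<epsilon>)<..<min d \<epsilon>} \<subseteq> U" using d by blast
  qed (use d assms in auto)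
qed

lemma tangent_spaceE_within:
  assumes "u \<in> tangent_space X x" "open U" "x \<in> U"
  obtains \<epsilon> \<gamma> where "\<epsilon> > 0" "smooth_on_open {-\<epsilon><..<\<epsilon>} \<gamma>" "\<gamma> ` {-\<epsilon><..<\<epsilon>} \<subseteq> X \<inter> U" "\<gamma> 0 = x" "(\<gamma> has_vector_derivative u) (at 0)"
proof -
  obtain \<epsilon> \<gamma> where g: "\<epsilon> > 0" "smooth_on_open {-\<epsilon><..<\<epsilon>} \<gamma>" "\<gamma> ` {-\<epsilon><..<\<epsilon>} \<subseteq> X" "\<gamma> 0 = x" "(\<gamma> has_vector_derivative u) (at 0)"
    using assms(1) by (rule tangent_spaceE)
  then obtain \<delta> where d: "\<delta> > 0" "\<delta> \<le> \<epsilon>" "\<gamma> ` {-\<delta><..<\<delta>} \<subseteq> U"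
    using shrink_curve[of \<epsilon> \<gamma> U] smooth_on_open_continuous assms by metis
  have s: "{-\<delta><..<\<delta>} \<subseteq> {-\<epsilon><..<\<epsilon>}" using d by auto
  have "\<gamma> ` {-\<delta><..<\<delta>} \<subseteq> X \<inter> U" using image_mono[OF s, of \<gamma>] g(3) d(3) by (intro Int_greatest) (rule order_trans)
  with d(1) smooth_on_open_subset[OF g(2) _ s] show thesis
    using g(4,5) by (intro that[of \<delta> \<gamma>]) auto
qed

lemma tangent_space_mono: "X \<subseteq> Y \<Longrightarrow> tangent_space X x \<subseteq> tangent_space Y x"
  unfolding tangent_space_def by blast

lemma tangent_space_cong_open:
  assumes "open U" "x \<in> U" "X \<inter> U = Y \<inter> U"
  shows "tangent_space X x = tangent_space Y x"
proof -
  have *: "tangent_space X x \<subseteq> tangent_space Y x" if "X \<inter> U = Y \<inter> U" for X Y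
  proof
    fix u assume "u \<in> tangent_space X x"
    then obtain \<epsilon> \<gamma> where "\<epsilon> > 0" "smooth_on_open {-\<epsilon><..<\<epsilon>} \<gamma>" "\<gamma> ` {-\<epsilon><..<\<epsilon>} \<subseteq> X \<inter> U" "\<gamma> 0 = x" "(\<gamma> has_vector_derivative u) (at 0)"
      using assms(1,2) by (rule tangent_spaceE_within)
    then show "u \<in> tangent_space Y x" using that by (intro tangent_spaceI) auto
  qed
  show ?thesis using *[of X Y] *[of Y X] assms(3) by blast
qed

lemma tangent_space_openin:
  assumes "openin (top_of_set M) S" "x \<in> S"
  shows "tangent_space S x = tangent_space M x"
proof -
  obtain U where "open U" "S = M \<inter> U" using assms(1) by (auto simp: openin_open)
  then show ?thesis using assms(2) by (intro tangent_space_cong_open[of U]) auto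
qed

lemma tangent_space_open: 
  assumes "open D" "x \<in> D" shows "tangent_space D x = UNIV"
proof -
  have "u \<in> tangent_space UNIV x" for u
  proof (rule tangent_spaceI[of 1 "\<lambda>t. x + t *\<^sub>R u"])
    show "smooth_on_open {- 1<..<1} (\<lambda>t. x + t *\<^sub>R u)"
      by (intro smooth_on_open_add smooth_on_open_const smooth_on_open_linear bounded_linear_scaleR_left) auto
    show "((\<lambda>t. x + t *\<^sub>R u) has_vector_derivative u) (at 0)"
      by (auto intro!: derivative_eq_intros simp: has_vector_derivative_def)
  qed auto
  then show ?thesis using tangent_space_cong_open[of D x D UNIV] assms by auto
qed

section \<open>The tangent map and its functoriality\<close>

lemma smooth_map_on_differentiable:
  assumes "smooth_map_on X f" "x \<in> X"
  shows "(f has_derivative dmap f X x) (at x within X)"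
proof -
  obtain U g where U: "open U" "x \<in> U" "smooth_on_open U g" "\<forall>y\<in>U \<inter> X. g y = f y"
    using assms by (rule smooth_map_onE)
  have "(g has_derivative frechet_derivative g (at x)) (at x within X)"
    using U smooth_on_open_has_derivative has_derivative_at_withinI by blast
  then have "(f has_derivative frechet_derivative g (at x)) (at x within X)"
    by (rule has_derivative_cong_open[of _ _ _ _ U]) (use U assms in auto)
  then show ?thesis using differentiable_def frechet_derivative_works by blast
qed

lemma dmap_linear: "smooth_map_on X f \<Longrightarrow> x \<in> X \<Longrightarrow> linear (dmap f X x)"
  using smooth_map_on_differentiable has_derivative_linear by blast

lemma dmap_eq:
  assumes "smooth_map_on X f" "u \<in> tangent_space X x"
    and "open U" "x \<in> U" "(g has_derivative g') (at x)" "\<And>y. y \<in> U \<Longrightarrow> y \<in> X \<Longrightarrow> g y = f y"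
  shows "dmap f X x u = g' u"
proof -
  obtain \<epsilon> \<gamma> where g: "\<epsilon> > 0" "smooth_on_open {-\<epsilon><..<\<epsilon>} \<gamma>" "\<gamma> ` {-\<epsilon><..<\<epsilon>} \<subseteq> X" "\<gamma> 0 = x" "(\<gamma> has_vector_derivative u) (at 0)"
    using assms(2) by (rule tangent_spaceE)
  have x: "x \<in> X" using assms(2) tangent_space_base by blast
  have "(f has_derivative g') (at x within X)"
    by (rule has_derivative_cong_open[of g _ _ _ U])
      (use assms x in \<open>auto intro: has_derivative_at_withinI\<close>)
  from derivative_unique_half_curve[OF smooth_map_on_differentiable[OF assms(1) x] this has_vector_derivative_at_within[OF g(5)]]
  show ?thesis using g by force
qed

lemma dmap_eq_frechet:
  assumes "smooth_map_on X f" "u \<in> tangent_space X x"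
    and "x \<in> U" "smooth_on_open U g" "\<And>y. y \<in> U \<Longrightarrow> y \<in> X \<Longrightarrow> g y = f y"
  shows "dmap f X x u = frechet_derivative g (at x) u"
  using assms(4) smooth_on_open_def by (intro dmap_eq[OF assms(1,2), of U g])
    (auto intro: assms(3,5) smooth_on_open_has_derivative[OF assms(4,3)])

lemma dmap_cong:
  assumes "smooth_map_on X f" "smooth_map_on Y g" "u \<in> tangent_space X x" "u \<in> tangent_space Y x"
    "open U" "x \<in> U" "\<And>y. y \<in> U \<Longrightarrow> y \<in> X \<Longrightarrow> y \<in> Y \<and> f y = g y"
  shows "dmap f X x u = dmap g Y x u"
proof -
  have "x \<in> Y" using assms(4) tangent_space_base by blast
  with assms(2) obtain V h where V: "open V" "x \<in> V" "smooth_on_open V h" "\<forall>y\<in>V \<inter> Y. h y = g y"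
    by (rule smooth_map_onE)
  have h: "(h has_derivative frechet_derivative h (at x)) (at x)" using V smooth_on_open_has_derivative by blast
  have "dmap f X x u = frechet_derivative h (at x) u"
    by (rule dmap_eq[OF assms(1,3) _ _ h, of "U \<inter> V"]) (use V assms in auto)
  moreover have "dmap g Y x u = frechet_derivative h (at x) u"
    by (rule dmap_eq[OF assms(2,4) _ _ h, of V]) (use V in auto)
  ultimately show ?thesis by simp
qed

lemma smooth_curve_image:
  assumes "smooth_map_on X f" "smooth_on_open {-\<epsilon><..<\<epsilon>} \<gamma>" "\<gamma> ` {-\<epsilon><..<\<epsilon>} \<subseteq> X"
  shows "smooth_on_open {-\<epsilon><..<\<epsilon>::real} (\<lambda>t. f (\<gamma> t))"
  using smooth_map_on_compose[OF assms(1) _ assms(3)] assms(2)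
  by (metis smooth_map_on_open_iff smooth_on_open_def)

lemma dmap_curve:
  assumes "smooth_map_on X f" "\<epsilon> > 0" "smooth_on_open {-\<epsilon><..<\<epsilon>} \<gamma>" "\<gamma> ` {-\<epsilon><..<\<epsilon>} \<subseteq> X" "\<gamma> 0 = x"
    "(\<gamma> has_vector_derivative u) (at 0)"
  shows "((\<lambda>t. f (\<gamma> t)) has_vector_derivative dmap f X x u) (at (0::real))"
proof -
  have u: "u \<in> tangent_space X x" using assms tangent_spaceI by blast
  then have "x \<in> X" by (rule tangent_space_base)
  with assms(1) obtain U g where U: "open U" "x \<in> U" "smooth_on_open U g" "\<forall>y\<in>U \<inter> X. g y = f y"
    by (rule smooth_map_onE)
  have gd: "(g has_derivative frechet_derivative g (at x)) (at x)"
    using U smooth_on_open_has_derivative by blast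
  have e: "dmap f X x u = frechet_derivative g (at x) u"
    using dmap_eq_frechet[OF assms(1) u U(2,3)] U(4) by blast
  obtain \<delta> where d: "\<delta> > 0" "\<delta> \<le> \<epsilon>" "\<gamma> ` {-\<delta><..<\<delta>} \<subseteq> U"
    using shrink_curve[of \<epsilon> \<gamma> U] smooth_on_open_continuous assms U by metis
  have "((\<lambda>t. g (\<gamma> t)) has_derivative (\<lambda>t. frechet_derivative g (at x) (t *\<^sub>R u))) (at 0)"
    using has_derivative_compose[of \<gamma> "\<lambda>t. t *\<^sub>R u" 0 UNIV g] assms(5,6) gd unfolding has_vector_derivative_def by simp
  then have "((\<lambda>t. g (\<gamma> t)) has_vector_derivative frechet_derivative g (at x) u) (at 0)"
    unfolding has_vector_derivative_def
    by (rule has_derivative_eq_rhs) (simp add: fun_eq_iff has_derivative_linear[OF gd] linear_scale)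
  then show ?thesis unfolding e
    by (rule has_vector_derivative_transform_within_open[of _ _ _ "{-\<delta><..<\<delta>}"])
      (use d U assms(4) in \<open>auto simp: image_subset_iff\<close>)
qed

lemma dmap_tangent:
  assumes "smooth_map_on X f" "f ` X \<subseteq> Y" "u \<in> tangent_space X x"
  shows "dmap f X x u \<in> tangent_space Y (f x)"
proof -
  obtain \<epsilon> \<gamma> where g: "\<epsilon> > 0" "smooth_on_open {-\<epsilon><..<\<epsilon>} \<gamma>" "\<gamma> ` {-\<epsilon><..<\<epsilon>} \<subseteq> X" "\<gamma> 0 = x" "(\<gamma> has_vector_derivative u) (at 0)"
    using assms(3) by (rule tangent_spaceE)
  show ?thesis
    by (rule tangent_spaceI[OF g(1) smooth_curve_image[OF assms(1) g(2,3)] _ _ dmap_curve[OF assms(1) g]])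
      (use g assms in auto)
qed

text \<open>Both sides are the velocity at 0 of the same curve, so uniqueness of the derivative on
  the line settles the matter, whatever derivatives \<open>frechet_derivative\<close> has
  chosen.\<close>

lemma dmap_chain:
  assumes "smooth_map_on X f" "smooth_map_on Y g" "f ` X \<subseteq> Y" "u \<in> tangent_space X x"
  shows "dmap (\<lambda>x. g (f x)) X x u = dmap g Y (f x) (dmap f X x u)"
proof -
  obtain \<epsilon> \<gamma> where c: "\<epsilon> > 0" "smooth_on_open {-\<epsilon><..<\<epsilon>} \<gamma>" "\<gamma> ` {-\<epsilon><..<\<epsilon>} \<subseteq> X" "\<gamma> 0 = x" "(\<gamma> has_vector_derivative u) (at 0)"
    using assms(4) by (rule tangent_spaceE)
  have "((\<lambda>t. g (f (\<gamma> t))) has_vector_derivative dmap g Y (f x) (dmap f X x u)) (at 0)"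
    by (rule dmap_curve[OF assms(2) c(1) smooth_curve_image[OF assms(1) c(2,3)] _ _ dmap_curve[OF assms(1) c]])
      (use c assms in auto)
  moreover have "((\<lambda>t. g (f (\<gamma> t))) has_vector_derivative dmap (\<lambda>x. g (f x)) X x u) (at 0)"
    by (rule dmap_curve[OF smooth_map_on_compose[OF assms(2,1,3)] c])
  ultimately show ?thesis using vector_derivative_unique_at by blast
qed

lemma dmap_ident: "u \<in> tangent_space X x \<Longrightarrow> dmap (\<lambda>x. x) X x u = u"
  using dmap_eq[of X "\<lambda>x. x" u x UNIV "\<lambda>x. x" "\<lambda>x. x"] smooth_map_on_ident by auto

lemma dmap_inverse:
  assumes "smooth_map_on X f" "smooth_map_on Y g" "f ` X \<subseteq> Y" "\<And>y. y \<in> X \<Longrightarrow> g (f y) = y" "u \<in> tangent_space X x"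
  shows "dmap g Y (f x) (dmap f X x u) = u"
proof -
  have "dmap g Y (f x) (dmap f X x u) = dmap (\<lambda>x. g (f x)) X x u"
    using dmap_chain[OF assms(1,2,3,5)] by simp
  also have "\<dots> = dmap (\<lambda>x. x) X x u"
    by (rule dmap_cong[of _ _ _ _ _ _ UNIV])
      (use assms smooth_map_on_compose[OF assms(2,1,3)] smooth_map_on_ident in auto)
  finally show ?thesis using dmap_ident assms(5) by simp
qed

text \<open>Joint continuity on the tangent bundle. On tangent vectors near a given point
  \<open>dmap\<close> is the derivative of one local extension, so the choices made at different
  points fit together.\<close>

lemma continuous_on_dmap:
  assumes "smooth_map_on X f"
  shows "continuous_on {(x, u). u \<in> tangent_space X x} (\<lambda>(x, u). dmap f X x u)"
  unfolding continuous_on_eq_continuous_within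
proof clarify
  fix x u assume u: "u \<in> tangent_space X x"
  let ?T = "{(x, u). u \<in> tangent_space X x}"
  have x: "x \<in> X" using u tangent_space_base by blast
  with assms obtain U g where U: "open U" "x \<in> U" "smooth_on_open U g" "\<forall>y\<in>U \<inter> X. g y = f y"
    by (rule smooth_map_onE)
  have "isCont (\<lambda>(x, u). frechet_derivative g (at x) u) (x, u)"
    using continuous_on_derivative[OF U(3)] U(1,2) continuous_on_eq_continuous_at[of "U \<times> UNIV"] by (auto simp: open_Times)
  then have "continuous (at (x, u) within ?T) (\<lambda>(x, u). frechet_derivative g (at x) u)"
    by (rule continuous_at_imp_continuous_within)
  then show "continuous (at (x, u) within ?T) (\<lambda>(x, u). dmap f X x u)"
  proof (rule continuous_transform_within_openin[of _ _ _ "?T \<inter> U \<times> UNIV"])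
    show "openin (top_of_set ?T) (?T \<inter> U \<times> UNIV)" using U by (auto simp: openin_open_Int open_Times)
    fix p assume "p \<in> ?T \<inter> U \<times> UNIV"
    then show "(case p of (x, u) \<Rightarrow> frechet_derivative g (at x) u) = (case p of (x, u) \<Rightarrow> dmap f X x u)"
      using dmap_eq_frechet[OF assms _ _ U(3)] U(4) by auto
  qed (use u U in auto)
qed

section \<open>Charts, retractions and orientations\<close>

lemma diffeomorphism_inverse:
  assumes "diffeomorphism X Y f"
  shows "smooth_map_on X f" "smooth_map_on Y (inv_into X f)" "f ` X = Y" "inv_into X f ` Y = X"
    "\<And>x. x \<in> X \<Longrightarrow> inv_into X f (f x) = x" "\<And>y. y \<in> Y \<Longrightarrow> f (inv_into X f y) = y"
    "\<And>y. y \<in> Y \<Longrightarrow> inv_into X f y \<in> X" "inj_on f X"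
  using assms unfolding diffeomorphism_def bij_betw_def
  by (auto simp: inv_into_into f_inv_into_f image_iff intro!: bexI[of _ "f _"])

text \<open>The inverse chart is smooth only through local extensions. The set \<open>U\<close> is
  cut down until one extension \<open>G\<close> takes values in \<open>D\<close> and all points of
  \<open>M\<close> in \<open>U\<close> belong to the chart.\<close>

lemma parametrization_local_inverse:
  assumes "parametrization M D \<psi>" "x \<in> \<psi> ` D"
  obtains U G where "open U" "x \<in> U" "smooth_on_open U G" "G ` U \<subseteq> D" "\<And>y. y \<in> U \<Longrightarrow> y \<in> M \<Longrightarrow> y \<in> \<psi> ` D \<and> \<psi> (G y) = y"
    "\<And>q. q \<in> D \<Longrightarrow> \<psi> q \<in> U \<Longrightarrow> G (\<psi> q) = q"
proof -
  have D: "open D" "openin (top_of_set M) (\<psi> ` D)" "diffeomorphism D (\<psi> ` D) \<psi>"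
    using assms unfolding parametrization_def by auto
  note d = diffeomorphism_inverse[OF D(3)]
  obtain V where V: "open V" "\<psi> ` D = M \<inter> V" using D(2) by (auto simp: openin_open)
  obtain U G where U: "open U" "x \<in> U" "smooth_on_open U G" "\<forall>y\<in>U \<inter> \<psi> ` D. G y = inv_into D \<psi> y"
    using d(2) assms(2) by (rule smooth_map_onE)
  have op: "open (U \<inter> G -` D)"
    using U(1,3) D(1) smooth_on_open_continuous continuous_on_open_vimage by (metis Int_commute)
  have "open (V \<inter> (U \<inter> G -` D))" using op V by auto
  moreover have "x \<in> V \<inter> (U \<inter> G -` D)" using U V assms(2) d(7) by auto
  moreover have "smooth_on_open (V \<inter> (U \<inter> G -` D)) G" using U(3) calculation(1) by (auto intro: smooth_on_open_subset)
  moreover have "y \<in> \<psi> ` D \<and> \<psi> (G y) = y" if "y \<in> V \<inter> (U \<inter> G -` D)" "y \<in> M" for y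
    using that U(4) d(6) V(2) by auto
  moreover have "G (\<psi> q) = q" if "q \<in> D" "\<psi> q \<in> V \<inter> (U \<inter> G -` D)" for q
    using that U(4) d(5) by auto
  ultimately show thesis using that[of "V \<inter> (U \<inter> G -` D)" G] by auto
qed

text \<open>Functoriality for the chart and its inverse, composed in both orders, gives surjectivity
  onto the tangent space and injectivity.\<close>

lemma parametrization_tangent:
  assumes "parametrization M D \<psi>" "p \<in> D"
  shows "tangent_space M (\<psi> p) = range (frechet_derivative \<psi> (at p))" "inj (frechet_derivative \<psi> (at p))"
    "linear (frechet_derivative \<psi> (at p))"
proof -
  have D: "open D" "openin (top_of_set M) (\<psi> ` D)" "diffeomorphism D (\<psi> ` D) \<psi>"
    using assms unfolding parametrization_def by auto
  note d = diffeomorphism_inverse[OF D(3)]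
  have s: "smooth_on_open D \<psi>" using d(1) D(1) smooth_map_on_imp_open by blast
  have e: "dmap \<psi> D p = frechet_derivative \<psi> (at p)" using at_within_open[OF assms(2) D(1)] by simp
  have TM: "tangent_space (\<psi> ` D) (\<psi> p) = tangent_space M (\<psi> p)"
    using tangent_space_openin[OF D(2)] assms(2) by blast
  have TD: "tangent_space D p = UNIV" by (rule tangent_space_open[OF D(1) assms(2)])
  have 1: "range (frechet_derivative \<psi> (at p)) \<subseteq> tangent_space M (\<psi> p)"
    using dmap_tangent[OF d(1), of "\<psi> ` D" _ p] unfolding e TM TD by auto
  have "u \<in> range (frechet_derivative \<psi> (at p))" if "u \<in> tangent_space M (\<psi> p)" for u
  proof -
    have "dmap \<psi> D (inv_into D \<psi> (\<psi> p)) (dmap (inv_into D \<psi>) (\<psi> ` D) (\<psi> p) u) = u"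
      by (rule dmap_inverse[OF d(2) d(1)]) (use d that TM in auto)
    then show ?thesis using d(5)[OF assms(2)] unfolding e[symmetric] by (metis rangeI)
  qed
  with 1 show "tangent_space M (\<psi> p) = range (frechet_derivative \<psi> (at p))" by blast
  have "dmap (inv_into D \<psi>) (\<psi> ` D) (\<psi> p) (dmap \<psi> D p u) = u" for u
    by (rule dmap_inverse[OF d(1,2)]) (use d TD in auto)
  then show "inj (frechet_derivative \<psi> (at p))" unfolding e by (metis injI)
  show "linear (frechet_derivative \<psi> (at p))" using s assms(2) smooth_on_open_linear_derivative by blast
qed

lemma closed_3manifold_chart:
  assumes "closed_3manifold M" "x \<in> M"
  obtains D \<psi> p where "parametrization M D \<psi>" "p \<in> D" "\<psi> p = x"
proof -
  obtain D \<psi> where "parametrization M D \<psi>" "x \<in> \<psi> ` D" using assms unfolding closed_3manifold_def by blast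
  then show thesis using that by blast
qed

text \<open>Closure under addition is not visible from velocities of curves; a chart provides
  it.\<close>

lemma tangent_space_subspace:
  assumes "closed_3manifold M" "x \<in> M" shows "subspace (tangent_space M x)"
proof -
  obtain D \<psi> p where "parametrization M D \<psi>" "p \<in> D" "\<psi> p = x" using assms by (rule closed_3manifold_chart)
  then show ?thesis using parametrization_tangent linear_subspace_image[OF _ subspace_UNIV] by metis
qed

lemma local_retraction:
  assumes "closed_3manifold M" "x \<in> M"
  obtains U r where "open U" "x \<in> U" "smooth_on_open U r" "r ` U \<subseteq> M" "\<And>y. y \<in> U \<Longrightarrow> y \<in> M \<Longrightarrow> r y = y"
proof -
  obtain D \<psi> where D: "parametrization M D \<psi>" "x \<in> \<psi> ` D"
    using assms unfolding closed_3manifold_def by blast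
  obtain U G where U: "open U" "x \<in> U" "smooth_on_open U G" "G ` U \<subseteq> D" "\<And>y. y \<in> U \<Longrightarrow> y \<in> M \<Longrightarrow> y \<in> \<psi> ` D \<and> \<psi> (G y) = y"
    using parametrization_local_inverse[OF D] by metis
  have "smooth_on_open D \<psi>" "\<psi> ` D \<subseteq> M"
    using D(1) unfolding parametrization_def diffeomorphism_def by (auto simp: smooth_map_on_open_iff dest: openin_imp_subset)
  then show thesis
    using that[of U "\<lambda>y. \<psi> (G y)"] U smooth_on_open_compose[of D \<psi> U G] by blast
qed

text \<open>At points of \<open>M\<close> the derivative of a retraction is a linear, in general not
  orthogonal, projection onto the tangent space.\<close>

lemma local_retraction_derivative:
  assumes "smooth_on_open U r" "r ` U \<subseteq> M" "\<And>y. y \<in> U \<Longrightarrow> y \<in> M \<Longrightarrow> r y = y" "x \<in> U" "x \<in> M"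
  shows "frechet_derivative r (at x) a \<in> tangent_space M x"
    and "u \<in> tangent_space M x \<Longrightarrow> frechet_derivative r (at x) u = u"
proof -
  have op: "open U" using assms smooth_on_open_def by blast
  have sm: "smooth_map_on U r" using assms smooth_on_open_imp_map by blast
  have e: "dmap r U x = frechet_derivative r (at x)" using at_within_open[OF assms(4) op] by simp
  show "frechet_derivative r (at x) a \<in> tangent_space M x"
    using dmap_tangent[OF sm assms(2), of a x] tangent_space_open[OF op assms(4)] e assms(3)[OF assms(4,5)] by simp
  assume u: "u \<in> tangent_space M x"
  have "dmap (\<lambda>x. x) M x u = frechet_derivative r (at x) u"
    by (rule dmap_eq_frechet[OF smooth_map_on_ident u assms(4,1)]) (use assms in auto)
  then show "frechet_derivative r (at x) u = u" using dmap_ident[OF u] by simp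
qed

lemma smooth_on_open_extend_zero:
  assumes "smooth_on_open U f" "smooth_on_open UNIV b" "closed C" "C \<subseteq> U" "\<And>y. y \<notin> C \<Longrightarrow> b y = (0::real)"
  shows "smooth_on_open UNIV (\<lambda>y. b y *\<^sub>R f y)"
proof -
  have "smooth_on_open U (\<lambda>y. b y *\<^sub>R f y)"
    using assms(1,2) by (intro smooth_on_open_scaleR) (auto intro: smooth_on_open_subset simp: smooth_on_open_def[of U f])
  moreover have "smooth_on_open (- C) (\<lambda>y. b y *\<^sub>R f y)"
    by (rule smooth_on_open_cong[OF smooth_on_open_const[of "- C" 0]]) (use assms(3,5) in auto)
  ultimately have "smooth_on_open (U \<union> - C) (\<lambda>y. b y *\<^sub>R f y)" by (rule smooth_on_open_Un)
  moreover have "U \<union> - C = UNIV" using assms by auto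
  ultimately show ?thesis by simp
qed

lemma finite_bump_cover:
  fixes M :: "'a::euclidean_space set"
  assumes "compact M" "\<And>x. x \<in> M \<Longrightarrow> open (U x) \<and> x \<in> U x"
  obtains S b C where "finite S" "S \<subseteq> M" "\<And>x. x \<in> S \<Longrightarrow> smooth_on_open UNIV (b x)" "\<And>x y. x \<in> S \<Longrightarrow> 0 \<le> (b x y :: real)"
    "\<And>x. x \<in> S \<Longrightarrow> closed (C x) \<and> C x \<subseteq> U x" "\<And>x y. x \<in> S \<Longrightarrow> y \<notin> C x \<Longrightarrow> b x y = 0"
    "\<And>y. y \<in> M \<Longrightarrow> (\<Sum>x\<in>S. b x y) > 0"
proof -
  have "\<exists>b C. smooth_on_open UNIV b \<and> (\<forall>y. b y \<ge> (0::real)) \<and> b x > 0 \<and> closed C \<and> C \<subseteq> U x \<and> (\<forall>y. y \<notin> C \<longrightarrow> b y = 0)"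
    if "x \<in> M" for x
    using smooth_bump[of "U x" x] assms that by metis
  then obtain b C where b: "\<And>x. x \<in> M \<Longrightarrow> smooth_on_open UNIV (b x) \<and> (\<forall>y. b x y \<ge> (0::real)) \<and> b x x > 0
      \<and> closed (C x) \<and> C x \<subseteq> U x \<and> (\<forall>y. y \<notin> C x \<longrightarrow> b x y = 0)" by metis
  have "\<exists>S\<subseteq>M. finite S \<and> M \<subseteq> (\<Union>x\<in>S. {y. b x y > 0})"
  proof (rule compactE_image[OF assms(1), of M "\<lambda>x. {y. b x y > 0}"])
    show "open {y. b x y > 0}" if "x \<in> M" for x
      using smooth_on_open_continuous[of UNIV "b x"] b[OF that] by (auto intro!: open_Collect_less)
    show "M \<subseteq> (\<Union>x\<in>M. {y. b x y > 0})" using b by blast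
  qed blast
  then obtain S where S: "S \<subseteq> M" "finite S" "M \<subseteq> (\<Union>x\<in>S. {y. b x y > 0})" by blast
  have spos: "(\<Sum>x\<in>S. b x y) > 0" if y: "y \<in> M" for y
  proof -
    obtain x where "x \<in> S" "b x y > 0" using S(3) y by blast
    then show ?thesis using S(1,2) b by (intro sum_pos2) auto
  qed
  show thesis by (rule that[of S b C]) (use S b spos in blast)+
qed

text \<open>Linear projections onto a fixed subspace form a convex set, so the derivatives of local
  retractions can be averaged with bump functions.\<close>

lemma tangent_projection:
  assumes "closed_3manifold M"
  obtains Q where "\<And>a. smooth_map_on M (\<lambda>y. Q y a)" "\<And>y. linear (Q y)"
    "\<And>y a. y \<in> M \<Longrightarrow> Q y a \<in> tangent_space M y" "\<And>y u. u \<in> tangent_space M y \<Longrightarrow> Q y u = u"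
proof -
  have cM: "compact M" using assms closed_3manifold_def by blast
  have "\<exists>U r. open U \<and> x \<in> U \<and> smooth_on_open U r \<and> r ` U \<subseteq> M \<and> (\<forall>y. y \<in> U \<longrightarrow> y \<in> M \<longrightarrow> r y = y)" if "x \<in> M" for x
    using local_retraction[OF assms that] by metis
  then obtain U r where U: "\<And>x. x \<in> M \<Longrightarrow> open (U x) \<and> x \<in> U x \<and> smooth_on_open (U x) (r x) \<and> r x ` U x \<subseteq> M \<and> (\<forall>y. y \<in> U x \<longrightarrow> y \<in> M \<longrightarrow> r x y = y)"
    by metis
  obtain S b C where S: "finite S" "S \<subseteq> M" "\<And>x. x \<in> S \<Longrightarrow> smooth_on_open UNIV (b x)" "\<And>x y. x \<in> S \<Longrightarrow> 0 \<le> (b x y :: real)"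
    "\<And>x. x \<in> S \<Longrightarrow> closed (C x) \<and> C x \<subseteq> U x" "\<And>x y. x \<in> S \<Longrightarrow> y \<notin> C x \<Longrightarrow> b x y = 0"
    "\<And>y. y \<in> M \<Longrightarrow> (\<Sum>x\<in>S. b x y) > 0"
    using finite_bump_cover[OF cM, of U] U by blast
  define s where "s y = (\<Sum>x\<in>S. b x y)" for y
  \<comment> \<open>Outside \<open>U x\<close> the expression
    \<open>frechet_derivative (r x) (at y)\<close> need not be linear. The case distinction keeps
    \<open>R y\<close> linear at every point of the ambient space and changes nothing where the
    weight is nonzero.\<close>
  define R where "R y a = (\<Sum>x\<in>S. b x y *\<^sub>R (if y \<in> C x then frechet_derivative (r x) (at y) a else 0))" for y a
  have sR: "smooth_on_open UNIV (\<lambda>y. R y a)" for a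
    unfolding R_def
  proof (rule smooth_on_open_sum)
    fix x assume x: "x \<in> S"
    have "smooth_on_open UNIV (\<lambda>y. b x y *\<^sub>R frechet_derivative (r x) (at y) a)"
      by (rule smooth_on_open_extend_zero[where U="U x" and C="C x"])
        (use x U S in \<open>auto intro!: smooth_on_open_derivative\<close>)
    then show "smooth_on_open UNIV (\<lambda>y. b x y *\<^sub>R (if y \<in> C x then frechet_derivative (r x) (at y) a else 0))"
      by (rule smooth_on_open_cong) (use S(6)[OF x] in auto)
  qed auto
  have ss: "smooth_map_on M (\<lambda>y. inverse (s y))"
  proof (rule smooth_map_on_compose[where g=inverse and f=s])
    show "smooth_map_on (- {0}) (inverse :: real \<Rightarrow> real)"
      using smooth_on_open_inverse smooth_on_open_imp_map by blast
    show "smooth_map_on M s" unfolding s_def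
      by (rule smooth_on_open_imp_map[OF smooth_on_open_sum[of UNIV]]) (use S in auto)
    show "s ` M \<subseteq> - {0}" using S(7) unfolding s_def by fastforce
  qed
  have lin: "linear (\<lambda>a. if y \<in> C x then frechet_derivative (r x) (at y) a else 0)" if "x \<in> S" for x y
  proof (cases "y \<in> C x")
    case True
    then have "linear (frechet_derivative (r x) (at y))"
      using U S(2,5) that smooth_on_open_linear_derivative by blast
    then show ?thesis using True by simp
  qed (simp add: linear_zero)
  show thesis
  proof (rule that[of "\<lambda>y a. inverse (s y) *\<^sub>R R y a"])
    show "smooth_map_on M (\<lambda>y. inverse (s y) *\<^sub>R R y a)" for a
      by (rule smooth_map_on_scaleR[OF ss smooth_on_open_imp_map[OF sR]]) auto
    show "linear (\<lambda>a. inverse (s y) *\<^sub>R R y a)" for y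
      unfolding R_def by (intro linear_compose_scale_right linear_compose_sum ballI lin)
    show "inverse (s y) *\<^sub>R R y a \<in> tangent_space M y" if y: "y \<in> M" for y a
    proof -
      have T: "subspace (tangent_space M y)" using tangent_space_subspace[OF assms y] .
      have "(if y \<in> C x then frechet_derivative (r x) (at y) a else 0) \<in> tangent_space M y" if "x \<in> S" for x
      proof (cases "y \<in> C x")
        case True
        then have "y \<in> U x" "x \<in> M" using S(2,5) that by auto
        then show ?thesis using U[of x] True y local_retraction_derivative(1)[of "U x" "r x" M y a] by auto
      qed (use subspace_0[OF T] in auto)
      then show ?thesis unfolding R_def by (intro subspace_scale[OF T] subspace_sum[OF T])
    qed
    show "inverse (s y) *\<^sub>R R y u = u" if u: "u \<in> tangent_space M y" for y u
    proof -
      have y: "y \<in> M" using u tangent_space_base by blast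
      have "b x y *\<^sub>R (if y \<in> C x then frechet_derivative (r x) (at y) u else 0) = b x y *\<^sub>R u" if "x \<in> S" for x
      proof (cases "y \<in> C x")
        case True
        then have "y \<in> U x" "x \<in> M" using S(2,5) that by auto
        then show ?thesis using U[of x] True y u local_retraction_derivative(2)[of "U x" "r x" M y u] by auto
      qed (use S(6)[OF that] in auto)
      then have "R y u = s y *\<^sub>R u" unfolding R_def s_def by (simp only: scaleR_sum_left cong: sum.cong)
      then show ?thesis using S(7)[OF y] unfolding s_def by simp
    qed
  qed
qed

lemma continuous_on_linear_family:
  fixes Q :: "'a::topological_space \<Rightarrow> 'b::euclidean_space \<Rightarrow> 'c::real_normed_vector"
  assumes "\<And>a. continuous_on X (\<lambda>y. Q y a)" "\<And>y. linear (Q y)" "continuous_on Y f" "continuous_on Y g" "f ` Y \<subseteq> X"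
  shows "continuous_on Y (\<lambda>z. Q (f z) (g z))"
proof -
  have "continuous_on Y (\<lambda>z. \<Sum>b\<in>Basis. (g z \<bullet> b) *\<^sub>R Q (f z) b)"
    by (intro continuous_intros continuous_on_compose2[OF assms(1)] assms)
  then show ?thesis by (simp only: linear_expand_Basis[OF assms(2), symmetric])
qed

text \<open>The triple product, equal to the determinant with these three rows. Through the cross
  product, \<open>cross_matrix_mult\<close> yields multiplicativity.\<close>

definition det3 :: "real^3 \<Rightarrow> real^3 \<Rightarrow> real^3 \<Rightarrow> real" where
  "det3 a b c = a \<bullet> cross3 b c"

lemma det3_linear:
  assumes "linear J"
  shows "det3 (J a) (J b) (J c) = det (matrix J) * det3 a b c"
proof -
  have J: "J x = matrix J *v x" for x using assms by (simp add: matrix_works)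
  have "det3 (J a) (J b) (J c) = a \<bullet> (transpose (matrix J) *v cross3 (J b) (J c))"
    unfolding det3_def J[of a] by (metis dot_lmul_matrix inner_commute transpose_matrix_vector)
  also have "\<dots> = det (matrix J) * det3 a b c"
    unfolding det3_def by (metis J cross_matrix_mult inner_scaleR_right)
  finally show ?thesis .
qed

lemma det3_scale: "det3 (k *\<^sub>R a) (k *\<^sub>R b) (k *\<^sub>R c) = k ^ 3 * det3 a b c"
  by (simp add: det3_def cross_mult_left cross_mult_right power3_eq_cube)

lemma continuous_on_det3:
  fixes f :: "'a::t2_space \<Rightarrow> real^3"
  shows "continuous_on X f \<Longrightarrow> continuous_on X g \<Longrightarrow> continuous_on X h \<Longrightarrow> continuous_on X (\<lambda>x. det3 (f x) (g x) (h x))"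
  unfolding det3_def by (simp add: continuous_on_inner continuous_on_cross)

lemma transition_derivative:
  assumes \<psi>: "parametrization M D \<psi>" "p \<in> D" and \<psi>': "parametrization M D' \<psi>'"
    and U: "open U" "\<psi> p \<in> U" "smooth_on_open U G" "G ` U \<subseteq> D'" "\<And>y. y \<in> U \<Longrightarrow> y \<in> M \<Longrightarrow> y \<in> \<psi>' ` D' \<and> \<psi>' (G y) = y"
  shows "((inv_into D' \<psi>' \<circ> \<psi>) has_derivative (\<lambda>a. frechet_derivative G (at (\<psi> p)) (frechet_derivative \<psi> (at p) a))) (at p)"
proof -
  have D: "open D" "diffeomorphism D (\<psi> ` D) \<psi>" "\<psi> ` D \<subseteq> M"
    using \<psi> unfolding parametrization_def by (auto dest: openin_imp_subset)
  have inj: "inj_on \<psi>' D'" using \<psi>' unfolding parametrization_def diffeomorphism_def bij_betw_def by auto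
  have s: "smooth_on_open D \<psi>"
    using diffeomorphism_inverse(1)[OF D(2)] D(1) smooth_map_on_imp_open by blast
  have op: "open (D \<inter> \<psi> -` U)"
    using s D(1) U(1) smooth_on_open_continuous continuous_on_open_vimage by (metis Int_commute)
  have "((\<lambda>q. G (\<psi> q)) has_derivative (\<lambda>a. frechet_derivative G (at (\<psi> p)) (frechet_derivative \<psi> (at p) a))) (at p)"
    using has_derivative_compose[of \<psi> _ p UNIV G] smooth_on_open_has_derivative[OF s \<psi>(2)] smooth_on_open_has_derivative[OF U(3,2)] by simp
  then show ?thesis
  proof (rule has_derivative_cong_open[OF _ op])
    fix q assume q: "q \<in> D \<inter> \<psi> -` U"
    then have "\<psi>' (G (\<psi> q)) = \<psi> q" "G (\<psi> q) \<in> D'" using U(4,5) D(3) by auto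
    then show "G (\<psi> q) = (inv_into D' \<psi>' \<circ> \<psi>) q" using inv_into_f_f[OF inj] by (metis comp_apply)
  qed (use \<psi> U in auto)
qed

lemma oriented_atlas_transition:
  assumes "oriented_atlas M \<A>" "(D, \<psi>) \<in> \<A>" "(D', \<psi>') \<in> \<A>" "p \<in> D" "\<psi> p \<in> \<psi>' ` D'"
  shows "det (matrix (frechet_derivative (inv_into D' \<psi>' \<circ> \<psi>) (at p))) > 0"
proof -
  have "\<forall>(D, \<psi>)\<in>\<A>. \<forall>(D', \<psi>')\<in>\<A>. \<forall>p\<in>D. \<psi> p \<in> \<psi>' ` D' \<longrightarrow>
      det (matrix (frechet_derivative (inv_into D' \<psi>' \<circ> \<psi>) (at p))) > 0"
    using assms(1) unfolding oriented_atlas_def by blast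
  from bspec[OF this assms(2)] have "\<forall>(D', \<psi>')\<in>\<A>. \<forall>p\<in>D. \<psi> p \<in> \<psi>' ` D' \<longrightarrow>
      det (matrix (frechet_derivative (inv_into D' \<psi>' \<circ> \<psi>) (at p))) > 0" by simp
  from bspec[OF this assms(3)] show ?thesis using assms(4,5) by simp
qed

text \<open>The volume forms of the charts are averaged. Transition maps have positive determinant,
  so at \<open>y\<close> all summands are nonnegative multiples of one determinant, and at least one
  multiple is positive.\<close>

lemma volume_form:
  assumes "closed_3manifold M" "oriented_atlas M \<A>"
  obtains vol where "continuous_on UNIV (\<lambda>(y, a, b, c). vol y a b c :: real)"
    "\<And>y. y \<in> M \<Longrightarrow> \<exists>\<kappa> C. \<kappa> > 0 \<and> linear C \<and> inj C \<and> range C = tangent_space M y \<and>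
       (\<forall>a b c. vol y (C a) (C b) (C c) = \<kappa> * det3 a b c)"
proof -
  have cM: "compact M" using assms closed_3manifold_def by blast
  have "\<exists>D \<psi> U G. (D, \<psi>) \<in> \<A> \<and> parametrization M D \<psi> \<and> open U \<and> x \<in> U \<and> smooth_on_open U G \<and> G ` U \<subseteq> D \<and>
    (\<forall>y. y \<in> U \<longrightarrow> y \<in> M \<longrightarrow> y \<in> \<psi> ` D \<and> \<psi> (G y) = y)" if x: "x \<in> M" for x
  proof -
    obtain D \<psi> where D: "(D, \<psi>) \<in> \<A>" "x \<in> \<psi> ` D" using x assms(2) unfolding oriented_atlas_def by blast
    then have p: "parametrization M D \<psi>" using assms(2) unfolding oriented_atlas_def by blast
    show ?thesis using parametrization_local_inverse[OF p D(2)] p D by metis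
  qed
  then obtain D \<psi> U G where U: "\<And>x. x \<in> M \<Longrightarrow> (D x, \<psi> x) \<in> \<A> \<and> parametrization M (D x) (\<psi> x) \<and> open (U x) \<and> x \<in> U x \<and>
     smooth_on_open (U x) (G x) \<and> G x ` U x \<subseteq> D x \<and> (\<forall>y. y \<in> U x \<longrightarrow> y \<in> M \<longrightarrow> y \<in> \<psi> x ` D x \<and> \<psi> x (G x y) = y)"
    by metis
  obtain S b C where S: "finite S" "S \<subseteq> M" "\<And>x. x \<in> S \<Longrightarrow> smooth_on_open UNIV (b x)" "\<And>x y. x \<in> S \<Longrightarrow> 0 \<le> (b x y :: real)"
    "\<And>x. x \<in> S \<Longrightarrow> closed (C x) \<and> C x \<subseteq> U x" "\<And>x y. x \<in> S \<Longrightarrow> y \<notin> C x \<Longrightarrow> b x y = 0"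
    "\<And>y. y \<in> M \<Longrightarrow> (\<Sum>x\<in>S. b x y) > 0"
    using finite_bump_cover[OF cM, of U] U by blast
  \<comment> \<open>The weight multiplies the vectors instead of the form. This makes
    \<open>L x\<close> smooth on the whole space, and the weight reappears as a cube in
    \<open>\<kappa>\<close>.\<close>
  define L where "L x y a = b x y *\<^sub>R (if y \<in> C x then frechet_derivative (G x) (at y) a else 0)" for x y a
  have Ls: "smooth_on_open UNIV (\<lambda>y. L x y a)" if x: "x \<in> S" for x a
  proof -
    have "smooth_on_open UNIV (\<lambda>y. b x y *\<^sub>R frechet_derivative (G x) (at y) a)"
      by (rule smooth_on_open_extend_zero[where U="U x" and C="C x"])
        (use x U S in \<open>auto intro!: smooth_on_open_derivative\<close>)
    then show ?thesis unfolding L_def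
      by (rule smooth_on_open_cong) (use S(6)[OF x] in auto)
  qed
  have Ll: "linear (L x y)" if "x \<in> S" for x y
  proof (cases "y \<in> C x")
    case True
    then have "linear (frechet_derivative (G x) (at y))"
      using U S(2,5) that smooth_on_open_linear_derivative by blast
    then show ?thesis using True unfolding L_def by (simp add: linear_compose_scale_right)
  qed (simp add: L_def[abs_def] linear_zero)
  have Lc: "continuous_on UNIV (\<lambda>z. L x (f z) (g z))" if "x \<in> S" "continuous_on UNIV f" "continuous_on UNIV g"
    for x and f g :: "'a \<times> 'a \<times> 'a \<times> 'a \<Rightarrow> 'a"
    by (rule continuous_on_linear_family[OF smooth_on_open_continuous[OF Ls] Ll]) (use that in auto)
  define vol where "vol y p q r = (\<Sum>x\<in>S. det3 (L x y p) (L x y q) (L x y r))" for y p q r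
  show thesis
  proof (rule that[of vol])
    show "continuous_on UNIV (\<lambda>(y, a, b, c). vol y a b c)"
      unfolding vol_def case_prod_beta
      by (intro continuous_on_sum continuous_on_det3 Lc) (auto intro!: continuous_intros)
    fix y assume y: "y \<in> M"
    then obtain x0 where x0: "x0 \<in> S" "b x0 y > 0"
      using S(1,4) S(7)[OF y] by (metis (no_types, lifting) less_eq_real_def sum.neutral order_less_irrefl)
    have yU: "y \<in> U x" if "x \<in> S" "b x y \<noteq> 0" for x using S(5,6) that by blast
    have yU0: "y \<in> U x0" "x0 \<in> M" using yU x0 S(2) by auto
    define p where "p = G x0 y"
    have p: "p \<in> D x0" "\<psi> x0 p = y" "parametrization M (D x0) (\<psi> x0)" "(D x0, \<psi> x0) \<in> \<A>"
      using U[OF yU0(2)] yU0 y unfolding p_def by auto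
    define F where "F = frechet_derivative (\<psi> x0) (at p)"
    \<comment> \<open>At \<open>y\<close> everything is referred to the chart of \<open>x0\<close>:
      \<open>J x\<close> is the derivative of the transition from that chart to the chart of
      \<open>x\<close>.\<close>
    define J where "J x a = frechet_derivative (G x) (at y) (F a)" for x a
    have J: "linear (J x)" "det (matrix (J x)) > 0" if "x \<in> S" "b x y \<noteq> 0" for x
    proof -
      have x: "x \<in> M" "y \<in> U x" using that S(2) yU by auto
      have d: "((inv_into (D x) (\<psi> x) \<circ> \<psi> x0) has_derivative J x) (at p)"
        unfolding J_def F_def using transition_derivative[OF p(3,1), of "D x" "\<psi> x" "U x" "G x"] U[OF x(1)] x p by simp
      then show "linear (J x)" by (rule has_derivative_linear)
      have "y \<in> \<psi> x ` D x" "(D x, \<psi> x) \<in> \<A>" using U[OF x(1)] x y by auto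
      then have "det (matrix (frechet_derivative (inv_into (D x) (\<psi> x) \<circ> \<psi> x0) (at p))) > 0"
        using oriented_atlas_transition[OF assms(2) p(4) _ p(1)] p(2) by simp
      then show "det (matrix (J x)) > 0" using frechet_derivative_at[OF d] by simp
    qed
    define \<kappa> where "\<kappa> = (\<Sum>x\<in>S. b x y ^ 3 * det (matrix (J x)))"
    have "\<kappa> > 0" unfolding \<kappa>_def
    proof (rule sum_pos2[OF S(1) x0(1)])
      show "0 < b x0 y ^ 3 * det (matrix (J x0))" using x0 J(2)[OF x0(1)] by simp
      show "0 \<le> b x y ^ 3 * det (matrix (J x))" if "x \<in> S" for x
        using J(2)[OF that] S(4)[OF that, of y] by (cases "b x y = 0") auto
    qed
    moreover have "vol y (F a1) (F a2) (F a3) = \<kappa> * det3 a1 a2 a3" for a1 a2 a3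
      unfolding vol_def \<kappa>_def sum_distrib_right
    proof (rule sum.cong[OF refl])
      fix x assume x: "x \<in> S"
      show "det3 (L x y (F a1)) (L x y (F a2)) (L x y (F a3)) = b x y ^ 3 * det (matrix (J x)) * det3 a1 a2 a3"
      proof (cases "b x y = 0")
        case False
        then have "y \<in> C x" using S(6)[OF x] by blast
        then have "L x y (F a) = b x y *\<^sub>R J x a" for a unfolding L_def J_def by simp
        then show ?thesis using det3_linear[OF J(1)[OF x False]] by (simp add: det3_scale)
      qed (simp add: L_def det3_def)
    qed
    moreover have "linear F" "inj F" "range F = tangent_space M y"
      unfolding F_def using parametrization_tangent[OF p(3,1)] p(2) by auto
    ultimately show "\<exists>\<kappa> C. \<kappa> > 0 \<and> linear C \<and> inj C \<and> range C = tangent_space M y \<and>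
       (\<forall>a b c. vol y (C a) (C b) (C c) = \<kappa> * det3 a b c)" by blast
  qed
qed

section \<open>Change of angle along an interval\<close>

text \<open>The increment of a continuous argument, not reduced modulo \<open>2 * pi\<close>. By
  \<open>angle_change_eq\<close> the choice of the logarithm is immaterial.\<close>

definition angle_change :: "(real \<Rightarrow> complex) \<Rightarrow> real" where
  "angle_change g = (let l = SOME l. continuous_on {0..1} l \<and> (\<forall>t\<in>{0..1}. g t = exp (l t)) in Im (l 1) - Im (l 0))"

text \<open>Two continuous logarithms differ by a continuous function with values in the discrete
  set of multiples of \<open>2 * pi * \<i>\<close>, hence by a constant.\<close>

lemma angle_change_eq:
  assumes "continuous_on {0..1} l" "\<And>t. t \<in> {0..1} \<Longrightarrow> g t = exp (l t)"
  shows "angle_change g = Im (l 1) - Im (l 0)"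
proof -
  define m where "m = (SOME l. continuous_on {0..1} l \<and> (\<forall>t\<in>{0..1}. g t = exp (l t)))"
  have m: "continuous_on {0..1} m \<and> (\<forall>t\<in>{0..1}. g t = exp (m t))"
    unfolding m_def using someI_ex[of "\<lambda>l. continuous_on {0..1} l \<and> (\<forall>t\<in>{0..1}. g t = exp (l t))"] assms by blast
  have d: "\<exists>n::int. l t - m t = \<i> * of_real (2 * pi * n)" if "t \<in> {0..1}" for t
  proof -
    have "exp (l t) = exp (m t)" using m assms(2) that by metis
    then obtain n :: int where "l t = m t + (2 * pi * n) * \<i>" using exp_eq[of "l t" "m t"] by (auto simp: mult_ac)
    then show ?thesis by (intro exI[of _ n]) (simp add: mult_ac)
  qed
  have "(\<lambda>t. l t - m t) constant_on {0..1}"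
  proof (rule continuous_discrete_range_constant)
    show "continuous_on {0..1} (\<lambda>t. l t - m t)" by (intro continuous_intros assms) (use m in auto)
    fix x :: real assume x: "x \<in> {0..1}"
    show "\<exists>e>0. \<forall>y. y \<in> {0..1} \<and> l y - m y \<noteq> l x - m x \<longrightarrow> e \<le> norm (l y - m y - (l x - m x))"
    proof (intro exI[of _ "2 * pi"] conjI allI impI)
      fix y assume y: "y \<in> {0..1} \<and> l y - m y \<noteq> l x - m x"
      obtain i j :: int where ij: "l x - m x = \<i> * of_real (2 * pi * i)" "l y - m y = \<i> * of_real (2 * pi * j)"
        using d x y by metis
      have "l y - m y - (l x - m x) = \<i> * of_real (2 * pi * (j - i))" unfolding ij by (simp add: algebra_simps)
      then have n: "norm (l y - m y - (l x - m x)) = 2 * pi * \<bar>real_of_int (j - i)\<bar>"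
        by (simp only: norm_mult norm_ii norm_of_real abs_mult) simp
      have "i \<noteq> j" using ij y by auto
      then have "1 \<le> \<bar>real_of_int (j - i)\<bar>" by linarith
      then show "2 * pi \<le> norm (l y - m y - (l x - m x))" unfolding n using pi_gt_zero by simp
    qed auto
  qed auto
  then have "l 1 - m 1 = l 0 - m 0" unfolding constant_on_def by (metis atLeastAtMost_iff order_refl zero_le_one)
  then have "Im (l 1 - m 1) = Im (l 0 - m 0)" by simp
  then show ?thesis unfolding angle_change_def m_def[symmetric] Let_def by simp
qed

lemma continuous_logarithm_interval:
  assumes "continuous_on {0..1::real} g" "\<And>t. t \<in> {0..1} \<Longrightarrow> g t \<noteq> (0::complex)"
  obtains l where "continuous_on {0..1} l" "\<And>t. t \<in> {0..1} \<Longrightarrow> g t = exp (l t)"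
  using continuous_logarithm_on_contractible[OF assms(1) convex_imp_contractible assms(2)] by auto

lemma angle_change_mult:
  assumes "continuous_on {0..1} g" "\<And>t. t \<in> {0..1} \<Longrightarrow> g t \<noteq> 0"
    and "continuous_on {0..1} h" "\<And>t. t \<in> {0..1} \<Longrightarrow> h t \<noteq> 0"
  shows "angle_change (\<lambda>t. g t * h t) = angle_change g + angle_change h"
proof -
  obtain k where k: "continuous_on {0..1} k" "\<And>t. t \<in> {0..1} \<Longrightarrow> g t = exp (k t)"
    using continuous_logarithm_interval assms(1,2) by blast
  obtain l where l: "continuous_on {0..1} l" "\<And>t. t \<in> {0..1} \<Longrightarrow> h t = exp (l t)"
    using continuous_logarithm_interval assms(3,4) by blast
  have "angle_change (\<lambda>t. g t * h t) = Im (k 1 + l 1) - Im (k 0 + l 0)"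
    by (rule angle_change_eq) (use k l in \<open>auto intro: continuous_intros simp: exp_add\<close>)
  then show ?thesis using angle_change_eq[OF k] angle_change_eq[OF l] by simp
qed

lemma angle_change_positive:
  assumes "continuous_on {0..1} g" "\<And>t. t \<in> {0..1} \<Longrightarrow> g t \<notin> \<real>\<^sub>\<le>\<^sub>0"
  shows "angle_change g = Im (Ln (g 1)) - Im (Ln (g 0))"
proof (rule angle_change_eq)
  show "continuous_on {0..1} (\<lambda>t. Ln (g t))" using assms by (intro continuous_intros) auto
  show "g t = exp (Ln (g t))" if "t \<in> {0..1}" for t
    using assms(2)[OF that] by (intro exp_Ln[symmetric]) auto
qed

text \<open>The principal arguments at both ends lie strictly between \<open>- pi\<close> and
  \<open>pi\<close>. The strict inequality is what allows \<open>torus_degree\<close> to conclude by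
  integrality.\<close>

lemma angle_change_nonpos_bound:
  assumes "continuous_on {0..1} g" "\<And>t. t \<in> {0..1} \<Longrightarrow> g t \<notin> \<real>\<^sub>\<le>\<^sub>0"
  shows "\<bar>angle_change g\<bar> < 2 * pi"
proof -
  have "\<bar>Im (Ln (g t))\<bar> < pi" if "t \<in> {0..1}" for t
    using Im_Ln_less_pi[of "g t"] mpi_less_Im_Ln[of "g t"] assms(2)[OF that]
    by (metis abs_less_iff minus_less_iff nonpos_Reals_zero_I complex_nonpos_Reals_iff Im_Ln_less_pi)
  from this[of 0] this[of 1] have "\<bar>Im (Ln (g 0))\<bar> < pi" "\<bar>Im (Ln (g 1))\<bar> < pi" by simp_all
  moreover have "angle_change g = Im (Ln (g 1)) - Im (Ln (g 0))" by (rule angle_change_positive[OF assms])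
  ultimately show ?thesis by linarith
qed

text \<open>The quotient of the two functions has positive real values and hence constant argument.
  Needed because \<open>z\<close> in \<open>plane_bundle\<close> is multiplicative only up to
  positive factors.\<close>

lemma angle_change_scale:
  assumes "continuous_on {0..1} g" "\<And>t. t \<in> {0..1} \<Longrightarrow> g t \<noteq> 0"
    and "continuous_on {0..1} h" "\<And>t. t \<in> {0..1} \<Longrightarrow> \<exists>c>0. h t = complex_of_real c * g t"
  shows "angle_change h = angle_change g"
proof -
  define q where "q t = h t / g t" for t
  have q: "\<exists>c>0. q t = complex_of_real c" if "t \<in> {0..1}" for t
    using assms(2,4)[OF that] unfolding q_def by auto
  have qc: "continuous_on {0..1} q" unfolding q_def using assms by (intro continuous_intros) auto
  have "q t \<notin> \<real>\<^sub>\<le>\<^sub>0" if "t \<in> {0..1}" for t using q[OF that] by (auto simp: complex_nonpos_Reals_iff)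
  then have "angle_change q = Im (Ln (q 1)) - Im (Ln (q 0))" using angle_change_positive qc by blast
  also have "\<dots> = 0" using q[of 0] q[of 1] by (auto simp: Ln_of_real)
  finally have 0: "angle_change q = 0" .
  have "angle_change (\<lambda>t. g t * q t) = angle_change g + angle_change q"
    by (rule angle_change_mult) (use assms q qc in force)+
  moreover have "angle_change (\<lambda>t. g t * q t) = angle_change h"
  proof -
    obtain l where l: "continuous_on {0..1} l" "\<And>t. t \<in> {0..1} \<Longrightarrow> h t = exp (l t)"
      using continuous_logarithm_interval[OF assms(3)] assms(2,4) by (metis mult_eq_0_iff of_real_eq_0_iff less_irrefl)
    have "angle_change (\<lambda>t. g t * q t) = Im (l 1) - Im (l 0)"
      by (rule angle_change_eq[OF l(1)]) (use l assms(2) in \<open>auto simp: q_def\<close>)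
    then show ?thesis using angle_change_eq[OF l] by simp
  qed
  ultimately show ?thesis using 0 by simp
qed

lemma angle_change_cis:
  assumes "continuous_on {0..1} \<theta>"
  shows "angle_change (\<lambda>t. cis (\<theta> t)) = \<theta> 1 - \<theta> 0"
proof -
  have "angle_change (\<lambda>t. cis (\<theta> t)) = Im (\<i> * of_real (\<theta> 1)) - Im (\<i> * of_real (\<theta> 0))"
    by (rule angle_change_eq) (auto intro!: continuous_intros assms simp: cis_conv_exp)
  then show ?thesis by simp
qed

section \<open>A first Chern cochain\<close>

definition edge_point :: "real \<Rightarrow> nat \<Rightarrow> real" where
  "edge_point t = (\<lambda>i. if i = 0 then 1 - t else if i = 1 then t else 0)"

definition triangle_point :: "real \<times> real \<Rightarrow> nat \<Rightarrow> real" where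
  "triangle_point = (\<lambda>(a, b) i. if i = 0 then 1 - a - b else if i = 1 then a else if i = 2 then b else 0)"

definition triangle :: "(real \<times> real) set" where
  "triangle = {(a, b). 0 \<le> a \<and> 0 \<le> b \<and> a + b \<le> 1}"

lemma convex_triangle: "convex triangle"
proof -
  have eq: "triangle = {p. (-1, 0) \<bullet> p \<le> 0} \<inter> {p. (0, -1) \<bullet> p \<le> 0} \<inter> {p. (1, 1) \<bullet> p \<le> (1::real)}"
    unfolding triangle_def by (auto simp: inner_prod_def)
  show ?thesis unfolding eq by (intro convex_Int convex_halfspace_le)
qed

lemma edge_point_simplex: "t \<in> {0..1} \<Longrightarrow> edge_point t \<in> standard_simplex 1"
  by (auto simp: standard_simplex_def edge_point_def)

lemma triangle_point_simplex: "p \<in> triangle \<Longrightarrow> triangle_point p \<in> standard_simplex 2"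
  by (auto simp: standard_simplex_def triangle_point_def triangle_def numeral_2_eq_2)

lemma continuous_edge_point: "continuous_on X edge_point"
proof (rule continuous_on_coordinatewise_then_product)
  fix i show "continuous_on X (\<lambda>t. edge_point t i)"
    by (cases "i = 0"; cases "i = 1") (auto simp: edge_point_def intro!: continuous_intros)
qed

lemma continuous_triangle_point: "continuous_on X triangle_point"
proof (rule continuous_on_coordinatewise_then_product)
  fix i show "continuous_on X (\<lambda>p. triangle_point p i)"
    by (cases "i = 0"; cases "i = 1"; cases "i = 2")
      (auto simp: triangle_point_def[abs_def] case_prod_beta intro!: continuous_intros)
qed

lemma face_edge_point:
  "simplical_face 0 (edge_point t) = triangle_point (1 - t, t)"
  "simplical_face 1 (edge_point t) = triangle_point (0, t)"
  "simplical_face 2 (edge_point t) = triangle_point (t, 0)"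
  by (auto simp: fun_eq_iff simplical_face_def edge_point_def triangle_point_def)

lemma continuous_simplical_face: "continuous_on X (simplical_face k :: (nat \<Rightarrow> real) \<Rightarrow> nat \<Rightarrow> real)"
proof (rule continuous_on_coordinatewise_then_product)
  fix i
  have "continuous_on X (\<lambda>x::nat \<Rightarrow> real. x j)" for j
    by (rule continuous_on_subset[OF continuous_on_product_coordinates]) auto
  then show "continuous_on X (\<lambda>x::nat \<Rightarrow> real. simplical_face k x i)"
    by (cases "i < k"; cases "i = k") (simp_all add: simplical_face_def)
qed

text \<open>The cosimplicial identity; it pairs the terms that cancel in
  \<open>chern_cocycle\<close>.\<close>

lemma simplical_face_face:
  "i < j \<Longrightarrow> simplical_face j (simplical_face i x) = simplical_face i (simplical_face (j - 1) x)"
proof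
  fix n assume "i < j"
  then consider "n < i" | "n = i" | "i < n" "n < j" | "n = j" | "n > j" by linarith
  then show "simplical_face j (simplical_face i x) n = simplical_face i (simplical_face (j - 1) x) n"
    by cases (use \<open>i < j\<close> in \<open>auto simp: simplical_face_def\<close>)
qed

lemma singular_simplex_iff:
  "singular_simplex p (top_of_set M) f \<longleftrightarrow>
     continuous_on (standard_simplex p) f \<and> f ` standard_simplex p \<subseteq> M \<and> f \<in> extensional (standard_simplex p)"
  by (auto simp: singular_simplex_def continuous_map_in_subtopology euclidean_product_topology
      simp flip: continuous_map_iff_continuous)

text \<open>Extends a real cochain additively to integral chains. Real values are required since
  rotations along edges with free ends are not quantized.\<close>

definition chain_eval :: "(('b \<Rightarrow> 'a) \<Rightarrow> real) \<Rightarrow> (('b \<Rightarrow> 'a) \<Rightarrow>\<^sub>0 int) \<Rightarrow> real" where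
  "chain_eval f c = (\<Sum>\<sigma>\<in>Poly_Mapping.keys c. of_int (Poly_Mapping.lookup c \<sigma>) * f \<sigma>)"

lemma chain_eval_superset:
  assumes "finite A" "Poly_Mapping.keys c \<subseteq> A"
  shows "chain_eval f c = (\<Sum>\<sigma>\<in>A. of_int (Poly_Mapping.lookup c \<sigma>) * f \<sigma>)"
  unfolding chain_eval_def by (rule sum.mono_neutral_left) (use assms in \<open>auto simp: in_keys_iff\<close>)

lemma chain_eval_0 [simp]: "chain_eval f 0 = 0"
  by (simp add: chain_eval_def)

lemma chain_eval_of [simp]: "chain_eval f (frag_of \<sigma>) = f \<sigma>"
  by (simp add: chain_eval_def)

lemma chain_eval_add: "chain_eval f (a + b) = chain_eval f a + chain_eval f b"
proof -
  let ?A = "Poly_Mapping.keys a \<union> Poly_Mapping.keys b"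
  have "chain_eval f c = (\<Sum>\<sigma>\<in>?A. of_int (Poly_Mapping.lookup c \<sigma>) * f \<sigma>)" if "c \<in> {a, b, a + b}" for c
    by (rule chain_eval_superset) (use that keys_add[of a b] in auto)
  then show ?thesis by (simp add: lookup_add distrib_right sum.distrib)
qed

lemma chain_eval_diff: "chain_eval f (a - b) = chain_eval f a - chain_eval f b"
  using chain_eval_add[of f "a - b" b] by simp

lemma chain_eval_cmul: "chain_eval f (frag_cmul k c) = of_int k * chain_eval f c"
proof -
  have "chain_eval f (frag_cmul k c) = (\<Sum>\<sigma>\<in>Poly_Mapping.keys c. of_int (Poly_Mapping.lookup (frag_cmul k c) \<sigma>) * f \<sigma>)"
    by (rule chain_eval_superset) (use keys_cmul[of k c] in auto)
  then show ?thesis by (simp add: chain_eval_def sum_distrib_left mult.assoc)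
qed

lemma chain_eval_sum: "chain_eval f (\<Sum>i\<in>I. c i) = (\<Sum>i\<in>I. chain_eval f (c i))"
  by (induction I rule: infinite_finite_induct) (auto simp: chain_eval_add)

text \<open>An oriented plane bundle over \<open>M\<close>: \<open>N y\<close> is the set of nonzero vectors of the fibre and
  the argument of \<open>z y X Y\<close> is the angle from \<open>Y\<close> to \<open>X\<close> or its opposite.\<close>

locale plane_bundle =
  fixes M :: "'a::euclidean_space set" and N :: "'a \<Rightarrow> 'a set" and z :: "'a \<Rightarrow> 'a \<Rightarrow> 'a \<Rightarrow> complex"
  assumes z_nonzero: "\<And>y X Y. y \<in> M \<Longrightarrow> X \<in> N y \<Longrightarrow> Y \<in> N y \<Longrightarrow> z y X Y \<noteq> 0"
    and z_mult: "\<And>y X Y R. y \<in> M \<Longrightarrow> X \<in> N y \<Longrightarrow> Y \<in> N y \<Longrightarrow> R \<in> N y \<Longrightarrow>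
      \<exists>c>0. z y X Y * z y Y R = complex_of_real c * z y X R"
    and z_cont: "continuous_on {(y, X, Y). y \<in> M \<and> X \<in> N y \<and> Y \<in> N y} (\<lambda>(y, X, Y). z y X Y)"
    and sections: "\<And>p \<sigma>. singular_simplex p (top_of_set M) \<sigma> \<Longrightarrow>
      \<exists>s. continuous_on (standard_simplex p) s \<and> (\<forall>x\<in>standard_simplex p. s x \<in> N (\<sigma> x))"
begin

definition section_over :: "nat \<Rightarrow> ((nat \<Rightarrow> real) \<Rightarrow> 'a) \<Rightarrow> ((nat \<Rightarrow> real) \<Rightarrow> 'a) \<Rightarrow> bool" where
  "section_over p \<sigma> s \<longleftrightarrow> continuous_on (standard_simplex p) s \<and> (\<forall>x\<in>standard_simplex p. s x \<in> N (\<sigma> x))"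

definition some_section :: "nat \<Rightarrow> ((nat \<Rightarrow> real) \<Rightarrow> 'a) \<Rightarrow> (nat \<Rightarrow> real) \<Rightarrow> 'a" where
  "some_section p \<sigma> = (SOME s. section_over p \<sigma> s)"

lemma some_section: "singular_simplex p (top_of_set M) \<sigma> \<Longrightarrow> section_over p \<sigma> (some_section p \<sigma>)"
  unfolding some_section_def section_over_def using someI_ex[OF sections] by simp

lemma z_continuous:
  assumes "continuous_on S f" "continuous_on S X" "continuous_on S Y" "\<And>s. s \<in> S \<Longrightarrow> f s \<in> M \<and> X s \<in> N (f s) \<and> Y s \<in> N (f s)"
  shows "continuous_on S (\<lambda>s. z (f s) (X s) (Y s))"
proof -
  have "continuous_on S (\<lambda>s. (f s, X s, Y s))" by (intro continuous_intros assms)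
  from continuous_on_compose2[OF z_cont this] show ?thesis using assms(4) by auto
qed

definition rotation :: "(real \<Rightarrow> 'a) \<Rightarrow> (real \<Rightarrow> 'a) \<Rightarrow> (real \<Rightarrow> 'a) \<Rightarrow> real" where
  "rotation c X Y = angle_change (\<lambda>t. z (c t) (X t) (Y t))"

lemma rotation_trans:
  assumes c: "continuous_on {0..1} c" and X: "continuous_on {0..1} X" and Y: "continuous_on {0..1} Y" and R: "continuous_on {0..1} R"
    and "\<And>t. t \<in> {0..1} \<Longrightarrow> c t \<in> M \<and> X t \<in> N (c t) \<and> Y t \<in> N (c t) \<and> R t \<in> N (c t)"
  shows "rotation c X R = rotation c X Y + rotation c Y R"
proof -
  have cont: "continuous_on {0..1} (\<lambda>t. z (c t) (X t) (Y t))" "continuous_on {0..1} (\<lambda>t. z (c t) (Y t) (R t))"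
    "continuous_on {0..1} (\<lambda>t. z (c t) (X t) (R t))"
    using assms by (auto intro!: z_continuous)
  have "angle_change (\<lambda>t. z (c t) (X t) (Y t) * z (c t) (Y t) (R t)) = angle_change (\<lambda>t. z (c t) (X t) (R t))"
    by (rule angle_change_scale) (use assms cont z_nonzero z_mult in \<open>auto intro!: continuous_intros\<close>)
  moreover have "angle_change (\<lambda>t. z (c t) (X t) (Y t) * z (c t) (Y t) (R t)) = rotation c X Y + rotation c Y R"
    unfolding rotation_def by (rule angle_change_mult) (use assms cont z_nonzero in auto)
  ultimately show ?thesis by (simp add: rotation_def)
qed

definition edge_rotation :: "((nat \<Rightarrow> real) \<Rightarrow> 'a) \<Rightarrow> ((nat \<Rightarrow> real) \<Rightarrow> 'a) \<Rightarrow> ((nat \<Rightarrow> real) \<Rightarrow> 'a) \<Rightarrow> real" where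
  "edge_rotation \<sigma> s s' = rotation (\<lambda>t. \<sigma> (edge_point t)) (\<lambda>t. s (edge_point t)) (\<lambda>t. s' (edge_point t))"

lemma edge_rotation_trans:
  assumes "singular_simplex 1 (top_of_set M) \<sigma>" "section_over 1 \<sigma> s" "section_over 1 \<sigma> s'" "section_over 1 \<sigma> s''"
  shows "edge_rotation \<sigma> s s'' = edge_rotation \<sigma> s s' + edge_rotation \<sigma> s' s''"
  unfolding edge_rotation_def
  by (rule rotation_trans)
    (use assms edge_point_simplex in \<open>auto simp: singular_simplex_iff section_over_def
      intro!: continuous_on_compose2[OF _ continuous_edge_point]\<close>)

text \<open>On each edge \<open>s\<close> is compared with a reference section that depends only on
  the edge as a singular simplex, so triangles with a common edge share the reference.\<close>

definition boundary_rotation :: "((nat \<Rightarrow> real) \<Rightarrow> 'a) \<Rightarrow> ((nat \<Rightarrow> real) \<Rightarrow> 'a) \<Rightarrow> real" where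
  "boundary_rotation \<tau> s = (\<Sum>k\<le>2. (-1) ^ k * edge_rotation (singular_face 2 k \<tau>) (some_section 1 (singular_face 2 k \<tau>)) (s \<circ> simplical_face k))"

text \<open>If the reference sections agreed at the vertices, the value would be, up to sign,
  \<open>2 * pi\<close> times the obstruction to extending them over the triangle. They are chosen
  independently, so the cochain is only real-valued.\<close>

definition chern :: "((nat \<Rightarrow> real) \<Rightarrow> 'a) \<Rightarrow> real" where
  "chern \<tau> = boundary_rotation \<tau> (some_section 2 \<tau>)"

lemma section_over_face:
  assumes "section_over p \<sigma> s" "1 \<le> p" "k \<le> p"
  shows "section_over (p - 1) (singular_face p k \<sigma>) (s \<circ> simplical_face k)"
proof -
  have f: "simplical_face k x \<in> standard_simplex p" if "x \<in> standard_simplex (p - 1)" for x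
    using simplical_face_in_standard_simplex[OF assms(2,3)] that by simp
  have "continuous_on (standard_simplex (p - 1)) (s \<circ> simplical_face k)"
    unfolding o_def by (rule continuous_on_compose2[OF _ continuous_simplical_face]) (use assms f in \<open>auto simp: section_over_def\<close>)
  then show ?thesis using assms(1) f by (auto simp: section_over_def singular_face_def)
qed

text \<open>Over the contractible triangle the angle between two sections has a global logarithm
  \<open>l\<close>, so its increments around the boundary add up to zero.\<close>

lemma boundary_rotation_flat:
  assumes \<tau>: "singular_simplex 2 (top_of_set M) \<tau>" and s: "section_over 2 \<tau> s" "section_over 2 \<tau> s'"
  shows "(\<Sum>k\<le>2. (-1) ^ k * edge_rotation (singular_face 2 k \<tau>) (s \<circ> simplical_face k) (s' \<circ> simplical_face k)) = 0"
proof -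
  define g where "g p = z (\<tau> (triangle_point p)) (s (triangle_point p)) (s' (triangle_point p))" for p
  have tri: "\<tau> (triangle_point p) \<in> M" "s (triangle_point p) \<in> N (\<tau> (triangle_point p))" "s' (triangle_point p) \<in> N (\<tau> (triangle_point p))"
    if "p \<in> triangle" for p
    using triangle_point_simplex[OF that] \<tau> s by (auto simp: singular_simplex_iff section_over_def)
  have "continuous_on triangle g"
    unfolding g_def
    by (rule z_continuous; (rule continuous_on_compose2[OF _ continuous_triangle_point])?)
      (use \<tau> s tri triangle_point_simplex in \<open>auto simp: singular_simplex_iff section_over_def\<close>)
  moreover have "g p \<noteq> 0" if "p \<in> triangle" for p unfolding g_def using tri[OF that] z_nonzero by blast
  ultimately obtain l where l: "continuous_on triangle l" "\<And>p. p \<in> triangle \<Longrightarrow> g p = exp (l p)"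
    using continuous_logarithm_on_contractible[of triangle g] convex_imp_contractible[OF convex_triangle] by metis
  have e: "edge_rotation (singular_face 2 k \<tau>) (s \<circ> simplical_face k) (s' \<circ> simplical_face k) = Im (l (c 1)) - Im (l (c 0))"
    if c: "continuous_on {0..1} c" "c ` {0..1} \<subseteq> triangle" "\<And>t. simplical_face k (edge_point t) = triangle_point (c t)" for k c
    unfolding edge_rotation_def rotation_def
  proof (rule angle_change_eq)
    show "continuous_on {0..1} (\<lambda>t. l (c t))" by (rule continuous_on_compose2[OF l(1) c(1,2)])
    show "z (singular_face 2 k \<tau> (edge_point t)) ((s \<circ> simplical_face k) (edge_point t)) ((s' \<circ> simplical_face k) (edge_point t)) = exp (l (c t))"
      if "t \<in> {0..1}" for t
    proof -
      have "c t \<in> triangle" using c(2) that by blast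
      from l(2)[OF this] show ?thesis using edge_point_simplex[OF that] unfolding g_def by (simp add: singular_face_def c(3))
    qed
  qed
  have "edge_rotation (singular_face 2 0 \<tau>) (s \<circ> simplical_face 0) (s' \<circ> simplical_face 0) = Im (l (0, 1)) - Im (l (1, 0))"
    by (rule trans[OF e[OF _ _ face_edge_point(1)]]) (auto simp: triangle_def intro!: continuous_intros)
  moreover have "edge_rotation (singular_face 2 1 \<tau>) (s \<circ> simplical_face 1) (s' \<circ> simplical_face 1) = Im (l (0, 1)) - Im (l (0, 0))"
    by (rule trans[OF e[OF _ _ face_edge_point(2)]]) (auto simp: triangle_def intro!: continuous_intros)
  moreover have "edge_rotation (singular_face 2 2 \<tau>) (s \<circ> simplical_face 2) (s' \<circ> simplical_face 2) = Im (l (1, 0)) - Im (l (0, 0))"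
    by (rule trans[OF e[OF _ _ face_edge_point(3)]]) (auto simp: triangle_def intro!: continuous_intros)
  ultimately show ?thesis by (simp add: numeral_2_eq_2)
qed

lemma boundary_rotation_eq:
  assumes \<tau>: "singular_simplex 2 (top_of_set M) \<tau>" and s: "section_over 2 \<tau> s"
  shows "boundary_rotation \<tau> s = chern \<tau>"
proof -
  let ?s = "some_section 2 \<tau>"
  have f: "singular_simplex 1 (top_of_set M) (singular_face 2 k \<tau>)" if "k \<le> 2" for k
    using singular_simplex_singular_face[OF \<tau>, of k] that by simp
  have sf: "section_over 1 (singular_face 2 k \<tau>) (s \<circ> simplical_face k)" if "section_over 2 \<tau> s" "k \<le> 2" for k s
    using section_over_face[OF that(1) _ that(2)] by simp
  have "edge_rotation (singular_face 2 k \<tau>) (some_section 1 (singular_face 2 k \<tau>)) (s \<circ> simplical_face k) =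
      edge_rotation (singular_face 2 k \<tau>) (some_section 1 (singular_face 2 k \<tau>)) (?s \<circ> simplical_face k)
      + edge_rotation (singular_face 2 k \<tau>) (?s \<circ> simplical_face k) (s \<circ> simplical_face k)" if "k \<le> 2" for k
    by (rule edge_rotation_trans) (use f sf s some_section \<tau> that in auto)
  then have "boundary_rotation \<tau> s = chern \<tau> + (\<Sum>k\<le>2. (-1) ^ k * edge_rotation (singular_face 2 k \<tau>) (?s \<circ> simplical_face k) (s \<circ> simplical_face k))"
    unfolding boundary_rotation_def chern_def by (simp add: sum.distrib distrib_left)
  then show ?thesis using boundary_rotation_flat[OF \<tau> some_section[OF \<tau>] s] by simp
qed

text \<open>One section over the 3-simplex serves on all four faces. Every one of the six edges then
  occurs twice with the same rotation and opposite signs.\<close>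

lemma chern_cocycle:
  assumes \<omega>: "singular_simplex 3 (top_of_set M) \<omega>"
  shows "(\<Sum>j\<le>3. (-1) ^ j * chern (singular_face 3 j \<omega>)) = 0"
proof -
  let ?R = "some_section 3 \<omega>"
  define F where "F j i = edge_rotation (singular_face 2 i (singular_face 3 j \<omega>)) (some_section 1 (singular_face 2 i (singular_face 3 j \<omega>)))
     ((?R \<circ> simplical_face j) \<circ> simplical_face i)" for j i
  have c: "chern (singular_face 3 j \<omega>) = (\<Sum>i\<le>2. (-1) ^ i * F j i)" if "j \<le> 3" for j
  proof -
    have "singular_simplex 2 (top_of_set M) (singular_face 3 j \<omega>)"
      using singular_simplex_singular_face[OF \<omega>, of j] that by simp
    moreover have "section_over 2 (singular_face 3 j \<omega>) (?R \<circ> simplical_face j)"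
      using section_over_face[OF some_section[OF \<omega>], of j] that by simp
    ultimately show ?thesis using boundary_rotation_eq[of "singular_face 3 j \<omega>" "?R \<circ> simplical_face j"]
      unfolding boundary_rotation_def F_def by simp
  qed
  have F: "F j i = F i (j - 1)" if "i < j" "j \<le> 3" for i j
  proof -
    have "singular_face 2 i (singular_face 3 j \<omega>) = singular_face 2 (j - 1) (singular_face 3 i \<omega>)"
    proof
      fix x
      have "simplical_face i x \<in> standard_simplex 2" "simplical_face (j - 1) x \<in> standard_simplex 2" if "x \<in> standard_simplex 1"
        using simplical_face_in_standard_simplex[of 2 _ x] that \<open>i < j\<close> \<open>j \<le> 3\<close> by auto
      then show "singular_face 2 i (singular_face 3 j \<omega>) x = singular_face 2 (j - 1) (singular_face 3 i \<omega>) x"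
        using simplical_face_face[OF that(1), of x] by (auto simp: singular_face_def restrict_def)
    qed
    moreover have "(?R \<circ> simplical_face j) \<circ> simplical_face i = (?R \<circ> simplical_face i) \<circ> simplical_face (j - 1)"
      by (rule ext) (simp only: o_apply simplical_face_face[OF that(1)])
    ultimately show ?thesis by (simp add: F_def)
  qed
  have "(\<Sum>j\<le>3. (-1) ^ j * chern (singular_face 3 j \<omega>)) = (\<Sum>j\<le>3. (-1) ^ j * (\<Sum>i\<le>2. (-1) ^ i * F j i))"
    by (rule sum.cong) (auto simp: c)
  also have "\<dots> = 0"
    using F[of 0 1] F[of 0 2] F[of 0 3] F[of 1 2] F[of 1 3] F[of 2 3]
    by (simp add: numeral_2_eq_2 numeral_3_eq_3 algebra_simps)
  finally show ?thesis .
qed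

lemma chern_boundary:
  assumes "singular_chain 3 (top_of_set M) d"
  shows "chain_eval chern (chain_boundary 3 d) = 0"
proof -
  have "Poly_Mapping.keys d \<subseteq> singular_simplex_set 3 (top_of_set M)" using assms singular_chain_def by blast
  then show ?thesis
  proof (induction rule: frag_induction)
    case (one \<omega>)
    have "chain_eval chern (chain_boundary 3 (frag_of \<omega>)) = (\<Sum>j\<le>3. (-1) ^ j * chern (singular_face 3 j \<omega>))"
      by (simp add: chain_boundary_of chain_eval_sum chain_eval_cmul)
    then show ?case using chern_cocycle one by simp
  qed (auto simp: chain_boundary_diff chain_eval_diff)
qed

text \<open>\<open>h\<close> closes up to a torus while the section \<open>T\<close> need not. Two
  triangles form a cycle, which is a boundary, so \<open>chern\<close> agrees on them. With
  \<open>T\<close> as section, the diagonal and the reference sections drop out, and what remains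
  compares the mismatch of \<open>T\<close> on the two pairs of opposite edges.\<close>

lemma torus_rotation:
  assumes H2: "trivial_group (homology_group 2 (top_of_set M))"
    and h: "continuous_on ({0..1} \<times> {0..1}) h" "h ` ({0..1} \<times> {0..1}) \<subseteq> M"
    "\<And>s. s \<in> {0..1} \<Longrightarrow> h (0, s) = h (1, s)" "\<And>t. t \<in> {0..1} \<Longrightarrow> h (t, 0) = h (t, 1)"
    and T: "continuous_on ({0..1} \<times> {0..1}) T" "\<And>p. p \<in> {0..1} \<times> {0..1} \<Longrightarrow> T p \<in> N (h p)"
  shows "rotation (\<lambda>s. h (0, s)) (\<lambda>s. T (0, s)) (\<lambda>s. T (1, s)) = rotation (\<lambda>t. h (t, 0)) (\<lambda>t. T (t, 0)) (\<lambda>t. T (t, 1))"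
proof -
  let ?S = "standard_simplex 2"
  \<comment> \<open>The triangles with vertices (0,0), (1,0), (1,1) and (0,0), (0,1), (1,1).\<close>
  define \<pi>1 where "\<pi>1 = (\<lambda>x::nat \<Rightarrow> real. (x 1 + x 2, x 2))"
  define \<pi>2 where "\<pi>2 = (\<lambda>x::nat \<Rightarrow> real. (x 2, x 1 + x 2))"
  define \<tau>1 where "\<tau>1 = restrict (h \<circ> \<pi>1) ?S"
  define \<tau>2 where "\<tau>2 = restrict (h \<circ> \<pi>2) ?S"
  have \<pi>c: "continuous_on ?S \<pi>1" "continuous_on ?S \<pi>2"
    unfolding \<pi>1_def \<pi>2_def by (auto intro!: continuous_intros continuous_on_subset[OF continuous_on_product_coordinates])
  have \<pi>r: "\<pi>1 ` ?S \<subseteq> {0..1} \<times> {0..1}" "\<pi>2 ` ?S \<subseteq> {0..1} \<times> {0..1}"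
    unfolding \<pi>1_def \<pi>2_def standard_simplex_def by (auto simp: numeral_2_eq_2) (smt (verit))+
  have \<tau>: "singular_simplex 2 (top_of_set M) \<tau>1" "singular_simplex 2 (top_of_set M) \<tau>2"
    unfolding singular_simplex_iff \<tau>1_def \<tau>2_def
    using \<pi>r h(2) continuous_on_compose2[OF h(1) \<pi>c(1) \<pi>r(1)] continuous_on_compose2[OF h(1) \<pi>c(2) \<pi>r(2)]
    by (auto simp: image_subset_iff o_def cong: continuous_on_cong)
  have s: "section_over 2 \<tau>1 (T \<circ> \<pi>1)" "section_over 2 \<tau>2 (T \<circ> \<pi>2)"
    unfolding section_over_def \<tau>1_def \<tau>2_def
    using \<pi>r T(2) continuous_on_compose2[OF T(1) \<pi>c(1) \<pi>r(1)] continuous_on_compose2[OF T(1) \<pi>c(2) \<pi>r(2)]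
    by (auto simp: image_subset_iff o_def)
  have fx: "simplical_face k x \<in> ?S" if "x \<in> standard_simplex (Suc 0)" "k \<le> 2" for x k
    using simplical_face_in_standard_simplex[of 2 k x] that by simp
  have x01: "x 0 + x (Suc 0) = 1" "x 0 \<in> {0..1}" "x (Suc 0) \<in> {0..1}" if "x \<in> standard_simplex (Suc 0)" for x :: "nat \<Rightarrow> real"
    using that by (auto simp: standard_simplex_def)
  have face_h: "singular_face 2 k (restrict (h \<circ> \<pi>) ?S) = singular_face 2 k' (restrict (h \<circ> \<pi>') ?S)"
    if "k \<le> 2" "k' \<le> 2" "\<And>x. x \<in> standard_simplex (Suc 0) \<Longrightarrow> h (\<pi> (simplical_face k x)) = h (\<pi>' (simplical_face k' x))" for k k' \<pi> \<pi>'
    unfolding singular_face_def by (rule ext) (use that fx in \<open>auto simp: restrict_def\<close>)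
  \<comment> \<open>By periodicity of \<open>h\<close> the right edge is the left one and the bottom
    is the top as singular simplices; the diagonal is common. Each pair is listed with the face of
    \<open>\<tau>1\<close> first.\<close>
  have sf: "singular_face 2 0 \<tau>1 = singular_face 2 2 \<tau>2" "singular_face 2 1 \<tau>1 = singular_face 2 1 \<tau>2" "singular_face 2 2 \<tau>1 = singular_face 2 0 \<tau>2"
    unfolding \<tau>1_def \<tau>2_def
  proof (rule_tac [!] face_h)
    fix x :: "nat \<Rightarrow> real" assume x: "x \<in> standard_simplex (Suc 0)"
    show "h (\<pi>1 (simplical_face 0 x)) = h (\<pi>2 (simplical_face 2 x))"
      using x01[OF x] h(3)[of "x (Suc 0)"] by (simp add: \<pi>1_def \<pi>2_def simplical_face_def)
    show "h (\<pi>1 (simplical_face 1 x)) = h (\<pi>2 (simplical_face 1 x))"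
      by (simp add: \<pi>1_def \<pi>2_def simplical_face_def)
    show "h (\<pi>1 (simplical_face 2 x)) = h (\<pi>2 (simplical_face 0 x))"
      using x01[OF x] h(4)[of "x (Suc 0)"] by (simp add: \<pi>1_def \<pi>2_def simplical_face_def add.commute)
  qed auto
  let ?z = "frag_of \<tau>1 - frag_of \<tau>2"
  have "singular_chain 2 (top_of_set M) ?z" using \<tau> by (simp add: singular_chain_diff singular_chain_of)
  moreover have "chain_boundary 2 ?z = 0"
    by (simp add: chain_boundary_diff chain_boundary_of numeral_2_eq_2 sf[unfolded numeral_2_eq_2, simplified])
  ultimately have cyc: "singular_relcycle 2 (top_of_set M) {} ?z" by (simp add: singular_cycle)
  have "homologous_rel_set 2 (top_of_set M) {} ?z = singular_relboundary_set 2 (top_of_set M) {}"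
  proof -
    have "homologous_rel_set 2 (top_of_set M) {} ?z \<in> carrier (homology_group 2 (top_of_set M))"
      unfolding carrier_relative_homology_group[of 2 "top_of_set M" "{}", unfolded of_nat_numeral] using cyc by blast
    also have "\<dots> = {singular_relboundary_set 2 (top_of_set M) {}}"
      using H2 unfolding trivial_group_def one_relative_homology_group[of 2 "top_of_set M" "{}", unfolded of_nat_numeral] by blast
    finally show ?thesis by blast
  qed
  then have "singular_relboundary 2 (top_of_set M) {} ?z" using homologous_rel_set_eq_relboundary by blast
  then obtain d where d: "singular_chain 3 (top_of_set M) d" "chain_boundary 3 d = ?z"
    unfolding singular_boundary by (auto simp: numeral_3_eq_3 numeral_2_eq_2)
  have "chern \<tau>1 - chern \<tau>2 = 0" using chern_boundary[OF d(1)] unfolding d(2) by (simp add: chain_eval_diff)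
  then have br: "boundary_rotation \<tau>1 (T \<circ> \<pi>1) = boundary_rotation \<tau>2 (T \<circ> \<pi>2)"
    using boundary_rotation_eq[OF \<tau>(1) s(1)] boundary_rotation_eq[OF \<tau>(2) s(2)] by simp
  let ?l = "singular_face 2 2 \<tau>2" and ?b = "singular_face 2 2 \<tau>1" and ?d = "singular_face 2 1 \<tau>2"
  have dg: "edge_rotation ?d (some_section 1 ?d) ((T \<circ> \<pi>1) \<circ> simplical_face 1) = edge_rotation ?d (some_section 1 ?d) ((T \<circ> \<pi>2) \<circ> simplical_face 1)"
    unfolding edge_rotation_def by (simp add: \<pi>1_def \<pi>2_def simplical_face_def)
  have eq: "edge_rotation ?l (some_section 1 ?l) ((T \<circ> \<pi>1) \<circ> simplical_face 0) - edge_rotation ?l (some_section 1 ?l) ((T \<circ> \<pi>2) \<circ> simplical_face 2)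
     = edge_rotation ?b (some_section 1 ?b) ((T \<circ> \<pi>2) \<circ> simplical_face 0) - edge_rotation ?b (some_section 1 ?b) ((T \<circ> \<pi>1) \<circ> simplical_face 2)"
    using br sf dg unfolding boundary_rotation_def by (simp add: numeral_2_eq_2)
  have ss: "singular_simplex 1 (top_of_set M) ?l" "singular_simplex 1 (top_of_set M) ?b"
    using singular_simplex_singular_face[of 2 "top_of_set M" _ 2] \<tau> by auto
  have sc: "section_over 1 ?l ((T \<circ> \<pi>1) \<circ> simplical_face 0)" "section_over 1 ?l ((T \<circ> \<pi>2) \<circ> simplical_face 2)"
    "section_over 1 ?b ((T \<circ> \<pi>2) \<circ> simplical_face 0)" "section_over 1 ?b ((T \<circ> \<pi>1) \<circ> simplical_face 2)"
    using section_over_face[OF s(1), of 0] section_over_face[OF s(1), of 2] section_over_face[OF s(2), of 0] section_over_face[OF s(2), of 2] sf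
    by auto
  \<comment> \<open>The unknown reference sections are eliminated by
    \<open>edge_rotation_trans\<close>; only rotations between values of \<open>T\<close> are
    left.\<close>
  have 1: "edge_rotation ?l ((T \<circ> \<pi>2) \<circ> simplical_face 2) ((T \<circ> \<pi>1) \<circ> simplical_face 0) = edge_rotation ?b ((T \<circ> \<pi>1) \<circ> simplical_face 2) ((T \<circ> \<pi>2) \<circ> simplical_face 0)"
    using eq edge_rotation_trans[OF ss(1) some_section[OF ss(1)] sc(2,1)] edge_rotation_trans[OF ss(2) some_section[OF ss(2)] sc(4,3)] by simp
  have ac: "angle_change f = angle_change g" if "\<And>t. t \<in> {0..1} \<Longrightarrow> f t = g t" for f g :: "real \<Rightarrow> complex"
  proof -
    have "(\<lambda>l. continuous_on {0..1} l \<and> (\<forall>t\<in>{0..1}. f t = exp (l t))) = (\<lambda>l. continuous_on {0..1} l \<and> (\<forall>t\<in>{0..1}. g t = exp (l t)))"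
      using that by fastforce
    then show ?thesis unfolding angle_change_def by simp
  qed
  have "edge_rotation ?l ((T \<circ> \<pi>2) \<circ> simplical_face 2) ((T \<circ> \<pi>1) \<circ> simplical_face 0) = rotation (\<lambda>s. h (0, s)) (\<lambda>s. T (0, s)) (\<lambda>s. T (1, s))"
    unfolding edge_rotation_def rotation_def
    by (rule ac) (use edge_point_simplex fx in \<open>auto simp: singular_face_def \<tau>2_def \<pi>1_def \<pi>2_def simplical_face_def edge_point_def\<close>)
  moreover have "edge_rotation ?b ((T \<circ> \<pi>1) \<circ> simplical_face 2) ((T \<circ> \<pi>2) \<circ> simplical_face 0) = rotation (\<lambda>t. h (t, 0)) (\<lambda>t. T (t, 0)) (\<lambda>t. T (t, 1))"
    unfolding edge_rotation_def rotation_def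
    by (rule ac) (use edge_point_simplex fx in \<open>auto simp: singular_face_def \<tau>1_def \<pi>1_def \<pi>2_def simplical_face_def edge_point_def\<close>)
  ultimately show ?thesis using 1 by simp
qed

end

lemma homology_sphere_trivial:
  assumes "integral_homology_3sphere M"
  shows "trivial_group (homology_group 2 (top_of_set M))"
proof -
  have "trivial_group (reduced_homology_group 2 (nsphere 3))"
    using reduced_homology_group_nsphere(2)[of 2 3] by simp
  then have "trivial_group (homology_group 2 (nsphere 3))" by (simp add: un_reduced_homology_group)
  moreover have "homology_group 2 (top_of_set M) \<cong> homology_group 2 (nsphere 3)"
    using assms unfolding integral_homology_3sphere_def by blast
  ultimately show ?thesis
    by (simp add: isomorphic_group_triviality)
qed

section \<open>Unit quaternions\<close>

text \<open>Quaternions are pairs of complex numbers, imaginary quaternions are elements of \<open>real \<times> complex\<close>.\<close>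

type_synonym quat = "complex \<times> complex"

text \<open>The pair \<open>(a, b)\<close> stands for \<open>a + b j\<close>, where
  \<open>j c = cnj c j\<close> and \<open>j j = -1\<close>.\<close>

definition qmul :: "quat \<Rightarrow> quat \<Rightarrow> quat" where
  "qmul p q = (fst p * fst q - snd p * cnj (snd q), fst p * snd q + snd p * cnj (fst q))"

definition qcnj :: "quat \<Rightarrow> quat" where
  "qcnj q = (cnj (fst q), - snd q)"

definition imag_quat :: "real \<times> complex \<Rightarrow> quat" where
  "imag_quat w = (\<i> * of_real (fst w), snd w)"

text \<open>Conjugation with \<open>qcnj q\<close> in place of the inverse, so lengths are
  multiplied by \<open>(norm q)\<^sup>2\<close>. For unit \<open>q\<close> this is a rotation, and
  \<open>q\<close> to \<open>rot q (1, 0)\<close> is the Hopf fibration, with fibres the left cosets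
  of the circle \<open>(cis a, 0)\<close>.\<close>

definition rot :: "quat \<Rightarrow> real \<times> complex \<Rightarrow> real \<times> complex" where
  "rot q w = (let r = qmul (qmul q (imag_quat w)) (qcnj q) in (Im (fst r), snd r))"

lemma qmul_assoc: "qmul (qmul p q) r = qmul p (qmul q r)"
  by (simp add: qmul_def algebra_simps)

lemma qmul_one [simp]: "qmul (1, 0) q = q" "qmul q (1, 0) = q"
  by (auto simp: qmul_def)

lemma qcnj_qmul: "qcnj (qmul p q) = qmul (qcnj q) (qcnj p)"
  by (simp add: qmul_def qcnj_def algebra_simps)

lemma norm_quat: "(norm (q :: quat))\<^sup>2 = (norm (fst q))\<^sup>2 + (norm (snd q))\<^sup>2"
  by (simp add: norm_prod_def)

lemma qmul_qcnj: "qmul q (qcnj q) = (of_real ((norm q)\<^sup>2), 0)" "qmul (qcnj q) q = (of_real ((norm q)\<^sup>2), 0)"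
proof -
  have "fst q * cnj (fst q) + snd q * cnj (snd q) = of_real ((norm q)\<^sup>2)"
    unfolding norm_quat of_real_add complex_norm_square ..
  then show "qmul q (qcnj q) = (of_real ((norm q)\<^sup>2), 0)" "qmul (qcnj q) q = (of_real ((norm q)\<^sup>2), 0)"
    by (simp_all add: qmul_def qcnj_def mult.commute)
qed

lemma norm_qcnj [simp]: "norm (qcnj q) = norm q"
  by (simp add: qcnj_def norm_prod_def)

lemma qcnj_one [simp]: "qcnj (1, 0) = (1, 0)"
  by (simp add: qcnj_def)

lemma qmul_real_central: "qmul (qmul p (of_real c, 0)) q = qmul (of_real c, 0) (qmul p q)"
  by (simp add: qmul_def algebra_simps)

lemma norm_qmul: "norm (qmul p q) = norm p * norm q"
proof -
  have "(of_real ((norm (qmul p q))\<^sup>2), 0) = qmul (qmul p (qmul q (qcnj q))) (qcnj p)"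
    by (simp only: qmul_qcnj[symmetric] qcnj_qmul qmul_assoc)
  also have "\<dots> = (of_real ((norm q)\<^sup>2) * of_real ((norm p)\<^sup>2), 0)"
    unfolding qmul_qcnj qmul_real_central by (simp add: qmul_def)
  finally have "complex_of_real ((norm (qmul p q))\<^sup>2) = of_real ((norm q)\<^sup>2 * (norm p)\<^sup>2)" by simp
  then have "(norm (qmul p q))\<^sup>2 = (norm p * norm q)\<^sup>2" by (simp only: of_real_eq_iff power_mult_distrib mult.commute)
  then show ?thesis by (simp add: power2_eq_iff_nonneg)
qed

lemma imag_quat_eq: "imag_quat v = imag_quat w \<longleftrightarrow> v = w"
  by (auto simp: imag_quat_def prod_eq_iff)

lemma norm_imag_quat [simp]: "norm (imag_quat w) = norm w"
  by (simp add: imag_quat_def norm_prod_def norm_mult)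

lemma imag_quat_rot: "imag_quat (rot q w) = qmul (qmul q (imag_quat w)) (qcnj q)"
proof -
  have "Re (fst (qmul (qmul q (imag_quat w)) (qcnj q))) = 0"
    by (simp add: qmul_def qcnj_def imag_quat_def algebra_simps)
  moreover have "imag_quat (Im (fst r), snd r) = r" if "Re (fst r) = 0" for r
    using that by (simp add: imag_quat_def prod_eq_iff complex_eq_iff)
  ultimately show ?thesis unfolding rot_def Let_def by blast
qed

lemma rot_qmul: "rot (qmul p q) w = rot p (rot q w)"
  unfolding imag_quat_eq[symmetric] imag_quat_rot by (simp add: qcnj_qmul qmul_assoc)

lemma rot_one [simp]: "rot (1, 0) w = w"
  by (simp add: rot_def qmul_def qcnj_def imag_quat_def)

lemma norm_rot: "norm (rot q w) = (norm q)\<^sup>2 * norm w"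
proof -
  have "norm (rot q w) = norm (imag_quat (rot q w))" by simp
  also have "\<dots> = norm q * norm w * norm q" unfolding imag_quat_rot by (simp add: norm_qmul)
  finally show ?thesis by (simp add: power2_eq_square)
qed

lemma rot_scaleR: "rot q (k *\<^sub>R w) = k *\<^sub>R rot q w"
  by (simp add: rot_def Let_def qmul_def qcnj_def imag_quat_def scaleR_conv_of_real algebra_simps prod_eq_iff)

lemma rot_quat_scaleR: "rot (k *\<^sub>R q) w = k\<^sup>2 *\<^sub>R rot q w"
  by (simp add: rot_def Let_def qmul_def qcnj_def imag_quat_def scaleR_conv_of_real algebra_simps prod_eq_iff power2_eq_square)

lemma rot_add: "rot q (v + w) = rot q v + rot q w"
  by (simp add: rot_def Let_def qmul_def qcnj_def imag_quat_def algebra_simps prod_eq_iff)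

lemma linear_rot: "linear (rot q)"
  by (rule linearI) (auto simp: rot_add rot_scaleR)

lemma rot_qcnj: "norm q = 1 \<Longrightarrow> rot (qcnj q) (rot q w) = w" "norm q = 1 \<Longrightarrow> rot q (rot (qcnj q) w) = w"
  by (simp_all add: rot_qmul[symmetric] qmul_qcnj)

lemma continuous_on_qmul:
  fixes f g :: "'a::t2_space \<Rightarrow> quat"
  shows "continuous_on S f \<Longrightarrow> continuous_on S g \<Longrightarrow> continuous_on S (\<lambda>x. qmul (f x) (g x))"
  unfolding qmul_def by (intro continuous_intros)

lemma continuous_on_qcnj:
  fixes f :: "'a::t2_space \<Rightarrow> quat"
  shows "continuous_on S f \<Longrightarrow> continuous_on S (\<lambda>x. qcnj (f x))"
  unfolding qcnj_def by (intro continuous_intros)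

lemma continuous_on_rot:
  fixes f :: "'a::t2_space \<Rightarrow> quat"
  shows "continuous_on S f \<Longrightarrow> continuous_on S g \<Longrightarrow> continuous_on S (\<lambda>x. rot (f x) (g x))"
  unfolding rot_def Let_def qmul_def qcnj_def imag_quat_def by (intro continuous_intros)

text \<open>\<open>turn b a\<close> is a multiple of the shortest rotation from \<open>a\<close> to \<open>b\<close>.\<close>

definition turn :: "real \<times> complex \<Rightarrow> real \<times> complex \<Rightarrow> quat" where
  "turn b a = (1, 0) - qmul (imag_quat b) (imag_quat a)"

lemma imag_quat_square:
  assumes "norm a = 1"
  shows "qmul (imag_quat a) (imag_quat a) = (-1, 0)"
proof -
  have "(norm a)\<^sup>2 = 1" using assms by simp
  then have "(fst a)\<^sup>2 + ((Re (snd a))\<^sup>2 + (Im (snd a))\<^sup>2) = 1" by (simp add: norm_prod_def cmod_power2)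
  then show ?thesis
    by (simp add: qmul_def imag_quat_def prod_eq_iff complex_eq_iff power2_eq_square algebra_simps)
qed

lemma qmul_diff_right: "qmul p (q - r) = qmul p q - qmul p r"
  and qmul_diff_left: "qmul (q - r) p = qmul q p - qmul r p"
  by (simp_all add: qmul_def algebra_simps)

text \<open>Imaginary units square to -1, so \<open>1 - b a\<close> intertwines \<open>a\<close> and
  \<open>b\<close>: both products equal \<open>a + b\<close>.\<close>

lemma turn_rot:
  assumes "norm a = 1" "norm b = 1"
  shows "rot (turn b a) a = (norm (turn b a))\<^sup>2 *\<^sub>R b"
proof -
  have m: "qmul p (-1, 0) = - p" "qmul (-1, 0) p = - p" for p by (simp_all add: qmul_def prod_eq_iff)
  have "qmul (turn b a) (imag_quat a) = imag_quat a + imag_quat b"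
    by (simp add: turn_def qmul_diff_left qmul_assoc imag_quat_square[OF assms(1)] m)
  moreover have "qmul (imag_quat b) (turn b a) = imag_quat b + imag_quat a"
    by (simp add: turn_def qmul_diff_right qmul_assoc[symmetric] imag_quat_square[OF assms(2)] m)
  ultimately have 1: "qmul (turn b a) (imag_quat a) = qmul (imag_quat b) (turn b a)" by (simp add: add.commute)
  have "imag_quat (rot (turn b a) a) = qmul (imag_quat b) (of_real ((norm (turn b a))\<^sup>2), 0)"
    unfolding imag_quat_rot 1 by (simp only: qmul_assoc qmul_qcnj)
  also have "\<dots> = imag_quat ((norm (turn b a))\<^sup>2 *\<^sub>R b)"
    by (simp add: imag_quat_def qmul_def scaleR_conv_of_real mult.commute)
  finally show ?thesis by (simp only: imag_quat_eq)
qed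

text \<open>Zero would mean that \<open>b\<close> is antipodal to \<open>a\<close>, the only case
  without a shortest rotation.\<close>

lemma turn_nonzero:
  assumes "norm a = 1" "norm b = 1" "dist a b < 2"
  shows "turn b a \<noteq> 0"
proof
  assume "turn b a = 0"
  then have "qmul (imag_quat b) (imag_quat a) = (1, 0)" by (simp add: turn_def)
  then have "qmul (imag_quat b) (qmul (imag_quat b) (imag_quat a)) = imag_quat b" by simp
  then have "imag_quat b = - imag_quat a"
    unfolding qmul_assoc[symmetric] imag_quat_square[OF assms(2)] by (simp add: qmul_def prod_eq_iff)
  also have "\<dots> = imag_quat (- a)" by (simp add: imag_quat_def)
  finally have "b = - a" by (simp only: imag_quat_eq)
  then have "dist a b = norm (2 *\<^sub>R a)" by (simp add: dist_norm scaleR_2)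
  then show False using assms by simp
qed

lemma turn_self: "norm a = 1 \<Longrightarrow> turn a a = (2, 0)"
  using imag_quat_square by (simp add: turn_def)

definition unit_turn :: "real \<times> complex \<Rightarrow> real \<times> complex \<Rightarrow> quat" where
  "unit_turn b a = inverse (norm (turn b a)) *\<^sub>R turn b a"

lemma unit_turn:
  assumes "norm a = 1" "norm b = 1" "dist a b < 2"
  shows "norm (unit_turn b a) = 1" "rot (unit_turn b a) a = b"
  using turn_nonzero[OF assms] by (simp_all add: unit_turn_def rot_quat_scaleR turn_rot assms power_inverse)

lemma unit_turn_self: "norm a = 1 \<Longrightarrow> unit_turn a a = (1, 0)"
  by (simp add: unit_turn_def turn_self norm_prod_def prod_eq_iff complex_eq_iff)

lemma continuous_on_unit_turn:
  fixes f g :: "'a::t2_space \<Rightarrow> real \<times> complex"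
  assumes "continuous_on S f" "continuous_on S g" "\<And>x. x \<in> S \<Longrightarrow> norm (f x) = 1 \<and> norm (g x) = 1 \<and> dist (g x) (f x) < 2"
  shows "continuous_on S (\<lambda>x. unit_turn (f x) (g x))"
proof -
  have "continuous_on S (\<lambda>x. turn (f x) (g x))"
    unfolding turn_def imag_quat_def by (intro continuous_intros continuous_on_qmul assms)
  then show ?thesis unfolding unit_turn_def
    by (intro continuous_intros) (use turn_nonzero assms(3) in auto)
qed

fun turn_path :: "(nat \<Rightarrow> real \<times> complex) \<Rightarrow> nat \<Rightarrow> quat" where
  "turn_path f 0 = (1, 0)"
| "turn_path f (Suc n) = qmul (unit_turn (f (Suc n)) (f n)) (turn_path f n)"

text \<open>The time interval is divided so finely that consecutive vectors are never antipodal, and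
  the shortest rotations are multiplied. The result is determined by the path of \<open>x\<close>
  alone; the last two conclusions record this, and in \<open>solid_torus_contraction\<close> they
  give periodicity in the circle direction and the value one on the core.\<close>

lemma sphere_homotopy_lift:
  fixes F :: "real \<times> 'a::metric_space \<Rightarrow> real \<times> complex"
  assumes "compact X" "continuous_on ({0..1} \<times> X) F" "\<forall>p\<in>{0..1} \<times> X. norm (F p) = 1"
  obtains k where "continuous_on X k" "\<And>x. x \<in> X \<Longrightarrow> norm (k x) = 1" "\<And>x. x \<in> X \<Longrightarrow> rot (k x) (F (0, x)) = F (1, x)"
    "\<And>x y. x \<in> X \<Longrightarrow> y \<in> X \<Longrightarrow> (\<And>s. s \<in> {0..1} \<Longrightarrow> F (s, x) = F (s, y)) \<Longrightarrow> k x = k y"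
    "\<And>x. x \<in> X \<Longrightarrow> (\<And>s. s \<in> {0..1} \<Longrightarrow> F (s, x) = F (0, x)) \<Longrightarrow> k x = (1, 0)"
proof -
  have "uniformly_continuous_on ({0..1} \<times> X) F"
    using assms by (intro compact_uniformly_continuous compact_Times) auto
  then obtain d where d: "d > 0" "\<And>p p'. p \<in> {0..1} \<times> X \<Longrightarrow> p' \<in> {0..1} \<times> X \<Longrightarrow> dist p' p < d \<Longrightarrow> dist (F p') (F p) < 2"
    unfolding uniformly_continuous_on_def by (metis zero_less_numeral)
  obtain m :: nat where m: "m > 0" "1 / m < d"
    using real_arch_inverse[of d] d(1) by (auto simp: inverse_eq_divide)
  define f where "f x j = F (j / m, x)" for x and j :: nat
  have fX: "(real j / m, x) \<in> {0..1} \<times> X" if "x \<in> X" "j \<le> m" for x j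
    using that m by auto
  have f1: "norm (f x j) = 1" if "x \<in> X" "j \<le> m" for x j unfolding f_def using assms(3) fX[OF that] by blast
  have fd: "dist (f x j) (f x (Suc j)) < 2" if "x \<in> X" "Suc j \<le> m" for x j
  proof -
    have "dist (real j / m, x) (real (Suc j) / m, x) = 1 / m"
      by (simp add: dist_Pair_Pair dist_real_def flip: diff_divide_distrib)
    then show ?thesis unfolding f_def using d(2) fX that m by (metis Suc_leD)
  qed
  have fc: "continuous_on X (\<lambda>x. f x j)" if "j \<le> m" for j
    unfolding f_def by (rule continuous_on_compose2[OF assms(2)]) (use fX that in \<open>auto intro!: continuous_intros\<close>)
  have k: "continuous_on X (\<lambda>x. turn_path (f x) j) \<and> (\<forall>x\<in>X. norm (turn_path (f x) j) = 1 \<and> rot (turn_path (f x) j) (f x 0) = f x j)"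
    if "j \<le> m" for j
    using that
  proof (induction j)
    case (Suc j)
    have "continuous_on X (\<lambda>x. unit_turn (f x (Suc j)) (f x j))"
      by (rule continuous_on_unit_turn) (use fc fd f1 Suc.prems in auto)
    then show ?case
      using Suc unit_turn fd f1 by (auto simp: norm_qmul rot_qmul intro!: continuous_on_qmul)
  qed auto
  show thesis
  proof (rule that[of "\<lambda>x. turn_path (f x) m"])
    show "rot (turn_path (f x) m) (F (0, x)) = F (1, x)" if "x \<in> X" for x
      using k[of m] that m(1) by (auto simp: f_def)
    show "turn_path (f x) m = turn_path (f y) m" if xy: "x \<in> X" "y \<in> X" "\<And>s. s \<in> {0..1} \<Longrightarrow> F (s, x) = F (s, y)" for x y
    proof -
      have e: "f x j = f y j" if "j \<le> m" for j
        unfolding f_def by (rule xy(3)) (use fX[OF xy(1) that] in simp)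
      have "turn_path (f x) j = turn_path (f y) j" if "j \<le> m" for j
        using that by (induction j) (auto simp: e)
      then show ?thesis by simp
    qed
    show "turn_path (f x) m = (1, 0)" if x: "x \<in> X" "\<And>s. s \<in> {0..1} \<Longrightarrow> F (s, x) = F (0, x)" for x
    proof -
      have e: "f x j = F (0, x)" if "j \<le> m" for j
        unfolding f_def by (rule x(2)) (use fX[OF x(1) that] in simp)
      have "norm (F (0, x)) = 1" using assms(3) x(1) by auto
      then have "turn_path (f x) j = (1, 0)" if "j \<le> m" for j
        using that by (induction j) (auto simp: e unit_turn_self)
      then show ?thesis by simp
    qed
  qed (use k in auto)
qed

lemma rot_transitive:
  assumes "norm u = 1"
  obtains q where "norm q = 1" "rot q (1, 0) = u"
proof (cases "u = (-1, 0)")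
  case True
  \<comment> \<open>The antipode is out of reach of \<open>unit_turn\<close>; the quaternion
    \<open>j\<close> takes the axis there.\<close>
  show ?thesis by (rule that[of "(0, 1)"]) (auto simp: True rot_def qmul_def qcnj_def imag_quat_def)
next
  case False
  have "dist (1, 0) u < 2"
  proof (rule ccontr)
    assume "\<not> dist (1, 0) u < 2"
    moreover have "norm ((1::real, 0::complex) - u) \<le> norm (1::real, 0::complex) + norm u" by (rule norm_triangle_ineq4)
    ultimately have "norm ((1, 0) - u) = norm (1::real, 0::complex) + norm u" using assms by (simp add: dist_norm)
    then have "norm ((1, 0) + (- u)) = norm (1::real, 0::complex) + norm (- u)" by simp
    then have "norm (1::real, 0::complex) *\<^sub>R (- u) = norm (- u) *\<^sub>R (1, 0)" using norm_triangle_eq by blast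
    then have "- u = (1, 0)" using assms by simp
    then show False using False by (simp add: prod_eq_iff minus_equation_iff)
  qed
  then show ?thesis using that[OF unit_turn[of "(1, 0)" u]] assms by simp
qed

text \<open>A unit quaternion that fixes the axis \<open>(1, 0)\<close> commutes with
  \<open>i\<close>, which forces its second component to vanish. So two points of a Hopf fibre
  differ by a right factor on the complex unit circle.\<close>

lemma rot_stabilizer:
  assumes "norm q = 1" "norm p = 1" "rot p (1, 0) = rot q (1, 0)"
  shows "p = qmul q (fst (qmul (qcnj q) p), 0)" "norm (fst (qmul (qcnj q) p)) = 1"
proof -
  define r where "r = qmul (qcnj q) p"
  have n: "norm r = 1" using assms by (simp add: r_def norm_qmul)
  have "rot r (1, 0) = (1, 0)" unfolding r_def rot_qmul assms(3) rot_qcnj(1)[OF assms(1)] ..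
  then have "qmul (qmul r (\<i>, 0)) (qcnj r) = (\<i>, 0)" using imag_quat_rot[of r "(1, 0)"] by (simp add: imag_quat_def)
  then have "qmul (qmul r (\<i>, 0)) (qmul (qcnj r) r) = qmul (\<i>, 0) r" by (simp add: qmul_assoc[symmetric])
  then have "qmul r (\<i>, 0) = qmul (\<i>, 0) r" using n by (simp add: qmul_qcnj)
  then have "snd r * - \<i> = \<i> * snd r" by (simp add: qmul_def)
  then have s: "snd r = 0" by (simp add: complex_eq_iff)
  have "qmul q r = p" using assms(1) unfolding r_def by (simp add: qmul_assoc[symmetric] qmul_qcnj)
  then show "p = qmul q (fst (qmul (qcnj q) p), 0)" unfolding r_def[symmetric] using s by (metis prod.collapse)
  show "norm (fst (qmul (qcnj q) p)) = 1" unfolding r_def[symmetric] using n s by (simp add: norm_prod_def)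
qed

text \<open>Two lifts of the same map differ by a function to the circle, which has a real angle
  because the domain is contractible.\<close>

lemma rot_seam:
  fixes p q :: "'a::real_normed_vector \<Rightarrow> quat"
  assumes "contractible X" "continuous_on X p" "continuous_on X q"
    "\<And>x. x \<in> X \<Longrightarrow> norm (p x) = 1 \<and> norm (q x) = 1 \<and> rot (p x) (1, 0) = rot (q x) (1, 0)"
  obtains \<alpha> where "continuous_on X \<alpha>" "\<And>x. x \<in> X \<Longrightarrow> p x = qmul (q x) (cis (\<alpha> x), 0)"
proof -
  define c where "c x = fst (qmul (qcnj (q x)) (p x))" for x
  have c1: "norm (c x) = 1" "p x = qmul (q x) (c x, 0)" if "x \<in> X" for x
    using rot_stabilizer[of "q x" "p x"] assms(4)[OF that] unfolding c_def by auto
  have "continuous_on X c" unfolding c_def by (intro continuous_intros continuous_on_qmul continuous_on_qcnj assms)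
  moreover have "c x \<noteq> 0" if "x \<in> X" for x using c1[OF that] by auto
  ultimately obtain l where l: "continuous_on X l" "\<And>x. x \<in> X \<Longrightarrow> c x = exp (l x)"
    using continuous_logarithm_on_contractible[of X c] assms(1) by metis
  have "c x = cis (Im (l x))" if "x \<in> X" for x
  proof -
    have "exp (Re (l x)) = 1" using c1(1)[OF that] l(2)[OF that] by (metis norm_exp_eq_Re)
    then show ?thesis using l(2)[OF that] by (simp add: exp_eq_polar[of "l x"])
  qed
  then show thesis using that[of "\<lambda>x. Im (l x)"] l c1 by (auto intro!: continuous_intros)
qed

text \<open>The doubling of the angle is the factor between the degree and the Euler number.\<close>

lemma rot_cis:
  "rot (cis \<alpha>, 0) (0, 1) = cos (2 * \<alpha>) *\<^sub>R (0, 1) + sin (2 * \<alpha>) *\<^sub>R (0, \<i>)"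
proof -
  have "rot (cis \<alpha>, 0) (0, 1) = (0, cis (\<alpha> + \<alpha>))"
    by (simp add: rot_def qmul_def qcnj_def imag_quat_def cis_mult)
  also have "cis (\<alpha> + \<alpha>) = complex_of_real (cos (2 * \<alpha>)) + complex_of_real (sin (2 * \<alpha>)) * \<i>"
    by (simp add: complex_eq_iff)
  finally show ?thesis by (simp add: scaleR_conv_of_real)
qed

lemma rot_cis_axis [simp]: "rot (cis \<alpha>, 0) (1, 0) = (1, 0)"
proof -
  have "Im (fst (qmul (qmul (cis \<alpha>, 0) (imag_quat (1, 0))) (qcnj (cis \<alpha>, 0)))) = 1"
    by (simp add: qmul_def qcnj_def imag_quat_def flip: power2_eq_square)
  moreover have "snd (qmul (qmul (cis \<alpha>, 0) (imag_quat (1, 0))) (qcnj (cis \<alpha>, 0))) = 0"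
    by (simp add: qmul_def qcnj_def imag_quat_def)
  ultimately show ?thesis by (simp only: rot_def Let_def)
qed

lemma qmul_cis: "qmul (cis a, 0) (cis b, 0) = (cis (a + b), 0)"
  by (simp add: qmul_def cis_mult)

section \<open>Contracting loops of vectors over a solid torus\<close>

text \<open>By compactness closed sets have closed images, so \<open>E\<close> is a quotient map
  onto its image.\<close>

lemma continuous_on_factor:
  fixes E :: "'a::metric_space \<Rightarrow> 'b::metric_space" and f :: "'a \<Rightarrow> 'c::topological_space"
  assumes "compact S" "continuous_on S E" "continuous_on S f"
    and "\<And>x y. x \<in> S \<Longrightarrow> y \<in> S \<Longrightarrow> E x = E y \<Longrightarrow> f x = f y"
  obtains g where "continuous_on (E ` S) g" "\<And>x. x \<in> S \<Longrightarrow> g (E x) = f x"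
proof -
  define g where "g y = f (SOME x. x \<in> S \<and> E x = y)" for y
  have g: "g (E x) = f x" if x: "x \<in> S" for x
  proof -
    have "(SOME z. z \<in> S \<and> E z = E x) \<in> S \<and> E (SOME z. z \<in> S \<and> E z = E x) = E x"
      by (rule someI[of "\<lambda>z. z \<in> S \<and> E z = E x" x]) (use x in auto)
    then show ?thesis unfolding g_def using assms(4) x by blast
  qed
  have "closedin (top_of_set (E ` S)) (E ` S \<inter> g -` C)" if C: "closedin (top_of_set (g ` E ` S)) C" for C
  proof -
    have e: "g ` E ` S = f ` S" using g by (auto simp: image_image)
    have "closedin (top_of_set S) (S \<inter> f -` C)"
      using continuous_on_imp_closedin[OF assms(3)] C unfolding e by blast
    then have "compact (S \<inter> f -` C)" using closedin_compact[OF assms(1)] by blast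
    then have "compact (E ` (S \<inter> f -` C))"
      using compact_continuous_image continuous_on_subset[OF assms(2)] by blast
    moreover have "E ` (S \<inter> f -` C) = E ` S \<inter> g -` C" using g by auto
    ultimately show ?thesis by (metis Int_lower1 closed_subset compact_imp_closed)
  qed
  then have "continuous_on (E ` S) g" unfolding continuous_on_closed by blast
  then show thesis using that g by blast
qed

definition circle_point :: "real \<Rightarrow> complex" where
  "circle_point t = cis (2 * pi * t)"

lemma circle_point_0 [simp]: "circle_point 0 = 1" "circle_point 1 = 1"
  by (simp_all add: circle_point_def)

lemma norm_circle_point [simp]: "norm (circle_point t) = 1"
  by (simp add: circle_point_def)

lemma continuous_circle_point [continuous_intros]: "continuous_on S f \<Longrightarrow> continuous_on S (\<lambda>x. circle_point (f x))"
  unfolding circle_point_def by (intro continuous_intros)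

lemma circle_point_image: "circle_point ` {0..1} = sphere 0 1"
proof -
  have "z \<in> circle_point ` {0..1}" if z: "norm z = 1" for z
  proof -
    obtain a where a: "0 \<le> a" "a < 2 * pi" "z = cis a"
      using z Arg2pi[of z] by (metis Arg2pi_eq cis_conv_exp mult_1 of_real_1)
    then show ?thesis by (intro image_eqI[of _ _ "a / (2 * pi)"]) (auto simp: circle_point_def field_simps)
  qed
  then show ?thesis by auto
qed

lemma circle_point_inj:
  assumes "s \<in> {0..1}" "t \<in> {0..1}" "circle_point s = circle_point t"
  shows "s = t \<or> (s = 0 \<and> t = 1) \<or> (s = 1 \<and> t = 0)"
proof -
  obtain n :: int where n: "2 * pi * s = 2 * pi * t + 2 * pi * n"
    using assms(3) sin_cos_eq_iff[of "2 * pi * s" "2 * pi * t"] unfolding circle_point_def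
    by (auto simp: complex_eq_iff mult_ac)
  then have "2 * pi * (s - t - n) = 0" by (simp add: algebra_simps)
  then have "s = t + n" by simp
  moreover have "-1 \<le> n" "n \<le> 1" using calculation assms(1,2) by auto
  then have "n = -1 \<or> n = 0 \<or> n = 1" by linarith
  ultimately show ?thesis using assms(1,2) by auto
qed

lemma periodic_square_factor:
  fixes f :: "real \<times> real \<Rightarrow> 'c::topological_space"
  assumes "continuous_on ({0..1} \<times> {0..1}) f" "\<And>s. s \<in> {0..1} \<Longrightarrow> f (0, s) = f (1, s)" "\<And>t. t \<in> {0..1} \<Longrightarrow> f (t, 0) = f (t, 1)"
  obtains g where "continuous_on (sphere 0 1 \<times> sphere 0 1) g" "\<And>t s. t \<in> {0..1} \<Longrightarrow> s \<in> {0..1} \<Longrightarrow> g (circle_point t, circle_point s) = f (t, s)"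
proof -
  let ?E = "\<lambda>p. (circle_point (fst p), circle_point (snd p))"
  have c: "compact ({0..1::real} \<times> {0..1::real})" by (intro compact_Times) auto
  have E: "continuous_on ({0..1} \<times> {0..1}) ?E" by (intro continuous_intros)
  have f: "f x = f y" if "x \<in> {0..1} \<times> {0..1}" "y \<in> {0..1} \<times> {0..1}" "?E x = ?E y" for x y
    using that circle_point_inj[of "fst x" "fst y"] circle_point_inj[of "snd x" "snd y"] assms(2,3)
    by (cases x; cases y) auto
  obtain g where g: "continuous_on (?E ` ({0..1} \<times> {0..1})) g" "\<And>x. x \<in> {0..1} \<times> {0..1} \<Longrightarrow> g (?E x) = f x"
    using continuous_on_factor[OF c E assms(1) f] by blast
  have "?E ` ({0..1} \<times> {0..1}) = (circle_point ` {0..1}) \<times> (circle_point ` {0..1})" by force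
  then show thesis using that[of g] g unfolding circle_point_image by force
qed

lemma scaleR_solve:
  fixes x y :: "'a::real_vector"
  assumes "k *\<^sub>R x = m *\<^sub>R y" "k \<noteq> 0"
  shows "x = (inverse k * m) *\<^sub>R y"
proof -
  have "x = inverse k *\<^sub>R (k *\<^sub>R x)" using assms(2) by simp
  then show ?thesis unfolding assms(1) by simp
qed

text \<open>A continuous map of the torus may fill the 3-sphere. A polynomial approximation cannot,
  for reasons of dimension, and once a direction is missed straight segments lead to it without
  meeting zero.\<close>

lemma torus_map_nullhomotopic:
  fixes g :: "complex \<times> complex \<Rightarrow> quat"
  assumes "continuous_on (sphere 0 1 \<times> sphere 0 1) g" "\<And>p. p \<in> sphere 0 1 \<times> sphere 0 1 \<Longrightarrow> norm (g p) = 1"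
  obtains \<Gamma> c where "continuous_on ((sphere 0 1 \<times> sphere 0 1) \<times> {0..1::real}) \<Gamma>"
    "\<And>p \<tau>. p \<in> sphere 0 1 \<times> sphere 0 1 \<Longrightarrow> \<tau> \<in> {0..1} \<Longrightarrow> norm (\<Gamma> (p, \<tau>)) = 1"
    "\<And>p. p \<in> sphere 0 1 \<times> sphere 0 1 \<Longrightarrow> \<Gamma> (p, 0) = g p" "\<And>p. p \<in> sphere 0 1 \<times> sphere 0 1 \<Longrightarrow> \<Gamma> (p, 1) = c"
proof -
  let ?T = "sphere 0 1 \<times> sphere 0 1 :: (complex \<times> complex) set"
  have cT: "compact ?T" by (intro compact_Times) auto
  obtain p where p: "polynomial_function p" "\<And>x. x \<in> ?T \<Longrightarrow> norm (g x - p x) < 1 / 2"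
    using Stone_Weierstrass_polynomial_function[OF cT assms(1), of "1 / 2"] by auto
  have pc: "continuous_on S p" for S using p(1) continuous_on_polymonial_function by blast
  have p_pos: "norm (p x) > 1 / 2" if "x \<in> ?T" for x
    using p(2)[OF that] assms(2)[OF that] norm_triangle_ineq2[of "g x" "p x"] by simp
  \<comment> \<open>The cone over the approximated torus, parametrized by three real variables; its
    range is negligible in the four-dimensional space of quaternions.\<close>
  define F where "F = (\<lambda>(l, t, s). l *\<^sub>R p (circle_point t, circle_point s))"
  have "F differentiable_on UNIV"
  proof -
    have cp: "(\<lambda>x. circle_point (h x)) differentiable (at x)" if hd: "h differentiable (at x)" for h :: "real \<times> real \<times> real \<Rightarrow> real" and x
    proof -
      obtain h' where h: "(h has_derivative h') (at x)" using hd unfolding differentiable_def by blast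
      have "\<exists>D. ((\<lambda>x. complex_of_real (cos (2 * pi * h x)) + \<i> * complex_of_real (sin (2 * pi * h x))) has_derivative D) (at x)"
        by (intro exI) (rule has_derivative_add has_derivative_of_real has_derivative_mult_right has_derivative_cos has_derivative_sin h)+
      moreover have "(\<lambda>x. circle_point (h x)) = (\<lambda>x. complex_of_real (cos (2 * pi * h x)) + \<i> * complex_of_real (sin (2 * pi * h x)))"
        by (auto simp: circle_point_def complex_eq_iff)
      ultimately show ?thesis unfolding differentiable_def by simp
    qed
    have "(\<lambda>x. fst x *\<^sub>R p (circle_point (fst (snd x)), circle_point (snd (snd x)))) differentiable (at x)" for x
    proof (intro derivative_intros)
      show "(\<lambda>x. p (circle_point (fst (snd x)), circle_point (snd (snd x)))) differentiable (at x)"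
        by (rule differentiable_compose[of p]; (rule differentiable_at_polynomial_function[OF p(1)])?)
          (auto intro!: differentiable_Pair cp simp: bounded_linear_imp_differentiable bounded_linear_compose[OF bounded_linear_fst bounded_linear_snd] bounded_linear_compose[OF bounded_linear_snd bounded_linear_snd])
    qed (simp add: bounded_linear_imp_differentiable bounded_linear_fst)
    then show ?thesis unfolding F_def differentiable_on_def case_prod_beta by auto
  qed
  then have "negligible (range F)"
    by (intro negligible_differentiable_image_lowdim) auto
  then obtain c0 where c0: "c0 \<notin> range F" using non_negligible_UNIV by (metis UNIV_eq_I)
  have c0n: "c0 \<noteq> 0"
  proof
    assume "c0 = 0"
    moreover have "F (0, 0, 0) = 0" unfolding F_def by simp
    ultimately show False using c0 by (metis rangeI)
  qed
  define c where "c = inverse (norm c0) *\<^sub>R c0"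
  have c1: "norm c = 1" using c0n by (simp add: c_def)
  \<comment> \<open>The parameter \<open>l\<close> of the cone takes both signs, so the whole line
    through \<open>c\<close> is missed and no segment from \<open>p x\<close> to \<open>c\<close>
    contains zero.\<close>
  have miss: "p x \<noteq> l *\<^sub>R c" if "x \<in> ?T" for x l
  proof
    assume e: "p x = l *\<^sub>R c"
    obtain t s where ts: "x = (circle_point t, circle_point s)"
      using \<open>x \<in> ?T\<close> circle_point_image by (metis (no_types, lifting) SigmaE imageE)
    have "l \<noteq> 0" using p_pos[OF that] e by auto
    then have "c0 = (norm c0 / l) *\<^sub>R p x" using c0n unfolding e c_def by simp
    also have "\<dots> = F (norm c0 / l, t, s)" unfolding F_def ts by simp
    finally show False using c0 by blast
  qed
  \<comment> \<open>Up to \<open>\<tau> = 1 / 2\<close> the straight segment from \<open>g\<close>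
    to \<open>p\<close>, afterwards the one from \<open>p\<close> to \<open>c\<close>.\<close>
  define A where "A = (\<lambda>(x, \<tau>). max 0 (1 - 2 * \<tau>) *\<^sub>R g x + min (2 * \<tau>) (2 - 2 * \<tau>) *\<^sub>R p x + max 0 (2 * \<tau> - 1) *\<^sub>R c)"
  have Ac: "continuous_on (?T \<times> {0..1}) A"
    unfolding A_def case_prod_beta
    by (intro continuous_intros continuous_on_compose2[OF assms(1)] continuous_on_compose2[OF pc[of UNIV]]) auto
  have A0: "A (x, \<tau>) \<noteq> 0" if x: "x \<in> ?T" "\<tau> \<in> {0..1}" for x \<tau>
  proof (cases "\<tau> \<le> 1 / 2")
    case True
    then have e: "A (x, \<tau>) = g x - (2 * \<tau>) *\<^sub>R (g x - p x)" unfolding A_def by (simp add: algebra_simps)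
    have "norm ((2 * \<tau>) *\<^sub>R (g x - p x)) \<le> 1 * norm (g x - p x)"
      unfolding norm_scaleR using True x by (intro mult_right_mono) auto
    also have "\<dots> < norm (g x)" using p(2)[OF x(1)] assms(2)[OF x(1)] by simp
    finally have "g x \<noteq> (2 * \<tau>) *\<^sub>R (g x - p x)" by (metis less_irrefl)
    then show ?thesis unfolding e by (simp only: right_minus_eq not_False_eq_True)
  next
    case False
    then have e: "A (x, \<tau>) = (2 - 2 * \<tau>) *\<^sub>R p x + (2 * \<tau> - 1) *\<^sub>R c" unfolding A_def by simp
    show ?thesis
    proof
      assume z: "A (x, \<tau>) = 0"
      show False
      proof (cases "\<tau> = 1")
        case True then show False using z c1 unfolding e by simp
      next
        case neq: False
        have "(2 - 2 * \<tau>) *\<^sub>R p x = - (2 * \<tau> - 1) *\<^sub>R c" using z unfolding e by (simp only: scaleR_minus_left eq_neg_iff_add_eq_0)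
        moreover have "2 - 2 * \<tau> \<noteq> 0" using neq by simp
        ultimately have "p x = (inverse (2 - 2 * \<tau>) * - (2 * \<tau> - 1)) *\<^sub>R c" by (rule scaleR_solve)
        then show False using miss[OF x(1)] by blast
      qed
    qed
  qed
  show thesis
  proof (rule that[of "\<lambda>y. inverse (norm (A y)) *\<^sub>R A y" c])
    show "continuous_on (?T \<times> {0..1}) (\<lambda>y. inverse (norm (A y)) *\<^sub>R A y)"
      by (intro continuous_intros Ac) (use A0 in auto)
    show "norm (inverse (norm (A (x, \<tau>))) *\<^sub>R A (x, \<tau>)) = 1" if "x \<in> ?T" "\<tau> \<in> {0..1}" for x \<tau>
      using A0[OF that] by simp
    show "inverse (norm (A (x, 0))) *\<^sub>R A (x, 0) = g x" if "x \<in> ?T" for x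
      using assms(2)[OF that] by (simp add: A_def)
    show "inverse (norm (A (x, 1))) *\<^sub>R A (x, 1) = c" if "x \<in> ?T" for x
      using c1 by (simp add: A_def)
  qed
qed

text \<open>A lift \<open>q\<close> over the square closes up only up to angles
  \<open>\<alpha>\<close> and \<open>\<beta>\<close> along the seams. Right factors on the circle do
  not change \<open>u\<close>, and if both angles have the same total change one such factor removes
  both seams.\<close>

lemma torus_lift:
  fixes u :: "real \<times> real \<Rightarrow> real \<times> complex"
  assumes q: "continuous_on ({0..1} \<times> {0..1}) q" "\<And>p. p \<in> {0..1} \<times> {0..1} \<Longrightarrow> norm (q p) = 1 \<and> rot (q p) (1, 0) = u p"
    and \<alpha>: "continuous_on {0..1} \<alpha>" "\<And>t. t \<in> {0..1} \<Longrightarrow> q (t, 1) = qmul (q (t, 0)) (cis (\<alpha> t), 0)"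
    and \<beta>: "continuous_on {0..1} \<beta>" "\<And>s. s \<in> {0..1} \<Longrightarrow> q (1, s) = qmul (q (0, s)) (cis (\<beta> s), 0)"
    and eq: "\<alpha> 1 - \<alpha> 0 = \<beta> 1 - \<beta> 0"
  obtains g where "continuous_on (sphere 0 1 \<times> sphere 0 1) g" "\<And>p. p \<in> sphere 0 1 \<times> sphere 0 1 \<Longrightarrow> norm (g p) = 1"
    "\<And>z. z \<in> sphere 0 1 \<Longrightarrow> g (z, 1) = (1, 0)"
    "\<And>t s. t \<in> {0..1} \<Longrightarrow> s \<in> {0..1} \<Longrightarrow> rot (g (circle_point t, circle_point s)) (u (t, 0)) = u (t, s)"
proof -
  define \<kappa> where "\<kappa> = \<alpha> 1 - \<alpha> 0"
  \<comment> \<open>Linear interpolation against the two seams. The term with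
    \<open>\<kappa>\<close> corrects the double count at the corner; this is where equality of the
    total changes enters.\<close>
  define \<gamma> where "\<gamma> = (\<lambda>(t, s). t * s * \<kappa> - s * \<alpha> t - t * \<beta> s)"
  define q' where "q' x = qmul (q x) (cis (\<gamma> x), 0)" for x
  have \<gamma>c: "continuous_on ({0..1} \<times> {0..1}) \<gamma>"
    unfolding \<gamma>_def case_prod_beta
    by (intro continuous_intros continuous_on_compose2[OF \<alpha>(1)] continuous_on_compose2[OF \<beta>(1)]) auto
  have q'c: "continuous_on ({0..1} \<times> {0..1}) q'"
    unfolding q'_def by (intro continuous_on_qmul q continuous_intros \<gamma>c)
  have q'1: "norm (q' x) = 1" "rot (q' x) (1, 0) = u x" if "x \<in> {0..1} \<times> {0..1}" for x
    using q(2)[OF that] by (simp_all add: q'_def norm_qmul rot_qmul)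
  have top: "q' (t, 1) = q' (t, 0)" if "t \<in> {0..1}" for t
  proof -
    have b: "\<beta> 1 = \<beta> 0 + \<kappa>" using eq by (simp add: \<kappa>_def)
    have "\<alpha> t + \<gamma> (t, 1) = \<gamma> (t, 0)" by (simp add: \<gamma>_def b algebra_simps)
    then show ?thesis unfolding q'_def \<alpha>(2)[OF that] qmul_assoc qmul_cis by simp
  qed
  have right: "q' (1, s) = q' (0, s)" if "s \<in> {0..1}" for s
  proof -
    have "\<beta> s + \<gamma> (1, s) = \<gamma> (0, s)" by (simp add: \<gamma>_def \<kappa>_def algebra_simps)
    then show ?thesis unfolding q'_def \<beta>(2)[OF that] qmul_assoc qmul_cis by simp
  qed
  \<comment> \<open>Dividing by the value at \<open>s = 0\<close> normalizes the lift to one there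
    and turns it into the transport from \<open>u (t, 0)\<close> to \<open>u (t, s)\<close>.\<close>
  define f where "f = (\<lambda>(t, s). qmul (q' (t, s)) (qcnj (q' (t, 0))))"
  have fc: "continuous_on ({0..1} \<times> {0..1}) f"
    unfolding f_def case_prod_beta
    by (intro continuous_on_qmul continuous_on_qcnj continuous_on_compose2[OF q'c] continuous_intros) auto
  obtain g where g: "continuous_on (sphere 0 1 \<times> sphere 0 1) g"
    "\<And>t s. t \<in> {0..1} \<Longrightarrow> s \<in> {0..1} \<Longrightarrow> g (circle_point t, circle_point s) = f (t, s)"
    using periodic_square_factor[OF fc] top right unfolding f_def by auto
  have surj: "\<exists>t\<in>{0..1}. z = circle_point t" if "z \<in> sphere 0 1" for z
    using that circle_point_image by blast
  show thesis
  proof (rule that[OF g(1)])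
    show "norm (g p) = 1" if "p \<in> sphere 0 1 \<times> sphere 0 1" for p
    proof -
      obtain z1 z2 where p: "p = (z1, z2)" "z1 \<in> sphere 0 1" "z2 \<in> sphere 0 1" using \<open>p \<in> _\<close> by blast
      obtain t where "t \<in> {0..1}" "z1 = circle_point t" using surj[OF p(2)] by blast
      moreover obtain s where "s \<in> {0..1}" "z2 = circle_point s" using surj[OF p(3)] by blast
      ultimately have "t \<in> {0..1}" "s \<in> {0..1}" "p = (circle_point t, circle_point s)" using p by auto
      then show ?thesis using g(2) q'1(1) by (simp add: f_def norm_qmul)
    qed
    show "g (z, 1) = (1, 0)" if "z \<in> sphere 0 1" for z
    proof -
      obtain t where t: "t \<in> {0..1}" "z = circle_point t" using surj[OF \<open>z \<in> sphere 0 1\<close>] by blast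
      have "g (circle_point t, circle_point 0) = f (t, 0)" by (rule g(2)) (use t in auto)
      then show ?thesis using t q'1(1)[of "(t, 0)"] by (simp add: f_def qmul_qcnj)
    qed
    show "rot (g (circle_point t, circle_point s)) (u (t, 0)) = u (t, s)" if "t \<in> {0..1}" "s \<in> {0..1}" for t s
    proof -
      have "rot (qcnj (q' (t, 0))) (u (t, 0)) = (1, 0)"
        using q'1[of "(t, 0)"] rot_qcnj(1)[of "q' (t, 0)" "(1, 0)"] that by simp
      then show ?thesis using g(2)[OF that] q'1(2)[of "(t, s)"] that by (simp add: f_def rot_qmul)
    qed
  qed
qed

text \<open>At every stage a unit quaternion acts on the fixed vector \<open>u (x, 0)\<close>, so
  the result cannot vanish. \<open>g\<close> carries the vectors on the core through the loop,
  \<open>k\<close> carries them from the core out to radius \<open>R\<close>; both factors are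
  deformed to one.\<close>

lemma solid_torus_contraction:
  fixes u :: "(complex \<times> complex) \<times> real \<Rightarrow> real \<times> complex"
  defines "T R \<equiv> sphere 0 1 \<times> cball 0 R"
  assumes R: "R \<ge> 0" and u: "continuous_on (T R \<times> {0..1}) u" "\<forall>p\<in>T R \<times> {0..1}. norm (u p) = 1" "\<forall>x\<in>T R. u (x, 0) = u (x, 1)"
    and g: "continuous_on (sphere 0 1 \<times> sphere 0 1) g" "\<forall>p\<in>sphere 0 1 \<times> sphere 0 1. norm (g p) = 1"
    "\<forall>z\<in>sphere 0 1. g (z, 1) = (1, 0)"
    "\<forall>z\<in>sphere 0 1. \<forall>s\<in>{0..1}. rot (g (z, circle_point s)) (u ((z, 0), 0)) = u ((z, 0), s)"
  obtains U where "continuous_on ((T R \<times> {0..1}) \<times> {0..1::real}) U"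
    "\<And>x s \<tau>. x \<in> T R \<Longrightarrow> s \<in> {0..1} \<Longrightarrow> \<tau> \<in> {0..1} \<Longrightarrow> norm (U ((x, s), \<tau>)) = 1"
    "\<And>x s. x \<in> T R \<Longrightarrow> s \<in> {0..1} \<Longrightarrow> U ((x, s), 0) = u (x, s)"
    "\<And>x s. x \<in> T R \<Longrightarrow> s \<in> {0..1} \<Longrightarrow> U ((x, s), 1) = u (x, 0)"
    "\<And>x s \<tau>. x \<in> T R \<Longrightarrow> s \<in> {0, 1} \<Longrightarrow> \<tau> \<in> {0..1} \<Longrightarrow> U ((x, s), \<tau>) = u (x, 0)"
proof -
  note u = u(1) u(2,3)[rule_format] and g = g(1) g(2-4)[rule_format]
  let ?X = "T R \<times> {0..1::real}"
  have cX: "compact ?X" unfolding T_def by (intro compact_Times) auto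
  define shr where "shr = (\<lambda>(r::real, ((z::complex, \<zeta>::complex), s::real)). ((z, r *\<^sub>R \<zeta>), s))"
  have shr: "shr (r, x) \<in> ?X" if "r \<in> {0..1}" "x \<in> ?X" for r x
  proof -
    have "r * norm (snd (fst x)) \<le> 1 * R" using that by (intro mult_mono) (auto simp: T_def)
    then show ?thesis using that by (auto simp: shr_def T_def)
  qed
  have shrc: "continuous_on S shr" for S unfolding shr_def case_prod_beta by (intro continuous_intros)
  have Fc: "continuous_on ({0..1} \<times> ?X) (\<lambda>p. u (shr p))"
    by (rule continuous_on_compose2[OF u(1) shrc]) (use shr in \<open>metis (no_types, lifting) SigmaE image_subsetI\<close>)
  have F1: "\<forall>p\<in>{0..1} \<times> ?X. norm (u (shr p)) = 1"
    using u(2) shr by (metis (no_types, lifting) SigmaE)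
  obtain k where k: "continuous_on ?X k" "\<And>x. x \<in> ?X \<Longrightarrow> norm (k x) = 1" "\<And>x. x \<in> ?X \<Longrightarrow> rot (k x) (u (shr (0, x))) = u (shr (1, x))"
    "\<And>x y. x \<in> ?X \<Longrightarrow> y \<in> ?X \<Longrightarrow> (\<And>r. r \<in> {0..1} \<Longrightarrow> u (shr (r, x)) = u (shr (r, y))) \<Longrightarrow> k x = k y"
    "\<And>x. x \<in> ?X \<Longrightarrow> (\<And>r. r \<in> {0..1} \<Longrightarrow> u (shr (r, x)) = u (shr (0, x))) \<Longrightarrow> k x = (1, 0)"
    using sphere_homotopy_lift[OF cX Fc F1] by blast
  have k_ends: "k (x, 1) = k (x, 0)" if x: "x \<in> T R" for x
  proof (rule k(4))
    fix r :: real assume r: "r \<in> {0..1}"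
    obtain z \<zeta> where [simp]: "x = (z, \<zeta>)" by fastforce
    have "(z, r *\<^sub>R \<zeta>) \<in> T R" using shr[OF r, of "(x, 0)"] x by (auto simp: shr_def)
    then show "u (shr (r, x, 1)) = u (shr (r, x, 0))" using u(3) by (simp add: shr_def)
  qed (use x in auto)
  have k_core: "k ((z, 0), s) = (1, 0)" if "z \<in> sphere 0 1" "s \<in> {0..1}" for z s
    by (rule k(5)) (use that R in \<open>auto simp: shr_def T_def\<close>)
  obtain \<Gamma> c where \<Gamma>: "continuous_on ((sphere 0 1 \<times> sphere 0 1) \<times> {0..1::real}) \<Gamma>"
    "\<And>p \<tau>. p \<in> sphere 0 1 \<times> sphere 0 1 \<Longrightarrow> \<tau> \<in> {0..1} \<Longrightarrow> norm (\<Gamma> (p, \<tau>)) = 1"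
    "\<And>p. p \<in> sphere 0 1 \<times> sphere 0 1 \<Longrightarrow> \<Gamma> (p, 0) = g p" "\<And>p. p \<in> sphere 0 1 \<times> sphere 0 1 \<Longrightarrow> \<Gamma> (p, 1) = c"
    using torus_map_nullhomotopic[OF g(1,2)] by blast
  \<comment> \<open>At \<open>\<tau> = 0\<close>: back to the core at time \<open>0\<close>, along
    the core circle to \<open>s\<close>, out again. At \<open>\<tau> = 1\<close> the factors
    \<open>k\<close> sit on the core and \<open>\<Gamma>\<close> is constant. At the ends of the
    loop the product is one for all \<open>\<tau>\<close>, because of the quotient of the two values
    of \<open>\<Gamma>\<close> and because \<open>k\<close> is periodic.\<close>
  define Q where "Q = (\<lambda>(((z, \<zeta>), s), \<tau>).
     qmul (qmul (k ((z, (1 - \<tau>) *\<^sub>R \<zeta>), s)) (qmul (\<Gamma> ((z, circle_point s), \<tau>)) (qcnj (\<Gamma> ((z, 1), \<tau>)))))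
       (qcnj (k ((z, (1 - \<tau>) *\<^sub>R \<zeta>), 0))))"
  have shr2: "((z, (1 - \<tau>) *\<^sub>R \<zeta>), s) \<in> ?X" if "(z, \<zeta>) \<in> T R" "s \<in> {0..1}" "\<tau> \<in> {0..1}" for z \<zeta> s \<tau>
    using shr[of "1 - \<tau>" "((z, \<zeta>), s)"] that by (auto simp: shr_def)
  have kc: "continuous_on (?X \<times> {0..1}) (\<lambda>p. k (f p))" if "continuous_on (?X \<times> {0..1}) f" "\<And>p. p \<in> ?X \<times> {0..1} \<Longrightarrow> f p \<in> ?X" for f
    by (rule continuous_on_compose2[OF k(1) that(1)]) (use that(2) in blast)
  have gc: "continuous_on (?X \<times> {0..1}) (\<lambda>p. \<Gamma> (f p))"
    if "continuous_on (?X \<times> {0..1}) f" "\<And>p. p \<in> ?X \<times> {0..1} \<Longrightarrow> f p \<in> (sphere 0 1 \<times> sphere 0 1) \<times> {0..1::real}" for f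
    by (rule continuous_on_compose2[OF \<Gamma>(1) that(1)]) (use that(2) in blast)
  have Qc: "continuous_on (?X \<times> {0..1}) Q"
    unfolding Q_def case_prod_beta
    by (intro continuous_on_qmul continuous_on_qcnj kc gc continuous_intros) (use shr2 in \<open>auto simp: T_def\<close>)
  have Q1: "norm (Q ((x, s), \<tau>)) = 1" if "x \<in> T R" "s \<in> {0..1}" "\<tau> \<in> {0..1}" for x s \<tau>
  proof -
    obtain z \<zeta> where x: "x = (z, \<zeta>)" by fastforce
    have z: "z \<in> sphere 0 1" using that x by (simp add: T_def)
    show ?thesis
      using k(2)[OF shr2[of z \<zeta> s \<tau>]] k(2)[OF shr2[of z \<zeta> 0 \<tau>]] \<Gamma>(2)[of "(z, circle_point s)" \<tau>] \<Gamma>(2)[of "(z, 1)" \<tau>] that z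
      unfolding x Q_def by (simp add: norm_qmul)
  qed
  show thesis
  proof (rule that[of "\<lambda>p. rot (Q p) (u (fst (fst p), 0))"])
    show "continuous_on (?X \<times> {0..1}) (\<lambda>p. rot (Q p) (u (fst (fst p), 0)))"
      by (intro continuous_on_rot Qc continuous_on_compose2[OF u(1)] continuous_intros) auto
    fix x s \<tau> assume x: "x \<in> T R"
    obtain z \<zeta> where xz: "x = (z, \<zeta>)" by fastforce
    have z: "z \<in> sphere 0 1" using x xz by (simp add: T_def)
    have u01: "norm (u (x, 0)) = 1" using u(2) x by auto
    show "norm (rot (Q ((x, s), \<tau>)) (u (fst (fst ((x, s), \<tau>)), 0))) = 1" if "s \<in> {0..1}" "\<tau> \<in> {0..1}" for s \<tau>
      using Q1[OF x that] u01 by (simp add: norm_rot)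
    have kn: "norm (k (x, s)) = 1" if "s \<in> {0..1}" for s using k(2) x that by auto
    have k0: "rot (k (x, s)) (u ((z, 0), s)) = u (x, s)" if "s \<in> {0..1}" for s
      using k(3)[of "(x, s)"] x that by (simp add: shr_def xz)
    show "rot (Q ((x, s), 0)) (u (fst (fst ((x, s), 0)), 0)) = u (x, s)" if s: "s \<in> {0..1}" for s
    proof -
      have "rot (qcnj (k (x, 0))) (u (x, 0)) = u ((z, 0), 0)"
        using k0[of 0] rot_qcnj(1)[OF kn[of 0], of "u ((z, 0), 0)"] by simp
      moreover have "Q ((x, s), 0) = qmul (qmul (k (x, s)) (g (z, circle_point s))) (qcnj (k (x, 0)))"
        using \<Gamma>(3)[of "(z, circle_point s)"] \<Gamma>(3)[of "(z, 1)"] g(3)[OF z] z by (simp add: Q_def xz qcnj_def)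
      ultimately show ?thesis using g(4)[OF z s] k0[OF s] by (simp add: rot_qmul)
    qed
    show "rot (Q ((x, s), 1)) (u (fst (fst ((x, s), 1)), 0)) = u (x, 0)" if s: "s \<in> {0..1}" for s
    proof -
      have "norm c = 1" using \<Gamma>(2)[of "(z, 1)" 1] \<Gamma>(4)[of "(z, 1)"] z by simp
      then have "Q ((x, s), 1) = (1, 0)"
        using \<Gamma>(4)[of "(z, circle_point s)"] \<Gamma>(4)[of "(z, 1)"] k_core[OF z] z s by (simp add: Q_def xz qmul_qcnj)
      then show ?thesis by simp
    qed
    show "rot (Q ((x, s), \<tau>)) (u (fst (fst ((x, s), \<tau>)), 0)) = u (x, 0)" if s: "s \<in> {0, 1}" "\<tau> \<in> {0..1}" for s \<tau>
    proof -
      have "circle_point s = 1" using s by auto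
      moreover have "qmul (\<Gamma> ((z, 1), \<tau>)) (qcnj (\<Gamma> ((z, 1), \<tau>))) = (1, 0)"
        using \<Gamma>(2)[of "(z, 1)" \<tau>] z s by (simp add: qmul_qcnj)
      moreover have zt: "(z, (1 - \<tau>) *\<^sub>R \<zeta>) \<in> T R" using shr2[of z \<zeta> 0 \<tau>] x xz s by auto
      moreover have "k ((z, (1 - \<tau>) *\<^sub>R \<zeta>), s) = k ((z, (1 - \<tau>) *\<^sub>R \<zeta>), 0)" using s k_ends[OF zt] by auto
      moreover have "norm (k ((z, (1 - \<tau>) *\<^sub>R \<zeta>), 0)) = 1" using k(2) zt by auto
      ultimately have "Q ((x, s), \<tau>) = (1, 0)" by (simp add: Q_def xz qmul_qcnj)
      then show ?thesis by simp
    qed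
  qed
qed

text \<open>
  A loop \<open>u\<close> of fields restricts on the core to a map from the torus to the sphere, lifted by \<open>q\<close> over the square.
  Its degree is, up to a factor, the difference of the changes of the seam angles \<open>\<alpha>\<close> and \<open>\<beta>\<close>.
\<close>

definition core_degree_zero :: "((complex \<times> complex) \<times> real \<Rightarrow> real \<times> complex) \<Rightarrow> bool" where
  "core_degree_zero u \<longleftrightarrow> (\<forall>q \<alpha> \<beta>. continuous_on ({0..1} \<times> {0..1}) q \<longrightarrow>
     (\<forall>t\<in>{0..1}. \<forall>s\<in>{0..1}. norm (q (t, s)) = 1 \<and> (\<exists>c>0. u ((circle_point t, 0), s) = c *\<^sub>R rot (q (t, s)) (1, 0))) \<longrightarrow>
     continuous_on {0..1} \<alpha> \<longrightarrow> (\<forall>t\<in>{0..1}. q (t, 1) = qmul (q (t, 0)) (cis (\<alpha> t), 0)) \<longrightarrow>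
     continuous_on {0..1} \<beta> \<longrightarrow> (\<forall>s\<in>{0..1}. q (1, s) = qmul (q (0, s)) (cis (\<beta> s), 0)) \<longrightarrow>
     \<alpha> 1 - \<alpha> 0 = \<beta> 1 - \<beta> 0)"

lemma solid_torus_vector_contraction:
  fixes u :: "(complex \<times> complex) \<times> real \<Rightarrow> real \<times> complex"
  defines "T R \<equiv> sphere 0 1 \<times> cball 0 R"
  assumes R: "R \<ge> 0" and u: "continuous_on (T R \<times> {0..1}) u" "\<And>p. p \<in> T R \<times> {0..1} \<Longrightarrow> u p \<noteq> 0"
    "\<And>x. x \<in> T R \<Longrightarrow> u (x, 0) = u (x, 1)"
    and degree: "core_degree_zero u"
  obtains U where "continuous_on ((T R \<times> {0..1}) \<times> {0..1::real}) U"
    "\<And>x s \<tau>. x \<in> T R \<Longrightarrow> s \<in> {0..1} \<Longrightarrow> \<tau> \<in> {0..1} \<Longrightarrow> U ((x, s), \<tau>) \<noteq> 0"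
    "\<And>x s. x \<in> T R \<Longrightarrow> s \<in> {0..1} \<Longrightarrow> U ((x, s), 0) = u (x, s)"
    "\<And>x s. x \<in> T R \<Longrightarrow> s \<in> {0..1} \<Longrightarrow> U ((x, s), 1) = u (x, 0)"
    "\<And>x s \<tau>. x \<in> T R \<Longrightarrow> s \<in> {0, 1} \<Longrightarrow> \<tau> \<in> {0..1} \<Longrightarrow> U ((x, s), \<tau>) = u (x, 0)"
proof -
  define w where "w p = inverse (norm (u p)) *\<^sub>R u p" for p
  have wc: "continuous_on (T R \<times> {0..1}) w" unfolding w_def by (intro continuous_intros u(1)) (use u(2) in auto)
  have w1: "norm (w p) = 1" "u p = norm (u p) *\<^sub>R w p" "norm (u p) > 0" if "p \<in> T R \<times> {0..1}" for p
    using u(2)[OF that] by (auto simp: w_def)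
  have w01: "w (x, 0) = w (x, 1)" if "x \<in> T R" for x using u(3)[OF that] by (simp add: w_def)
  have core: "((circle_point t, 0), s) \<in> T R \<times> {0..1}" if "s \<in> {0..1}" for t s using that R by (simp add: T_def)
  define v where "v = (\<lambda>(t, s). w ((circle_point t, 0), s))"
  let ?Q = "{0..1::real} \<times> {0..1::real}"
  have vc: "continuous_on ?Q v"
    unfolding v_def case_prod_beta by (rule continuous_on_compose2[OF wc]) (use core in \<open>auto intro!: continuous_intros\<close>)
  have v1: "norm (v p) = 1" if "p \<in> ?Q" for p using w1(1)[OF core[of "snd p"]] that by (auto simp: v_def split: prod.splits)
  \<comment> \<open>The square is contracted to its corner, so lifting this homotopy and choosing
    one quaternion over the corner gives a lift over the whole square.\<close>
  define F where "F = (\<lambda>(r, p). v (r *\<^sub>R p))"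
  have sq: "r *\<^sub>R p \<in> ?Q" if "r \<in> {0..1}" "p \<in> ?Q" for r p using that by (auto simp: mult_le_one scaleR_prod_def)
  have Fc: "continuous_on ({0..1} \<times> ?Q) F"
    unfolding F_def case_prod_beta by (rule continuous_on_compose2[OF vc]) (use sq in \<open>auto intro!: continuous_intros simp: mem_Times_iff\<close>)
  have F1: "\<forall>p\<in>{0..1::real} \<times> ?Q. norm (F p) = 1"
  proof
    fix p assume "p \<in> {0..1::real} \<times> ?Q"
    then obtain r x where "p = (r, x)" "r \<in> {0..1}" "x \<in> ?Q" by blast
    then show "norm (F p) = 1" using v1[OF sq[of r x]] by (simp add: F_def del: scaleR_Pair)
  qed
  have cQ: "compact ?Q" by (intro compact_Times) auto
  obtain k where k: "continuous_on ?Q k" "\<And>x. x \<in> ?Q \<Longrightarrow> norm (k x) = 1" "\<And>x. x \<in> ?Q \<Longrightarrow> rot (k x) (F (0, x)) = F (1, x)"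
    using sphere_homotopy_lift[OF cQ Fc F1] by metis
  obtain q0 where q0: "norm q0 = 1" "rot q0 (1, 0) = v (0, 0)"
    using rot_transitive[of "v (0, 0)"] v1[of "(0, 0)"] by auto
  define q where "q x = qmul (k x) q0" for x
  have qc: "continuous_on ?Q q" unfolding q_def by (intro continuous_on_qmul k continuous_intros)
  have q1: "norm (q x) = 1 \<and> rot (q x) (1, 0) = v x" if "x \<in> ?Q" for x
    using k(2,3)[OF that] q0 unfolding q_def F_def by (simp add: norm_qmul rot_qmul zero_prod_def)
  have v_top: "v (t, 1) = v (t, 0)" and v_right: "v (1, s) = v (0, s)" if "t \<in> {0..1}" for t s
    using w01[of "(circle_point t, 0)"] R by (auto simp: v_def T_def)
  have con: "contractible {0..1::real}" by (rule convex_imp_contractible) simp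
  have edge: "continuous_on {0..1} (\<lambda>t. q (t, s))" "continuous_on {0..1} (\<lambda>t. q (s, t))" if "s \<in> {0..1}" for s
    by (rule continuous_on_compose2[OF qc]; use that in \<open>auto intro!: continuous_intros\<close>)+
  obtain \<alpha> where \<alpha>: "continuous_on {0..1} \<alpha>" "\<And>t. t \<in> {0..1} \<Longrightarrow> q (t, 1) = qmul (q (t, 0)) (cis (\<alpha> t), 0)"
    using rot_seam[OF con edge(1)[of 1] edge(1)[of 0]] q1 v_top by auto
  obtain \<beta> where \<beta>: "continuous_on {0..1} \<beta>" "\<And>s. s \<in> {0..1} \<Longrightarrow> q (1, s) = qmul (q (0, s)) (cis (\<beta> s), 0)"
    using rot_seam[OF con edge(2)[of 1] edge(2)[of 0]] q1 v_right by auto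
  have "\<alpha> 1 - \<alpha> 0 = \<beta> 1 - \<beta> 0"
  proof (rule degree[unfolded core_degree_zero_def, rule_format, OF qc _ \<alpha> \<beta>])
    fix t s :: real assume ts: "t \<in> {0..1}" "s \<in> {0..1}"
    have "v (t, s) = w ((circle_point t, 0), s)" by (simp add: v_def)
    then show "norm (q (t, s)) = 1 \<and> (\<exists>c>0. u ((circle_point t, 0), s) = c *\<^sub>R rot (q (t, s)) (1, 0))"
      using q1[of "(t, s)"] w1(2,3)[OF core[OF ts(2)], of t] ts by (metis SigmaI)
  qed
  from torus_lift[OF qc q1 \<alpha> \<beta> this] obtain g where g: "continuous_on (sphere 0 1 \<times> sphere 0 1) g"
    "\<And>p. p \<in> sphere 0 1 \<times> sphere 0 1 \<Longrightarrow> norm (g p) = 1" "\<And>z. z \<in> sphere 0 1 \<Longrightarrow> g (z, 1) = (1, 0)"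
    "\<And>t s. t \<in> {0..1} \<Longrightarrow> s \<in> {0..1} \<Longrightarrow> rot (g (circle_point t, circle_point s)) (v (t, 0)) = v (t, s)" by blast
  have g4: "rot (g (z, circle_point s)) (w ((z, 0), 0)) = w ((z, 0), s)" if z: "z \<in> sphere 0 1" "s \<in> {0..1}" for z s
  proof -
    obtain t where "t \<in> {0..1}" "z = circle_point t" using z circle_point_image by (metis imageE)
    then show ?thesis using g(4) z by (simp add: v_def)
  qed
  obtain U where U: "continuous_on ((T R \<times> {0..1}) \<times> {0..1::real}) U"
    "\<And>x s \<tau>. x \<in> T R \<Longrightarrow> s \<in> {0..1} \<Longrightarrow> \<tau> \<in> {0..1} \<Longrightarrow> norm (U ((x, s), \<tau>)) = 1"
    "\<And>x s. x \<in> T R \<Longrightarrow> s \<in> {0..1} \<Longrightarrow> U ((x, s), 0) = w (x, s)"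
    "\<And>x s. x \<in> T R \<Longrightarrow> s \<in> {0..1} \<Longrightarrow> U ((x, s), 1) = w (x, 0)"
    "\<And>x s \<tau>. x \<in> T R \<Longrightarrow> s \<in> {0, 1} \<Longrightarrow> \<tau> \<in> {0..1} \<Longrightarrow> U ((x, s), \<tau>) = w (x, 0)"
    using solid_torus_contraction[OF R wc[unfolded T_def] _ _ g(1)] w1(1) w01 g(2,3) g4
    unfolding T_def by blast
  \<comment> \<open>The lengths, removed by normalization, are interpolated separately. At
    \<open>s = 0\<close> and \<open>s = 1\<close> the two lengths agree, so the ends of the loop
    remain fixed.\<close>
  define n where "n = (\<lambda>((x, s), \<tau>). (1 - \<tau>) * norm (u (x, s)) + \<tau> * norm (u (x, 0)))"
  have nc: "continuous_on ((T R \<times> {0..1}) \<times> {0..1::real}) n"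
    unfolding n_def case_prod_beta by (intro continuous_intros continuous_on_compose2[OF u(1)]) auto
  have npos: "n ((x, s), \<tau>) > 0" if "x \<in> T R" "s \<in> {0..1}" "\<tau> \<in> {0..1}" for x s \<tau>
  proof -
    have "norm (u (x, s)) > 0" "norm (u (x, 0)) > 0" using w1(3) that by auto
    then show ?thesis using that unfolding n_def by (cases "\<tau> = 1") (auto intro: add_pos_nonneg)
  qed
  show thesis
  proof (rule that[of "\<lambda>p. n p *\<^sub>R U p"])
    show "continuous_on ((T R \<times> {0..1}) \<times> {0..1}) (\<lambda>p. n p *\<^sub>R U p)" by (intro continuous_intros nc U(1))
    fix x s \<tau> assume x: "x \<in> T R"
    show "n ((x, s), \<tau>) *\<^sub>R U ((x, s), \<tau>) \<noteq> 0" if "s \<in> {0..1}" "\<tau> \<in> {0..1}" for s \<tau>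
      using npos[OF x that] U(2)[OF x that] by auto
    show "n ((x, s), 0) *\<^sub>R U ((x, s), 0) = u (x, s)" if "s \<in> {0..1}" for s
      using U(3)[OF x that] w1(2)[of "(x, s)"] x that by (simp add: n_def)
    show "n ((x, s), 1) *\<^sub>R U ((x, s), 1) = u (x, 0)" if "s \<in> {0..1}" for s
      using U(4)[OF x that] w1(2)[of "(x, 0)"] x by (simp add: n_def)
    show "n ((x, s), \<tau>) *\<^sub>R U ((x, s), \<tau>) = u (x, 0)" if "s \<in> {0, 1}" "\<tau> \<in> {0..1}" for s \<tau>
      using U(5)[OF x that] w1(2)[of "(x, 0)"] u(3)[OF x] x that by (auto simp: n_def algebra_simps)
  qed
qed

section \<open>The plane bundle normal to a field\<close>

text \<open>The sign can jump only where \<open>f\<close> vanishes, and there the square root tends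
  to zero.\<close>

lemma continuous_on_sgn_sqrt:
  fixes f g :: "'a::metric_space \<Rightarrow> real"
  assumes f: "continuous_on D f" and g: "continuous_on D g" and "\<And>x. x \<in> D \<Longrightarrow> f x = 0 \<Longrightarrow> g x = 0"
  shows "continuous_on D (\<lambda>x. sgn (f x) * sqrt (g x))"
  unfolding continuous_on_def
proof
  fix x assume x: "x \<in> D"
  have fx: "(f \<longlongrightarrow> f x) (at x within D)" and gx: "(g \<longlongrightarrow> g x) (at x within D)"
    using f g x unfolding continuous_on_def by auto
  show "((\<lambda>x. sgn (f x) * sqrt (g x)) \<longlongrightarrow> sgn (f x) * sqrt (g x)) (at x within D)"
  proof (cases "f x = 0")
    case False
    then show ?thesis by (intro tendsto_mult tendsto_sgn fx tendsto_real_sqrt gx)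
  next
    case True
    then have "((\<lambda>y. sqrt (g y)) \<longlongrightarrow> 0) (at x within D)"
      using tendsto_real_sqrt[OF gx] assms(3)[OF x] by simp
    then have "((\<lambda>y. \<bar>sqrt (g y)\<bar>) \<longlongrightarrow> 0) (at x within D)" by (simp add: tendsto_rabs_zero)
    then have "((\<lambda>x. sgn (f x) * sqrt (g x)) \<longlongrightarrow> 0) (at x within D)"
      by (rule Lim_null_comparison[rotated]) (auto simp: abs_mult sgn_if)
    then show ?thesis using True by simp
  qed
qed

locale oriented_unit_field =
  fixes M :: "'a::euclidean_space set" and v :: "'a \<Rightarrow> 'a" and Q :: "'a \<Rightarrow> 'a \<Rightarrow> 'a" and vol :: "'a \<Rightarrow> 'a \<Rightarrow> 'a \<Rightarrow> 'a \<Rightarrow> real"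
  assumes manifold: "closed_3manifold M"
    and Q: "\<And>a. continuous_on M (\<lambda>y. Q y a)" "\<And>y. linear (Q y)"
      "\<And>y a. y \<in> M \<Longrightarrow> Q y a \<in> tangent_space M y" "\<And>y u. u \<in> tangent_space M y \<Longrightarrow> Q y u = u"
    and vol: "continuous_on UNIV (\<lambda>(y, a, b, c). vol y a b c :: real)"
      "\<And>y. y \<in> M \<Longrightarrow> \<exists>\<kappa> C. \<kappa> > 0 \<and> linear C \<and> inj C \<and> range C = tangent_space M y \<and>
         (\<forall>a b c. vol y (C a) (C b) (C c) = \<kappa> * det3 a b c)"
    and v: "continuous_on M v" "\<And>y. y \<in> M \<Longrightarrow> v y \<in> tangent_space M y" "\<And>y. y \<in> M \<Longrightarrow> norm (v y) = 1"
begin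

definition Np :: "'a \<Rightarrow> 'a set" where
  "Np y = {X \<in> tangent_space M y. X \<bullet> v y = 0}"

definition N :: "'a \<Rightarrow> 'a set" where
  "N y = Np y - {0}"

text \<open>The imaginary part is the oriented area of the parallelogram: the Gram determinant gives
  its size, and \<open>vol\<close> only the sign, so \<open>vol\<close> may have any positive
  normalization. In an oriented orthonormal coordinate \<open>c\<close> this is
  \<open>cnj (c X) * c Y\<close>.\<close>

definition z :: "'a \<Rightarrow> 'a \<Rightarrow> 'a \<Rightarrow> complex" where
  "z y X Y = Complex (X \<bullet> Y) (sgn (vol y (v y) X Y) * sqrt ((X \<bullet> X) * (Y \<bullet> Y) - (X \<bullet> Y)\<^sup>2))"

lemma subspace_Np: "y \<in> M \<Longrightarrow> subspace (Np y)"
  using tangent_space_subspace[OF manifold]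
  by (auto simp: Np_def subspace_def inner_add_left)

text \<open>On the normal plane \<open>vol y (v y)\<close> is an alternating bilinear form, hence a
  multiple of the determinant. The sign of \<open>\<kappa>\<close> is left open because the basis is
  not chosen oriented.\<close>

lemma orthonormal_frame:
  assumes y: "y \<in> M"
  obtains e f \<kappa> where "e \<in> Np y" "f \<in> Np y" "norm e = 1" "norm f = 1" "e \<bullet> f = 0" "\<kappa> \<noteq> 0"
    "\<And>X. X \<in> Np y \<Longrightarrow> X = (X \<bullet> e) *\<^sub>R e + (X \<bullet> f) *\<^sub>R f"
    "\<And>X Y. X \<in> Np y \<Longrightarrow> Y \<in> Np y \<Longrightarrow> vol y (v y) X Y = \<kappa> * ((X \<bullet> e) * (Y \<bullet> f) - (X \<bullet> f) * (Y \<bullet> e))"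
proof -
  let ?T = "tangent_space M y"
  obtain \<kappa> C where C: "\<kappa> > 0" "linear C" "inj C" "range C = ?T" "\<And>a b c. vol y (C a) (C b) (C c) = \<kappa> * det3 a b c"
    using vol(2)[OF y] by blast
  have T: "subspace ?T" using tangent_space_subspace[OF manifold y] .
  have vT: "v y \<in> ?T" and v0: "v y \<noteq> 0" and v1: "norm (v y) = 1" using v(2,3)[OF y] by auto
  have dT: "dim ?T = 3"
    using dim_image_eq[of C UNIV] C(2-4) by (simp add: dim_UNIV inj_on_subset)
  have e: "{x \<in> ?T. \<forall>u\<in>span {v y}. orthogonal u x} = Np y"
    by (auto simp: Np_def orthogonal_def span_singleton inner_commute)
  have "dim (Np y) + dim (span {v y}) = dim ?T"
    using dim_subspace_orthogonal_to_vectors[of "span {v y}" ?T] span_minimal[OF _ T, of "{v y}"] T vT unfolding e by auto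
  then have "dim (Np y) = 2" using dT v0 by (simp add: dim_singleton)
  then obtain B where B: "B \<subseteq> Np y" "pairwise orthogonal B" "\<And>x. x \<in> B \<Longrightarrow> norm x = 1" "card B = 2" "span B = Np y"
    using orthonormal_basis_subspace[OF subspace_Np[OF y]] by metis
  then obtain e f where ef: "B = {e, f}" "e \<noteq> f" by (metis card_2_iff)
  have on: "e \<in> Np y" "f \<in> Np y" "norm e = 1" "norm f = 1" "e \<bullet> f = 0"
    using B ef by (auto simp: pairwise_def orthogonal_def)
  have on2: "e \<bullet> e = 1" "f \<bullet> f = 1" "f \<bullet> e = 0" "e \<bullet> v y = 0" "f \<bullet> v y = 0" "v y \<bullet> v y = 1" "v y \<bullet> e = 0" "v y \<bullet> f = 0"
    using on v1 by (auto simp: Np_def dot_square_norm inner_commute)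
  have ex: "X = (X \<bullet> e) *\<^sub>R e + (X \<bullet> f) *\<^sub>R f" if X: "X \<in> Np y" for X
  proof -
    have "X \<in> span {e, f}" using X B(5) ef by simp
    then obtain a b where "X = a *\<^sub>R e + b *\<^sub>R f" by (auto simp: span_insert span_singleton) (metis add.commute diff_add_cancel)
    then show ?thesis using on on2 by (simp add: inner_add_left)
  qed
  obtain a where a: "v y = C a" using vT C(4) by blast
  obtain b where b: "e = C b" using on(1) C(4) unfolding Np_def by blast
  obtain c where c: "f = C c" using on(2) C(4) unfolding Np_def by blast
  \<comment> \<open>\<open>J\<close> sends the coordinate axes to the preimages of
    \<open>v y\<close>, \<open>e\<close> and \<open>f\<close>. These are independent, so
    \<open>det3 a b c\<close> is the determinant of an injective map.\<close>
  define J where "J x = (x $ 1) *\<^sub>R a + (x $ 2) *\<^sub>R b + (x $ 3) *\<^sub>R c" for x :: "real^3"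
  have J: "linear J" unfolding J_def by (rule linearI) (auto simp: algebra_simps)
  have "inj J"
  proof (subst linear_injective_0[OF J], intro allI impI)
    fix x assume "J x = 0"
    then have z: "(x $ 1) *\<^sub>R v y + (x $ 2) *\<^sub>R e + (x $ 3) *\<^sub>R f = 0"
      unfolding a b c using linear_0[OF C(2)] by (simp add: J_def linear_add[OF C(2)] linear_scale[OF C(2)] flip: linear_scale[OF C(2)] linear_add[OF C(2)])
    from arg_cong[OF z, of "\<lambda>w. w \<bullet> v y"] arg_cong[OF z, of "\<lambda>w. w \<bullet> e"] arg_cong[OF z, of "\<lambda>w. w \<bullet> f"]
    have "x $ 1 = 0" "x $ 2 = 0" "x $ 3 = 0"
      using on on2 by (simp_all add: inner_add_left)
    then show "x = 0" by (simp add: vec_eq_iff forall_3)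
  qed
  then have dJ: "det (matrix J) \<noteq> 0" using det_nz_iff_inj[OF J] by simp
  have "det3 (J (axis 1 1)) (J (axis 2 1)) (J (axis 3 1)) = det (matrix J) * det3 (axis 1 1) (axis 2 1) (axis 3 1)"
    by (rule det3_linear[OF J])
  then have d: "det3 a b c = det (matrix J)"
    by (simp add: J_def det3_def axis_def cross3_def inner_vec_def sum_3)
  have bil: "det3 a (x2 *\<^sub>R b + x3 *\<^sub>R c) (y2 *\<^sub>R b + y3 *\<^sub>R c) = (x2 * y3 - x3 * y2) * det3 a b c" for x2 x3 y2 y3
    by (simp add: det3_def cross3_def inner_vec_def sum_3 algebra_simps)
  show thesis
  proof (rule that[of e f "\<kappa> * det3 a b c"])
    show "vol y (v y) X Y = \<kappa> * det3 a b c * ((X \<bullet> e) * (Y \<bullet> f) - (X \<bullet> f) * (Y \<bullet> e))" if "X \<in> Np y" "Y \<in> Np y" for X Y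
    proof -
      have "X = C ((X \<bullet> e) *\<^sub>R b + (X \<bullet> f) *\<^sub>R c)" "Y = C ((Y \<bullet> e) *\<^sub>R b + (Y \<bullet> f) *\<^sub>R c)"
        using ex[OF that(1)] ex[OF that(2)] by (simp_all add: linear_add[OF C(2)] linear_scale[OF C(2)] b c)
      then have "vol y (v y) X Y = \<kappa> * det3 a ((X \<bullet> e) *\<^sub>R b + (X \<bullet> f) *\<^sub>R c) ((Y \<bullet> e) *\<^sub>R b + (Y \<bullet> f) *\<^sub>R c)"
        using C(5) a by metis
      then show ?thesis unfolding bil by simp
    qed
  qed (use on ex C(1) d dJ in auto)
qed

lemma hermitian_coordinate:
  assumes y: "y \<in> M"
  obtains c where "linear c" "\<And>X. X \<in> Np y \<Longrightarrow> c X = 0 \<longleftrightarrow> X = 0" "\<And>X Y. X \<in> Np y \<Longrightarrow> Y \<in> Np y \<Longrightarrow> z y X Y = cnj (c X) * c Y"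
    "\<exists>X\<in>N y. True" "\<And>X Y. X \<in> Np y \<Longrightarrow> Y \<in> Np y \<Longrightarrow> vol y (v y) X Y = 0 \<Longrightarrow> (X \<bullet> X) * (Y \<bullet> Y) - (X \<bullet> Y)\<^sup>2 = 0"
proof -
  obtain e f \<kappa> where e: "e \<in> Np y" "f \<in> Np y" "norm e = 1" "norm f = 1" "e \<bullet> f = 0" "\<kappa> \<noteq> 0"
    "\<And>X. X \<in> Np y \<Longrightarrow> X = (X \<bullet> e) *\<^sub>R e + (X \<bullet> f) *\<^sub>R f"
    "\<And>X Y. X \<in> Np y \<Longrightarrow> Y \<in> Np y \<Longrightarrow> vol y (v y) X Y = \<kappa> * ((X \<bullet> e) * (Y \<bullet> f) - (X \<bullet> f) * (Y \<bullet> e))"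
    using orthonormal_frame[OF y] by metis
  have ee: "e \<bullet> e = 1" "f \<bullet> f = 1" "f \<bullet> e = 0" using e(3-5) by (auto simp: dot_square_norm inner_commute)
  have ip: "X \<bullet> Y = (X \<bullet> e) * (Y \<bullet> e) + (X \<bullet> f) * (Y \<bullet> f)" if "X \<in> Np y" "Y \<in> Np y" for X Y
  proof -
    have "X \<bullet> Y = ((X \<bullet> e) *\<^sub>R e + (X \<bullet> f) *\<^sub>R f) \<bullet> ((Y \<bullet> e) *\<^sub>R e + (Y \<bullet> f) *\<^sub>R f)" using e(7) that by metis
    also have "\<dots> = (X \<bullet> e) * (Y \<bullet> e) + (X \<bullet> f) * (Y \<bullet> f)" using ee e(5) by (simp add: inner_add_left inner_add_right)
    finally show ?thesis .
  qed
  have gram: "(X \<bullet> X) * (Y \<bullet> Y) - (X \<bullet> Y)\<^sup>2 = ((X \<bullet> e) * (Y \<bullet> f) - (X \<bullet> f) * (Y \<bullet> e))\<^sup>2" if "X \<in> Np y" "Y \<in> Np y" for X Y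
    unfolding ip[OF that] ip[OF that(1) that(1)] ip[OF that(2) that(2)] by (simp add: power2_eq_square algebra_simps)
  \<comment> \<open>The second axis is reversed if \<open>e\<close>, \<open>f\<close> is negatively
    oriented.\<close>
  define c where "c X = Complex (X \<bullet> e) (sgn \<kappa> * (X \<bullet> f))" for X
  have s: "sgn \<kappa> * sgn \<kappa> = 1" using e(6) by (simp add: sgn_if)
  show thesis
  proof (rule that[of c])
    show "linear c" unfolding c_def by (rule linearI) (auto simp: inner_add_left complex_eq_iff algebra_simps)
    show "c X = 0 \<longleftrightarrow> X = 0" if X: "X \<in> Np y" for X
    proof
      assume "c X = 0"
      then have "X \<bullet> e = 0" "X \<bullet> f = 0" using e(6) by (auto simp: c_def complex_eq_iff sgn_zero_iff)
      then show "X = 0" using e(7)[OF X] by simp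
    qed (simp add: c_def complex_eq_iff)
    show "z y X Y = cnj (c X) * c Y" if X: "X \<in> Np y" "Y \<in> Np y" for X Y
    proof -
      define d where "d = (X \<bullet> e) * (Y \<bullet> f) - (X \<bullet> f) * (Y \<bullet> e)"
      have "sgn (\<kappa> * d) * sqrt (d\<^sup>2) = sgn \<kappa> * (sgn d * \<bar>d\<bar>)" by (simp add: sgn_mult)
      also have "\<dots> = sgn \<kappa> * d" by (simp add: sgn_mult_abs)
      finally have im: "sgn (\<kappa> * d) * sqrt (d\<^sup>2) = sgn \<kappa> * d" .
      have "z y X Y = Complex (X \<bullet> Y) (sgn \<kappa> * d)"
        unfolding z_def gram[OF X] e(8)[OF X] d_def[symmetric] im ..
      also have "\<dots> = Complex ((X \<bullet> e) * (Y \<bullet> e) + (X \<bullet> f) * (Y \<bullet> f)) (sgn \<kappa> * d)"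
        using ip[OF X] by simp
      also have "\<dots> = cnj (c X) * c Y"
        using e(6) by (cases "\<kappa> > 0") (simp_all add: c_def complex_eq_iff d_def algebra_simps)
      finally show ?thesis .
    qed
    show "\<exists>X\<in>N y. True" using e(1,3) by (auto simp: N_def intro!: bexI[of _ e])
    show "(X \<bullet> X) * (Y \<bullet> Y) - (X \<bullet> Y)\<^sup>2 = 0" if "X \<in> Np y" "Y \<in> Np y" "vol y (v y) X Y = 0" for X Y
      using that e(6,8) unfolding gram[OF that(1,2)] by simp
  qed
qed

lemma vol_zero_gram:
  assumes "y \<in> M" "X \<in> Np y" "Y \<in> Np y" "vol y (v y) X Y = 0"
  shows "(X \<bullet> X) * (Y \<bullet> Y) - (X \<bullet> Y)\<^sup>2 = 0"
  by (rule hermitian_coordinate[OF assms(1)]) (use assms(2-4) in blast)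

text \<open>Linear on all ambient vectors, so that a vector normal to \<open>v\<close> at one point
  can be carried to the normal plane at a nearby point.\<close>

definition proj :: "'a \<Rightarrow> 'a \<Rightarrow> 'a" where
  "proj y a = Q y a - (Q y a \<bullet> v y) *\<^sub>R v y"

lemma proj: "y \<in> M \<Longrightarrow> proj y a \<in> Np y" "y \<in> M \<Longrightarrow> X \<in> Np y \<Longrightarrow> proj y X = X" "linear (proj y)"
proof -
  show "proj y a \<in> Np y" if y: "y \<in> M"
    using subspace_diff[OF tangent_space_subspace[OF manifold y] Q(3)[OF y] subspace_scale[OF tangent_space_subspace[OF manifold y] v(2)[OF y]]] v(3)[OF y]
    by (simp add: Np_def proj_def inner_diff_left dot_square_norm)
  show "y \<in> M \<Longrightarrow> X \<in> Np y \<Longrightarrow> proj y X = X" by (simp add: Np_def proj_def Q(4))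
  show "linear (proj y)" unfolding proj_def
    by (rule linearI) (auto simp: linear_add[OF Q(2)] linear_scale[OF Q(2)] algebra_simps inner_add_left)
qed

lemma proj_eq_0: "y \<in> M \<Longrightarrow> u \<in> tangent_space M y \<Longrightarrow> proj y u = 0 \<Longrightarrow> u = (u \<bullet> v y) *\<^sub>R v y"
  by (simp add: proj_def Q(4))

lemma continuous_on_proj:
  assumes "continuous_on S f" "continuous_on S g" "f ` S \<subseteq> M"
  shows "continuous_on S (\<lambda>x. proj (f x) (g x))"
  unfolding proj_def
  by (intro continuous_intros continuous_on_linear_family[OF Q(1,2)] continuous_on_compose2[OF v(1)] assms)

text \<open>Along the contraction of \<open>X\<close> to \<open>a\<close> a unit vector of the fibre
  over \<open>\<sigma> a\<close> is carried in small steps by \<open>proj\<close>. On the compact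
  \<open>M\<close> the projection to a normal plane at a close enough point kills no unit normal
  vector.\<close>

lemma section_exists:
  fixes C :: "real \<times> 'b::metric_space \<Rightarrow> 'b"
  assumes X: "compact X" and C: "continuous_on ({0..1} \<times> X) C" "\<And>r x. r \<in> {0..1} \<Longrightarrow> x \<in> X \<Longrightarrow> C (r, x) \<in> X"
    "\<And>x. x \<in> X \<Longrightarrow> C (0, x) = a" "\<And>x. x \<in> X \<Longrightarrow> C (1, x) = x" "a \<in> X"
    and \<sigma>: "continuous_on X \<sigma>" "\<sigma> ` X \<subseteq> M"
  shows "\<exists>s. continuous_on X s \<and> (\<forall>x\<in>X. s x \<in> N (\<sigma> x))"
proof -
  have cM: "compact M" using manifold closed_3manifold_def by blast
  define F where "F p = \<sigma> (C p)" for p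
  have Fc: "continuous_on ({0..1} \<times> X) F" unfolding F_def
    by (rule continuous_on_compose2[OF \<sigma>(1) C(1)]) (use C(2) in auto)
  have FM: "F (r, x) \<in> M" if "r \<in> {0..1}" "x \<in> X" for r x using C(2)[OF that] \<sigma>(2) by (auto simp: F_def)
  have cK: "compact (M \<times> sphere (0::'a) 1)" by (intro compact_Times cM compact_sphere)
  have "continuous_on (M \<times> sphere 0 1) (\<lambda>p. proj (fst p) (snd p))"
    by (intro continuous_on_proj continuous_intros) auto
  then have "uniformly_continuous_on (M \<times> sphere 0 1) (\<lambda>p. proj (fst p) (snd p))"
    by (rule compact_uniformly_continuous[OF _ cK])
  then obtain d where d: "d > 0" "\<And>p p'. p \<in> M \<times> sphere 0 1 \<Longrightarrow> p' \<in> M \<times> sphere 0 1 \<Longrightarrow> dist p' p < d \<Longrightarrow> dist (proj (fst p') (snd p')) (proj (fst p) (snd p)) < 1"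
    unfolding uniformly_continuous_on_def by (metis zero_less_one)
  have close: "proj y' X \<noteq> 0" if "y \<in> M" "y' \<in> M" "dist y' y < d" "X \<in> Np y" "norm X = 1" for y y' X
  proof -
    have "dist (proj y' X) (proj y X) < 1"
      using d(2)[of "(y, X)" "(y', X)"] that by (simp add: dist_Pair_Pair)
    then show ?thesis using that by (auto simp: proj(2))
  qed
  have "uniformly_continuous_on ({0..1} \<times> X) F"
    using Fc X by (intro compact_uniformly_continuous compact_Times) auto
  then obtain \<delta> where \<delta>: "\<delta> > 0" "\<And>p p'. p \<in> {0..1} \<times> X \<Longrightarrow> p' \<in> {0..1} \<times> X \<Longrightarrow> dist p' p < \<delta> \<Longrightarrow> dist (F p') (F p) < d"
    unfolding uniformly_continuous_on_def using d(1) by metis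
  obtain m :: nat where m: "m > 0" "1 / m < \<delta>"
    using real_arch_inverse[of \<delta>] \<delta>(1) by (auto simp: inverse_eq_divide)
  define f where "f x j = F (j / m, x)" for x and j :: nat
  have fX: "(real j / m, x) \<in> {0..1} \<times> X" if "x \<in> X" "j \<le> m" for x j
    using that m by auto
  have fM: "f x j \<in> M" if "x \<in> X" "j \<le> m" for x j unfolding f_def using FM fX[OF that] by auto
  have fd: "dist (f x (Suc j)) (f x j) < d" if "x \<in> X" "Suc j \<le> m" for x j
  proof -
    have "dist (real (Suc j) / m, x) (real j / m, x) = 1 / m"
      by (simp add: dist_Pair_Pair dist_real_def flip: diff_divide_distrib)
    then show ?thesis unfolding f_def using \<delta>(2) fX that m by (metis Suc_leD)
  qed
  have fc: "continuous_on X (\<lambda>x. f x j)" if "j \<le> m" for j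
    unfolding f_def by (rule continuous_on_compose2[OF Fc]) (use fX that in \<open>auto intro!: continuous_intros\<close>)
  have aM: "\<sigma> a \<in> M" using C(5) \<sigma>(2) by blast
  obtain X0 where X0: "X0 \<in> N (\<sigma> a)" using hermitian_coordinate[OF aM] by metis
  have "\<exists>s. continuous_on X s \<and> (\<forall>x\<in>X. s x \<in> Np (f x j) \<and> norm (s x) = 1)" if "j \<le> m" for j
    using that
  proof (induction j)
    case 0
    have "f x 0 = \<sigma> a" if "x \<in> X" for x using C(3)[OF that] by (simp add: f_def F_def)
    then show ?case
      using X0 subspace_scale[OF subspace_Np[OF aM], of X0 "inverse (norm X0)"]
      by (intro exI[of _ "\<lambda>_. inverse (norm X0) *\<^sub>R X0"]) (auto simp: N_def)
  next
    case (Suc j)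
    then obtain s where s: "continuous_on X s" "\<And>x. x \<in> X \<Longrightarrow> s x \<in> Np (f x j)" "\<And>x. x \<in> X \<Longrightarrow> norm (s x) = 1" by auto
    let ?t = "\<lambda>x. proj (f x (Suc j)) (s x)"
    have t0: "?t x \<noteq> 0" if "x \<in> X" for x
      using close[OF fM[OF that, of j] fM[OF that, of "Suc j"] fd[OF that] s(2,3)[OF that]] Suc.prems by simp
    have tc: "continuous_on X ?t" by (rule continuous_on_proj) (use fc s fM Suc.prems in auto)
    show ?case
    proof (intro exI[of _ "\<lambda>x. inverse (norm (?t x)) *\<^sub>R ?t x"] conjI ballI)
      show "continuous_on X (\<lambda>x. inverse (norm (?t x)) *\<^sub>R ?t x)" by (intro continuous_intros tc) (use t0 in auto)
      fix x assume x: "x \<in> X"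
      show "inverse (norm (?t x)) *\<^sub>R ?t x \<in> Np (f x (Suc j))"
        using fM[OF x Suc.prems] by (intro subspace_scale[OF subspace_Np] proj)
      show "norm (inverse (norm (?t x)) *\<^sub>R ?t x) = 1" using t0[OF x] by simp
    qed
  qed
  from this[of m] obtain s where s: "continuous_on X s" "\<And>x. x \<in> X \<Longrightarrow> s x \<in> Np (f x m)" "\<And>x. x \<in> X \<Longrightarrow> norm (s x) = 1" by auto
  have "f x m = \<sigma> x" if "x \<in> X" for x using C(4)[OF that] m by (simp add: f_def F_def)
  then have "s x \<in> N (\<sigma> x)" if "x \<in> X" for x using s(2,3)[OF that] that by (auto simp: N_def)
  then show ?thesis using s(1) by blast
qed

sublocale plane_bundle M N z
proof
  fix y X Y assume y: "y \<in> M" and X: "X \<in> N y" "Y \<in> N y"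
  obtain c where c: "\<And>X. X \<in> Np y \<Longrightarrow> c X = 0 \<longleftrightarrow> X = 0" "\<And>X Y. X \<in> Np y \<Longrightarrow> Y \<in> Np y \<Longrightarrow> z y X Y = cnj (c X) * c Y"
    using hermitian_coordinate[OF y] by metis
  show "z y X Y \<noteq> 0" using c X by (auto simp: N_def)
  fix R assume R: "R \<in> N y"
  have "c Y * cnj (c Y) = of_real ((norm (c Y))\<^sup>2)" by (simp only: complex_norm_square)
  moreover have "z y X Y * z y Y R = (c Y * cnj (c Y)) * z y X R" using c(2) X R by (simp add: N_def)
  ultimately show "\<exists>k>0. z y X Y * z y Y R = complex_of_real k * z y X R"
    using c(1) X by (intro exI[of _ "(norm (c Y))\<^sup>2"]) (auto simp: N_def)
next
  let ?D = "{(y, X, Y). y \<in> M \<and> X \<in> N y \<and> Y \<in> N y}"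
  have vc: "continuous_on ?D (\<lambda>p. v (fst p))" by (rule continuous_on_compose2[OF v(1)]) (auto intro!: continuous_intros)
  have "continuous_on ?D (\<lambda>p. (fst p, v (fst p), fst (snd p), snd (snd p)))" by (intro continuous_intros vc)
  from continuous_on_compose2[OF vol(1) this subset_UNIV] have "continuous_on ?D (\<lambda>p. vol (fst p) (v (fst p)) (fst (snd p)) (snd (snd p)))" unfolding prod.case .
  then have "continuous_on ?D (\<lambda>p. sgn (vol (fst p) (v (fst p)) (fst (snd p)) (snd (snd p))) *
     sqrt ((fst (snd p) \<bullet> fst (snd p)) * (snd (snd p) \<bullet> snd (snd p)) - (fst (snd p) \<bullet> snd (snd p))\<^sup>2))"
  proof (rule continuous_on_sgn_sqrt)
    fix p assume "p \<in> ?D" "vol (fst p) (v (fst p)) (fst (snd p)) (snd (snd p)) = 0"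
    then show "(fst (snd p) \<bullet> fst (snd p)) * (snd (snd p) \<bullet> snd (snd p)) - (fst (snd p) \<bullet> snd (snd p))\<^sup>2 = 0"
      using vol_zero_gram[of "fst p" "fst (snd p)" "snd (snd p)"] by (auto simp: N_def)
  qed (intro continuous_intros)
  then have "continuous_on ?D (\<lambda>p. z (fst p) (fst (snd p)) (snd (snd p)))"
    unfolding z_def Complex_eq
    by (intro continuous_on_add continuous_on_of_real continuous_on_mult_left continuous_on_inner continuous_on_fst continuous_on_snd continuous_on_id)
  then show "continuous_on ?D (\<lambda>(y, X, Y). z y X Y)" by (simp add: case_prod_beta)
next
  fix p \<sigma> assume \<sigma>: "singular_simplex p (top_of_set M) \<sigma>"
  \<comment> \<open>The straight contraction of the simplex to its vertex of index 0.\<close>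
  let ?C = "\<lambda>(r::real, x::nat \<Rightarrow> real) i. (1 - r) * (if i = 0 then 1 else 0) + r * x i"
  show "\<exists>s. continuous_on (standard_simplex p) s \<and> (\<forall>x\<in>standard_simplex p. s x \<in> N (\<sigma> x))"
  proof (rule section_exists[where C="?C" and a="\<lambda>i. if i = 0 then 1 else 0"])
    show "compact (standard_simplex p)" using compactin_standard_simplex[of p] by (simp add: euclidean_product_topology)
    show "continuous_on ({0..1} \<times> standard_simplex p) ?C"
    proof (rule continuous_on_coordinatewise_then_product)
      fix i
      have "continuous_on ({0..1} \<times> standard_simplex p) (\<lambda>q. snd q i)"
        by (rule continuous_on_compose2[OF continuous_on_product_coordinates[of i] continuous_on_snd[OF continuous_on_id]]) auto
      then show "continuous_on ({0..1} \<times> standard_simplex p) (\<lambda>q. ?C q i)"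
        unfolding case_prod_beta by (intro continuous_intros)
    qed
    show "?C (r, x) \<in> standard_simplex p" if "r \<in> {0..1}" "x \<in> standard_simplex p" for r x
      using convex_standard_simplex[of "\<lambda>i. if i = 0 then 1 else 0" p x r] that by simp
  qed (use \<sigma> in \<open>auto simp: singular_simplex_iff\<close>)
qed

lemma z_linear:
  assumes y: "y \<in> M" and X: "X \<in> Np y" "W \<in> Np y"
  shows "z y X (a *\<^sub>R X + b *\<^sub>R W) = of_real (a * (X \<bullet> X)) + of_real b * z y X W"
    and "X \<noteq> 0 \<Longrightarrow> Im (z y X W) = 0 \<Longrightarrow> \<exists>k. W = k *\<^sub>R X"
proof -
  obtain c where c: "linear c" "\<And>X. X \<in> Np y \<Longrightarrow> c X = 0 \<longleftrightarrow> X = 0" "\<And>X Y. X \<in> Np y \<Longrightarrow> Y \<in> Np y \<Longrightarrow> z y X Y = cnj (c X) * c Y"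
    using hermitian_coordinate[OF y] by metis
  note S = subspace_Np[OF y]
  have XX: "cnj (c X) * c X = of_real (X \<bullet> X)"
    using c(3)[OF X(1,1)] unfolding z_def by (simp add: power2_eq_square complex_of_real_def)
  have "z y X (a *\<^sub>R X + b *\<^sub>R W) = cnj (c X) * c (a *\<^sub>R X + b *\<^sub>R W)"
    by (rule c(3)) (use X S in \<open>auto intro!: subspace_add subspace_scale\<close>)
  also have "\<dots> = of_real a * (cnj (c X) * c X) + of_real b * (cnj (c X) * c W)"
    by (simp add: linear_add[OF c(1)] linear_scale[OF c(1)] scaleR_conv_of_real algebra_simps)
  finally show "z y X (a *\<^sub>R X + b *\<^sub>R W) = of_real (a * (X \<bullet> X)) + of_real b * z y X W"
    using XX c(3)[OF X] by simp
  assume X0: "X \<noteq> 0" and im: "Im (z y X W) = 0"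
  define k where "k = Re (z y X W) / (X \<bullet> X)"
  have "z y X W = of_real (k * (X \<bullet> X))" using im X0 by (simp add: k_def complex_eq_iff)
  then have "cnj (c X) * c W = cnj (c X) * (of_real k * c X)" using c(3)[OF X] XX by (simp add: mult_ac)
  then have "c W = of_real k * c X" using c(2)[OF X(1)] X0 by simp
  then have "c (W - k *\<^sub>R X) = 0" by (simp add: linear_diff[OF c(1)] linear_scale[OF c(1)] scaleR_conv_of_real)
  then have "W - k *\<^sub>R X = 0" using c(2)[of "W - k *\<^sub>R X"] X S by (simp add: subspace_diff subspace_scale)
  then show "\<exists>k. W = k *\<^sub>R X" by (intro exI[of _ k]) simp
qed

end

text \<open>The image of the unit circle under a linear map with orientation
  \<open>\<epsilon>\<close> that fixes the ray of positive reals. A point of it is never a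
  nonpositive multiple of \<open>cis (\<epsilon> * \<theta>)\<close>: comparing imaginary parts
  contradicts the orientation, except on the real axis, where \<open>a > 0\<close> decides.\<close>

lemma ellipse_angle:
  assumes "a > 0" "\<epsilon> * V > 0" "\<epsilon>\<^sup>2 = 1"
  shows "Complex (a * cos \<theta> + b * sin \<theta>) (V * sin \<theta>) * cis (- \<epsilon> * \<theta>) \<notin> \<real>\<^sub>\<le>\<^sub>0"
proof
  define w where "w = Complex (a * cos \<theta> + b * sin \<theta>) (V * sin \<theta>)"
  assume "w * cis (- \<epsilon> * \<theta>) \<in> \<real>\<^sub>\<le>\<^sub>0"
  then obtain r where r: "r \<le> 0" "w * cis (- \<epsilon> * \<theta>) = of_real r" by (auto simp: complex_nonpos_Reals_iff complex_eq_iff)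
  then have "w * (cis (- \<epsilon> * \<theta>) * cis (\<epsilon> * \<theta>)) = of_real r * cis (\<epsilon> * \<theta>)" by (simp only: mult.assoc[symmetric])
  then have w: "w = of_real r * cis (\<epsilon> * \<theta>)" by (simp add: cis_mult)
  have e: "\<epsilon> = 1 \<or> \<epsilon> = -1" using assms(3) by (simp add: power2_eq_1_iff)
  then have "sin (\<epsilon> * \<theta>) = \<epsilon> * sin \<theta>" "cos (\<epsilon> * \<theta>) = cos \<theta>" by auto
  then have im: "V * sin \<theta> = r * (\<epsilon> * sin \<theta>)" and re: "a * cos \<theta> + b * sin \<theta> = r * cos \<theta>"
    using w unfolding w_def by (auto simp: complex_eq_iff)
  have "sin \<theta> = 0"
  proof (rule ccontr)
    assume "sin \<theta> \<noteq> 0"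
    then have "V = r * \<epsilon>" using im by simp
    then have "\<epsilon> * V = r * \<epsilon>\<^sup>2" by (simp add: power2_eq_square)
    then show False using assms r by simp
  qed
  then have "\<bar>cos \<theta>\<bar> = 1" "a * cos \<theta> = r * cos \<theta>" using re sin_zero_abs_cos_one[of \<theta>] by simp_all
  then have "cos \<theta> \<noteq> 0" "a * cos \<theta> = r * cos \<theta>" by (metis abs_zero zero_neq_one, simp)
  then show False using assms(1) r(1) by simp
qed

lemma rotation_bound:
  assumes "continuous_on {0..1} g" "\<And>s. s \<in> {0..1} \<Longrightarrow> g s \<noteq> 0" "continuous_on {0..1} \<theta>" "\<epsilon>\<^sup>2 = 1"
    "\<And>s. s \<in> {0..1} \<Longrightarrow> g s * cis (- \<epsilon> * (2 * \<theta> s)) \<notin> \<real>\<^sub>\<le>\<^sub>0"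
  shows "\<bar>angle_change g - 2 * \<epsilon> * (\<theta> 1 - \<theta> 0)\<bar> < 2 * pi"
proof -
  let ?w = "\<lambda>s. g s * cis (- \<epsilon> * (2 * \<theta> s))"
  have c: "continuous_on {0..1} (\<lambda>s. cis (- \<epsilon> * (2 * \<theta> s)))" by (intro continuous_intros assms(3))
  have "angle_change ?w = angle_change g + angle_change (\<lambda>s. cis (- \<epsilon> * (2 * \<theta> s)))"
    by (rule angle_change_mult) (use assms c in auto)
  moreover have "angle_change (\<lambda>s. cis (- \<epsilon> * (2 * \<theta> s))) = - \<epsilon> * (2 * \<theta> 1) - - \<epsilon> * (2 * \<theta> 0)"
    by (rule angle_change_cis) (intro continuous_intros assms(3))
  moreover have "\<bar>angle_change ?w\<bar> < 2 * pi"
    by (rule angle_change_nonpos_bound) (use assms c in \<open>auto intro: continuous_intros\<close>)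
  ultimately show ?thesis by (simp add: algebra_simps)
qed

text \<open>
  Along two opposite edges of the square the vectors \<open>A p (rot (q p) (0, 1))\<close>, projected to the normal planes, turn relative
  to each other by twice the change of the seam angle, up to less than \<open>2 * pi\<close>. These rotations agree for both pairs of
  edges, and the changes of \<open>\<alpha>\<close> and \<open>\<beta>\<close> differ by a multiple of \<open>2 * pi\<close>, so they are equal.
\<close>

lemma (in oriented_unit_field) torus_degree:
  fixes A :: "real \<times> real \<Rightarrow> real \<times> complex \<Rightarrow> 'a"
  assumes H2: "trivial_group (homology_group 2 (top_of_set M))"
    and h: "continuous_on ({0..1} \<times> {0..1}) h" "h ` ({0..1} \<times> {0..1}) \<subseteq> M"
      "\<And>s. s \<in> {0..1} \<Longrightarrow> h (0, s) = h (1, s)" "\<And>t. t \<in> {0..1} \<Longrightarrow> h (t, 0) = h (t, 1)"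
    and A: "\<And>w. continuous_on ({0..1} \<times> {0..1}) (\<lambda>p. A p w)" "\<And>p. linear (A p)"
      "\<And>p w. p \<in> {0..1} \<times> {0..1} \<Longrightarrow> A p w \<in> tangent_space M (h p)"
      "\<And>p w. p \<in> {0..1} \<times> {0..1} \<Longrightarrow> A p w = 0 \<Longrightarrow> w = 0"
      "\<And>s. s \<in> {0..1} \<Longrightarrow> A (0, s) = A (1, s)" "\<And>t. t \<in> {0..1} \<Longrightarrow> A (t, 0) = A (t, 1)"
    and q: "continuous_on ({0..1} \<times> {0..1}) q" "\<And>p. p \<in> {0..1} \<times> {0..1} \<Longrightarrow> norm (q p) = 1"
      "\<And>p. p \<in> {0..1} \<times> {0..1} \<Longrightarrow> \<exists>c>0. A p (rot (q p) (1, 0)) = c *\<^sub>R v (h p)"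
    and \<alpha>: "continuous_on {0..1} \<alpha>" "\<And>t. t \<in> {0..1} \<Longrightarrow> q (t, 1) = qmul (q (t, 0)) (cis (\<alpha> t), 0)"
    and \<beta>: "continuous_on {0..1} \<beta>" "\<And>s. s \<in> {0..1} \<Longrightarrow> q (1, s) = qmul (q (0, s)) (cis (\<beta> s), 0)"
  shows "\<alpha> 1 - \<alpha> 0 = \<beta> 1 - \<beta> 0"
proof -
  let ?S = "{0..1::real} \<times> {0..1::real}"
  \<comment> \<open>With the axis \<open>rot (q p) (1, 0)\<close> these complete a rotated standard
    basis. Since \<open>A p\<close> is injective and maps the axis to a positive multiple of
    \<open>v (h p)\<close>, the projections \<open>T p\<close> and \<open>W p\<close> are
    independent.\<close>
  define Y where "Y p = rot (q p) (0, 1)" for p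
  define Z where "Z p = rot (q p) (0, \<i>)" for p
  define T where "T p = proj (h p) (A p (Y p))" for p
  define W where "W p = proj (h p) (A p (Z p))" for p
  have hM: "h p \<in> M" if "p \<in> ?S" for p using h(2) that by blast
  have rc: "continuous_on ?S (\<lambda>p. rot (q p) w)" for w by (intro continuous_on_rot q continuous_intros)
  have Ac: "continuous_on ?S (\<lambda>p. A p (f p))" if "continuous_on ?S f" for f
    using continuous_on_linear_family[of ?S A ?S "\<lambda>p. p" f] A(1,2) that by (auto intro!: continuous_intros)
  have Tc: "continuous_on ?S T" unfolding T_def Y_def by (rule continuous_on_proj[OF h(1) Ac[OF rc] h(2)])
  have Wc: "continuous_on ?S W" unfolding W_def Z_def by (rule continuous_on_proj[OF h(1) Ac[OF rc] h(2)])
  have inj: "w = 0" if p: "p \<in> ?S" and w: "proj (h p) (A p (rot (q p) (0, w))) = 0" for p w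
  proof -
    obtain c where c: "c > 0" "A p (rot (q p) (1, 0)) = c *\<^sub>R v (h p)" using q(3)[OF p] by blast
    define k where "k = (A p (rot (q p) (0, w)) \<bullet> v (h p)) / c"
    have "A p (rot (q p) (0, w)) = (k * c) *\<^sub>R v (h p)"
      using proj_eq_0[OF hM[OF p] A(3)[OF p] w] c(1) by (simp add: k_def)
    also have "\<dots> = A p (rot (q p) (k *\<^sub>R (1, 0)))"
      by (simp only: rot_scaleR linear_scale[OF A(2)] c(2) scaleR_scaleR)
    finally have "A p (rot (q p) ((0, w) - k *\<^sub>R (1, 0))) = 0"
      by (simp only: linear_diff[OF linear_rot] linear_diff[OF A(2)] right_minus_eq)
    then have "rot (q p) ((0, w) - k *\<^sub>R (1, 0)) = 0" using A(4)[OF p] by blast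
    then have "norm ((0, w) - k *\<^sub>R (1::real, 0::complex)) = 0" using norm_rot[of "q p"] q(2)[OF p] by (metis mult_1 norm_zero one_power2)
    then show "w = 0" by (simp add: prod_eq_iff)
  qed
  have TN: "T p \<in> N (h p)" "W p \<in> Np (h p)" if p: "p \<in> ?S" for p
    using inj[OF p, of 1] proj(1)[OF hM[OF p]] by (auto simp: N_def T_def W_def Y_def)
  have lin: "proj (h p) (A p (rot (q p) (a *\<^sub>R (0, 1) + b *\<^sub>R (0, \<i>)))) = a *\<^sub>R T p + b *\<^sub>R W p" for p a b
    by (simp only: T_def W_def Y_def Z_def rot_add rot_scaleR linear_add[OF A(2)] linear_scale[OF A(2)] linear_add[OF proj(3)] linear_scale[OF proj(3)])
  define V where "V p = Im (z (h p) (T p) (W p))" for p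
  have WN: "W p \<in> N (h p)" if p: "p \<in> ?S" for p
    using inj[OF p, of \<i>] TN(2)[OF p] by (auto simp: N_def W_def Z_def)
  have Vc: "continuous_on ?S V"
    unfolding V_def by (intro continuous_intros z_continuous h(1) Tc Wc) (use hM TN WN in auto)
  have V0: "V p \<noteq> 0" if p: "p \<in> ?S" for p
  proof
    assume "V p = 0"
    then obtain k where "W p = k *\<^sub>R T p"
      using z_linear(2)[OF hM[OF p], of "T p" "W p"] TN[OF p] unfolding V_def N_def by auto
    then have "proj (h p) (A p (rot (q p) (0, \<i> - of_real k))) = 0"
      using lin[of p "- k" 1] by (simp add: scaleR_conv_of_real)
    from inj[OF p this] show False by (simp add: complex_eq_iff)
  qed
  \<comment> \<open>\<open>V\<close> is the oriented area spanned by \<open>T\<close> and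
    \<open>W\<close>. It has no zeros on the connected square, so the orientation is the same
    everywhere.\<close>
  obtain \<epsilon> where \<epsilon>: "\<epsilon>\<^sup>2 = 1" "\<And>p. p \<in> ?S \<Longrightarrow> \<epsilon> * V p > 0"
  proof -
    have "connected (V ` ?S)" by (intro connected_continuous_image Vc connected_Times) auto
    then have iv: "is_interval (V ` ?S)" by (simp add: is_interval_connected_1)
    have "(\<forall>p\<in>?S. V p > 0) \<or> (\<forall>p\<in>?S. V p < 0)"
    proof (rule ccontr)
      assume "\<not> ?thesis"
      then obtain p p' where p: "p \<in> ?S" "p' \<in> ?S" "V p < 0" "V p' > 0" using V0 by (meson linorder_neqE_linordered_idom)
      then have "0 \<in> V ` ?S" using iv[unfolded is_interval_1, rule_format, of "V p" "V p'" 0] by auto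
      then show False using V0 by force
    qed
    then show thesis using that[of 1] that[of "-1"] by auto
  qed
  \<comment> \<open>Here \<open>c\<close> and \<open>c'\<close> run along opposite edges, where
    \<open>h\<close> and \<open>A\<close> agree and \<open>q\<close> differs by the seam angle
    \<open>\<theta>\<close>. In the basis \<open>T\<close>, \<open>W\<close> at \<open>c s\<close>
    the vector \<open>T (c' s)\<close> has coordinates \<open>cos (2 * \<theta> s)\<close> and
    \<open>sin (2 * \<theta> s)\<close>.\<close>
  have key: "\<bar>angle_change (\<lambda>s. z (h (c s)) (T (c s)) (T (c' s))) - 2 * \<epsilon> * (\<theta> 1 - \<theta> 0)\<bar> < 2 * pi"
    if c: "continuous_on {0..1} c" "continuous_on {0..1} c'" "\<And>s. s \<in> {0..1} \<Longrightarrow> c s \<in> ?S \<and> c' s \<in> ?S \<and> h (c' s) = h (c s) \<and> A (c' s) = A (c s)"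
      and \<theta>: "continuous_on {0..1} \<theta>" "\<And>s. s \<in> {0..1} \<Longrightarrow> q (c' s) = qmul (q (c s)) (cis (\<theta> s), 0)" for c c' \<theta>
  proof (rule rotation_bound[OF _ _ \<theta>(1) \<epsilon>(1)])
    have Tc': "T (c' s) = cos (2 * \<theta> s) *\<^sub>R T (c s) + sin (2 * \<theta> s) *\<^sub>R W (c s)" if s: "s \<in> {0..1}" for s
    proof -
      have "T (c' s) = proj (h (c s)) (A (c s) (rot (qmul (q (c s)) (cis (\<theta> s), 0)) (0, 1)))"
        using c(3)[OF s] \<theta>(2)[OF s] by (simp add: T_def Y_def)
      also have "rot (qmul (q (c s)) (cis (\<theta> s), 0)) (0, 1) = rot (q (c s)) (cos (2 * \<theta> s) *\<^sub>R (0, 1) + sin (2 * \<theta> s) *\<^sub>R (0, \<i>))"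
        by (simp only: rot_qmul rot_cis)
      finally show ?thesis using lin by simp
    qed
    show "continuous_on {0..1} (\<lambda>s. z (h (c s)) (T (c s)) (T (c' s)))"
    proof (rule z_continuous)
      have im: "c ` {0..1} \<subseteq> ?S" "c' ` {0..1} \<subseteq> ?S" using c(3) by blast+
      show "continuous_on {0..1} (\<lambda>s. h (c s))" by (rule continuous_on_compose2[OF h(1) c(1) im(1)])
      show "continuous_on {0..1} (\<lambda>s. T (c s))" by (rule continuous_on_compose2[OF Tc c(1) im(1)])
      show "continuous_on {0..1} (\<lambda>s. T (c' s))" by (rule continuous_on_compose2[OF Tc c(2) im(2)])
      show "h (c s) \<in> M \<and> T (c s) \<in> N (h (c s)) \<and> T (c' s) \<in> N (h (c s))" if "s \<in> {0..1}" for s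
        using c(3)[OF that] hM TN(1) by metis
    qed
    fix s :: real assume s: "s \<in> {0..1}"
    have cs: "c s \<in> ?S" "c' s \<in> ?S" "h (c' s) = h (c s)" using c(3)[OF s] by auto
    show "z (h (c s)) (T (c s)) (T (c' s)) \<noteq> 0"
      using z_nonzero[OF hM[OF cs(1)] TN(1)[OF cs(1)]] TN(1)[OF cs(2)] cs(3) by auto
    let ?a = "T (c s) \<bullet> T (c s)"
    have a: "?a > 0" using TN(1)[OF cs(1)] by (simp add: N_def)
    have "z (h (c s)) (T (c s)) (T (c' s)) = of_real (cos (2 * \<theta> s) * ?a) + of_real (sin (2 * \<theta> s)) * z (h (c s)) (T (c s)) (W (c s))"
      unfolding Tc'[OF s] using TN[OF cs(1)] by (intro z_linear(1) hM cs(1)) (auto simp: N_def)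
    also have "\<dots> = Complex (?a * cos (2 * \<theta> s) + Re (z (h (c s)) (T (c s)) (W (c s))) * sin (2 * \<theta> s)) (V (c s) * sin (2 * \<theta> s))"
      by (simp add: complex_eq_iff V_def)
    finally show "z (h (c s)) (T (c s)) (T (c' s)) * cis (- \<epsilon> * (2 * \<theta> s)) \<notin> \<real>\<^sub>\<le>\<^sub>0"
      using ellipse_angle[OF a \<epsilon>(2)[OF cs(1)] \<epsilon>(1)] by simp
  qed
  have lr: "\<bar>angle_change (\<lambda>s. z (h (0, s)) (T (0, s)) (T (1, s))) - 2 * \<epsilon> * (\<beta> 1 - \<beta> 0)\<bar> < 2 * pi"
    by (rule key[of "\<lambda>s. (0, s)" "\<lambda>s. (1, s)"]) (use h(3) A(5) \<beta> in \<open>auto intro!: continuous_intros\<close>)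
  have tb: "\<bar>angle_change (\<lambda>t. z (h (t, 0)) (T (t, 0)) (T (t, 1))) - 2 * \<epsilon> * (\<alpha> 1 - \<alpha> 0)\<bar> < 2 * pi"
    by (rule key[of "\<lambda>t. (t, 0)" "\<lambda>t. (t, 1)"]) (use h(4) A(6) \<alpha> in \<open>auto intro!: continuous_intros\<close>)
  have "rotation (\<lambda>s. h (0, s)) (\<lambda>s. T (0, s)) (\<lambda>s. T (1, s)) = rotation (\<lambda>t. h (t, 0)) (\<lambda>t. T (t, 0)) (\<lambda>t. T (t, 1))"
    by (rule torus_rotation[OF H2 h Tc TN(1)])
  then have "\<bar>2 * \<epsilon> * (\<beta> 1 - \<beta> 0) - 2 * \<epsilon> * (\<alpha> 1 - \<alpha> 0)\<bar> < 4 * pi" using lr tb unfolding rotation_def by linarith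
  then have "\<bar>2 * \<epsilon> * ((\<beta> 1 - \<beta> 0) - (\<alpha> 1 - \<alpha> 0))\<bar> < 4 * pi" by (simp add: algebra_simps)
  then have small: "\<bar>(\<beta> 1 - \<beta> 0) - (\<alpha> 1 - \<alpha> 0)\<bar> < 2 * pi" using \<epsilon>(1) by (auto simp: power2_eq_1_iff)
  \<comment> \<open>The value \<open>q (1, 1)\<close> is reached from the corner
    \<open>(0, 0)\<close> along two sides in two ways; comparing them shows that the difference of
    the changes is a multiple of \<open>2 * pi\<close>.\<close>
  have "qmul (q (0, 0)) (cis (\<beta> 0 + \<alpha> 1), 0) = qmul (q (0, 0)) (cis (\<alpha> 0 + \<beta> 1), 0)"
    using \<alpha>(2)[of 0] \<alpha>(2)[of 1] \<beta>(2)[of 0] \<beta>(2)[of 1] by (simp add: qmul_assoc qmul_cis)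
  then have "qmul (qcnj (q (0, 0))) (qmul (q (0, 0)) (cis (\<beta> 0 + \<alpha> 1), 0)) = qmul (qcnj (q (0, 0))) (qmul (q (0, 0)) (cis (\<alpha> 0 + \<beta> 1), 0))" by simp
  then have "cis (\<beta> 0 + \<alpha> 1) = cis (\<alpha> 0 + \<beta> 1)" using q(2)[of "(0, 0)"] by (simp add: qmul_assoc[symmetric] qmul_qcnj)
  then obtain n :: int where "\<beta> 0 + \<alpha> 1 = \<alpha> 0 + \<beta> 1 + 2 * pi * n"
    using sin_cos_eq_iff[of "\<beta> 0 + \<alpha> 1" "\<alpha> 0 + \<beta> 1"] by (auto simp: complex_eq_iff)
  then have n: "(\<beta> 1 - \<beta> 0) - (\<alpha> 1 - \<alpha> 0) = 2 * pi * (- n)" by simp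
  then have "2 * pi * \<bar>real_of_int n\<bar> < 2 * pi * 1" using small by (simp add: abs_mult)
  then have "\<bar>real_of_int n\<bar> < 1" using mult_less_cancel_left_pos[of "2 * pi" "\<bar>real_of_int n\<bar>" 1] pi_gt_zero by linarith
  then have "n = 0" by linarith
  then show ?thesis using n by simp
qed

section \<open>Tubular coordinates\<close>

lemma smooth_sin_cos: "smooth_on_open UNIV (sin :: real \<Rightarrow> real)" "smooth_on_open UNIV (cos :: real \<Rightarrow> real)"
proof -
  have "Ck_on k UNIV (sin :: real \<Rightarrow> real) \<and> Ck_on k UNIV (cos :: real \<Rightarrow> real)" for k
  proof (induction k)
    case 0 show ?case by (auto intro: continuous_intros)
  next
    case (Suc k)
    have 1: "Ck_on (Suc k) UNIV (sin :: real \<Rightarrow> real)"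
      by (rule Ck_on_real_SucI[where f'=cos]) (use Suc in \<open>auto intro!: derivative_eq_intros\<close>)
    have 2: "Ck_on (Suc k) UNIV (cos :: real \<Rightarrow> real)"
    proof (rule Ck_on_real_SucI[where f'="\<lambda>x. - sin x"])
      show "Ck_on k UNIV (\<lambda>x::real. - sin x)"
        using Suc by (intro Ck_on_bounded_linear[OF bounded_linear_minus[OF bounded_linear_ident]]) auto
    qed (auto intro!: derivative_eq_intros)
    show ?case using 1 2 by blast
  qed
  then show "smooth_on_open UNIV (sin :: real \<Rightarrow> real)" "smooth_on_open UNIV (cos :: real \<Rightarrow> real)"
    by (auto simp: smooth_on_open_def)
qed

lemma smooth_cis: "smooth_on_open UNIV (\<lambda>s. cis (k * s))"
proof -
  have l: "smooth_on_open UNIV (\<lambda>s::real. k * s)"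
    by (rule smooth_on_open_linear) (auto intro: bounded_linear_mult_right)
  have "smooth_on_open UNIV (\<lambda>s. cos (k * s) *\<^sub>R (1::complex) + sin (k * s) *\<^sub>R \<i>)"
    by (intro smooth_on_open_add smooth_on_open_scaleR smooth_on_open_const
        smooth_on_open_compose[OF smooth_sin_cos(1) l] smooth_on_open_compose[OF smooth_sin_cos(2) l]) auto
  then show ?thesis
    by (rule smooth_on_open_cong) (simp add: complex_eq_iff)
qed

lemma cis_has_vector_derivative: "((\<lambda>s. cis (k * s)) has_vector_derivative \<i> * of_real k) (at 0)"
proof -
  have "((\<lambda>s. cos (k * s) *\<^sub>R (1::complex) + sin (k * s) *\<^sub>R \<i>) has_vector_derivative (- sin (k * 0) * k) *\<^sub>R 1 + (cos (k * 0) * k) *\<^sub>R \<i>) (at 0)"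
    by (auto intro!: derivative_eq_intros has_vector_derivative_scaleR simp: has_real_derivative_iff_has_vector_derivative[symmetric])
  moreover have "(\<lambda>s. cis (k * s)) = (\<lambda>s. cos (k * s) *\<^sub>R (1::complex) + sin (k * s) *\<^sub>R \<i>)"
    by (auto simp: complex_eq_iff)
  ultimately show ?thesis by (simp add: scaleR_conv_of_real mult.commute)
qed

definition solid_torus :: "real \<Rightarrow> (complex \<times> complex) set" where
  "solid_torus r = sphere 0 1 \<times> cball 0 r"

definition open_solid_torus :: "real \<Rightarrow> (complex \<times> complex) set" where
  "open_solid_torus r = sphere 0 1 \<times> ball 0 r"

text \<open>The vector of the solid torus with angular velocity \<open>a\<close> (in turns) and transverse velocity \<open>c\<close>.\<close>

definition torus_vector :: "complex \<Rightarrow> real \<times> complex \<Rightarrow> complex \<times> complex" where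
  "torus_vector z w = (\<i> * z * of_real (2 * pi * fst w), snd w)"

lemma linear_torus_vector: "linear (torus_vector z)"
  unfolding torus_vector_def by (rule linearI) (auto simp: scaleR_conv_of_real algebra_simps)

lemma solid_torus_curve:
  assumes "(z, \<zeta>) \<in> open_solid_torus 1"
  obtains \<epsilon> where "\<epsilon> > 0" "smooth_on_open {-\<epsilon><..<\<epsilon>} (\<lambda>s. (z * cis (2 * pi * a * s), \<zeta> + s *\<^sub>R c))"
    "(\<lambda>s. (z * cis (2 * pi * a * s), \<zeta> + s *\<^sub>R c)) ` {-\<epsilon><..<\<epsilon>} \<subseteq> open_solid_torus 1"
    "((\<lambda>s. (z * cis (2 * pi * a * s), \<zeta> + s *\<^sub>R c)) has_vector_derivative torus_vector z (a, c)) (at 0)"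
proof -
  let ?p = "\<lambda>s. (z * cis (2 * pi * a * s), \<zeta> + s *\<^sub>R c)"
  have z: "norm z = 1" "norm \<zeta> < 1" using assms by (auto simp: open_solid_torus_def)
  have sm: "smooth_on_open UNIV ?p"
    by (intro smooth_on_open_Pair smooth_on_open_mult smooth_on_open_const smooth_cis smooth_on_open_add smooth_on_open_linear bounded_linear_scaleR_left) auto
  have "continuous_on {-1<..<1} (\<lambda>s. \<zeta> + s *\<^sub>R c)" by (intro continuous_intros)
  moreover have "\<zeta> + 0 *\<^sub>R c \<in> ball 0 1" using z by simp
  ultimately obtain \<epsilon> where e: "\<epsilon> > 0" "(\<lambda>s. \<zeta> + s *\<^sub>R c) ` {-\<epsilon><..<\<epsilon>} \<subseteq> ball 0 1"
    using shrink_curve[OF zero_less_one _ _ open_ball] by blast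
  show thesis
  proof (rule that[OF e(1)])
    show "smooth_on_open {-\<epsilon><..<\<epsilon>} ?p" using sm by (rule smooth_on_open_subset) auto
    show "?p ` {-\<epsilon><..<\<epsilon>} \<subseteq> open_solid_torus 1" using e(2) z by (auto simp: open_solid_torus_def norm_mult)
    have "((\<lambda>s. z * cis (2 * pi * a * s)) has_vector_derivative z * (\<i> * of_real (2 * pi * a))) (at 0)"
      by (intro has_vector_derivative_mult_right cis_has_vector_derivative)
    moreover have "((\<lambda>s. \<zeta> + s *\<^sub>R c) has_vector_derivative c) (at 0)"
      by (auto intro!: derivative_eq_intros simp: has_vector_derivative_def)
    ultimately have "(?p has_vector_derivative (z * (\<i> * of_real (2 * pi * a)), c)) (at 0)" by (rule has_vector_derivative_Pair)
    then show "(?p has_vector_derivative torus_vector z (a, c)) (at 0)" by (simp add: torus_vector_def mult_ac)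
  qed
qed

lemma torus_vector_tangent:
  assumes "(z, \<zeta>) \<in> open_solid_torus 1"
  shows "torus_vector z w \<in> tangent_space (solid_torus 1) (z, \<zeta>)"
proof -
  obtain \<epsilon> where e: "\<epsilon> > 0" "smooth_on_open {-\<epsilon><..<\<epsilon>} (\<lambda>s. (z * cis (2 * pi * fst w * s), \<zeta> + s *\<^sub>R snd w))"
    "(\<lambda>s. (z * cis (2 * pi * fst w * s), \<zeta> + s *\<^sub>R snd w)) ` {-\<epsilon><..<\<epsilon>} \<subseteq> open_solid_torus 1"
    "((\<lambda>s. (z * cis (2 * pi * fst w * s), \<zeta> + s *\<^sub>R snd w)) has_vector_derivative torus_vector z (fst w, snd w)) (at 0)"
    using solid_torus_curve[OF assms, of "fst w" "snd w"] by blast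
  have "open_solid_torus 1 \<subseteq> solid_torus 1" by (auto simp: open_solid_torus_def solid_torus_def)
  then show ?thesis using e by (intro tangent_spaceI[OF e(1,2)]) auto
qed

text \<open>The first component has constant norm, so its velocity is orthogonal to
  \<open>z\<close>, that is, an imaginary multiple of it.\<close>

lemma solid_torus_tangent:
  assumes "u \<in> tangent_space (solid_torus 1) (z, \<zeta>)"
  shows "u = torus_vector z (Im (cnj z * fst u) / (2 * pi), snd u)"
proof -
  obtain \<epsilon> \<gamma> where g: "\<epsilon> > 0" "smooth_on_open {-\<epsilon><..<\<epsilon>} \<gamma>" "\<gamma> ` {-\<epsilon><..<\<epsilon>} \<subseteq> solid_torus 1" "\<gamma> 0 = (z, \<zeta>)" "(\<gamma> has_vector_derivative u) (at 0)"
    using assms by (rule tangent_spaceE)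
  have z: "norm z = 1" using tangent_space_base[OF assms] by (simp add: solid_torus_def)
  have d: "((\<lambda>s. fst (\<gamma> s)) has_vector_derivative fst u) (at 0)"
    by (rule bounded_linear.has_vector_derivative[OF bounded_linear_fst g(5)])
  have "((\<lambda>s. fst (\<gamma> s) \<bullet> fst (\<gamma> s)) has_vector_derivative fst (\<gamma> 0) \<bullet> fst u + fst u \<bullet> fst (\<gamma> 0)) (at 0)"
    by (rule bounded_bilinear.has_vector_derivative[OF bounded_bilinear_inner d d])
  moreover have "((\<lambda>s. fst (\<gamma> s) \<bullet> fst (\<gamma> s)) has_vector_derivative 0) (at 0)"
  proof (rule has_vector_derivative_transform_within_open[of "\<lambda>_. 1" _ _ "{-\<epsilon><..<\<epsilon>}"])
    fix s assume "s \<in> {-\<epsilon><..<\<epsilon>}"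
    then have "norm (fst (\<gamma> s)) = 1" using g(3) by (force simp: solid_torus_def image_subset_iff)
    then show "1 = fst (\<gamma> s) \<bullet> fst (\<gamma> s)" by (simp add: dot_square_norm)
  qed (use g(1) in auto)
  ultimately have "fst (\<gamma> 0) \<bullet> fst u + fst u \<bullet> fst (\<gamma> 0) = 0" by (rule vector_derivative_unique_at)
  then have "z \<bullet> fst u = 0" using g(4) by (simp add: inner_commute)
  then have re: "Re (cnj z * fst u) = 0" by (simp add: inner_complex_def)
  have "z * cnj z = 1" using z by (simp add: complex_norm_square[symmetric])
  then have "fst u = z * (cnj z * fst u)" by (simp add: mult.assoc[symmetric])
  also have "cnj z * fst u = \<i> * of_real (Im (cnj z * fst u))" using re by (simp add: complex_eq_iff)
  finally have "fst u = z * (\<i> * of_real (Im (cnj z * fst u)))" .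
  also have "\<dots> = fst (torus_vector z (Im (cnj z * fst u) / (2 * pi), snd u))"
    by (simp only: torus_vector_def fst_conv) simp
  finally show ?thesis by (intro prod_eqI) (simp_all only: torus_vector_def snd_conv)
qed

locale tubular_neighbourhood =
  fixes M :: "'a::euclidean_space set" and K :: "'a set" and \<phi> :: "complex \<times> complex \<Rightarrow> 'a"
  assumes manifold: "closed_3manifold M" and tubular: "tubular_param M K \<phi>"
begin

definition \<psi> :: "'a \<Rightarrow> complex \<times> complex" where
  "\<psi> = inv_into (solid_torus 1) \<phi>"

definition open_tube :: "real \<Rightarrow> 'a set" where
  "open_tube r = \<phi> ` open_solid_torus r"

lemma tube_eq: "tube \<phi> r = \<phi> ` solid_torus r"
  by (simp add: tube_def solid_torus_def)

lemma diffeo: "diffeomorphism (solid_torus 1) (tube \<phi> 1) \<phi>"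
  using tubular by (simp add: tubular_param_def tube_def solid_torus_def)

lemmas diffeo_facts = diffeomorphism_inverse[OF diffeo, folded \<psi>_def]

lemma K_eq: "K = \<phi> ` (sphere 0 1 \<times> {0})" and tube_1_subset: "tube \<phi> 1 \<subseteq> M"
  using tubular by (auto simp: tubular_param_def tube_def)

lemma K_subset: "r \<ge> 0 \<Longrightarrow> K \<subseteq> tube \<phi> r"
  unfolding K_eq tube_eq by (auto simp: solid_torus_def)

lemma solid_torus_mono: "r \<le> s \<Longrightarrow> solid_torus r \<subseteq> solid_torus s" "r < s \<Longrightarrow> solid_torus r \<subseteq> open_solid_torus s"
  "open_solid_torus r \<subseteq> solid_torus r" "r \<le> s \<Longrightarrow> open_solid_torus r \<subseteq> open_solid_torus s"
  by (auto simp: solid_torus_def open_solid_torus_def)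

lemma tube_mono: "r \<le> s \<Longrightarrow> tube \<phi> r \<subseteq> tube \<phi> s" "r < s \<Longrightarrow> tube \<phi> r \<subseteq> open_tube s" "open_tube r \<subseteq> tube \<phi> r"
  "r \<le> s \<Longrightarrow> open_tube r \<subseteq> open_tube s"
  unfolding tube_eq open_tube_def by (rule image_mono, rule solid_torus_mono, assumption?)+

lemma \<psi>_\<phi>: "p \<in> solid_torus 1 \<Longrightarrow> \<psi> (\<phi> p) = p"
  using diffeo_facts(5) by blast

lemma tube_iff: "p \<in> solid_torus 1 \<Longrightarrow> r \<le> 1 \<Longrightarrow> \<phi> p \<in> tube \<phi> r \<longleftrightarrow> norm (snd p) \<le> r"
  "p \<in> solid_torus 1 \<Longrightarrow> r \<le> 1 \<Longrightarrow> \<phi> p \<in> open_tube r \<longleftrightarrow> norm (snd p) < r"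
proof -
  assume p: "p \<in> solid_torus 1" "r \<le> 1"
  note inj = inj_on_image_mem_iff[OF diffeo_facts(8) p(1)]
  show "\<phi> p \<in> tube \<phi> r \<longleftrightarrow> norm (snd p) \<le> r"
    unfolding tube_eq using inj[of "solid_torus r"] solid_torus_mono(1)[OF p(2)] p(1) by (auto simp: solid_torus_def)
  show "\<phi> p \<in> open_tube r \<longleftrightarrow> norm (snd p) < r"
    unfolding open_tube_def using inj[of "open_solid_torus r"] solid_torus_mono(3)[of r] solid_torus_mono(1)[OF p(2)] p(1)
    by (auto simp: solid_torus_def open_solid_torus_def)
qed

lemma compact_tube: "r \<le> 1 \<Longrightarrow> compact (tube \<phi> r)"
proof -
  assume r: "r \<le> 1"
  have "compact (solid_torus r)" unfolding solid_torus_def by (intro compact_Times) auto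
  moreover have "continuous_on (solid_torus r) \<phi>"
    using smooth_map_on_continuous[OF diffeo_facts(1)] solid_torus_mono(1)[OF r] continuous_on_subset by blast
  ultimately show ?thesis unfolding tube_eq by (rule compact_continuous_image[rotated])
qed

text \<open>\<open>tubular_param\<close> asks only for a diffeomorphism onto the image. That the
  image of the open solid torus is open in \<open>M\<close> comes from invariance of domain, applied
  in a chart.\<close>

lemma openin_open_tube:
  assumes r: "r \<le> 1"
  shows "openin (top_of_set M) (open_tube r)"
proof (subst openin_subopen, intro ballI)
  fix x assume x: "x \<in> open_tube r"
  then obtain z \<zeta> where zz: "z \<in> sphere 0 1" "\<zeta> \<in> ball 0 r" "x = \<phi> (z, \<zeta>)" by (auto simp: open_tube_def open_solid_torus_def)
  obtain t0 where t0: "z = circle_point t0" using circle_point_image zz(1) by blast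
  have sub: "open_tube r \<subseteq> M" using tube_mono(3)[of r] tube_mono(1)[OF r] tube_1_subset by blast
  then have xM: "x \<in> M" using x by blast
  obtain D c where D: "parametrization M D c" "x \<in> c ` D" using manifold xM unfolding closed_3manifold_def by blast
  obtain U G where U: "open U" "x \<in> U" "smooth_on_open U G" "G ` U \<subseteq> D" "\<And>y. y \<in> U \<Longrightarrow> y \<in> M \<Longrightarrow> y \<in> c ` D \<and> c (G y) = y"
    using parametrization_local_inverse[OF D] by metis
  \<comment> \<open>An angular interval of length 1 around \<open>t0\<close>, on which
    \<open>circle_point\<close> is injective.\<close>
  define I where "I = {t0 - 1/2<..<t0 + 1/2} \<times> ball (0::complex) r"
  define f where "f p = \<phi> (circle_point (fst p), snd p)" for p
  have fT: "(circle_point (fst p), snd p) \<in> open_solid_torus r" if "p \<in> I" for p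
    using that by (auto simp: I_def open_solid_torus_def)
  have fc: "continuous_on I f" unfolding f_def
    by (rule continuous_on_compose2[OF smooth_map_on_continuous[OF diffeo_facts(1)]])
      (use fT solid_torus_mono(3)[of r] solid_torus_mono(1)[OF r] in \<open>auto intro!: continuous_intros\<close>)
  have oI: "open I" unfolding I_def by (intro open_Times) auto
  define O1 where "O1 = I \<inter> f -` U"
  have oO1: "open O1" unfolding O1_def by (rule continuous_open_preimage[OF fc oI U(1)])
  have inM: "f p \<in> open_tube r" if "p \<in> I" for p using fT[OF that] by (auto simp: f_def open_tube_def)
  have cp_inj: "s = t" if st: "circle_point s = circle_point t" "\<bar>s - t\<bar> < 1" for s t
  proof -
    obtain n :: int where n: "2 * pi * s = 2 * pi * t + 2 * pi * n"
      using st(1) sin_cos_eq_iff[of "2 * pi * s" "2 * pi * t"] unfolding circle_point_def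
      by (auto simp: complex_eq_iff mult_ac)
    then have "2 * pi * (s - t - n) = 0" by (simp add: algebra_simps)
    then have "s = t + n" by simp
    then have "\<bar>real_of_int n\<bar> < 1" using st(2) by simp
    then show ?thesis using \<open>s = t + n\<close> by simp
  qed
  have "inj_on (\<lambda>p. G (f p)) O1"
  proof (rule inj_onI)
    fix p p' assume p: "p \<in> O1" "p' \<in> O1" "G (f p) = G (f p')"
    have pI: "p \<in> I" "p' \<in> I" "f p \<in> U" "f p' \<in> U" using p(1,2) by (simp_all add: O1_def)
    have f: "f p \<in> U" "f p \<in> M" "f p' \<in> U" "f p' \<in> M"
      by (rule pI subsetD[OF sub inM])+
    then have "f p = f p'" using U(5) p(3) by metis
    then have "\<phi> (circle_point (fst p), snd p) = \<phi> (circle_point (fst p'), snd p')" by (simp add: f_def)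
    moreover have "(circle_point (fst p), snd p) \<in> solid_torus 1" "(circle_point (fst p'), snd p') \<in> solid_torus 1"
      using fT[of p] fT[of p'] p solid_torus_mono(3)[of r] solid_torus_mono(1)[OF r] by (auto simp: O1_def)
    ultimately have "(circle_point (fst p), snd p) = (circle_point (fst p'), snd p')" by (rule inj_onD[OF diffeo_facts(8)])
    moreover have "\<bar>fst p - fst p'\<bar> < 1" using p by (auto simp: O1_def I_def abs_less_iff)
    ultimately show "p = p'" using cp_inj by (auto simp: prod_eq_iff)
  qed
  moreover have "continuous_on O1 (\<lambda>p. G (f p))"
    by (rule continuous_on_compose2[OF smooth_on_open_continuous[OF U(3)] continuous_on_subset[OF fc]]) (auto simp: O1_def)
  \<comment> \<open>Both \<open>real \<times> complex\<close> and \<open>real^3\<close> have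
    dimension three.\<close>
  ultimately have oG: "open ((\<lambda>p. G (f p)) ` O1)"
    using oO1 by (intro invariance_of_domain_gen) auto
  define V where "V = U \<inter> G -` ((\<lambda>p. G (f p)) ` O1)"
  have oV: "open V" unfolding V_def
    by (rule continuous_open_preimage[OF smooth_on_open_continuous[OF U(3)] U(1) oG])
  have "x = f (t0, \<zeta>)" "(t0, \<zeta>) \<in> O1"
    using zz t0 U(2) by (auto simp: f_def O1_def I_def)
  then have "x \<in> M \<inter> V" using xM U(2) by (auto simp: V_def)
  moreover have "M \<inter> V \<subseteq> open_tube r"
  proof
    fix y assume y: "y \<in> M \<inter> V"
    then obtain p where p: "p \<in> O1" "G y = G (f p)" by (auto simp: V_def)
    then have "y = f p" using y U(5)[of y] U(5)[of "f p"] inM[of p] sub by (auto simp: V_def O1_def)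
    then show "y \<in> open_tube r" using inM p by (auto simp: O1_def)
  qed
  moreover have "openin (top_of_set M) (M \<inter> V)" using oV by (simp add: openin_open_Int)
  ultimately show "\<exists>T. openin (top_of_set M) T \<and> x \<in> T \<and> T \<subseteq> open_tube r" by blast
qed

lemma open_tube_subset: "r \<le> 1 \<Longrightarrow> open_tube r \<subseteq> M"
  using openin_open_tube openin_imp_subset by blast

lemma closed_M: "closed M" "compact M"
  using manifold compact_imp_closed by (auto simp: closed_3manifold_def)

text \<open>A point at radius exactly \<open>r\<close> is a limit of points pushed outwards along
  its ray; \<open>r < 1\<close> leaves room for this inside the parametrized tube.\<close>

lemma exterior_eq:
  assumes "0 < r" "r < 1"
  shows "exterior M \<phi> r = M - open_tube r"
proof
  have "closedin (top_of_set M) (M - open_tube r)"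
    using openin_open_tube[of r] assms by (intro closedin_diff) auto
  then have "closed (M - open_tube r)" using closed_M(1) closedin_closed_trans by blast
  moreover have "M - tube \<phi> r \<subseteq> M - open_tube r" using tube_mono(3) by blast
  ultimately show "exterior M \<phi> r \<subseteq> M - open_tube r"
    unfolding exterior_def by (rule closure_minimal[rotated])
  show "M - open_tube r \<subseteq> exterior M \<phi> r"
  proof
    fix x assume x: "x \<in> M - open_tube r"
    show "x \<in> exterior M \<phi> r"
    proof (cases "x \<in> tube \<phi> r")
      case False then show ?thesis using x closure_subset unfolding exterior_def by fastforce
    next
      case True
      then obtain z \<zeta> where p: "(z, \<zeta>) \<in> solid_torus r" "x = \<phi> (z, \<zeta>)" by (auto simp: tube_eq)
      then have p1: "(z, \<zeta>) \<in> solid_torus 1" using solid_torus_mono(1)[of r 1] assms by auto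
      then have n: "norm \<zeta> = r" "norm z = 1"
        using tube_iff(2)[OF p1, of r] x p assms by (auto simp: solid_torus_def)
      let ?y = "\<lambda>t. \<phi> (z, (1 + t) *\<^sub>R \<zeta>)"
      have st: "(z, (1 + t) *\<^sub>R \<zeta>) \<in> solid_torus 1" if "0 \<le> t" "t \<le> (1 - r) / r" for t
      proof -
        have "(1 + t) * r \<le> 1" using that assms by (simp add: field_simps)
        then show ?thesis using n that by (simp add: solid_torus_def)
      qed
      have e0: "(1 - r) / r > 0" using assms by simp
      have "continuous_on {0..(1 - r) / r} ?y"
        by (rule continuous_on_compose2[OF smooth_map_on_continuous[OF diffeo_facts(1)]]) (use st in \<open>auto intro!: continuous_intros\<close>)
      moreover have "0 \<in> {0..(1 - r) / r}" using e0 by simp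
      ultimately have "(?y \<longlongrightarrow> ?y 0) (at 0 within {0..(1 - r) / r})"
        unfolding continuous_on_def by blast
      then have "(?y \<longlongrightarrow> x) (at 0 within {0..(1 - r) / r})" using p(2) by simp
      then have lim: "(?y \<longlongrightarrow> x) (at 0 within {0<..(1 - r) / r})"
        by (rule tendsto_within_subset) auto
      have "?y t \<in> M - tube \<phi> r" if "t \<in> {0<..(1 - r) / r}" for t
      proof -
        have "(z, (1 + t) *\<^sub>R \<zeta>) \<in> solid_torus 1" using st that by auto
        moreover have "norm ((1 + t) *\<^sub>R \<zeta>) > r" using n that assms by simp
        ultimately show ?thesis using tube_iff(1)[of _ r] assms tube_1_subset by (force simp: tube_eq)
      qed
      then have "\<forall>\<^sub>F t in at 0 within {0<..(1 - r) / r}. ?y t \<in> closure (M - tube \<phi> r)"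
        unfolding eventually_at_filter by (intro always_eventually allI impI) (use closure_subset in blast)
      moreover have "at 0 within {0<..(1 - r) / r} \<noteq> bot"
        using e0 by (simp add: trivial_limit_within islimpt_greaterThanLessThan1 islimpt_Ioc)
      ultimately show ?thesis unfolding exterior_def by (rule Lim_in_closed_set[OF closed_closure _ _ lim])
    qed
  qed
qed

lemma boundary_eq:
  assumes "0 < r" "r < 1"
  shows "boundary_torus M \<phi> r = \<phi> ` (sphere 0 1 \<times> sphere 0 r)"
proof -
  have "(x \<in> M - open_tube r \<and> x \<in> tube \<phi> r) = (x \<in> \<phi> ` (sphere 0 1 \<times> sphere 0 r))" for x
  proof
    assume x: "x \<in> M - open_tube r \<and> x \<in> tube \<phi> r"
    then obtain p where p: "p \<in> solid_torus r" "x = \<phi> p" by (auto simp: tube_eq)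
    then have p1: "p \<in> solid_torus 1" using solid_torus_mono(1)[of r 1] assms by auto
    then show "x \<in> \<phi> ` (sphere 0 1 \<times> sphere 0 r)"
      using tube_iff(2)[OF p1, of r] x p assms by (auto simp: solid_torus_def intro!: image_eqI[of _ _ p])
  next
    assume "x \<in> \<phi> ` (sphere 0 1 \<times> sphere 0 r)"
    then obtain p where p: "p \<in> sphere 0 1 \<times> sphere 0 r" "x = \<phi> p" by auto
    then have p1: "p \<in> solid_torus 1" using assms by (auto simp: solid_torus_def)
    then show "x \<in> M - open_tube r \<and> x \<in> tube \<phi> r"
      using tube_iff[OF p1, of r] p assms tube_1_subset by (auto simp: tube_eq)
  qed
  then show ?thesis unfolding boundary_torus_def exterior_eq[OF assms] by blast
qed

text \<open>Radial scaling by \<open>r / R\<close> moves points of the solid torus by at most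
  \<open>R - r\<close>, so uniform continuity of \<open>\<phi>\<close> keeps the thicker tube near
  the compact one.\<close>

lemma tube_thicken:
  assumes "0 \<le> r" "r < 1" "openin (top_of_set M) W" "tube \<phi> r \<subseteq> W"
  obtains R where "r < R" "R < 1" "tube \<phi> R \<subseteq> W"
proof -
  obtain V where V: "open V" "W = M \<inter> V" using assms(3) by (auto simp: openin_open)
  obtain e where e: "e > 0" "(\<Union>x\<in>tube \<phi> r. ball x e) \<subseteq> V"
    using compact_subset_open_imp_ball_epsilon_subset[OF compact_tube[of r] V(1)] assms V by auto
  have "compact (solid_torus 1)" unfolding solid_torus_def by (intro compact_Times) auto
  then have "uniformly_continuous_on (solid_torus 1) \<phi>"
    using compact_uniformly_continuous[OF smooth_map_on_continuous[OF diffeo_facts(1)]] by blast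
  then obtain d where d: "d > 0" "\<And>p p'. p \<in> solid_torus 1 \<Longrightarrow> p' \<in> solid_torus 1 \<Longrightarrow> dist p' p < d \<Longrightarrow> dist (\<phi> p') (\<phi> p) < e"
    unfolding uniformly_continuous_on_def using e(1) by metis
  define R where "R = r + min (d / 2) ((1 - r) / 2)"
  have R: "r < R" "R < 1" "R - r < d" using d(1) assms by (auto simp: R_def min_def field_simps)
  have "tube \<phi> R \<subseteq> W"
  proof
    fix x assume "x \<in> tube \<phi> R"
    then obtain z \<zeta> where p: "(z, \<zeta>) \<in> solid_torus R" "x = \<phi> (z, \<zeta>)" by (auto simp: tube_eq)
    have p1: "(z, \<zeta>) \<in> solid_torus 1" using p(1) solid_torus_mono(1)[of R 1] R by auto
    have R0: "R > 0" using R assms by simp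
    have n: "norm \<zeta> \<le> R" "norm z = 1" using p(1) by (auto simp: solid_torus_def)
    have a: "\<bar>r / R\<bar> * norm \<zeta> \<le> r"
      using mult_left_mono[OF n(1), of "r / R"] R0 assms by simp
    then have p2: "(z, (r / R) *\<^sub>R \<zeta>) \<in> solid_torus r" using n by (simp add: solid_torus_def)
    have "dist (z, \<zeta>) (z, (r / R) *\<^sub>R \<zeta>) = norm ((1 - r / R) *\<^sub>R \<zeta>)"
      by (simp add: dist_Pair_Pair dist_norm algebra_simps)
    also have "\<dots> = (1 - r / R) * norm \<zeta>" using R R0 by simp
    also have "\<dots> \<le> (1 - r / R) * R" using R R0 n by (intro mult_left_mono) auto
    also have "(1 - r / R) * R = R - r" using R0 by (simp add: left_diff_distrib)
    also have "\<dots> < d" by (rule R(3))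
    finally have "dist (\<phi> (z, \<zeta>)) (\<phi> (z, (r / R) *\<^sub>R \<zeta>)) < e"
      using d(2)[OF _ p1, of "(z, (r / R) *\<^sub>R \<zeta>)"] p2 solid_torus_mono(1)[of r 1] assms by auto
    moreover have "\<phi> (z, (r / R) *\<^sub>R \<zeta>) \<in> tube \<phi> r" using p2 by (simp add: tube_eq)
    ultimately have "x \<in> V" using e(2) unfolding p(2) by (intro subsetD[OF e(2)] UN_I[of "\<phi> (z, (r / R) *\<^sub>R \<zeta>)"]) (simp_all add: dist_commute)
    moreover have "x \<in> M" using p1 p(2) tube_1_subset by (auto simp: tube_eq)
    ultimately show "x \<in> W" using V by blast
  qed
  then show thesis using that R by blast
qed

text \<open>Trivializes the tangent bundle of \<open>M\<close> over the open tube, so that fields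
  there become maps to nonzero elements of \<open>real \<times> complex\<close>, on which
  quaternions act.\<close>

definition frame :: "'a \<Rightarrow> real \<times> complex \<Rightarrow> 'a" where
  "frame x w = dmap \<phi> (solid_torus 1) (\<psi> x) (torus_vector (fst (\<psi> x)) w)"

definition coframe :: "'a \<Rightarrow> 'a \<Rightarrow> real \<times> complex" where
  "coframe x u = (Im (cnj (fst (\<psi> x)) * fst (dmap \<psi> (tube \<phi> 1) x u)) / (2 * pi), snd (dmap \<psi> (tube \<phi> 1) x u))"

lemma \<psi>_open_tube:
  assumes "x \<in> open_tube r" "r \<le> 1"
  shows "\<psi> x \<in> open_solid_torus r" "\<phi> (\<psi> x) = x" "\<psi> x \<in> solid_torus 1" "x \<in> tube \<phi> 1" "x \<in> open_tube 1"
proof -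
  obtain p where p: "p \<in> open_solid_torus r" "x = \<phi> p" using assms by (auto simp: open_tube_def)
  moreover have "p \<in> solid_torus 1" using p(1) solid_torus_mono(3)[of r] solid_torus_mono(1)[OF assms(2)] by blast
  ultimately show "\<psi> x \<in> open_solid_torus r" "\<phi> (\<psi> x) = x" "\<psi> x \<in> solid_torus 1" "x \<in> tube \<phi> 1"
    using \<psi>_\<phi> by (auto simp: tube_eq)
  show "x \<in> open_tube 1" using assms tube_mono(4) by blast
qed

lemma tangent_tube:
  assumes "x \<in> open_tube 1" "u \<in> tangent_space M x"
  shows "u \<in> tangent_space (tube \<phi> 1) x"
  using tangent_space_openin[OF openin_open_tube[of 1] assms(1)] tangent_space_mono[OF tube_mono(3)[of 1]] assms(2) by auto

lemma torus_vector_tangent_\<psi>: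
  "x \<in> open_tube 1 \<Longrightarrow> torus_vector (fst (\<psi> x)) w \<in> tangent_space (solid_torus 1) (\<psi> x)"
  using torus_vector_tangent[of "fst (\<psi> x)" "snd (\<psi> x)"] \<psi>_open_tube(1)[of x 1] by simp

lemma frame_coframe:
  assumes x: "x \<in> open_tube 1"
  shows "frame x w \<in> tangent_space M x" "coframe x (frame x w) = w" "u \<in> tangent_space M x \<Longrightarrow> frame x (coframe x u) = u"
    "linear (frame x)" "linear (coframe x)"
proof -
  note p = \<psi>_open_tube[OF x order_refl]
  obtain z \<zeta> where z: "\<psi> x = (z, \<zeta>)" by fastforce
  have z1: "norm z = 1" using p(1) z by (simp add: open_solid_torus_def)
  have tv: "torus_vector (fst (\<psi> x)) w \<in> tangent_space (solid_torus 1) (\<psi> x)"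
    using torus_vector_tangent[of z \<zeta> w] p(1) z by simp
  then show "frame x w \<in> tangent_space M x"
    using dmap_tangent[OF diffeo_facts(1) _ tv, of M] diffeo_facts(3) tube_1_subset p(2) unfolding frame_def by auto
  have "dmap \<psi> (tube \<phi> 1) (\<phi> (\<psi> x)) (dmap \<phi> (solid_torus 1) (\<psi> x) (torus_vector (fst (\<psi> x)) w)) = torus_vector (fst (\<psi> x)) w"
    by (rule dmap_inverse[OF diffeo_facts(1,2) _ _ tv]) (use diffeo_facts in auto)
  then have e: "dmap \<psi> (tube \<phi> 1) x (frame x w) = torus_vector (fst (\<psi> x)) w" unfolding frame_def p(2) .
  have "cnj z * z = 1" using z1 by (simp add: complex_norm_square[symmetric] mult.commute)
  moreover have "cnj z * fst (torus_vector z w) = (cnj z * z) * (\<i> * complex_of_real (2 * pi * fst w))"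
    by (simp add: torus_vector_def mult_ac)
  ultimately have "Im (cnj z * fst (torus_vector z w)) = 2 * pi * fst w" by simp
  then show "coframe x (frame x w) = w" unfolding coframe_def e z by (simp add: prod_eq_iff) (simp add: torus_vector_def)
  show "frame x (coframe x u) = u" if u: "u \<in> tangent_space M x"
  proof -
    have ut: "u \<in> tangent_space (tube \<phi> 1) x" using tangent_tube[OF x u] .
    have "dmap \<psi> (tube \<phi> 1) x u \<in> tangent_space (solid_torus 1) (\<psi> x)"
      by (rule dmap_tangent[OF diffeo_facts(2) _ ut]) (use diffeo_facts in auto)
    then have "torus_vector z (coframe x u) = dmap \<psi> (tube \<phi> 1) x u"
      using solid_torus_tangent[of "dmap \<psi> (tube \<phi> 1) x u" z \<zeta>] z unfolding coframe_def by simp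
    then have "frame x (coframe x u) = dmap \<phi> (solid_torus 1) (\<psi> x) (dmap \<psi> (tube \<phi> 1) x u)" unfolding frame_def z by simp
    also have "\<dots> = u" by (rule dmap_inverse[OF diffeo_facts(2,1) _ _ ut]) (use diffeo_facts in auto)
    finally show ?thesis .
  qed
  have l: "linear (dmap \<phi> (solid_torus 1) (\<psi> x))" "linear (dmap \<psi> (tube \<phi> 1) x)"
    using dmap_linear diffeo_facts(1,2) p by blast+
  show "linear (frame x)" unfolding frame_def
    using linear_compose[OF linear_torus_vector l(1)] by (simp add: o_def)
  have "linear (\<lambda>p::complex \<times> complex. (Im (c * fst p) / k, snd p))" for c k
    by (rule linearI) (auto simp: prod_eq_iff algebra_simps add_divide_distrib diff_divide_distrib)
  from linear_compose[OF l(2) this[of "cnj (fst (\<psi> x))" "2 * pi"]] show "linear (coframe x)" unfolding coframe_def by (simp add: o_def)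
qed

lemma continuous_on_frame:
  assumes "continuous_on S f" "continuous_on S g" "f ` S \<subseteq> open_tube 1"
  shows "continuous_on S (\<lambda>s. frame (f s) (g s))"
proof -
  have \<psi>f: "continuous_on S (\<lambda>s. \<psi> (f s))"
    by (rule continuous_on_compose2[OF smooth_map_on_continuous[OF diffeo_facts(2)] assms(1)]) (use assms(3) tube_mono(3)[of 1] in blast)
  have "continuous_on S (\<lambda>s. (\<psi> (f s), torus_vector (fst (\<psi> (f s))) (g s)))"
    unfolding torus_vector_def by (intro continuous_intros \<psi>f assms)
  moreover have "(\<lambda>s. (\<psi> (f s), torus_vector (fst (\<psi> (f s))) (g s))) ` S \<subseteq> {(x, u). u \<in> tangent_space (solid_torus 1) x}"
    by (rule image_subsetI) (use torus_vector_tangent_\<psi> assms(3) in \<open>simp add: image_subset_iff\<close>)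
  ultimately show ?thesis
    using continuous_on_compose2[OF continuous_on_dmap[OF diffeo_facts(1)]] unfolding frame_def by fastforce
qed

lemma continuous_on_coframe:
  assumes "continuous_on S f" "continuous_on S g" "f ` S \<subseteq> open_tube 1" "\<And>s. s \<in> S \<Longrightarrow> g s \<in> tangent_space M (f s)"
  shows "continuous_on S (\<lambda>s. coframe (f s) (g s))"
proof -
  have \<psi>f: "continuous_on S (\<lambda>s. \<psi> (f s))"
    by (rule continuous_on_compose2[OF smooth_map_on_continuous[OF diffeo_facts(2)] assms(1)]) (use assms(3) tube_mono(3)[of 1] in blast)
  have "continuous_on S (\<lambda>s. (f s, g s))" by (intro continuous_intros assms)
  from continuous_on_compose2[OF continuous_on_dmap[OF diffeo_facts(2)] this]
  have "continuous_on S (\<lambda>s. dmap \<psi> (tube \<phi> 1) (f s) (g s))"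
    using tangent_tube assms(3,4) by (force simp: image_subset_iff)
  then show ?thesis unfolding coframe_def by (intro continuous_intros \<psi>f) auto
qed

end

section \<open>Fields along the boundary torus\<close>

lemma curve_composition_derivative:
  fixes \<rho> :: "'a::euclidean_space \<Rightarrow> real"
  assumes "smooth_on_open N \<rho>" "\<gamma> t \<in> N" "(\<gamma> has_vector_derivative u) (at t within S)"
  shows "((\<lambda>s. \<rho> (\<gamma> s)) has_real_derivative frechet_derivative \<rho> (at (\<gamma> t)) u) (at t within S)"
proof -
  have d: "(\<rho> has_derivative frechet_derivative \<rho> (at (\<gamma> t))) (at (\<gamma> t))"
    by (rule smooth_on_open_has_derivative[OF assms(1,2)])
  from has_derivative_in_compose[OF assms(3)[unfolded has_vector_derivative_def] has_derivative_at_withinI[OF d]]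
  have "((\<lambda>s. \<rho> (\<gamma> s)) has_derivative (\<lambda>s. frechet_derivative \<rho> (at (\<gamma> t)) (s *\<^sub>R u))) (at t within S)" .
  then show ?thesis
    unfolding has_field_derivative_def
    by (rule has_derivative_eq_rhs) (simp add: fun_eq_iff linear_scale[OF has_derivative_linear[OF d]] mult.commute)
qed

lemma right_derivative_nonneg:
  fixes f :: "real \<Rightarrow> real"
  assumes "(f has_real_derivative d) (at 0 within {0..<\<epsilon>})" "\<epsilon> > 0" "\<And>s. s \<in> {0<..<\<epsilon>} \<Longrightarrow> f s \<ge> f 0"
  shows "d \<ge> 0"
proof (rule ccontr)
  assume "\<not> d \<ge> 0"
  then obtain \<eta> where \<eta>: "\<eta> > 0" "\<And>h. h > 0 \<Longrightarrow> 0 + h \<in> {0..<\<epsilon>} \<Longrightarrow> h < \<eta> \<Longrightarrow> f (0 + h) < f 0"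
    using has_real_derivative_neg_dec_right[OF assms(1)] by auto
  obtain h where h: "0 < h" "h < \<eta>" "h < \<epsilon>" using field_lbound_gt_zero[OF \<eta>(1) assms(2)] by blast
  show False using \<eta>(2)[of h] assms(3)[of h] h by simp
qed

context tubular_neighbourhood
begin

definition height :: "'a \<Rightarrow> 'a \<Rightarrow> real" where
  "height x u = snd (\<psi> x) \<bullet> snd (coframe x u)"

lemma boundary_point:
  assumes "0 < r" "r < 1" "x \<in> boundary_torus M \<phi> r"
  shows "x \<in> open_tube 1" "norm (snd (\<psi> x)) = r" "x \<in> exterior M \<phi> r" "x \<in> M" "x \<in> tube \<phi> r"
proof -
  obtain p where p: "p \<in> sphere 0 1 \<times> sphere 0 r" "x = \<phi> p" using assms(3) unfolding boundary_eq[OF assms(1,2)] by blast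
  then have "p \<in> open_solid_torus 1" "p \<in> solid_torus 1" "p \<in> solid_torus r" using assms by (auto simp: open_solid_torus_def solid_torus_def)
  then show "x \<in> open_tube 1" "norm (snd (\<psi> x)) = r" "x \<in> tube \<phi> r" using p \<psi>_\<phi> by (auto simp: open_tube_def tube_eq)
  then show "x \<in> M" using open_tube_subset by blast
  show "x \<in> exterior M \<phi> r" using assms(3) by (simp add: boundary_torus_def)
qed

lemma exterior_near_boundary:
  assumes "0 < r" "r < 1" "y \<in> open_tube 1"
  shows "y \<in> exterior M \<phi> r \<longleftrightarrow> r \<le> norm (snd (\<psi> y))" "y \<in> boundary_torus M \<phi> r \<longleftrightarrow> norm (snd (\<psi> y)) = r"
proof -
  note p = \<psi>_open_tube[OF assms(3) order_refl]
  have m: "y \<in> M" using assms(3) open_tube_subset by blast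
  show a: "y \<in> exterior M \<phi> r \<longleftrightarrow> r \<le> norm (snd (\<psi> y))"
    using tube_iff(2)[OF p(3), of r] assms m unfolding exterior_eq[OF assms(1,2)] p(2) by auto
  show "y \<in> boundary_torus M \<phi> r \<longleftrightarrow> norm (snd (\<psi> y)) = r"
    using tube_iff(1)[OF p(3), of r] a assms unfolding boundary_torus_def p(2) by auto
qed

lemma height_linear:
  assumes "x \<in> open_tube 1"
  shows "height x (k *\<^sub>R u) = k * height x u" "height x (- u) = - height x u"
  using linear_scale[OF frame_coframe(5)[OF assms]] linear_neg[OF frame_coframe(5)[OF assms]]
  by (simp_all add: height_def)

lemma height_derivative:
  assumes "x \<in> open_tube 1" "\<epsilon> > 0" "smooth_on_open {-\<epsilon><..<\<epsilon>} \<gamma>" "\<gamma> ` {-\<epsilon><..<\<epsilon>} \<subseteq> open_tube 1" "\<gamma> 0 = x" "(\<gamma> has_vector_derivative u) (at 0)"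
  shows "((\<lambda>s. snd (\<psi> (\<gamma> s)) \<bullet> snd (\<psi> (\<gamma> s))) has_real_derivative 2 * height x u) (at 0)"
proof -
  have "((\<lambda>s. \<psi> (\<gamma> s)) has_vector_derivative dmap \<psi> (tube \<phi> 1) x u) (at 0)"
    by (rule dmap_curve[OF diffeo_facts(2) assms(2,3) _ assms(5,6)]) (use assms(4) tube_mono(3)[of 1] in blast)
  then have d: "((\<lambda>s. snd (\<psi> (\<gamma> s))) has_vector_derivative snd (dmap \<psi> (tube \<phi> 1) x u)) (at 0)"
    by (rule bounded_linear.has_vector_derivative[OF bounded_linear_snd])
  have "((\<lambda>s. snd (\<psi> (\<gamma> s)) \<bullet> snd (\<psi> (\<gamma> s))) has_vector_derivative
      snd (\<psi> (\<gamma> 0)) \<bullet> snd (dmap \<psi> (tube \<phi> 1) x u) + snd (dmap \<psi> (tube \<phi> 1) x u) \<bullet> snd (\<psi> (\<gamma> 0))) (at 0)"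
    by (rule bounded_bilinear.has_vector_derivative[OF bounded_bilinear_inner d d])
  then show ?thesis
    unfolding has_real_derivative_iff_has_vector_derivative
    by (simp add: assms(5) height_def coframe_def inner_commute)
qed

lemma frame_curve:
  assumes "x \<in> open_tube 1" "\<epsilon> > 0" "smooth_on_open {-\<epsilon><..<\<epsilon>} p" "p ` {-\<epsilon><..<\<epsilon>} \<subseteq> open_solid_torus 1" "p 0 = \<psi> x"
    "(p has_vector_derivative torus_vector (fst (\<psi> x)) w) (at 0)"
  shows "smooth_on_open {-\<epsilon><..<\<epsilon>} (\<lambda>s. \<phi> (p s))" "(\<lambda>s. \<phi> (p s)) ` {-\<epsilon><..<\<epsilon>} \<subseteq> open_tube 1" "\<phi> (p 0) = x"
    "((\<lambda>s. \<phi> (p s)) has_vector_derivative frame x w) (at 0)" "\<And>s. s \<in> {-\<epsilon><..<\<epsilon>} \<Longrightarrow> \<psi> (\<phi> (p s)) = p s"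
proof -
  have sub: "p ` {-\<epsilon><..<\<epsilon>} \<subseteq> solid_torus 1" using assms(4) solid_torus_mono(3)[of 1] by blast
  show "smooth_on_open {-\<epsilon><..<\<epsilon>} (\<lambda>s. \<phi> (p s))" by (rule smooth_curve_image[OF diffeo_facts(1) assms(3) sub])
  show "(\<lambda>s. \<phi> (p s)) ` {-\<epsilon><..<\<epsilon>} \<subseteq> open_tube 1" using assms(4) by (auto simp: open_tube_def)
  show "\<phi> (p 0) = x" using assms(5) \<psi>_open_tube[OF assms(1)] by simp
  show "((\<lambda>s. \<phi> (p s)) has_vector_derivative frame x w) (at 0)"
    unfolding frame_def by (rule dmap_curve[OF diffeo_facts(1) assms(2,3) sub assms(5,6)])
  show "\<psi> (\<phi> (p s)) = p s" if "s \<in> {-\<epsilon><..<\<epsilon>}" for s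
    using \<psi>_\<phi> sub that by blast
qed

lemma straight_curve:
  assumes x: "x \<in> open_tube 1" and u: "u \<in> tangent_space M x"
  obtains \<epsilon> \<gamma> where "\<epsilon> > 0" "smooth_on_open {-\<epsilon><..<\<epsilon>} \<gamma>" "\<gamma> ` {-\<epsilon><..<\<epsilon>} \<subseteq> open_tube 1" "\<gamma> 0 = x"
    "(\<gamma> has_vector_derivative u) (at 0)" "\<And>s. s \<in> {-\<epsilon><..<\<epsilon>} \<Longrightarrow> snd (\<psi> (\<gamma> s)) = snd (\<psi> x) + s *\<^sub>R snd (coframe x u)"
proof -
  obtain z \<zeta> where z: "\<psi> x = (z, \<zeta>)" by fastforce
  obtain a c where w: "coframe x u = (a, c)" by fastforce
  have "(z, \<zeta>) \<in> open_solid_torus 1" using \<psi>_open_tube(1)[OF x] z by simp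
  then obtain \<epsilon> where e: "\<epsilon> > 0" "smooth_on_open {-\<epsilon><..<\<epsilon>} (\<lambda>s. (z * cis (2 * pi * a * s), \<zeta> + s *\<^sub>R c))"
    "(\<lambda>s. (z * cis (2 * pi * a * s), \<zeta> + s *\<^sub>R c)) ` {-\<epsilon><..<\<epsilon>} \<subseteq> open_solid_torus 1"
    "((\<lambda>s. (z * cis (2 * pi * a * s), \<zeta> + s *\<^sub>R c)) has_vector_derivative torus_vector z (a, c)) (at 0)"
    using solid_torus_curve[of z \<zeta> a c] by blast
  have p0: "(\<lambda>s. (z * cis (2 * pi * a * s), \<zeta> + s *\<^sub>R c)) 0 = \<psi> x" by (simp add: z)
  have d: "((\<lambda>s. (z * cis (2 * pi * a * s), \<zeta> + s *\<^sub>R c)) has_vector_derivative torus_vector (fst (\<psi> x)) (coframe x u)) (at 0)"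
    using e(4) by (simp add: z w)
  note f = frame_curve[OF x e(1-3) p0 d]
  show thesis
    by (rule that[OF e(1) f(1,2,3)])
      (use f(4,5) frame_coframe(3)[OF x u] z w in auto)
qed

lemma boundary_tangent_iff:
  assumes r: "0 < r" "r < 1" and x: "x \<in> boundary_torus M \<phi> r" and u: "u \<in> tangent_space M x"
  shows "u \<in> tangent_space (boundary_torus M \<phi> r) x \<longleftrightarrow> height x u = 0"
proof
  note b = boundary_point[OF r x]
  assume "u \<in> tangent_space (boundary_torus M \<phi> r) x"
  then obtain \<epsilon> \<gamma> where g: "\<epsilon> > 0" "smooth_on_open {-\<epsilon><..<\<epsilon>} \<gamma>" "\<gamma> ` {-\<epsilon><..<\<epsilon>} \<subseteq> boundary_torus M \<phi> r" "\<gamma> 0 = x" "(\<gamma> has_vector_derivative u) (at 0)"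
    by (rule tangent_spaceE)
  have "\<gamma> ` {-\<epsilon><..<\<epsilon>} \<subseteq> open_tube 1" using g(3) boundary_point(1)[OF r] by blast
  note h = height_derivative[OF b(1) g(1,2) this g(4,5)]
  have "((\<lambda>s. r\<^sup>2) has_real_derivative 2 * height x u) (at 0)"
    by (rule has_field_derivative_transform_within_open[OF h, of "{-\<epsilon><..<\<epsilon>}"])
      (use g(1,3) boundary_point(2)[OF r] in \<open>auto simp: dot_square_norm image_subset_iff\<close>)
  then show "height x u = 0" using DERIV_unique[OF _ DERIV_const] by fastforce
next
  note b = boundary_point[OF r x]
  assume h: "height x u = 0"
  obtain z \<zeta> where z: "\<psi> x = (z, \<zeta>)" by fastforce
  obtain a c where w: "coframe x u = (a, c)" by fastforce
  have zz: "(z, \<zeta>) \<in> open_solid_torus 1" "norm \<zeta> = r" using \<psi>_open_tube(1)[OF b(1)] z b(2) by auto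
  then have z1: "norm z = 1" by (simp add: open_solid_torus_def)
  \<comment> \<open>Height zero means that \<open>c\<close> is orthogonal to \<open>\<zeta>\<close>,
    hence an imaginary multiple of it. Rotating \<open>\<zeta>\<close> with angular velocity
    \<open>k\<close> has this velocity and stays on the torus.\<close>
  define k where "k = Im (cnj \<zeta> * c) / r\<^sup>2"
  have ck: "c = \<zeta> * (\<i> * of_real k)"
  proof -
    have "Re (cnj \<zeta> * c) = 0" using h by (simp add: height_def z w inner_complex_def)
    then have "cnj \<zeta> * c = \<i> * of_real (Im (cnj \<zeta> * c))" by (simp add: complex_eq_iff)
    then have "\<zeta> * (cnj \<zeta> * c) = \<zeta> * (\<i> * of_real (Im (cnj \<zeta> * c)))" by simp
    moreover have "\<zeta> * cnj \<zeta> = of_real (r\<^sup>2)" using zz(2) by (simp only: complex_norm_square[symmetric])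
    ultimately have "of_real (r\<^sup>2) * c = \<zeta> * (\<i> * of_real (Im (cnj \<zeta> * c)))" by (simp only: mult.assoc[symmetric])
    then show ?thesis using r(1) unfolding k_def by (simp add: field_simps)
  qed
  let ?p = "\<lambda>s. (z * cis (2 * pi * a * s), \<zeta> * cis (k * s))"
  have sm: "smooth_on_open {-1<..<1} ?p"
    by (rule smooth_on_open_subset[of UNIV])
      (auto intro!: smooth_on_open_Pair smooth_on_open_mult smooth_cis)
  have im: "?p ` {-1<..<1} \<subseteq> open_solid_torus 1" using zz z1 r by (auto simp: open_solid_torus_def norm_mult)
  have "((\<lambda>s. z * cis (2 * pi * a * s)) has_vector_derivative z * (\<i> * of_real (2 * pi * a))) (at 0)"
    "((\<lambda>s. \<zeta> * cis (k * s)) has_vector_derivative \<zeta> * (\<i> * of_real k)) (at 0)"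
    by (intro has_vector_derivative_mult_right cis_has_vector_derivative)+
  then have "(?p has_vector_derivative (z * (\<i> * of_real (2 * pi * a)), \<zeta> * (\<i> * of_real k))) (at 0)" by (rule has_vector_derivative_Pair)
  then have d: "(?p has_vector_derivative torus_vector (fst (\<psi> x)) (coframe x u)) (at 0)"
    unfolding z w ck[symmetric] by (simp add: torus_vector_def mult_ac)
  have p0: "?p 0 = \<psi> x" by (simp add: z)
  note f = frame_curve[OF b(1) zero_less_one sm im p0 d]
  show "u \<in> tangent_space (boundary_torus M \<phi> r) x"
  proof (rule tangent_spaceI[OF zero_less_one f(1) _ f(3)])
    show "(\<lambda>s. \<phi> (?p s)) ` {-1<..<1} \<subseteq> boundary_torus M \<phi> r"
      unfolding boundary_eq[OF r] using z1 zz(2) by (auto simp: norm_mult)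
    show "((\<lambda>s. \<phi> (?p s)) has_vector_derivative u) (at 0)" using f(4) frame_coframe(3)[OF b(1) u] by simp
  qed
qed

text \<open>Along a straight line in the transverse disc the squared norm gains
  \<open>2 * s * height x u\<close> and a square. By convexity of the disc a tangent line also stays
  outside, so height zero is included.\<close>

lemma exterior_half_curve:
  assumes r: "0 < r" "r < 1" and x: "x \<in> boundary_torus M \<phi> r" and u: "u \<in> tangent_space M x" and h: "height x u \<ge> 0"
  obtains \<epsilon> \<gamma> where "\<epsilon> > 0" "smooth_on_open {-\<epsilon><..<\<epsilon>} \<gamma>" "\<gamma> ` {-\<epsilon><..<\<epsilon>} \<subseteq> M" "\<gamma> ` {0..<\<epsilon>} \<subseteq> exterior M \<phi> r"
    "\<gamma> 0 = x" "(\<gamma> has_vector_derivative u) (at 0)"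
proof -
  note b = boundary_point[OF r x]
  obtain \<epsilon> \<gamma> where g: "\<epsilon> > 0" "smooth_on_open {-\<epsilon><..<\<epsilon>} \<gamma>" "\<gamma> ` {-\<epsilon><..<\<epsilon>} \<subseteq> open_tube 1" "\<gamma> 0 = x"
    "(\<gamma> has_vector_derivative u) (at 0)" "\<And>s. s \<in> {-\<epsilon><..<\<epsilon>} \<Longrightarrow> snd (\<psi> (\<gamma> s)) = snd (\<psi> x) + s *\<^sub>R snd (coframe x u)"
    using straight_curve[OF b(1) u] by blast
  have "\<gamma> s \<in> exterior M \<phi> r" if s: "s \<in> {0..<\<epsilon>}" for s
  proof -
    have s': "s \<in> {-\<epsilon><..<\<epsilon>}" using s g(1) by auto
    have "r\<^sup>2 = (norm (snd (\<psi> x)))\<^sup>2" using b(2) by simp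
    also have "\<dots> \<le> (norm (snd (\<psi> x)))\<^sup>2 + 2 * (s * height x u) + s\<^sup>2 * (norm (snd (coframe x u)))\<^sup>2"
      using s h by simp
    also have "\<dots> = (norm (snd (\<psi> x) + s *\<^sub>R snd (coframe x u)))\<^sup>2"
      using dot_norm[of "snd (\<psi> x)" "s *\<^sub>R snd (coframe x u)"] unfolding height_def by (simp add: power_mult_distrib field_simps)
    also have "\<dots> = (norm (snd (\<psi> (\<gamma> s))))\<^sup>2" using g(6)[OF s'] by simp
    finally have "r \<le> norm (snd (\<psi> (\<gamma> s)))" by (rule power2_le_imp_le[OF _ norm_ge_zero])
    then show ?thesis using exterior_near_boundary(1)[OF r] g(3) s' by blast
  qed
  then show thesis using that[OF g(1,2)] g(3,4,5) open_tube_subset[of 1] by blast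
qed

text \<open>A curve entering the exterior has nonnegative derivative of the squared radius at its
  start; excluding tangent vectors makes it positive.\<close>

lemma points_into_iff:
  assumes r: "0 < r" "r < 1" and x: "x \<in> boundary_torus M \<phi> r"
  shows "points_strictly_into M (exterior M \<phi> r) (boundary_torus M \<phi> r) x u \<longleftrightarrow> u \<in> tangent_space M x \<and> height x u > 0"
proof
  note b = boundary_point[OF r x]
  assume "points_strictly_into M (exterior M \<phi> r) (boundary_torus M \<phi> r) x u"
  then obtain \<epsilon> \<gamma> where nt: "u \<notin> tangent_space (boundary_torus M \<phi> r) x" and
    g: "\<epsilon> > 0" "smooth_on_open {-\<epsilon><..<\<epsilon>} \<gamma>" "\<gamma> ` {-\<epsilon><..<\<epsilon>} \<subseteq> M" "\<gamma> ` {0..<\<epsilon>} \<subseteq> exterior M \<phi> r" "\<gamma> 0 = x" "(\<gamma> has_vector_derivative u) (at 0)"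
    unfolding points_strictly_into_def by blast
  have u: "u \<in> tangent_space M x" using g by (intro tangent_spaceI[of \<epsilon> \<gamma>])
  obtain V where V: "open V" "open_tube 1 = M \<inter> V" using openin_open_tube[of 1] by (auto simp: openin_open)
  obtain \<delta> where d: "\<delta> > 0" "\<delta> \<le> \<epsilon>" "\<gamma> ` {-\<delta><..<\<delta>} \<subseteq> V"
    using shrink_curve[OF g(1) smooth_on_open_continuous[OF g(2)] _ V(1)] g(5) b(1) V(2) by blast
  have sub: "{-\<delta><..<\<delta>} \<subseteq> {-\<epsilon><..<\<epsilon>}" "{0..<\<delta>} \<subseteq> {0..<\<epsilon>}" using d by auto
  have im: "\<gamma> ` {-\<delta><..<\<delta>} \<subseteq> open_tube 1" using d(3) g(3) sub V(2) by blast
  have "((\<lambda>s. snd (\<psi> (\<gamma> s)) \<bullet> snd (\<psi> (\<gamma> s))) has_real_derivative 2 * height x u) (at 0)"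
    by (rule height_derivative[OF b(1) d(1) smooth_on_open_subset[OF g(2) _ sub(1)] im g(5,6)]) simp
  then have "2 * height x u \<ge> 0"
  proof (rule right_derivative_nonneg[OF has_field_derivative_at_within d(1)])
    fix s assume s: "s \<in> {0<..<\<delta>}"
    then have "\<gamma> s \<in> exterior M \<phi> r" "\<gamma> s \<in> open_tube 1" using g(4) im sub(2) by force+
    then have "r \<le> norm (snd (\<psi> (\<gamma> s)))" using exterior_near_boundary(1)[OF r] by blast
    then show "snd (\<psi> (\<gamma> 0)) \<bullet> snd (\<psi> (\<gamma> 0)) \<le> snd (\<psi> (\<gamma> s)) \<bullet> snd (\<psi> (\<gamma> s))"
      using b(2) r(1) g(5) by (simp add: dot_square_norm power_mono)
  qed
  moreover have "height x u \<noteq> 0" using nt boundary_tangent_iff[OF r x u] by blast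
  ultimately show "u \<in> tangent_space M x \<and> height x u > 0" using u by simp
next
  assume u: "u \<in> tangent_space M x \<and> height x u > 0"
  obtain \<epsilon> \<gamma> where "\<epsilon> > 0" "smooth_on_open {-\<epsilon><..<\<epsilon>} \<gamma>" "\<gamma> ` {-\<epsilon><..<\<epsilon>} \<subseteq> M" "\<gamma> ` {0..<\<epsilon>} \<subseteq> exterior M \<phi> r"
    "\<gamma> 0 = x" "(\<gamma> has_vector_derivative u) (at 0)"
    using exterior_half_curve[OF r x] u by (metis less_imp_le)
  then show "points_strictly_into M (exterior M \<phi> r) (boundary_torus M \<phi> r) x u"
    unfolding points_strictly_into_def using boundary_tangent_iff[OF r x] u by fastforce
qed

text \<open>
  Where \<open>v\<close> is tangent to the boundary torus, it points into the exterior immediately ahead along the torus.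
  This holds near a knot to which \<open>v\<close> is transverse, because \<open>height\<close> is half the derivative of \<open>norm (snd (\<psi> x))\<^sup>2\<close>
  along \<open>v\<close>, and the second derivative is positive on the knot.
\<close>

definition convex_contact :: "real \<Rightarrow> ('a \<Rightarrow> 'a) \<Rightarrow> bool" where
  "convex_contact r v \<longleftrightarrow> (\<forall>x\<in>boundary_torus M \<phi> r. v x \<in> tangent_space M x \<and> (height x (v x) = 0 \<longrightarrow>
     (\<exists>\<epsilon> \<delta>. \<epsilon> > 0 \<and> smooth_on_open {-\<epsilon><..<\<epsilon>} \<delta> \<and> \<delta> ` {-\<epsilon><..<\<epsilon>} \<subseteq> boundary_torus M \<phi> r \<and> \<delta> 0 = x \<and>
        (\<delta> has_vector_derivative v x) (at 0) \<and> (\<forall>s\<in>{0<..<\<epsilon>}. height (\<delta> s) (v (\<delta> s)) > 0))))"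

text \<open>On the knot \<open>snd (\<psi> x)\<close> vanishes, so the derivative of the height
  along \<open>v\<close> is the squared length of the transverse part of \<open>v\<close>. This is
  positive by transversality and stays positive on a thin tube by compactness.\<close>

lemma convex_contact_near_knot:
  assumes N: "open N" "K \<subseteq> N" "field_on M (M \<inter> N) v" and fr: "\<And>x. x \<in> K \<Longrightarrow> v x \<notin> tangent_space K x"
  obtains R where "0 < R" "R < 1" "tube \<phi> R \<subseteq> N" "\<And>r. 0 < r \<Longrightarrow> r \<le> R \<Longrightarrow> convex_contact r v"
proof -
  have vs: "smooth_map_on (M \<inter> N) v" and vT: "\<And>x. x \<in> M \<inter> N \<Longrightarrow> v x \<in> tangent_space M x"
    using N(3) unfolding field_on_def vector_field_along_def by auto
  have K0: "tube \<phi> 0 = K" unfolding K_eq tube_def by simp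
  have KT: "K \<subseteq> open_tube 1" using K0 tube_mono(2)[of 0 1] by simp
  have "\<exists>W F. x \<in> W \<and> smooth_on_open W F \<and> (\<forall>y\<in>W \<inter> open_tube 1 \<inter> N. F y = height y (v y) \<and> frechet_derivative F (at y) (v y) > 0)"
    if x: "x \<in> K" for x
  proof -
    have xT: "x \<in> open_tube 1" "x \<in> tube \<phi> 1" using x KT tube_mono(3)[of 1] by blast+
    have xN: "x \<in> M \<inter> N" using x N(2) xT(1) open_tube_subset by blast
    obtain U1 \<Psi> where U1: "open U1" "x \<in> U1" "smooth_on_open U1 \<Psi>" "\<forall>y\<in>U1 \<inter> tube \<phi> 1. \<Psi> y = \<psi> y"
      using diffeo_facts(2) xT(2) by (rule smooth_map_onE)
    obtain U2 V where U2: "open U2" "x \<in> U2" "smooth_on_open U2 V" "\<forall>y\<in>U2 \<inter> (M \<inter> N). V y = v y"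
      using vs xN by (rule smooth_map_onE)
    let ?U = "U1 \<inter> U2"
    have op: "open ?U" using U1 U2 by blast
    have \<Psi>s: "smooth_on_open ?U \<Psi>" and Vs: "smooth_on_open ?U V"
      using smooth_on_open_subset[OF U1(3) op] smooth_on_open_subset[OF U2(3) op] by auto
    define A where "A y = snd (\<Psi> y)" for y
    define B where "B y = snd (frechet_derivative \<Psi> (at y) (V y))" for y
    have As: "smooth_on_open ?U A" unfolding A_def by (rule smooth_on_open_bounded_linear[OF bounded_linear_snd \<Psi>s])
    have Bs: "smooth_on_open ?U B" unfolding B_def
      by (rule smooth_on_open_bounded_linear[OF bounded_linear_snd smooth_on_open_derivative_field[OF \<Psi>s Vs]])
    \<comment> \<open>A smooth extension of \<open>height y (v y)\<close> to an open set of the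
      ambient space, which can be differentiated there.\<close>
    define F where "F y = A y \<bullet> B y" for y
    have Fs: "smooth_on_open ?U F" unfolding F_def by (rule smooth_on_open_inner[OF As Bs])
    define g where "g y = frechet_derivative F (at y) (V y)" for y
    have gs: "smooth_on_open ?U g" unfolding g_def by (rule smooth_on_open_derivative_field[OF Fs Vs])
    have Fh: "F y = height y (v y)" if "y \<in> ?U \<inter> open_tube 1 \<inter> N" for y
    proof -
      have y: "y \<in> tube \<phi> 1" "y \<in> M \<inter> N" using that tube_mono(3)[of 1] open_tube_subset[of 1] by blast+
      have "v y \<in> tangent_space (tube \<phi> 1) y" using tangent_tube vT y that by blast
      then have "dmap \<psi> (tube \<phi> 1) y (v y) = frechet_derivative \<Psi> (at y) (v y)"
        by (rule dmap_eq_frechet[OF diffeo_facts(2) _ _ U1(3)]) (use that U1(4) in auto)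
      moreover have "V y = v y" "\<Psi> y = \<psi> y" using U1(4) U2(4) y that by auto
      ultimately show ?thesis unfolding F_def A_def B_def height_def coframe_def by simp
    qed
    have px: "\<psi> x \<in> sphere 0 1 \<times> {0}"
    proof -
      obtain p where "p \<in> sphere 0 1 \<times> {0}" "x = \<phi> p" using x unfolding K_eq by blast
      moreover have "p \<in> solid_torus 1" using calculation by (auto simp: solid_torus_def)
      ultimately show ?thesis using \<psi>_\<phi> by simp
    qed
    have Vx: "V x = v x" "\<Psi> x = \<psi> x" using U1(2,4) U2(2,4) xN xT by auto
    have Ax: "A x = 0" using px Vx by (auto simp: A_def)
    have vtx: "v x \<in> tangent_space M x" using vT xN by blast
    have "v x \<in> tangent_space (tube \<phi> 1) x" using tangent_tube[OF xT(1) vtx] .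
    then have dx: "dmap \<psi> (tube \<phi> 1) x (v x) = frechet_derivative \<Psi> (at x) (v x)"
      by (rule dmap_eq_frechet[OF diffeo_facts(2) _ U1(2,3)]) (use U1(4) in auto)
    have Bx: "B x = snd (coframe x (v x))" unfolding B_def Vx coframe_def dx by simp
    \<comment> \<open>Without a transverse part \<open>v x\<close> would be the velocity of a curve
      running along the core, contrary to the framing.\<close>
    have B0: "B x \<noteq> 0"
    proof
      assume "B x = 0"
      then obtain a where w: "coframe x (v x) = (a, 0)" unfolding Bx by (metis prod.collapse)
      obtain z where z: "\<psi> x = (z, 0)" "norm z = 1" using px by auto
      have "(z, 0) \<in> open_solid_torus 1" using z by (simp add: open_solid_torus_def)
      then obtain \<epsilon> where e: "\<epsilon> > 0" "smooth_on_open {-\<epsilon><..<\<epsilon>} (\<lambda>s. (z * cis (2 * pi * a * s), 0 + s *\<^sub>R (0::complex)))"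
        "(\<lambda>s. (z * cis (2 * pi * a * s), 0 + s *\<^sub>R 0)) ` {-\<epsilon><..<\<epsilon>} \<subseteq> open_solid_torus 1"
        "((\<lambda>s. (z * cis (2 * pi * a * s), 0 + s *\<^sub>R 0)) has_vector_derivative torus_vector z (a, 0)) (at 0)"
        using solid_torus_curve[of z 0 a 0] by blast
      have p0: "(\<lambda>s. (z * cis (2 * pi * a * s), 0 + s *\<^sub>R (0::complex))) 0 = \<psi> x" by (simp add: z)
      have d: "((\<lambda>s. (z * cis (2 * pi * a * s), 0 + s *\<^sub>R (0::complex))) has_vector_derivative torus_vector (fst (\<psi> x)) (coframe x (v x))) (at 0)"
        using e(4) by (simp add: z w)
      note f = frame_curve[OF xT(1) e(1-3) p0 d]
      have "v x \<in> tangent_space K x"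
      proof (rule tangent_spaceI[OF e(1) f(1) _ f(3)])
        show "(\<lambda>s. \<phi> (z * cis (2 * pi * a * s), 0 + s *\<^sub>R 0)) ` {-\<epsilon><..<\<epsilon>} \<subseteq> K"
          unfolding K_eq using z(2) by (auto simp: norm_mult)
        show "((\<lambda>s. \<phi> (z * cis (2 * pi * a * s), 0 + s *\<^sub>R 0)) has_vector_derivative v x) (at 0)"
          using f(4) frame_coframe(3)[OF xT(1) vtx] by simp
      qed
      then show False using fr x by blast
    qed
    have Ad: "(A has_derivative (\<lambda>w. snd (frechet_derivative \<Psi> (at x) w))) (at x)"
      unfolding A_def by (rule has_derivative_snd[OF smooth_on_open_has_derivative[OF \<Psi>s]]) (use U1 U2 in auto)
    have Bd: "(B has_derivative frechet_derivative B (at x)) (at x)"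
      by (rule smooth_on_open_has_derivative[OF Bs]) (use U1 U2 in auto)
    have "(F has_derivative (\<lambda>w. A x \<bullet> frechet_derivative B (at x) w + snd (frechet_derivative \<Psi> (at x) w) \<bullet> B x)) (at x)"
      unfolding F_def by (rule has_derivative_inner[OF Ad Bd])
    then have "frechet_derivative F (at x) = (\<lambda>w. A x \<bullet> frechet_derivative B (at x) w + snd (frechet_derivative \<Psi> (at x) w) \<bullet> B x)"
      by (rule frechet_derivative_at[symmetric])
    then have "g x = snd (frechet_derivative \<Psi> (at x) (V x)) \<bullet> B x" unfolding g_def Ax by simp
    also have "\<dots> = B x \<bullet> B x" by (simp add: B_def)
    finally have gx: "g x > 0" using B0 by simp
    define W where "W = ?U \<inter> g -` {0<..}"
    have oW: "open W" unfolding W_def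
      by (rule continuous_open_preimage[OF smooth_on_open_continuous[OF gs] op]) auto
    have "frechet_derivative F (at y) (v y) > 0" if "y \<in> W \<inter> open_tube 1 \<inter> N" for y
    proof -
      have "V y = v y" using U2(4) that open_tube_subset[of 1] unfolding W_def by blast
      then show ?thesis using that unfolding W_def g_def by auto
    qed
    moreover have "x \<in> W" using gx U1 U2 by (simp add: W_def)
    moreover have WU: "W \<subseteq> ?U" by (auto simp: W_def)
    moreover have "smooth_on_open W F" by (rule smooth_on_open_subset[OF Fs oW WU])
    moreover have "F y = height y (v y)" if "y \<in> W \<inter> open_tube 1 \<inter> N" for y
      using Fh[of y] that WU by blast
    ultimately show ?thesis by blast
  qed
  then obtain W F where W: "\<And>x. x \<in> K \<Longrightarrow> x \<in> W x \<and> smooth_on_open (W x) (F x) \<and>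
      (\<forall>y\<in>W x \<inter> open_tube 1 \<inter> N. F x y = height y (v y) \<and> frechet_derivative (F x) (at y) (v y) > 0)" by metis
  have "openin (top_of_set M) (M \<inter> ((\<Union>x\<in>K. W x) \<inter> N))"
    using W N(1) unfolding smooth_on_open_def by (intro openin_open_Int open_Int open_UN) auto
  moreover have "tube \<phi> 0 \<subseteq> M \<inter> ((\<Union>x\<in>K. W x) \<inter> N)"
    unfolding K0 using W N(2) KT open_tube_subset[of 1] by blast
  ultimately obtain R where R: "0 < R" "R < 1" "tube \<phi> R \<subseteq> M \<inter> ((\<Union>x\<in>K. W x) \<inter> N)"
    using tube_thicken[OF order_refl zero_less_one] by blast
  have "convex_contact r v" if r: "0 < r" "r \<le> R" for r
    unfolding convex_contact_def
  proof (intro ballI conjI impI)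
    have r1: "r < 1" using r R by simp
    fix x assume x: "x \<in> boundary_torus M \<phi> r"
    note b = boundary_point[OF r(1) r1 x]
    have xR: "x \<in> tube \<phi> R" using b(5) tube_mono(1)[OF r(2)] by blast
    then show vx: "v x \<in> tangent_space M x" using vT R(3) by blast
    assume "height x (v x) = 0"
    then have "v x \<in> tangent_space (boundary_torus M \<phi> r) x" using boundary_tangent_iff[OF r(1) r1 x vx] by blast
    moreover obtain y where y: "y \<in> K" "x \<in> W y" using xR R(3) by blast
    moreover have oW: "open (W y)" using W[OF y(1)] smooth_on_open_def by blast
    ultimately obtain \<epsilon> \<delta> where d: "\<epsilon> > 0" "smooth_on_open {-\<epsilon><..<\<epsilon>} \<delta>" "\<delta> ` {-\<epsilon><..<\<epsilon>} \<subseteq> boundary_torus M \<phi> r \<inter> W y"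
      "\<delta> 0 = x" "(\<delta> has_vector_derivative v x) (at 0)"
      using tangent_spaceE_within[of "v x" "boundary_torus M \<phi> r" x "W y"] by metis
    have in3: "\<delta> s \<in> W y \<inter> open_tube 1 \<inter> N" if "s \<in> {-\<epsilon><..<\<epsilon>}" for s
    proof -
      have "\<delta> s \<in> boundary_torus M \<phi> r" "\<delta> s \<in> W y" using d(3) that by blast+
      then show ?thesis using boundary_point(1,5)[OF r(1) r1] tube_mono(1)[OF r(2)] R(3) by blast
    qed
    \<comment> \<open>Along a curve in the torus with velocity \<open>v x\<close> the height starts
      at zero with positive derivative.\<close>
    have "((\<lambda>s. F y (\<delta> s)) has_real_derivative frechet_derivative (F y) (at (\<delta> 0)) (v x)) (at 0)"
      by (rule curve_composition_derivative[of "W y"]) (use W[OF y(1)] d y in auto)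
    moreover have pos: "frechet_derivative (F y) (at (\<delta> 0)) (v x) > 0" using W[OF y(1)] in3[of 0] d(1,4) by auto
    ultimately obtain \<eta> where \<eta>: "\<eta> > 0" "\<And>h. h > 0 \<Longrightarrow> h < \<eta> \<Longrightarrow> F y (\<delta> 0) < F y (\<delta> (0 + h))"
      using has_real_derivative_pos_inc_right[of "\<lambda>s. F y (\<delta> s)" _ 0 UNIV] by auto
    have F0: "F y (\<delta> 0) = 0" using W[OF y(1)] in3[of 0] d(1,4) \<open>height x (v x) = 0\<close> by auto
    let ?e = "min \<epsilon> \<eta>"
    have sub: "{-?e<..<?e} \<subseteq> {-\<epsilon><..<\<epsilon>}" by auto
    show "\<exists>\<epsilon> \<delta>. \<epsilon> > 0 \<and> smooth_on_open {-\<epsilon><..<\<epsilon>} \<delta> \<and> \<delta> ` {-\<epsilon><..<\<epsilon>} \<subseteq> boundary_torus M \<phi> r \<and> \<delta> 0 = x \<and>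
        (\<delta> has_vector_derivative v x) (at 0) \<and> (\<forall>s\<in>{0<..<\<epsilon>}. height (\<delta> s) (v (\<delta> s)) > 0)"
    proof (intro exI[of _ ?e] exI[of _ \<delta>] conjI ballI)
      show "?e > 0" using d(1) \<eta>(1) by simp
      show "smooth_on_open {-?e<..<?e} \<delta>" by (rule smooth_on_open_subset[OF d(2) _ sub]) simp
      show "\<delta> ` {-?e<..<?e} \<subseteq> boundary_torus M \<phi> r" using d(3) sub by blast
      fix s assume s: "s \<in> {0<..<?e}"
      then have "F y (\<delta> s) > 0" using \<eta>(2)[of s] F0 by simp
      moreover have "F y (\<delta> s) = height (\<delta> s) (v (\<delta> s))" using W[OF y(1)] in3[of s] s by auto
      ultimately show "height (\<delta> s) (v (\<delta> s)) > 0" by simp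
    qed (use d in auto)
  qed
  then show thesis using that R by blast
qed

text \<open>
  Only the tangency case is subtle. Let \<open>m\<close> be the derivative of \<open>\<rho>\<close> along \<open>w\<close>. By concavity \<open>m\<close> increases
  strictly in the direction \<open>w x\<close>. It does not decrease in the direction \<open>v x\<close>, since \<open>v\<close>, so also \<open>w\<close>, points
  into the exterior along a curve in the boundary with velocity \<open>v x\<close>.
\<close>

lemma pattern_field_not_opposite:
  assumes r: "0 < r" "r < 1" and cc: "convex_contact r v"
    and w: "w \<in> pattern_fields M (exterior M \<phi> r) (boundary_torus M \<phi> r) (pattern_of M (exterior M \<phi> r) (boundary_torus M \<phi> r) v)"
    and x: "x \<in> boundary_torus M \<phi> r" and k: "k > 0"
  shows "w x \<noteq> - (k *\<^sub>R v x)"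
proof
  let ?E = "exterior M \<phi> r" and ?B = "boundary_torus M \<phi> r"
  assume opp: "w x = - (k *\<^sub>R v x)"
  note b = boundary_point[OF r x]
  have vT: "v y \<in> tangent_space M y" if "y \<in> ?B" for y using cc that unfolding convex_contact_def by blast
  have hw: "height x (w x) = - (k * height x (v x))" unfolding opp height_linear(2)[OF b(1)] height_linear(1)[OF b(1)] ..
  have ws: "smooth_map_on ?E w" using w unfolding pattern_fields_def field_on_def vector_field_along_def by blast
  have white: "points_strictly_into M ?E ?B y (w y)" if "y \<in> ?B" "points_strictly_into M ?E ?B y (v y)" for y
    using w that unfolding pattern_fields_def pattern_of_def by auto
  have black: "points_strictly_out_of M ?E ?B y (w y)" if "y \<in> ?B" "points_strictly_out_of M ?E ?B y (v y)" for y
    using w that unfolding pattern_fields_def pattern_of_def by auto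
  have tang: "simple_concave_tangency M ?E ?B w y" if "y \<in> ?B" "v y \<in> tangent_space ?B y" for y
    using w that unfolding pattern_fields_def pattern_of_def by auto
  have neg: "- v x \<in> tangent_space M x" 
    using subspace_neg[OF tangent_space_subspace[OF manifold b(4)] vT[OF x]] .
  consider "height x (v x) > 0" | "height x (v x) < 0" | "height x (v x) = 0" by linarith
  then show False
  proof cases
    case 1
    then have "height x (w x) > 0" using white[OF x] points_into_iff[OF r x] vT[OF x] by blast
    then show False using hw mult_pos_pos[OF k 1] by simp
  next
    case 2
    then have "points_strictly_out_of M ?E ?B x (v x)"
      unfolding points_strictly_out_of_def points_into_iff[OF r x] using neg height_linear(2)[OF b(1)] by simp
    then have "height x (- w x) > 0" using black[OF x] points_into_iff[OF r x] unfolding points_strictly_out_of_def by blast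
    then show False using hw 2 k height_linear(2)[OF b(1)] by (simp add: zero_less_mult_iff)
  next
    case 3
    have "simple_concave_tangency M ?E ?B w x" using tang[OF x] boundary_tangent_iff[OF r x vT[OF x]] 3 by blast
    then obtain \<epsilon> \<gamma> N \<rho> where g: "\<epsilon> > 0" "\<gamma> 0 = x" "\<forall>t\<in>{-\<epsilon><..<\<epsilon>}. \<gamma> t \<in> ?E \<and> (\<gamma> has_vector_derivative w (\<gamma> t)) (at t)"
      and \<rho>: "x \<in> N" "smooth_on_open N \<rho>" "?E \<inter> N = {y \<in> M \<inter> N. \<rho> y \<ge> 0}" "deriv (deriv (\<rho> \<circ> \<gamma>)) 0 \<noteq> 0"
      unfolding simple_concave_tangency_def by blast
    have oN: "open N" using \<rho>(2) by (simp add: smooth_on_open_def)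
    \<comment> \<open>Only \<open>E = {\<rho> \<ge> 0}\<close> is known near \<open>x\<close>. If
      \<open>\<rho>\<close> were positive at a boundary point, nearby points inside the open tube
      would belong to the exterior.\<close>
    have \<rho>0: "\<rho> y = 0" if y: "y \<in> ?B" "y \<in> N" for y
    proof (rule ccontr)
      assume "\<rho> y \<noteq> 0"
      then have \<rho>y: "\<rho> y > 0" using boundary_point(3)[OF r y(1)] y(2) \<rho>(3) by force
      note by' = boundary_point[OF r y(1)]
      obtain O' where O': "open O'" "O' = N \<inter> \<rho> -` {0<..}"
        using continuous_open_preimage[OF smooth_on_open_continuous[OF \<rho>(2)] oN] open_greaterThan by blast
      have yO: "y \<in> O'" using y(2) \<rho>y O'(2) by simp
      obtain p where p: "p \<in> open_solid_torus 1" "\<phi> p = y" using \<psi>_open_tube[OF by'(1) order_refl] by blast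
      have p1: "p \<in> solid_torus 1" using p(1) solid_torus_mono(3)[of 1] by blast
      have np: "norm (snd p) = r" "norm (fst p) = 1" using by'(2) \<psi>_\<phi>[OF p1] p by (auto simp: open_solid_torus_def mem_Times_iff)
      let ?c = "\<lambda>t. \<phi> (fst p, (1 - t) *\<^sub>R snd p)"
      have st: "(fst p, (1 - t) *\<^sub>R snd p) \<in> solid_torus 1" if "t \<in> {0..1}" for t
      proof -
        have "(1 - t) * r \<le> 1" using that r by (simp add: mult_le_one)
        then show ?thesis using np that by (simp add: solid_torus_def)
      qed
      have cc: "continuous_on {0..1} ?c"
        by (rule continuous_on_compose2[OF smooth_map_on_continuous[OF diffeo_facts(1)]]) (use st in \<open>auto intro!: continuous_intros\<close>)
      have c0: "?c 0 = y" using p by simp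
      obtain d where dd: "d > 0" "\<And>t. t \<in> {0..1} \<Longrightarrow> dist t 0 < d \<Longrightarrow> ?c t \<in> O'"
      proof -
        obtain \<eta> where \<eta>: "\<eta> > 0" "ball y \<eta> \<subseteq> O'" using O'(1) yO open_contains_ball by blast
        obtain d where "d > 0" "\<And>t. t \<in> {0..1} \<Longrightarrow> dist t 0 < d \<Longrightarrow> dist (?c t) (?c 0) < \<eta>"
          using cc \<eta>(1) unfolding continuous_on_iff by (metis atLeastAtMost_iff order_refl zero_le_one)
        then show thesis using that \<eta>(2) unfolding c0 by (metis dist_commute mem_ball subsetD)
      qed
      define t where "t = min (d / 2) 1"
      have t: "0 < t" "t \<le> 1" "t < d" using dd(1) by (auto simp: t_def)
      have "?c t \<in> O'" using dd(2) t by simp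
      moreover have stt: "(fst p, (1 - t) *\<^sub>R snd p) \<in> solid_torus 1" using st t by simp
      then have "?c t \<in> M" using tube_1_subset unfolding tube_eq by blast
      ultimately have "?c t \<in> ?E" using O'(2) \<rho>(3) by force
      moreover have "norm ((1 - t) *\<^sub>R snd p) < r" using np t r by simp
      then have "?c t \<in> open_tube r" using tube_iff(2)[OF stt, of r] r by simp
      ultimately show False unfolding exterior_eq[OF r] by blast
    qed
    obtain U V where U: "open U" "x \<in> U" "smooth_on_open U V" "\<forall>y\<in>U \<inter> ?E. V y = w y"
      using ws b(3) by (rule smooth_map_onE)
    \<comment> \<open>Along the orbit \<open>\<gamma>\<close> of \<open>w\<close> the function
      \<open>m\<close> is the first derivative of \<open>\<rho>\<close>, and its derivative along
      \<open>w x\<close> at \<open>x\<close> is the second one, nonzero by simplicity of the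
      tangency.\<close>
    define m where "m y = frechet_derivative \<rho> (at y) (V y)" for y
    have oUN: "open (U \<inter> N)" using U(1) oN by blast
    have ms: "smooth_on_open (U \<inter> N) m" unfolding m_def
      by (rule smooth_on_open_derivative_field[OF smooth_on_open_subset[OF \<rho>(2) oUN] smooth_on_open_subset[OF U(3) oUN]]) auto
    have Vx: "V x = w x" using U(2,4) b(3) by blast
    have gc: "continuous_on {-\<epsilon><..<\<epsilon>} \<gamma>"
      using g(3) by (intro continuous_at_imp_continuous_on ballI has_vector_derivative_continuous) auto
    obtain e where e: "e > 0" "e \<le> \<epsilon>" "\<gamma> ` {-e<..<e} \<subseteq> U \<inter> N"
      using shrink_curve[OF g(1) gc _ oUN] g(2) U(2) \<rho>(1) by blast
    have g1: "((\<lambda>t. \<rho> (\<gamma> t)) has_real_derivative m (\<gamma> t)) (at t)" if t: "t \<in> {-e<..<e}" for t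
    proof -
      have te: "t \<in> {-\<epsilon><..<\<epsilon>}" using t e(2) by auto
      have "\<gamma> t \<in> U \<inter> N" using e(3) t by blast
      then have "V (\<gamma> t) = w (\<gamma> t)" "\<gamma> t \<in> N" using U(4) g(3) te by blast+
      then show ?thesis unfolding m_def
        using curve_composition_derivative[OF \<rho>(2), of \<gamma> t "w (\<gamma> t)" UNIV] g(3) te by simp
    qed
    have g2: "((\<lambda>t. m (\<gamma> t)) has_real_derivative frechet_derivative m (at x) (w x)) (at 0)"
      using curve_composition_derivative[OF ms, of \<gamma> 0 "w x" UNIV] g U(2) \<rho>(1) by force
    have d1: "deriv (\<rho> \<circ> \<gamma>) t = m (\<gamma> t)" if "t \<in> {-e<..<e}" for t
      using DERIV_imp_deriv[OF g1[OF that]] by (simp add: o_def)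
    have "(deriv (\<rho> \<circ> \<gamma>) has_real_derivative frechet_derivative m (at x) (w x)) (at 0)"
      by (rule has_field_derivative_transform_within_open[OF g2, of "{-e<..<e}"]) (use e(1) d1 in auto)
    then have ne: "frechet_derivative m (at x) (w x) \<noteq> 0" using \<rho>(4) DERIV_imp_deriv by metis
    have \<rho>nn: "\<rho> (\<gamma> t) \<ge> 0" if "t \<in> {-e<..<e}" for t
    proof -
      have "\<gamma> t \<in> ?E \<inter> N" using that e(2,3) g(3) by auto
      then show ?thesis using \<rho>(3) by blast
    qed
    have rx: "\<rho> x = 0" using \<rho>0 x \<rho>(1) by blast
    have m0: "m (\<gamma> 0) = 0"
    proof -
      have "((\<lambda>t. \<rho> (\<gamma> t)) has_real_derivative m (\<gamma> 0)) (at 0)" using g1[of 0] e(1) by simp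
      then show ?thesis
        by (rule DERIV_local_min[of _ _ _ e]) (use e(1) \<rho>nn rx g(2) in \<open>auto simp: abs_less_iff\<close>)
    qed
    \<comment> \<open>With vanishing first and negative second derivative \<open>\<rho>\<close>
      would become negative along \<open>\<gamma>\<close>, although the orbit stays in the
      exterior.\<close>
    have pos: "frechet_derivative m (at x) (w x) > 0"
    proof (rule ccontr)
      assume "\<not> ?thesis"
      then have "frechet_derivative m (at x) (w x) < 0" using ne by simp
      then obtain \<eta> where \<eta>: "\<eta> > 0" "\<And>h. h > 0 \<Longrightarrow> h < \<eta> \<Longrightarrow> m (\<gamma> (0 + h)) < m (\<gamma> 0)"
        using has_real_derivative_neg_dec_right[OF g2] by auto
      obtain h where h: "0 < h" "h < \<eta>" "h < e" using field_lbound_gt_zero[OF \<eta>(1) e(1)] by blast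
      have "\<rho> (\<gamma> h) < \<rho> (\<gamma> 0)"
      proof (rule DERIV_neg_imp_decreasing_open[OF h(1)])
        fix t assume "0 < t" "t < h"
        then show "\<exists>y. ((\<lambda>t. \<rho> (\<gamma> t)) has_real_derivative y) (at t) \<and> y < 0"
          using g1[of t] \<eta>(2)[of t] m0 h by (intro exI[of _ "m (\<gamma> t)"]) auto
      next
        show "continuous_on {0..h} (\<lambda>t. \<rho> (\<gamma> t))"
          by (intro continuous_at_imp_continuous_on ballI DERIV_isCont[OF g1]) (use h e(1) in auto)
      qed
      then show False using \<rho>nn[of h] rx g(2) h by simp
    qed
    obtain \<epsilon>' \<delta> where d: "\<epsilon>' > 0" "smooth_on_open {-\<epsilon>'<..<\<epsilon>'} \<delta>" "\<delta> ` {-\<epsilon>'<..<\<epsilon>'} \<subseteq> ?B" "\<delta> 0 = x"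
      "(\<delta> has_vector_derivative v x) (at 0)" "\<forall>s\<in>{0<..<\<epsilon>'}. height (\<delta> s) (v (\<delta> s)) > 0"
      using cc x 3 unfolding convex_contact_def by blast
    obtain e' where e': "e' > 0" "e' \<le> \<epsilon>'" "\<delta> ` {-e'<..<e'} \<subseteq> U \<inter> N"
      using shrink_curve[OF d(1) smooth_on_open_continuous[OF d(2)] _ oUN] d(4) U(2) \<rho>(1) by blast
    \<comment> \<open>Ahead of \<open>x\<close> on the boundary \<open>v\<close> points into the
      exterior; these points are white, so \<open>w\<close> points into it as well.\<close>
    have mn: "m (\<delta> s) \<ge> 0" if s: "s \<in> {0<..<e'}" for s
    proof -
      have s': "s \<in> {-\<epsilon>'<..<\<epsilon>'}" "s \<in> {0<..<\<epsilon>'}" "s \<in> {-e'<..<e'}" using s e'(2) d(1) by auto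
      have B: "\<delta> s \<in> ?B" and UN: "\<delta> s \<in> U" "\<delta> s \<in> N" using d(3) s' e'(3) by blast+
      have "points_strictly_into M ?E ?B (\<delta> s) (v (\<delta> s))" using points_into_iff[OF r B] vT[OF B] d(6) s'(2) by blast
      then have "points_strictly_into M ?E ?B (\<delta> s) (w (\<delta> s))" using white B by blast
      then obtain a c where c: "a > 0" "smooth_on_open {-a<..<a} c" "c ` {0..<a} \<subseteq> ?E" "c 0 = \<delta> s"
        "(c has_vector_derivative w (\<delta> s)) (at (0::real))"
        unfolding points_strictly_into_def by blast
      obtain a' where a': "a' > 0" "a' \<le> a" "c ` {-a'<..<a'} \<subseteq> N"
        using shrink_curve[OF c(1) smooth_on_open_continuous[OF c(2)] _ oN] c(4) UN(2) by metis
      have "((\<lambda>t. \<rho> (c t)) has_real_derivative frechet_derivative \<rho> (at (c 0)) (w (\<delta> s))) (at 0)"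
        by (rule curve_composition_derivative[OF \<rho>(2)]) (use c UN in auto)
      then have "frechet_derivative \<rho> (at (c 0)) (w (\<delta> s)) \<ge> 0"
      proof (rule right_derivative_nonneg[OF has_field_derivative_at_within a'(1)])
        fix t assume t: "t \<in> {0<..<a'}"
        have "c t \<in> ?E" using c(3) t a'(2) by auto
        moreover have "c t \<in> N" using a'(3) t a'(1) by auto
        ultimately have "\<rho> (c t) \<ge> 0" using \<rho>(3) by blast
        then show "\<rho> (c 0) \<le> \<rho> (c t)" using \<rho>0[OF B UN(2)] c(4) by simp
      qed
      moreover have "V (\<delta> s) = w (\<delta> s)" using U(4) UN boundary_point(3)[OF r B] by blast
      ultimately show ?thesis unfolding m_def c(4) by simp
    qed
    have "((\<lambda>s. m (\<delta> s)) has_real_derivative frechet_derivative m (at (\<delta> 0)) (v x)) (at 0)"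
      by (rule curve_composition_derivative[OF ms]) (use d U(2) \<rho>(1) in auto)
    then have "frechet_derivative m (at (\<delta> 0)) (v x) \<ge> 0"
      by (rule right_derivative_nonneg[OF has_field_derivative_at_within e'(1)]) (use mn m0 d(4) g(2) in auto)
    \<comment> \<open>Since \<open>w x\<close> is opposite to \<open>v x\<close>, the derivative of
      \<open>m\<close> along \<open>w x\<close> cannot be positive.\<close>
    moreover have "frechet_derivative m (at x) (w x) = - (k * frechet_derivative m (at x) (v x))"
    proof -
      have "linear (frechet_derivative m (at x))" by (rule smooth_on_open_linear_derivative[OF ms]) (use U(2) \<rho>(1) in auto)
      from linear_neg[OF this] linear_scale[OF this] show ?thesis unfolding opp by simp
    qed
    ultimately have "k * frechet_derivative m (at x) (v x) \<ge> 0" using k d(4) by simp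
    then show False using pos \<open>frechet_derivative m (at x) (w x) = _\<close> by simp
  qed
qed

end

section \<open>Extending, transporting and smoothing fields\<close>

text \<open>The Dugundji extension of \<open>w\<close>, made tangent by \<open>Q\<close>, may vanish
  on \<open>T\<close> and is corrected by a convex combination with \<open>v\<close>. The weight is
  1 on the bad set \<open>A\<close> and 0 on \<open>E\<close>.\<close>

lemma extend_field:
  fixes M :: "'a::euclidean_space set"
  assumes M: "closed_3manifold M"
    and Q: "\<And>a. continuous_on M (\<lambda>y. Q y a)" "\<And>y. linear (Q y)"
      "\<And>y a. y \<in> M \<Longrightarrow> Q y a \<in> tangent_space M y" "\<And>y u. u \<in> tangent_space M y \<Longrightarrow> Q y u = u"
    and ET: "M = E \<union> T" "closed E" "compact T"
    and w: "continuous_on E w" "\<And>x. x \<in> E \<Longrightarrow> w x \<in> tangent_space M x" "\<And>x. x \<in> E \<Longrightarrow> w x \<noteq> 0"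
    and v: "continuous_on T v" "\<And>x. x \<in> T \<Longrightarrow> v x \<in> tangent_space M x" "\<And>x. x \<in> T \<Longrightarrow> v x \<noteq> 0"
    and opp: "\<And>x k. x \<in> E \<inter> T \<Longrightarrow> k > 0 \<Longrightarrow> w x \<noteq> - (k *\<^sub>R v x)"
  obtains u where "continuous_on M u" "\<And>x. x \<in> M \<Longrightarrow> u x \<in> tangent_space M x" "\<And>x. x \<in> M \<Longrightarrow> u x \<noteq> 0" "\<And>x. x \<in> E \<Longrightarrow> u x = w x"
proof -
  obtain w' where w': "continuous_on UNIV w'" "\<And>x. x \<in> E \<Longrightarrow> w' x = w x"
    using Dugundji[of UNIV UNIV E w] ET(2) w(1) by (metis UNIV_I UNIV_not_empty closed_closedin convex_UNIV subset_UNIV subtopology_UNIV)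
  define V where "V y = Q y (w' y)" for y
  have Vc: "continuous_on M V" unfolding V_def
    by (rule continuous_on_linear_family[OF Q(1,2) continuous_on_id]) (auto intro: continuous_on_subset[OF w'(1)])
  have VT: "V y \<in> tangent_space M y" if "y \<in> M" for y using Q(3)[OF that] by (simp add: V_def)
  have VE: "V y = w y" if "y \<in> E" for y using that w'(2) w(2) Q(4) by (simp add: V_def)
  have TM: "T \<subseteq> M" "E \<subseteq> M" using ET(1) by auto
  have VcT: "continuous_on T V" using continuous_on_subset[OF Vc TM(1)] .
  \<comment> \<open>\<open>A\<close> collects the points whose segment from \<open>V\<close> to
    \<open>v\<close> passes through zero. By \<open>opp\<close> it does not meet \<open>E\<close>,
    so a Urysohn function separates them. A zero of the combination lies in \<open>A\<close>, where
    only \<open>v\<close> is left.\<close>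
  define D where "D = {p \<in> {0..1} \<times> T. (1 - fst p) *\<^sub>R V (snd p) + fst p *\<^sub>R v (snd p) = 0}"
  define A where "A = snd ` D"
  have "continuous_on ({0..1} \<times> T) (\<lambda>p. (1 - fst p) *\<^sub>R V (snd p) + fst p *\<^sub>R v (snd p))"
    by (intro continuous_intros continuous_on_compose2[OF VcT] continuous_on_compose2[OF v(1)]) auto
  then have "closedin (top_of_set ({0..1} \<times> T)) D"
    unfolding D_def by (rule continuous_closedin_preimage_constant)
  then have "compact D" using closedin_compact[of "{0..1} \<times> T"] compact_Times[OF compact_Icc ET(3)] by blast
  then have "compact A" unfolding A_def
    by (rule compact_continuous_image[rotated]) (auto intro!: continuous_intros)
  then have clA: "closed A" by (rule compact_imp_closed)
  have AE: "A \<inter> E = {}"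
  proof (rule equals0I)
    fix x assume "x \<in> A \<inter> E"
    then obtain k where x: "x \<in> T" "x \<in> E" and k: "k \<in> {0..1}" "(1 - k) *\<^sub>R V x + k *\<^sub>R v x = 0"
      by (auto simp: A_def D_def)
    have e: "(1 - k) *\<^sub>R w x + k *\<^sub>R v x = 0" using k(2) VE[OF x(2)] by simp
    consider "k = 0" | "k = 1" | "0 < k" "k < 1" using k(1) by force
    then show False
    proof cases
      case 3
      from e have "(1 - k) *\<^sub>R w x = - (k *\<^sub>R v x)" by (simp add: eq_neg_iff_add_eq_0)
      then have "(1 / (1 - k)) *\<^sub>R ((1 - k) *\<^sub>R w x) = (1 / (1 - k)) *\<^sub>R (- (k *\<^sub>R v x))" by (rule arg_cong)
      then have "w x = - ((k / (1 - k)) *\<^sub>R v x)" using 3 by simp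
      moreover have "k / (1 - k) > 0" using 3 by simp
      ultimately show False using opp x by blast
    qed (use e w(3)[OF x(2)] v(3)[OF x(1)] in auto)
  qed
  obtain f :: "'a \<Rightarrow> real" where f: "continuous_on UNIV f" "\<And>x. x \<in> UNIV \<Longrightarrow> f x \<in> closed_segment 1 0" "\<And>x. x \<in> A \<Longrightarrow> f x = 1" "\<And>x. x \<in> E \<Longrightarrow> f x = 0"
    using Urysohn_local[of UNIV A E "1::real" 0] clA ET(2) AE by (metis closed_closedin subtopology_UNIV)
  have f01: "f x \<in> {0..1}" for x using f(2)[of x] by (simp add: closed_segment_eq_real_ivl split: if_splits)
  define u where "u x = (if x \<in> E then V x else (1 - f x) *\<^sub>R V x + f x *\<^sub>R v x)" for x
  have uT: "u x = (1 - f x) *\<^sub>R V x + f x *\<^sub>R v x" if "x \<in> T" for x using f(4) by (simp add: u_def)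
  have "continuous_on T (\<lambda>x. (1 - f x) *\<^sub>R V x + f x *\<^sub>R v x)"
    by (intro continuous_intros VcT v(1) continuous_on_subset[OF f(1)]) auto
  then have "continuous_on T u" by (rule continuous_on_eq) (simp add: uT)
  moreover have "continuous_on E u"
    by (rule continuous_on_eq[OF continuous_on_subset[OF Vc TM(2)]]) (simp add: u_def)
  ultimately have "continuous_on M u"
    unfolding ET(1) by (intro continuous_on_closed_Un ET(2) compact_imp_closed[OF ET(3)])
  moreover have "u x \<in> tangent_space M x" if x: "x \<in> M" for x
  proof (cases "x \<in> E")
    case True then show ?thesis using VT x by (simp add: u_def)
  next
    case False
    then have xT: "x \<in> T" using x ET(1) by blast
    note s = tangent_space_subspace[OF M x]
    show ?thesis unfolding uT[OF xT]
      by (intro subspace_add[OF s] subspace_scale[OF s] VT[OF x] v(2)[OF xT])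
  qed
  moreover have "u x \<noteq> 0" if x: "x \<in> M" for x
  proof (cases "x \<in> E")
    case True then show ?thesis using VE w(3) by (simp add: u_def)
  next
    case False
    then have xT: "x \<in> T" using x ET(1) by blast
    show ?thesis
    proof
      assume "u x = 0"
      then have "(f x, x) \<in> D" unfolding D_def using uT[OF xT] f01[of x] xT by simp
      then have "f x = 1" using f(3) unfolding A_def by force
      then show False using \<open>u x = 0\<close> uT[OF xT] v(3)[OF xT] by simp
    qed
  qed
  moreover have "u x = w x" if "x \<in> E" for x using VE that by (simp add: u_def)
  ultimately show thesis using that by blast
qed

text \<open>Compactness of \<open>S\<close> and of the unit sphere gives a uniform bound
  \<open>c * norm a \<le> norm (G p a)\<close>, so the solution inherits the continuity of the
  right-hand side.\<close>

lemma continuous_on_solution: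
  fixes G :: "'c::metric_space \<Rightarrow> 'a::euclidean_space \<Rightarrow> 'b::euclidean_space"
  assumes S: "compact S" and G: "\<And>a. continuous_on S (\<lambda>p. G p a)" "\<And>p. linear (G p)"
    "\<And>p a. p \<in> S \<Longrightarrow> G p a = 0 \<Longrightarrow> a = 0"
    and y: "continuous_on S y" and W: "\<And>p. p \<in> S \<Longrightarrow> G p (W p) = y p"
  shows "continuous_on S W"
proof (cases "S = {}")
  case False
  let ?N = "\<lambda>q. norm (G (fst q) (snd q))"
  have "continuous_on (S \<times> sphere 0 1) ?N"
    by (intro continuous_intros continuous_on_linear_family[OF G(1,2)]) auto
  moreover have "compact (S \<times> sphere (0::'a) 1)" "S \<times> sphere (0::'a) 1 \<noteq> {}" using S False by (auto intro: compact_Times)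
  ultimately obtain q where q: "q \<in> S \<times> sphere 0 1" "\<forall>q'\<in>S \<times> sphere 0 1. ?N q \<le> ?N q'"
    using continuous_attains_inf by blast
  define c where "c = ?N q"
  have "snd q \<noteq> 0" using q(1) by auto
  then have c: "c > 0" using q(1) G(3) by (auto simp: c_def)
  have bound: "c * norm a \<le> norm (G p a)" if "p \<in> S" for p a
  proof (cases "a = 0")
    case False
    have "c \<le> norm (G p ((1 / norm a) *\<^sub>R a))" using q(2)[rule_format, of "(p, (1 / norm a) *\<^sub>R a)"] that False by (simp add: c_def)
    also have "\<dots> = norm (G p a) / norm a" by (simp add: linear_scale[OF G(2)])
    finally show ?thesis using False by (simp add: field_simps)
  qed (simp add: linear_0[OF G(2)])
  show ?thesis unfolding continuous_on_def
  proof
    fix p assume p: "p \<in> S"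
    have "((\<lambda>p'. y p' - G p' (W p)) \<longlongrightarrow> y p - G p (W p)) (at p within S)"
      using y G(1) p unfolding continuous_on_def by (intro tendsto_diff) blast+
    then have "((\<lambda>p'. norm (y p' - G p' (W p)) / c) \<longlongrightarrow> 0) (at p within S)"
      using W[OF p] tendsto_divide[OF tendsto_norm tendsto_const, of _ 0 _ c] c by force
    moreover have "\<forall>\<^sub>F p' in at p within S. norm (W p' - W p) \<le> norm (y p' - G p' (W p)) / c"
      unfolding eventually_at_filter
    proof (intro always_eventually allI impI)
      fix p' assume "p' \<in> S"
      then show "norm (W p' - W p) \<le> norm (y p' - G p' (W p)) / c"
        using bound[of p' "W p' - W p"] W[of p'] c by (simp add: linear_diff[OF G(2)] field_simps)
    qed
    ultimately have "((\<lambda>p'. W p' - W p) \<longlongrightarrow> 0) (at p within S)"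
      by (rule Lim_null_comparison[rotated])
    then show "(W \<longlongrightarrow> W p) (at p within S)" by (simp add: LIM_zero_iff)
  qed
qed simp

lemma smooth_map_on_sum:
  assumes "\<And>i. i \<in> I \<Longrightarrow> smooth_map_on X (f i)"
  shows "smooth_map_on X (\<lambda>x. \<Sum>i\<in>I. f i x)"
  using assms by (induction I rule: infinite_finite_induct) (auto intro: smooth_map_on_add)

text \<open>Approximation gives closeness, but the ends and the germ at \<open>B\<close> have to be
  met exactly. So a polynomial homotopy is blended with \<open>w 0\<close> and \<open>w 1\<close>
  near the ends in time and with \<open>w 0\<close> near \<open>B\<close>. Where a summand has
  nonzero weight it is within \<open>m / 2\<close> of \<open>w\<close>, and \<open>m\<close> bounds
  the length of \<open>w\<close> from below.\<close>

lemma smooth_field_homotopy: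
  fixes M :: "'a::euclidean_space set" and w :: "real \<Rightarrow> 'a \<Rightarrow> 'a"
  assumes M: "closed_3manifold M"
    and Q: "\<And>a. smooth_map_on M (\<lambda>y. Q y a)" "\<And>y. linear (Q y)"
      "\<And>y a. y \<in> M \<Longrightarrow> Q y a \<in> tangent_space M y" "\<And>y u. u \<in> tangent_space M y \<Longrightarrow> Q y u = u"
    and E: "compact E" "E \<subseteq> M" "compact B" "open N" "B \<subseteq> N"
    and w: "continuous_on ({0..1} \<times> E) (\<lambda>(s, x). w s x)"
      "\<And>s x. s \<in> {0..1} \<Longrightarrow> x \<in> E \<Longrightarrow> w s x \<in> tangent_space M x" "\<And>s x. s \<in> {0..1} \<Longrightarrow> x \<in> E \<Longrightarrow> w s x \<noteq> 0"
      "smooth_map_on E (w 0)" "smooth_map_on E (w 1)" "\<And>s x. s \<in> {0..1} \<Longrightarrow> x \<in> E \<inter> N \<Longrightarrow> w s x = w 0 x"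
  obtains H N' where "smooth_map_on ({0..1::real} \<times> E) (\<lambda>(s, x). H s x)"
    "\<forall>s\<in>{0..1}. \<forall>x\<in>E. H s x \<in> tangent_space M x \<and> H s x \<noteq> 0" "\<forall>x\<in>E. H 0 x = w 0 x \<and> H 1 x = w 1 x"
    "open N'" "B \<subseteq> N'" "\<forall>s\<in>{0..1}. \<forall>x\<in>E \<inter> N'. H s x = w 0 x"
proof -
  let ?X = "{0..1::real} \<times> E"
  let ?w = "\<lambda>(s::real, x). w s x"
  have X: "compact ?X" using E(1) by (intro compact_Times) auto
  have "compact (?w ` ?X)" using compact_continuous_image[OF w(1) X] .
  moreover have "0 \<notin> ?w ` ?X" using w(3) by force
  ultimately obtain m where m: "m > 0" "\<And>s x. s \<in> {0..1} \<Longrightarrow> x \<in> E \<Longrightarrow> m \<le> norm (w s x)"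
  proof -
    assume a: "compact (?w ` ?X)" "0 \<notin> ?w ` ?X"
    obtain d where "d > 0" "\<forall>y\<in>?w ` ?X. d \<le> dist 0 y"
      using separate_point_closed[OF compact_imp_closed[OF a(1)] a(2)] by blast
    then show thesis using that[of d] by force
  qed
  have "uniformly_continuous_on ?X ?w" using compact_uniformly_continuous[OF w(1) X] .
  then obtain d0 where d0: "d0 > 0" "\<And>p p'. p \<in> ?X \<Longrightarrow> p' \<in> ?X \<Longrightarrow> dist p' p < d0 \<Longrightarrow> dist (?w p') (?w p) < m / 2"
    unfolding uniformly_continuous_on_def using half_gt_zero[OF m(1)] by metis
  \<comment> \<open>The bound \<open>1/2\<close> keeps the cutoffs \<open>\<alpha>\<close> and
    \<open>\<beta>\<close> at the two ends of the interval from overlapping.\<close>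
  define \<delta> where "\<delta> = min d0 (1/2)"
  have \<delta>: "\<delta> > 0" "\<delta> \<le> 1/2" using d0(1) by (auto simp: \<delta>_def)
  have near: "norm (w s x - w s' x) \<le> m / 2" if "s \<in> {0..1}" "s' \<in> {0..1}" "\<bar>s - s'\<bar> < \<delta>" "x \<in> E" for s s' x
    using d0(2)[of "(s', x)" "(s, x)"] that by (auto simp: dist_Pair_Pair dist_norm \<delta>_def intro: less_imp_le)
  have Qc: "continuous_on M (\<lambda>y. Q y a)" for a using smooth_map_on_continuous[OF Q(1)] .
  have "continuous_on (E \<times> cball 0 1) (\<lambda>q. Q (fst q) (snd q))"
    by (intro continuous_intros continuous_on_linear_family[OF Qc Q(2)]) (use E(2) in auto)
  then have "bounded ((\<lambda>q. Q (fst q) (snd q)) ` (E \<times> cball 0 1))"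
    using E(1) by (intro compact_imp_bounded compact_continuous_image compact_Times) auto
  then obtain C where C: "C > 0" "\<And>x a. x \<in> E \<Longrightarrow> norm a \<le> 1 \<Longrightarrow> norm (Q x a) \<le> C"
    unfolding bounded_pos by fastforce
  have QC: "norm (Q x a) \<le> C * norm a" if "x \<in> E" for x a
  proof (cases "a = 0")
    case False
    have "norm (Q x ((1 / norm a) *\<^sub>R a)) \<le> C" using C(2)[OF that] False by simp
    then have "norm (Q x a) / norm a \<le> C" by (simp add: linear_scale[OF Q(2)])
    then show ?thesis using False by (simp add: field_simps)
  qed (simp add: linear_0[OF Q(2)])
  \<comment> \<open>Projecting to the tangent spaces by \<open>Q\<close> enlarges the error by at
    most the factor \<open>C\<close>.\<close>
  have "m / (2 * C) > 0" using m(1) C(1) by simp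
  then obtain p where p: "polynomial_function p" "\<forall>q\<in>?X. norm (?w q - p q) < m / (2 * C)"
    using Stone_Weierstrass_polynomial_function[OF X w(1)] by blast
  define P where "P = (\<lambda>q. Q (snd q) (p q))"
  have Pw: "norm (P (s, x) - w s x) \<le> m / 2" if "s \<in> {0..1}" "x \<in> E" for s x
  proof -
    have "norm (p (s, x) - w s x) \<le> m / (2 * C)" using p(2)[rule_format, of "(s, x)"] that by (simp add: norm_minus_commute)
    have "P (s, x) - w s x = Q x (p (s, x) - w s x)" using Q(4)[OF w(2)[OF that]] by (simp add: P_def linear_diff[OF Q(2)])
    then have "norm (P (s, x) - w s x) \<le> C * norm (p (s, x) - w s x)" using QC[OF that(2)] by simp
    also have "\<dots> \<le> C * (m / (2 * C))" using C(1) \<open>_ \<le> m / (2 * C)\<close> by (intro mult_left_mono) auto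
    also have "\<dots> = m / 2" using C(1) by simp
    finally show ?thesis .
  qed
  have ssnd: "smooth_map_on ?X snd" "smooth_map_on ?X fst" by (auto intro: smooth_map_on_linear bounded_linear_snd bounded_linear_fst)
  have Ps: "smooth_map_on ?X P"
  proof -
    have "smooth_map_on ?X (\<lambda>q. \<Sum>b\<in>Basis. (p q \<bullet> b) *\<^sub>R Q (snd q) b)"
    proof (rule smooth_map_on_sum)
      fix b :: 'a
      have "smooth_on_open UNIV (\<lambda>q. p q \<bullet> b)"
        by (intro smooth_on_open_inner smooth_polynomial_function p(1) smooth_on_open_const) auto
      then have "smooth_map_on ?X (\<lambda>q. p q \<bullet> b)" by (rule smooth_on_open_imp_map) auto
      moreover have "smooth_map_on ?X (\<lambda>q. Q (snd q) b)"
        by (rule smooth_map_on_compose[OF Q(1) ssnd(1)]) (use E(2) in auto)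
      ultimately show "smooth_map_on ?X (\<lambda>q. (p q \<bullet> b) *\<^sub>R Q (snd q) b)" by (rule smooth_map_on_scaleR)
    qed
    then show ?thesis unfolding P_def by (rule smooth_map_on_cong) (rule linear_expand_Basis[OF Q(2), symmetric])
  qed
  obtain h V C' where h: "smooth_on_open UNIV h" "\<And>y. 0 \<le> h y \<and> h y \<le> (1::real)"
    "open V" "B \<subseteq> V" "\<And>y. y \<in> V \<Longrightarrow> h y = 1" "closed C'" "C' \<subseteq> N" "\<And>y. y \<notin> C' \<Longrightarrow> h y = 0"
    using smooth_cutoff[OF E(3-5)] by metis
  define \<alpha> where "\<alpha> s = smooth_step (1 - s / \<delta>)" for s
  define \<beta> where "\<beta> s = smooth_step (1 - (1 - s) / \<delta>)" for s
  have \<alpha>: "0 \<le> \<alpha> s" "\<alpha> s \<le> 1" "\<alpha> 0 = 1" "s \<ge> \<delta> \<Longrightarrow> \<alpha> s = 0"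
    and \<beta>: "0 \<le> \<beta> s" "\<beta> s \<le> 1" "\<beta> 1 = 1" "1 - s \<ge> \<delta> \<Longrightarrow> \<beta> s = 0" for s
    using smooth_step_range smooth_step_eq \<delta>(1) by (auto simp: \<alpha>_def \<beta>_def)
  have \<alpha>\<beta>: "\<alpha> s = 0 \<or> \<beta> s = 0" for s using \<alpha>(4)[of s] \<beta>(4)[of s] \<delta>(2) by linarith
  define F where "F s x = \<alpha> s *\<^sub>R w 0 x + \<beta> s *\<^sub>R w 1 x + (1 - \<alpha> s - \<beta> s) *\<^sub>R P (s, x)" for s x
  \<comment> \<open>The cutoff \<open>h\<close> lives in \<open>N\<close>, where \<open>w\<close>
    does not depend on \<open>s\<close>, so inserting \<open>w 0\<close> there causes no
    error.\<close>
  define H where "H s x = h x *\<^sub>R w 0 x + (1 - h x) *\<^sub>R F s x" for s x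
  have hN: "h x = 0 \<or> x \<in> N" for x using h(7,8) by blast
  have a: "smooth_map_on ?X (\<lambda>q. \<alpha> (fst q))" "smooth_map_on ?X (\<lambda>q. \<beta> (fst q))" "smooth_map_on ?X (\<lambda>q. h (snd q))"
  proof -
    have l: "smooth_on_open UNIV (\<lambda>s::real. 1 - s / \<delta>)" "smooth_on_open UNIV (\<lambda>s::real. 1 - (1 - s) / \<delta>)"
      unfolding divide_inverse by (intro smooth_on_open_diff smooth_on_open_mult smooth_on_open_const smooth_on_open_ident; simp)+
    have "smooth_on_open UNIV \<alpha>" "smooth_on_open UNIV \<beta>" unfolding \<alpha>_def \<beta>_def
      by (rule smooth_on_open_compose[OF smooth_smooth_step l(1)], simp, rule smooth_on_open_compose[OF smooth_smooth_step l(2)], simp)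
    then show "smooth_map_on ?X (\<lambda>q. \<alpha> (fst q))" "smooth_map_on ?X (\<lambda>q. \<beta> (fst q))" "smooth_map_on ?X (\<lambda>q. h (snd q))"
      using smooth_map_on_compose_open ssnd h(1) by blast+
  qed
  have b: "smooth_map_on ?X (\<lambda>q. w 0 (snd q))" "smooth_map_on ?X (\<lambda>q. w 1 (snd q))"
    by (rule smooth_map_on_compose[OF w(4) ssnd(1)], force, rule smooth_map_on_compose[OF w(5) ssnd(1)], force)
  have Hs: "smooth_map_on ?X (\<lambda>(s, x). H s x)"
    unfolding H_def F_def case_prod_beta prod.collapse
    by (intro smooth_map_on_add smooth_map_on_scaleR smooth_map_on_diff smooth_map_on_const a b Ps)
  have Fw: "norm (F s x - w s x) \<le> m / 2" if s: "s \<in> {0..1}" and x: "x \<in> E" for s x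
  proof -
    have e: "F s x - w s x = \<alpha> s *\<^sub>R (w 0 x - w s x) + \<beta> s *\<^sub>R (w 1 x - w s x) + (1 - \<alpha> s - \<beta> s) *\<^sub>R (P (s, x) - w s x)"
      by (simp add: F_def algebra_simps)
    have 1: "norm (\<alpha> s *\<^sub>R (w 0 x - w s x)) \<le> \<alpha> s * (m / 2)"
    proof (cases "s < \<delta>")
      case True
      then have "norm (w 0 x - w s x) \<le> m / 2" using near[of 0 s x] s x by auto
      from mult_left_mono[OF this \<alpha>(1)[of s]] show ?thesis using \<alpha>(1)[of s] by simp
    qed (simp add: \<alpha>(4))
    have 2: "norm (\<beta> s *\<^sub>R (w 1 x - w s x)) \<le> \<beta> s * (m / 2)"
    proof (cases "1 - s < \<delta>")
      case True
      then have "norm (w 1 x - w s x) \<le> m / 2" using near[of 1 s x] s x by auto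
      from mult_left_mono[OF this \<beta>(1)[of s]] show ?thesis using \<beta>(1)[of s] by simp
    qed (simp add: \<beta>(4))
    have nn: "1 - \<alpha> s - \<beta> s \<ge> 0" using \<alpha>\<beta>[of s] \<alpha>(2)[of s] \<beta>(2)[of s] by auto
    then have 3: "norm ((1 - \<alpha> s - \<beta> s) *\<^sub>R (P (s, x) - w s x)) \<le> (1 - \<alpha> s - \<beta> s) * (m / 2)"
      using mult_left_mono[OF Pw[OF s x] nn] by simp
    have "norm (F s x - w s x) \<le> \<alpha> s * (m / 2) + \<beta> s * (m / 2) + (1 - \<alpha> s - \<beta> s) * (m / 2)"
      unfolding e using 1 2 3 norm_triangle_mono by blast
    also have "\<dots> = m / 2" by (simp add: algebra_simps)
    finally show ?thesis .
  qed
  have zero1: "0 \<in> {0..1::real}" "1 \<in> {0..1::real}" by auto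
  have 1: "H s x \<in> tangent_space M x \<and> H s x \<noteq> 0" if s: "s \<in> {0..1}" and x: "x \<in> E" for s x
  proof
    have xM: "x \<in> M" using x E(2) by blast
    note S = tangent_space_subspace[OF M xM]
    show "H s x \<in> tangent_space M x" unfolding H_def F_def P_def
      by (intro subspace_add[OF S] subspace_scale[OF S] w(2) zero1 x) (use Q(3)[OF xM] in simp)
    have "h x *\<^sub>R (w 0 x - w s x) = 0" using hN[of x] w(6)[OF s] x by auto
    moreover have "H s x - w s x = h x *\<^sub>R (w 0 x - w s x) + (1 - h x) *\<^sub>R (F s x - w s x)" by (simp add: H_def algebra_simps)
    ultimately have "H s x - w s x = (1 - h x) *\<^sub>R (F s x - w s x)" by (simp only: add_0_left)
    then have "norm (H s x - w s x) = (1 - h x) * norm (F s x - w s x)" using h(2)[of x] by simp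
    also have "\<dots> \<le> 1 * norm (F s x - w s x)" using h(2)[of x] by (intro mult_right_mono) auto
    also have "\<dots> < m" using Fw[OF s x] m(1) by simp
    finally have "norm (H s x - w s x) < norm (w s x)" using m(2)[OF s x] by simp
    then show "H s x \<noteq> 0" by auto
  qed
  have 2: "H 0 x = w 0 x \<and> H 1 x = w 1 x" if x: "x \<in> E" for x
  proof
    have "\<beta> 0 = 0" "\<alpha> 1 = 0" using \<alpha>(4)[of 1] \<beta>(4)[of 0] \<delta>(2) by auto
    then have F01: "F 0 x = w 0 x" "F 1 x = w 1 x" using \<alpha>(3) \<beta>(3) by (simp_all add: F_def)
    show "H 0 x = w 0 x" unfolding H_def F01 by (simp add: algebra_simps)
    show "H 1 x = w 1 x" using hN[of x] w(6)[OF zero1(2), of x] x unfolding H_def F01 by (auto simp: algebra_simps)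
  qed
  show thesis
    by (rule that[of H V]) (use Hs 1 2 h(3,4,5) in \<open>auto simp: H_def\<close>)
qed

section \<open>Fields adapted to a pattern\<close>

text \<open>The condition depends on the germ of the field at \<open>x\<close> only: the orbit is
  shortened until it stays in \<open>N\<close>.\<close>

lemma simple_concave_tangency_cong:
  assumes "simple_concave_tangency M E B v x" "open N" "x \<in> N" "\<And>y. y \<in> E \<inter> N \<Longrightarrow> w y = v y"
  shows "simple_concave_tangency M E B w x"
proof -
  obtain \<epsilon> \<gamma> where v: "v x \<in> tangent_space B x" and g: "\<epsilon> > 0" "\<gamma> 0 = x"
    "\<forall>t\<in>{-\<epsilon><..<\<epsilon>}. \<gamma> t \<in> E \<and> (\<gamma> has_vector_derivative v (\<gamma> t)) (at t)" "\<forall>t\<in>{-\<epsilon><..<\<epsilon>} - {0}. \<gamma> t \<in> E - B"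
    and \<rho>: "\<exists>N. \<exists>\<rho>::'a \<Rightarrow> real. x \<in> N \<and> smooth_on_open N \<rho> \<and>
           (\<exists>u\<in>tangent_space M x. frechet_derivative \<rho> (at x) u \<noteq> 0) \<and>
           E \<inter> N = {y \<in> M \<inter> N. \<rho> y \<ge> 0} \<and> deriv (deriv (\<rho> \<circ> \<gamma>)) 0 \<noteq> 0"
    using assms(1) unfolding simple_concave_tangency_def by blast
  have "continuous_on {-\<epsilon><..<\<epsilon>} \<gamma>"
    using g(3) by (intro continuous_at_imp_continuous_on ballI has_vector_derivative_continuous) auto
  then obtain e where e: "e > 0" "e \<le> \<epsilon>" "\<gamma> ` {-e<..<e} \<subseteq> N"
    using shrink_curve[OF g(1) _ _ assms(2)] g(2) assms(3) by blast
  have wv: "w (\<gamma> t) = v (\<gamma> t)" "\<gamma> t \<in> E" "(\<gamma> has_vector_derivative w (\<gamma> t)) (at t)" if "t \<in> {-e<..<e}" for t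
  proof -
    have t: "t \<in> {-\<epsilon><..<\<epsilon>}" using that e(2) by auto
    then show "\<gamma> t \<in> E" using g(3) by blast
    then show "w (\<gamma> t) = v (\<gamma> t)" using assms(4) e(3) that by blast
    then show "(\<gamma> has_vector_derivative w (\<gamma> t)) (at t)" using g(3) t by simp
  qed
  have "w x \<in> tangent_space B x" using wv(1)[of 0] e(1) g(2) v by simp
  moreover have "\<forall>t\<in>{-e<..<e} - {0}. \<gamma> t \<in> E - B" using g(4) e(2) by auto
  ultimately show ?thesis
    unfolding simple_concave_tangency_def using e(1) g(2) wv(2,3) \<rho> by (intro conjI exI[of _ e] exI[of _ \<gamma>]) auto
qed

lemma pattern_fields_cong:
  assumes v: "v \<in> pattern_fields M E B (pattern_of M E B v')" and w: "field_on M E w"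
    and N: "open N" "B \<subseteq> N" "B \<subseteq> E" "\<And>y. y \<in> E \<inter> N \<Longrightarrow> w y = v y"
  shows "w \<in> pattern_fields M E B (pattern_of M E B v')"
proof -
  have "w x = v x" if "x \<in> B" for x using that N by blast
  then show ?thesis
    using v w simple_concave_tangency_cong[OF _ N(1) _ N(4)] N(2) unfolding pattern_fields_def pattern_of_def by fastforce
qed

lemma equiv_euler_equiv: "equiv (pattern_fields M E B P) (euler_equiv M E B P)"
proof (rule equivI)
  show "euler_equiv M E B P \<subseteq> pattern_fields M E B P \<times> pattern_fields M E B P" by (auto simp: euler_equiv_def)
  show "refl_on (pattern_fields M E B P) (euler_equiv M E B P)"
    by (rule refl_onI) (auto simp: euler_equiv_def)
  show "sym (euler_equiv M E B P)" by (rule symI) (auto simp: euler_equiv_def intro: equivclp_sym)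
  show "trans (euler_equiv M E B P)" by (rule transI) (auto simp: euler_equiv_def intro: equivclp_trans)
qed

lemma euler_action_trivial:
  assumes g: "g \<in> G_group M E B" and e: "e \<in> Eul M E B P" and BE: "B \<subseteq> E"
    and trivial: "\<And>f v. f \<in> G_diffeos M E B \<Longrightarrow> v \<in> pattern_fields M E B P \<Longrightarrow>
      push_forward E f v \<in> pattern_fields M E B P \<and> homotopic_fields M E B P (push_forward E f v) v"
  shows "euler_action M E B P g e = e"
proof -
  let ?R = "euler_equiv M E B P"
  obtain f where f: "f \<in> G_diffeos M E B" and gf: "g = {h. h \<in> G_diffeos M E B \<and> isotopic_rel_boundary E B f h}"
    using g by (auto simp: G_group_def quotient_def)
  obtain v where v: "v \<in> pattern_fields M E B P" and ev: "e = ?R `` {v}"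
    using e by (auto simp: Eul_def quotient_def)
  \<comment> \<open>Shows that the class \<open>g\<close> contains \<open>f\<close>; for an empty
    class the action would return the empty set.\<close>
  have "isotopic_rel_boundary E B f f"
  proof -
    have fs: "diffeomorphism E E f" using f by (simp add: G_diffeos_def)
    have "smooth_map_on ({0..1::real} \<times> E) (\<lambda>q. f (snd q))"
      by (rule smooth_map_on_compose[OF diffeomorphism_inverse(1)[OF fs] smooth_map_on_linear[OF bounded_linear_snd]]) auto
    moreover obtain N where "B \<subseteq> N" "\<forall>x\<in>E \<inter> N. f x = x" using f by (auto simp: G_diffeos_def)
    then have "\<forall>x\<in>B. f x = x" using BE by blast
    moreover have "(\<lambda>q. f (snd q)) = (\<lambda>(s::real, x). f x)" by auto
    ultimately show ?thesis using fs unfolding isotopic_rel_boundary_def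
      by (intro exI[of _ "\<lambda>s::real. f"]) simp
  qed
  then have fg: "f \<in> g" using f gf by blast
  have rel: "(push_forward E h u, u) \<in> ?R" if "h \<in> g" "u \<in> e" for h u
  proof -
    have u: "u \<in> pattern_fields M E B P" using that(2) ev by (auto simp: euler_equiv_def)
    moreover have "h \<in> G_diffeos M E B" using that(1) gf by blast
    ultimately show ?thesis using trivial[of h u] by (auto simp: euler_equiv_def intro!: r_into_equivclp)
  qed
  have "?R `` {push_forward E h u} = e" if "h \<in> g" "u \<in> e" for h u
    using equiv_class_eq[OF equiv_euler_equiv rel[OF that]] equiv_class_eq[OF equiv_euler_equiv, of v u] that(2) ev by auto
  moreover have "v \<in> e" using v ev equiv_class_self[OF equiv_euler_equiv] by metis
  ultimately show ?thesis unfolding euler_action_def using fg by blast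
qed

section \<open>Diffeomorphisms isotopic to the identity preserve Euler structures\<close>

text \<open>Viewing the isotopy as one map on \<open>{0..1} \<times> M\<close> gives joint
  continuity of its derivatives. The vectors \<open>(0, u)\<close> are velocities of curves at
  constant time, so they are tangent also at the ends of the interval.\<close>

lemma dmap_isotopy:
  assumes H: "smooth_map_on ({0..1::real} \<times> M) (\<lambda>(s, x). H s x)" and s: "s \<in> {0..1}" and u: "u \<in> tangent_space M x"
  shows "smooth_map_on M (H s)" "(0, u) \<in> tangent_space ({0..1} \<times> M) (s, x)"
    "dmap (\<lambda>(s, x). H s x) ({0..1} \<times> M) (s, x) (0, u) = dmap (H s) M x u"
proof -
  obtain \<epsilon> \<gamma> where g: "\<epsilon> > 0" "smooth_on_open {-\<epsilon><..<\<epsilon>} \<gamma>" "\<gamma> ` {-\<epsilon><..<\<epsilon>} \<subseteq> M" "\<gamma> 0 = x" "(\<gamma> has_vector_derivative u) (at 0)"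
    using u by (rule tangent_spaceE)
  have "smooth_map_on M (\<lambda>x. (\<lambda>(s, x). H s x) (s, x))"
    by (rule smooth_map_on_compose[OF H]) (use s in \<open>auto intro!: smooth_map_on_Pair smooth_map_on_ident\<close>)
  then show Hs: "smooth_map_on M (H s)" by simp
  have c: "smooth_on_open {-\<epsilon><..<\<epsilon>} (\<lambda>t. (s, \<gamma> t))" "(\<lambda>t. (s, \<gamma> t)) ` {-\<epsilon><..<\<epsilon>} \<subseteq> {0..1} \<times> M" "(s, \<gamma> 0) = (s, x)"
    "((\<lambda>t. (s, \<gamma> t)) has_vector_derivative (0, u)) (at 0)"
    using g s by (auto intro!: smooth_on_open_Pair has_vector_derivative_Pair derivative_eq_intros)
  show "(0, u) \<in> tangent_space ({0..1} \<times> M) (s, x)" by (rule tangent_spaceI[OF g(1) c])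
  have "((\<lambda>t. (\<lambda>(s, x). H s x) (s, \<gamma> t)) has_vector_derivative dmap (\<lambda>(s, x). H s x) ({0..1} \<times> M) (s, x) (0, u)) (at 0)"
    by (rule dmap_curve[OF H g(1) c])
  moreover have "((\<lambda>t. H s (\<gamma> t)) has_vector_derivative dmap (H s) M x u) (at 0)"
    by (rule dmap_curve[OF Hs g])
  ultimately show "dmap (\<lambda>(s, x). H s x) ({0..1} \<times> M) (s, x) (0, u) = dmap (H s) M x u"
    using vector_derivative_unique_at by fastforce
qed

lemma continuous_on_dmap_isotopy:
  fixes H :: "real \<Rightarrow> 'a::euclidean_space \<Rightarrow> 'a"
  assumes H: "smooth_map_on ({0..1} \<times> M) (\<lambda>(s, x). H s x)"
    and "continuous_on S s" "continuous_on S x" "continuous_on S u" "\<And>p. p \<in> S \<Longrightarrow> s p \<in> {0..1} \<and> u p \<in> tangent_space M (x p)"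
  shows "continuous_on S (\<lambda>p. dmap (H (s p)) M (x p) (u p))"
proof -
  have "continuous_on S (\<lambda>p. ((s p, x p), (0::real, u p)))" by (intro continuous_intros assms)
  moreover have "(\<lambda>p. ((s p, x p), (0::real, u p))) ` S \<subseteq> {(y, w). w \<in> tangent_space ({0..1} \<times> M) y}"
    using dmap_isotopy(2)[OF H] assms(5) by auto
  ultimately have "continuous_on S (\<lambda>p. dmap (\<lambda>(s, x). H s x) ({0..1} \<times> M) (s p, x p) (0, u p))"
    using continuous_on_compose2[OF continuous_on_dmap[OF H]] by fastforce
  then show ?thesis
    by (rule continuous_on_eq) (use dmap_isotopy(3)[OF H] assms(5) in auto)
qed

lemma smooth_map_on_dmap_field:
  assumes "smooth_map_on M f" "E \<subseteq> M" "smooth_map_on E v" "\<And>x. x \<in> E \<Longrightarrow> v x \<in> tangent_space M x"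
  shows "smooth_map_on E (\<lambda>x. dmap f M x (v x))"
proof (rule smooth_map_onI)
  fix x assume x: "x \<in> E"
  obtain U1 G where U1: "open U1" "x \<in> U1" "smooth_on_open U1 G" "\<forall>y\<in>U1 \<inter> M. G y = f y"
    using assms(1) subsetD[OF assms(2) x] by (rule smooth_map_onE)
  obtain U2 V where U2: "open U2" "x \<in> U2" "smooth_on_open U2 V" "\<forall>y\<in>U2 \<inter> E. V y = v y"
    using assms(3) x by (rule smooth_map_onE)
  have op: "open (U1 \<inter> U2)" using U1 U2 by blast
  have "smooth_on_open (U1 \<inter> U2) (\<lambda>y. frechet_derivative G (at y) (V y))"
    by (rule smooth_on_open_derivative_field[OF smooth_on_open_subset[OF U1(3) op] smooth_on_open_subset[OF U2(3) op]]) auto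
  moreover have "frechet_derivative G (at y) (V y) = dmap f M y (v y)" if y: "y \<in> U1 \<inter> U2 \<inter> E" for y
  proof -
    have "dmap f M y (v y) = frechet_derivative G (at y) (v y)"
      by (rule dmap_eq_frechet[OF assms(1) assms(4) _ U1(3)]) (use y U1(4) in auto)
    then show ?thesis using U2(4) y by auto
  qed
  ultimately show "\<exists>U g. x \<in> U \<and> smooth_on_open U g \<and> (\<forall>y\<in>U \<inter> E. g y = dmap f M y (v y))"
    using U1(2) U2(2) by blast
qed

context tubular_neighbourhood
begin

text \<open>\<open>push_forward\<close> uses an unspecified derivative within the exterior. At a
  boundary point \<open>u\<close> or \<open>- u\<close> is the velocity of a half-curve in the
  exterior, and linearity settles the other sign.\<close>

lemma exterior_derivative_unique:
  assumes r: "0 < r" "r < 1" and x: "x \<in> exterior M \<phi> r" and u: "u \<in> tangent_space M x"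
    and D: "(g has_derivative D1) (at x within exterior M \<phi> r)" "(g has_derivative D2) (at x within exterior M \<phi> r)"
  shows "D1 u = D2 u"
proof -
  have xM: "x \<in> M" using x exterior_eq[OF r] by blast
  have half: "D1 a = D2 a" if "\<epsilon> > 0" "\<gamma> ` {0..<\<epsilon>} \<subseteq> exterior M \<phi> r" "\<gamma> 0 = x" "(\<gamma> has_vector_derivative a) (at 0)" for \<epsilon> \<gamma> a
    by (rule derivative_unique_half_curve[OF D has_vector_derivative_at_within[OF that(4)] that(2,3,1)])
  show ?thesis
  proof (cases "x \<in> boundary_torus M \<phi> r")
    case True
    show ?thesis
    proof (cases "height x u \<ge> 0")
      case h: True
      show ?thesis using exterior_half_curve[OF r True u h] half by metis
    next
      case False
      have nu: "- u \<in> tangent_space M x" by (rule subspace_neg[OF tangent_space_subspace[OF manifold xM] u])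
      have "height x (- u) \<ge> 0" using False height_linear(2)[OF boundary_point(1)[OF r True]] by simp
      then have "D1 (- u) = D2 (- u)" using exterior_half_curve[OF r True nu] half by metis
      then show ?thesis
        using linear_neg[OF has_derivative_linear[OF D(1)]] linear_neg[OF has_derivative_linear[OF D(2)]] by simp
    qed
  next
    case False
    then have xr: "x \<in> M - tube \<phi> r" using x xM by (simp add: boundary_torus_def)
    have "open (- tube \<phi> r)" using compact_imp_closed[OF compact_tube[of r]] r by (simp add: open_Compl)
    then obtain \<epsilon> \<gamma> where g: "\<epsilon> > 0" "\<gamma> ` {-\<epsilon><..<\<epsilon>} \<subseteq> M \<inter> - tube \<phi> r" "\<gamma> 0 = x" "(\<gamma> has_vector_derivative u) (at 0)"
      using tangent_spaceE_within[OF u, of "- tube \<phi> r"] xr by blast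
    have "M \<inter> - tube \<phi> r \<subseteq> exterior M \<phi> r" using exterior_eq[OF r] tube_mono(3)[of r] by blast
    moreover have "{0..<\<epsilon>} \<subseteq> {-\<epsilon><..<\<epsilon>}" using g(1) by auto
    ultimately show ?thesis using half[OF g(1) _ g(3,4)] g(2) by blast
  qed
qed

lemma dmap_exterior_eq:
  assumes r: "0 < r" "r < 1" and f: "smooth_map_on (exterior M \<phi> r) f" and F: "smooth_map_on M F"
    and fF: "\<And>x. x \<in> exterior M \<phi> r \<Longrightarrow> f x = F x" and x: "x \<in> exterior M \<phi> r" and u: "u \<in> tangent_space M x"
  shows "dmap f (exterior M \<phi> r) x u = dmap F M x u"
proof (rule exterior_derivative_unique[OF r x u smooth_map_on_differentiable[OF f x]])
  have EM: "exterior M \<phi> r \<subseteq> M" using exterior_eq[OF r] by blast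
  have "(F has_derivative dmap F M x) (at x within exterior M \<phi> r)"
    using has_derivative_subset[OF smooth_map_on_differentiable[OF F] EM] x EM by blast
  then show "(f has_derivative dmap F M x) (at x within exterior M \<phi> r)"
    by (rule has_derivative_cong_open[of _ _ _ _ UNIV]) (use x fF in auto)
qed

lemma G_diffeo_isotopy:
  assumes r: "0 < r" "r < 1" and f: "f \<in> G_diffeos M (exterior M \<phi> r) (boundary_torus M \<phi> r)"
  obtains H N where "smooth_map_on ({0..1::real} \<times> M) (\<lambda>(s, x). H s x)" "\<forall>s\<in>{0..1}. diffeomorphism M M (H s)"
    "\<forall>x\<in>M. H 0 x = x" "\<forall>x\<in>exterior M \<phi> r. H 1 x = f x" "open N" "boundary_torus M \<phi> r \<subseteq> N"
    "\<forall>x\<in>exterior M \<phi> r \<inter> N. f x = x" "openin (top_of_set M) (open_tube r \<union> M \<inter> N)"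
    "tube \<phi> r \<subseteq> open_tube r \<union> M \<inter> N" "\<forall>x\<in>open_tube r \<union> M \<inter> N. H 1 x = x"
proof -
  let ?E = "exterior M \<phi> r" and ?B = "boundary_torus M \<phi> r"
  obtain N where N: "open N" "?B \<subseteq> N" "\<forall>x\<in>?E \<inter> N. f x = x" and iso: "isotopic_to_identity M (\<lambda>x. if x \<in> ?E then f x else x)"
    using f unfolding G_diffeos_def by blast
  then obtain H :: "real \<Rightarrow> 'a \<Rightarrow> 'a" where H: "smooth_map_on ({0..1} \<times> M) (\<lambda>(s, x). H s x)" "\<forall>s\<in>{0..1}. diffeomorphism M M (H s)"
    "\<forall>x\<in>M. H 0 x = x" "\<forall>x\<in>M. H 1 x = (if x \<in> ?E then f x else x)"
    unfolding isotopic_to_identity_def by blast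
  have EM: "?E = M - open_tube r" using exterior_eq[OF r] .
  have tM: "tube \<phi> r \<subseteq> M" using tube_mono(1)[of r 1] tube_1_subset r by auto
  show thesis
  proof (rule that[OF H(1-3) _ N])
    show "\<forall>x\<in>?E. H 1 x = f x" using H(4) EM by auto
    show "openin (top_of_set M) (open_tube r \<union> M \<inter> N)"
      using openin_open_tube[of r] r N(1) by (intro openin_Un openin_open_Int) auto
    show "tube \<phi> r \<subseteq> open_tube r \<union> M \<inter> N"
      using N(2) tM unfolding boundary_torus_def EM by blast
    show "\<forall>x\<in>open_tube r \<union> M \<inter> N. H 1 x = x"
    proof
      fix x assume x: "x \<in> open_tube r \<union> M \<inter> N"
      then have "x \<in> M" using open_tube_subset[of r] r by auto
      then show "H 1 x = x" using H(4) N(3) x EM by auto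
    qed
  qed
qed

text \<open>Near the boundary \<open>f\<close> is the identity and the push-forward is
  \<open>v\<close> itself, and the pattern conditions see nothing else. Elsewhere derivatives within
  the exterior are replaced by the tangent map of the extension \<open>F\<close> to
  \<open>M\<close>.\<close>

lemma push_forward_field:
  assumes r: "0 < r" "r < 1" and f: "f \<in> G_diffeos M (exterior M \<phi> r) (boundary_torus M \<phi> r)"
    and F: "diffeomorphism M M F" "\<forall>x\<in>exterior M \<phi> r. F x = f x"
    and N: "open N" "boundary_torus M \<phi> r \<subseteq> N" "\<forall>x\<in>exterior M \<phi> r \<inter> N. f x = x"
    and v: "v \<in> pattern_fields M (exterior M \<phi> r) (boundary_torus M \<phi> r) (pattern_of M (exterior M \<phi> r) (boundary_torus M \<phi> r) v')"
  shows "push_forward (exterior M \<phi> r) f v \<in> pattern_fields M (exterior M \<phi> r) (boundary_torus M \<phi> r) (pattern_of M (exterior M \<phi> r) (boundary_torus M \<phi> r) v')"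
    "\<And>x. x \<in> exterior M \<phi> r \<Longrightarrow> push_forward (exterior M \<phi> r) f v (f x) = dmap F M x (v x)"
    "\<And>x. x \<in> exterior M \<phi> r \<inter> N \<Longrightarrow> push_forward (exterior M \<phi> r) f v x = v x"
proof -
  let ?E = "exterior M \<phi> r" and ?B = "boundary_torus M \<phi> r"
  have EM: "?E \<subseteq> M" using exterior_eq[OF r] by blast
  have "diffeomorphism ?E ?E f" using f by (simp add: G_diffeos_def)
  note d = diffeomorphism_inverse[OF this]
  note dF = diffeomorphism_inverse[OF F(1)]
  have vs: "smooth_map_on ?E v" and vT: "\<And>x. x \<in> ?E \<Longrightarrow> v x \<in> tangent_space M x" and v0: "\<And>x. x \<in> ?E \<Longrightarrow> v x \<noteq> 0"
    using v unfolding pattern_fields_def field_on_def vector_field_along_def by auto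
  have pf: "push_forward ?E f v x = dmap F M (inv_into ?E f x) (v (inv_into ?E f x))" if x: "x \<in> ?E" for x
  proof -
    have "dmap f ?E (inv_into ?E f x) (v (inv_into ?E f x)) = dmap F M (inv_into ?E f x) (v (inv_into ?E f x))"
      by (rule dmap_exterior_eq[OF r d(1) dF(1)]) (use F(2) d(7)[OF x] vT in auto)
    then show ?thesis by (simp only: push_forward_def Let_def)
  qed
  show eq: "push_forward ?E f v (f x) = dmap F M x (v x)" if x: "x \<in> ?E" for x
    using pf[of "f x"] d(3,5) x by auto
  show near: "push_forward ?E f v x = v x" if x: "x \<in> ?E \<inter> N" for x
  proof -
    have fx: "f x = x" using N(3) x by blast
    have "((\<lambda>y. y) has_derivative dmap f ?E x) (at x within ?E)"
      by (rule has_derivative_cong_open[OF smooth_map_on_differentiable[OF d(1)] N(1)]) (use x N(3) in auto)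
    then have "dmap f ?E x (v x) = v x"
      using exterior_derivative_unique[OF r _ vT _ has_derivative_ident] x by blast
    moreover have "inv_into ?E f x = x" using d(5)[of x] fx x by auto
    ultimately show ?thesis by (simp add: push_forward_def)
  qed
  have "field_on M ?E (push_forward ?E f v)"
    unfolding field_on_def vector_field_along_def
  proof (intro conjI ballI)
    have "smooth_map_on ?E (\<lambda>x. dmap F M x (v x))" by (rule smooth_map_on_dmap_field[OF dF(1) EM vs vT])
    from smooth_map_on_compose[OF this d(2)]
    have "smooth_map_on ?E (\<lambda>x. dmap F M (inv_into ?E f x) (v (inv_into ?E f x)))" using d(4) by blast
    then show "smooth_map_on ?E (push_forward ?E f v)" by (rule smooth_map_on_cong) (simp add: pf)
    fix x assume "x \<in> ?E"
    then obtain y where y: "y \<in> ?E" "x = f y" using d(3) by blast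
    then have e: "push_forward ?E f v x = dmap F M y (v y)" "F y = x" using eq F(2) by auto
    show "push_forward ?E f v x \<in> tangent_space M x"
      unfolding e(1) using dmap_tangent[OF dF(1) _ vT[OF y(1)], of M] dF(3) e(2) by auto
    show "push_forward ?E f v x \<noteq> 0"
    proof
      assume "push_forward ?E f v x = 0"
      then have z: "dmap F M y (v y) = 0" using e by simp
      have "dmap (inv_into M F) M (F y) (dmap F M y (v y)) = v y"
        by (rule dmap_inverse[OF dF(1,2) _ _ vT[OF y(1)]]) (use dF in auto)
      moreover have "linear (dmap (inv_into M F) M (F y))" by (rule dmap_linear[OF dF(2)]) (use dF(3) y EM in auto)
      ultimately show False using v0[OF y(1)] linear_0 z by metis
    qed
  qed
  then show "push_forward ?E f v \<in> pattern_fields M ?E ?B (pattern_of M ?E ?B v')"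
    by (rule pattern_fields_cong[OF v _ N(1,2)]) (use near in \<open>auto simp: boundary_torus_def\<close>)
qed

text \<open>
  The fields \<open>W s\<close> obtained by pulling \<open>V\<close> back along the isotopy form a homotopy from \<open>V\<close>, which extends the
  push-forward, to a field which extends \<open>v\<close>. Near the knot it is a loop of fields.
\<close>

lemma pulled_back_fields:
  fixes H :: "real \<Rightarrow> 'a \<Rightarrow> 'a"
  assumes Q: "\<And>a. smooth_map_on M (\<lambda>y. Q y a)" "\<And>y. linear (Q y)"
      "\<And>y a. y \<in> M \<Longrightarrow> Q y a \<in> tangent_space M y" "\<And>y u. u \<in> tangent_space M y \<Longrightarrow> Q y u = u"
    and H: "smooth_map_on ({0..1} \<times> M) (\<lambda>(s, x). H s x)" "\<forall>s\<in>{0..1}. diffeomorphism M M (H s)" "\<forall>x\<in>M. H 0 x = x"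
    and V: "continuous_on M V" "\<And>x. x \<in> M \<Longrightarrow> V x \<in> tangent_space M x" "\<And>x. x \<in> M \<Longrightarrow> V x \<noteq> 0"
  obtains W where "continuous_on ({0..1} \<times> M) (\<lambda>(s, x). W s x)"
    "\<forall>s\<in>{0..1}. \<forall>x\<in>M. W s x \<in> tangent_space M x \<and> W s x \<noteq> 0 \<and> dmap (H s) M x (W s x) = V (H s x)"
    "\<forall>s\<in>{0..1}. \<forall>x. \<forall>u\<in>tangent_space M x. dmap (H s) M x u = V (H s x) \<longrightarrow> W s x = u"
    "\<forall>s\<in>{0..1}. \<forall>x. \<forall>u\<in>tangent_space M x. dmap (H s) M x u = 0 \<longrightarrow> u = 0"
    "\<forall>x\<in>M. W 0 x = V x"
proof -
  let ?X = "{0..1::real} \<times> M"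
  define W where "W s x = dmap (inv_into M (H s)) M (H s x) (V (H s x))" for s x
  have d: "smooth_map_on M (H s)" "smooth_map_on M (inv_into M (H s))" "H s ` M = M" "\<And>x. x \<in> M \<Longrightarrow> inv_into M (H s) (H s x) = x"
    "\<And>y. y \<in> M \<Longrightarrow> H s (inv_into M (H s) y) = y" "inv_into M (H s) ` M = M" if "s \<in> {0..1}" for s
    using diffeomorphism_inverse[OF H(2)[rule_format, OF that]] by blast+
  have HM: "H s x \<in> M" if "s \<in> {0..1}" "x \<in> M" for s x using d(3) that by blast
  have inv: "dmap (inv_into M (H s)) M (H s x) (dmap (H s) M x u) = u" if "s \<in> {0..1}" "u \<in> tangent_space M x" for s x u
    by (rule dmap_inverse[OF d(1,2)[OF that(1)] _ d(4)[OF that(1)] that(2)]) (use d(3)[OF that(1)] in auto)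
  have WT: "W s x \<in> tangent_space M x" and WV: "dmap (H s) M x (W s x) = V (H s x)" if "s \<in> {0..1}" "x \<in> M" for s x
  proof -
    have "dmap (inv_into M (H s)) M (H s x) (V (H s x)) \<in> tangent_space M (inv_into M (H s) (H s x))"
      by (rule dmap_tangent[OF d(2)[OF that(1)] _ V(2)[OF HM[OF that]]]) (use d(6)[OF that(1)] in auto)
    then show "W s x \<in> tangent_space M x" using d(4)[OF that] by (simp add: W_def)
    have "dmap (H s) M (inv_into M (H s) (H s x)) (dmap (inv_into M (H s)) M (H s x) (V (H s x))) = V (H s x)"
      by (rule dmap_inverse[OF d(2,1)[OF that(1)] _ d(5)[OF that(1)] V(2)[OF HM[OF that]]]) (use d(6)[OF that(1)] in auto)
    then show "dmap (H s) M x (W s x) = V (H s x)" using d(4)[OF that] by (simp add: W_def)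
  qed
  have uniq: "W s x = u" if "s \<in> {0..1}" "u \<in> tangent_space M x" "dmap (H s) M x u = V (H s x)" for s x u
    using inv[OF that(1,2)] that(3) by (simp add: W_def)
  have lin: "linear (dmap (H s) M x)" "linear (dmap (inv_into M (H s)) M (H s x))" if "s \<in> {0..1}" "x \<in> M" for s x
    using dmap_linear d(1,2)[OF that(1)] that HM by blast+
  have inj: "u = 0" if "s \<in> {0..1}" "u \<in> tangent_space M x" "dmap (H s) M x u = 0" for s x u
    using inv[OF that(1,2)] linear_0[OF lin(2)[OF that(1)]] that(3) tangent_space_base[OF that(2)] by metis
  \<comment> \<open>\<open>W\<close> solves a linear system in the ambient space: the first
    component pulls \<open>V\<close> back, the second forces the solution to be tangent. This gives
    continuity in \<open>s\<close> without any joint regularity of the inverses of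
    \<open>H s\<close>.\<close>
  define G where "G p a = (if p \<in> ?X then (dmap (H (fst p)) M (snd p) (Q (snd p) a), a - Q (snd p) a) else 0)" for p a
  have Qc: "continuous_on ?X (\<lambda>p. Q (snd p) a)" for a
    by (rule continuous_on_compose2[OF smooth_map_on_continuous[OF Q(1)]]) (auto intro!: continuous_intros)
  have Gc: "continuous_on ?X (\<lambda>p. G p a)" for a
  proof -
    have "continuous_on ?X (\<lambda>p. dmap (H (fst p)) M (snd p) (Q (snd p) a))"
      by (rule continuous_on_dmap_isotopy[OF H(1)]) (use Q(3) Qc in \<open>auto intro!: continuous_intros\<close>)
    then have "continuous_on ?X (\<lambda>p. (dmap (H (fst p)) M (snd p) (Q (snd p) a), a - Q (snd p) a))"
      by (intro continuous_intros Qc)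
    then show ?thesis by (rule continuous_on_eq) (simp add: G_def)
  qed
  have Gl: "linear (G p)" for p
  proof (cases "p \<in> ?X")
    case True
    then have l: "linear (dmap (H (fst p)) M (snd p))" using lin by auto
    have 1: "linear (\<lambda>a. dmap (H (fst p)) M (snd p) (Q (snd p) a))" using linear_compose[OF Q(2) l] by (simp add: o_def)
    have 2: "linear (\<lambda>a. a - Q (snd p) a)" by (rule linear_compose_sub[OF linear_ident Q(2)])
    have "linear (\<lambda>a. (dmap (H (fst p)) M (snd p) (Q (snd p) a), a - Q (snd p) a))"
      by (rule linearI) (simp_all only: linear_add[OF 1] linear_add[OF 2] linear_scale[OF 1] linear_scale[OF 2] add_Pair scaleR_Pair)
    then show ?thesis using True by (simp add: G_def[abs_def])
  qed (auto simp: G_def intro: linearI)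
  have Gi: "a = 0" if "p \<in> ?X" "G p a = 0" for p a
  proof -
    have p: "fst p \<in> {0..1}" "snd p \<in> M" using that(1) by auto
    have "dmap (H (fst p)) M (snd p) (Q (snd p) a) = 0" "a = Q (snd p) a" using that by (auto simp: G_def zero_prod_def)
    then show ?thesis using inj[OF p(1) Q(3)[OF p(2)]] by metis
  qed
  have Vc: "continuous_on ?X (\<lambda>p. V (H (fst p) (snd p)))"
    using continuous_on_compose2[OF V(1) smooth_map_on_continuous[OF H(1)]] HM by (force simp: case_prod_beta)
  have "continuous_on ?X (\<lambda>p. W (fst p) (snd p))"
  proof (rule continuous_on_solution[OF _ Gc Gl])
    show "compact ?X" using closed_M(2) by (intro compact_Times) auto
    show "a = 0" if "p \<in> ?X" "G p a = 0" for p a using Gi that by blast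
    show "continuous_on ?X (\<lambda>p. (V (H (fst p) (snd p)), 0::'a))" by (intro continuous_intros Vc)
    show "G p (W (fst p) (snd p)) = (V (H (fst p) (snd p)), 0)" if "p \<in> ?X" for p
      using that WV WT Q(4) by (auto simp: G_def)
  qed
  moreover have "W s x \<noteq> 0" if "s \<in> {0..1}" "x \<in> M" for s x
    using WV[OF that] V(3)[OF HM[OF that]] linear_0[OF lin(1)[OF that]] by auto
  moreover have "W 0 x = V x" if x: "x \<in> M" for x
  proof (rule uniq)
    have "dmap (H 0) M x (V x) = dmap (\<lambda>x. x) M x (V x)"
      by (rule dmap_cong[OF d(1) smooth_map_on_ident V(2)[OF x] V(2)[OF x] open_UNIV]) (use H(3) in auto)
    then show "dmap (H 0) M x (V x) = V (H 0 x)" using dmap_ident[OF V(2)[OF x]] H(3) x by simp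
  qed (use V(2)[OF x] in auto)
  ultimately show thesis
    using that[of W] WT WV uniq inj by (simp add: case_prod_beta)
qed

text \<open>The derivative of \<open>H s\<close> carries \<open>W s\<close> to \<open>V\<close>. So
  the coordinates of \<open>W\<close> on the core are the coordinates of \<open>V\<close> over the
  torus \<open>H s (k t)\<close> in the frames \<open>A\<close> carried along by the isotopy. The
  torus and the frames close up, and \<open>torus_degree\<close> applies.\<close>

lemma tube_degree:
  fixes H :: "real \<Rightarrow> 'a \<Rightarrow> 'a"
  assumes Q: "\<And>a. smooth_map_on M (\<lambda>y. Q y a)" "\<And>y. linear (Q y)"
      "\<And>y a. y \<in> M \<Longrightarrow> Q y a \<in> tangent_space M y" "\<And>y u. u \<in> tangent_space M y \<Longrightarrow> Q y u = u"
    and vol: "continuous_on UNIV (\<lambda>(y, a, b, c). vol y a b c :: real)"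
      "\<And>y. y \<in> M \<Longrightarrow> \<exists>\<kappa> C. \<kappa> > 0 \<and> linear C \<and> inj C \<and> range C = tangent_space M y \<and>
         (\<forall>a b c. vol y (C a) (C b) (C c) = \<kappa> * det3 a b c)"
    and H2: "trivial_group (homology_group 2 (top_of_set M))"
    and H: "smooth_map_on ({0..1} \<times> M) (\<lambda>(s, x). H s x)" "\<forall>s\<in>{0..1}. diffeomorphism M M (H s)" "\<forall>x\<in>M. H 0 x = x"
      "openin (top_of_set M) S" "K \<subseteq> S" "\<forall>x\<in>S. H 1 x = x"
    and inj: "\<forall>s\<in>{0..1}. \<forall>x. \<forall>u\<in>tangent_space M x. dmap (H s) M x u = 0 \<longrightarrow> u = 0"
    and V: "continuous_on M V" "\<And>x. x \<in> M \<Longrightarrow> V x \<in> tangent_space M x" "\<And>x. x \<in> M \<Longrightarrow> V x \<noteq> 0"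
    and W: "\<forall>s\<in>{0..1}. \<forall>x\<in>M. W s x \<in> tangent_space M x \<and> W s x \<noteq> 0 \<and> dmap (H s) M x (W s x) = V (H s x)"
  shows "core_degree_zero (\<lambda>p. coframe (\<phi> (fst p)) (W (snd p) (\<phi> (fst p))))"
  unfolding core_degree_zero_def
proof (intro allI impI)
  fix q \<alpha> \<beta>
  assume q: "continuous_on ({0..1} \<times> {0..1}) q"
      "\<forall>t\<in>{0..1}. \<forall>s\<in>{0..1}. norm (q (t, s)) = 1 \<and> (\<exists>c>0. coframe (\<phi> (fst ((circle_point t, 0), s))) (W (snd ((circle_point t, 0), s)) (\<phi> (fst ((circle_point t, 0), s)))) = c *\<^sub>R rot (q (t, s)) (1, 0))"
    and \<alpha>: "continuous_on {0..1} \<alpha>" "\<forall>t\<in>{0..1}. q (t, 1) = qmul (q (t, 0)) (cis (\<alpha> t), 0)"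
    and \<beta>: "continuous_on {0..1} \<beta>" "\<forall>s\<in>{0..1}. q (1, s) = qmul (q (0, s)) (cis (\<beta> s), 0)"
  let ?Q = "{0..1::real} \<times> {0..1::real}"
  define n where "n y = (1 / norm (V y)) *\<^sub>R V y" for y
  have nc: "continuous_on M n" unfolding n_def using V(1,3) by (auto intro!: continuous_intros)
  have nT: "n y \<in> tangent_space M y" if "y \<in> M" for y
    unfolding n_def by (rule subspace_scale[OF tangent_space_subspace[OF manifold that] V(2)[OF that]])
  interpret F: oriented_unit_field M n Q vol
  proof (rule oriented_unit_field.intro)
    show "continuous_on M (\<lambda>y. Q y a)" for a using smooth_map_on_continuous[OF Q(1)] .
    show "norm (n y) = 1" if "y \<in> M" for y using V(3)[OF that] by (simp add: n_def)
  qed (fact manifold Q vol nc nT)+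
  define k where "k t = \<phi> (circle_point t, 0)" for t
  have kp: "(circle_point t, 0) \<in> solid_torus 1" for t by (simp add: solid_torus_def)
  have kK: "k t \<in> K" for t unfolding K_eq k_def by simp
  have kT: "k t \<in> open_tube 1" for t unfolding open_tube_def k_def by (simp add: open_solid_torus_def)
  have kS: "k t \<in> S" for t using kK H(5) by blast
  have kM: "k t \<in> M" for t using kT open_tube_subset[of 1] by auto
  have kc: "continuous_on S' k" for S' unfolding k_def
    by (rule continuous_on_compose2[OF smooth_map_on_continuous[OF diffeo_facts(1)]]) (use kp in \<open>auto intro!: continuous_intros\<close>)
  have k01: "k 0 = k 1" by (simp add: k_def)
  have Hs: "smooth_map_on M (H s)" "H s ` M = M" if "s \<in> {0..1}" for s
    using diffeomorphism_inverse(1,3)[OF H(2)[rule_format, OF that]] by auto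
  have fT: "frame (k t) w \<in> tangent_space M (k t)" and fl: "linear (frame (k t))" for t w using frame_coframe(1,4)[OF kT] by auto
  define A where "A p w = (if p \<in> ?Q then dmap (H (snd p)) M (k (fst p)) (frame (k (fst p)) w) else 0)" for p w
  have dl: "linear (dmap (H s) M (k t))" if "s \<in> {0..1}" for s t using dmap_linear[OF Hs(1)[OF that] kM] .
  have d0: "dmap (H 0) M x u = u" if "u \<in> tangent_space M x" for x u
  proof -
    have "dmap (H 0) M x u = dmap (\<lambda>x. x) M x u"
      by (rule dmap_cong[OF Hs(1) smooth_map_on_ident that that open_UNIV]) (use H(3) in auto)
    then show ?thesis using dmap_ident[OF that] by simp
  qed
  \<comment> \<open>That \<open>H 1\<close> fixes the knot would close up the torus only; being the
    identity on a relatively open set it also has the identity as derivative, which closes up the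
    frames.\<close>
  obtain S' where S': "open S'" "S = M \<inter> S'" using H(4) by (auto simp: openin_open)
  have d1: "dmap (H 1) M x u = u" if "u \<in> tangent_space M x" "x \<in> S" for x u
  proof -
    have "dmap (H 1) M x u = dmap (\<lambda>x. x) M x u"
      by (rule dmap_cong[OF Hs(1) smooth_map_on_ident that(1) that(1) S'(1)]) (use H(6) S'(2) that(2) in auto)
    then show ?thesis using dmap_ident[OF that(1)] by simp
  qed
  show "\<alpha> 1 - \<alpha> 0 = \<beta> 1 - \<beta> 0"
  proof (rule F.torus_degree[of "\<lambda>p. H (snd p) (k (fst p))" A q \<alpha> \<beta>, OF H2])
    have "continuous_on ?Q (\<lambda>p. (\<lambda>(s, x). H s x) (snd p, k (fst p)))"
      by (rule continuous_on_compose2[OF smooth_map_on_continuous[OF H(1)]])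
        (use kM in \<open>auto intro!: continuous_intros continuous_on_compose2[OF kc[of UNIV]]\<close>)
    then show "continuous_on ?Q (\<lambda>p. H (snd p) (k (fst p)))" by simp
    show "(\<lambda>p. H (snd p) (k (fst p))) ` ?Q \<subseteq> M"
    proof (rule image_subsetI)
      fix p assume "p \<in> ?Q"
      then have "snd p \<in> {0..1}" by auto
      then show "H (snd p) (k (fst p)) \<in> M" using Hs(2) kM by blast
    qed
    show "H (snd (0, s)) (k (fst (0::real, s))) = H (snd (1, s)) (k (fst (1::real, s)))" for s using k01 by simp
    show "H (snd (t, 0::real)) (k (fst (t, 0::real))) = H (snd (t, 1::real)) (k (fst (t, 1::real)))" for t
      using H(3,6) kM kS by simp
    show "continuous_on ?Q (\<lambda>p. A p w)" for w
    proof -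
      have "continuous_on ?Q (\<lambda>p. dmap (H (snd p)) M (k (fst p)) (frame (k (fst p)) w))"
        by (rule continuous_on_dmap_isotopy[OF H(1)])
          (use fT kT in \<open>auto intro!: continuous_intros continuous_on_frame continuous_on_compose2[OF kc[of UNIV]]\<close>)
      then show ?thesis by (rule continuous_on_eq) (simp add: A_def)
    qed
    show "linear (A p)" for p
    proof (cases "p \<in> ?Q")
      case True
      then have "linear (\<lambda>w. dmap (H (snd p)) M (k (fst p)) (frame (k (fst p)) w))"
        using linear_compose[OF fl dl, of "snd p"] by (auto simp: o_def)
      then show ?thesis using True by (simp add: A_def[abs_def])
    qed (auto simp: A_def intro: linearI)
    show "A p w \<in> tangent_space M (H (snd p) (k (fst p)))" if "p \<in> ?Q" for p w
    proof -
      have s: "snd p \<in> {0..1}" using that by auto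
      have "dmap (H (snd p)) M (k (fst p)) (frame (k (fst p)) w) \<in> tangent_space M (H (snd p) (k (fst p)))"
        by (rule dmap_tangent[OF Hs(1)[OF s] _ fT]) (use Hs(2)[OF s] in simp)
      then show ?thesis using that by (simp add: A_def)
    qed
    show "w = 0" if "p \<in> ?Q" "A p w = 0" for p w
    proof -
      have s: "snd p \<in> {0..1}" using that by auto
      have "frame (k (fst p)) w = 0" by (rule inj[rule_format, OF s fT]) (use that in \<open>simp add: A_def\<close>)
      then show ?thesis using frame_coframe(2)[OF kT, of "fst p" w] linear_0[OF frame_coframe(5)[OF kT]] by metis
    qed
    show "A (0, s) = A (1, s)" for s by (rule ext) (simp add: A_def k01)
    show "A (t, 0) = A (t, 1)" for t
    proof -
      have "dmap (H 0) M (k t) (frame (k t) w) = dmap (H 1) M (k t) (frame (k t) w)" for w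
        using d0[OF fT] d1[OF fT kS] by simp
      then show ?thesis by (intro ext) (simp add: A_def)
    qed
    show "continuous_on ?Q q" by (rule q(1))
    show "norm (q p) = 1" if "p \<in> ?Q" for p using q(2) that by auto
    show "\<exists>c>0. A p (rot (q p) (1, 0)) = c *\<^sub>R n (H (snd p) (k (fst p)))" if pQ: "p \<in> ?Q" for p
    proof -
      obtain t s where p: "p = (t, s)" "t \<in> {0..1}" "s \<in> {0..1}" using pQ by auto
      then have ps: "fst p = t" "snd p = s" by auto
      obtain c where c: "c > 0" "coframe (k t) (W s (k t)) = c *\<^sub>R rot (q p) (1, 0)" using q(2) p(2,3) unfolding p(1) k_def fst_conv snd_conv by blast
      have Wf: "frame (k t) (coframe (k t) (W s (k t))) = W s (k t)" using frame_coframe(3)[OF kT] W p(3) kM by blast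
      have "c *\<^sub>R A p (rot (q p) (1, 0)) = dmap (H s) M (k t) (frame (k t) (c *\<^sub>R rot (q p) (1, 0)))"
        using pQ ps by (simp add: A_def linear_scale[OF fl] linear_scale[OF dl[OF p(3)]])
      also have "\<dots> = V (H s (k t))" using Wf W p(3) kM c(2) by simp
      finally have "(1 / c) *\<^sub>R (c *\<^sub>R A p (rot (q p) (1, 0))) = (1 / c) *\<^sub>R V (H s (k t))" by simp
      then have e: "A p (rot (q p) (1, 0)) = (1 / c) *\<^sub>R V (H s (k t))" using c(1) by simp
      have HM: "H s (k t) \<in> M" using Hs(2)[OF p(3)] kM by blast
      show ?thesis
        using c(1) V(3)[OF HM] by (intro exI[of _ "norm (V (H s (k t))) / c"]) (simp add: e n_def ps)
    qed
  qed (use \<alpha> \<beta> in auto)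
qed

end

context tubular_neighbourhood
begin

text \<open>The homotopy \<open>W\<close> is made constant near the boundary by contracting the loop of fields on the tube.\<close>

lemma contract_near_boundary:
  assumes r: "0 < r" "r < R" "R < 1"
    and W: "continuous_on ({0..1} \<times> M) (\<lambda>(s, x). W s x)"
      "\<And>s x. s \<in> {0..1} \<Longrightarrow> x \<in> M \<Longrightarrow> W s x \<in> tangent_space M x \<and> W s x \<noteq> 0"
      "\<And>x. x \<in> tube \<phi> R \<Longrightarrow> W 1 x = W 0 x"
    and degree: "core_degree_zero (\<lambda>p. coframe (\<phi> (fst p)) (W (snd p) (\<phi> (fst p))))"
  obtains w N where "continuous_on ({0..1::real} \<times> exterior M \<phi> r) (\<lambda>(s, x). w s x)"
    "\<forall>s\<in>{0..1}. \<forall>x\<in>exterior M \<phi> r. w s x \<in> tangent_space M x \<and> w s x \<noteq> 0"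
    "\<forall>x\<in>exterior M \<phi> r. w 0 x = W 0 x \<and> w 1 x = W 1 x"
    "open N" "boundary_torus M \<phi> r \<subseteq> N" "\<forall>s\<in>{0..1}. \<forall>x\<in>exterior M \<phi> r \<inter> N. w s x = w 0 x"
proof -
  let ?E = "exterior M \<phi> r" and ?T = "solid_torus R" and ?I = "{0..1::real}"
  have r1: "r < 1" using r by simp
  have EM: "?E = M - open_tube r" using exterior_eq[OF r(1) r1] .
  have T1: "?T \<subseteq> open_solid_torus 1" "?T \<subseteq> solid_torus 1" using solid_torus_mono(1,2)[of R 1] r by auto
  have \<phi>T: "\<phi> p \<in> open_tube 1" "\<phi> p \<in> M" "\<phi> p \<in> tube \<phi> R" if "p \<in> ?T" for p
    using that T1 open_tube_subset[of 1] unfolding open_tube_def tube_eq by auto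
  have \<phi>c: "continuous_on ?T \<phi>" using smooth_map_on_continuous[OF diffeo_facts(1)] continuous_on_subset T1(2) by blast
  define u :: "(complex \<times> complex) \<times> real \<Rightarrow> real \<times> complex" where "u p = coframe (\<phi> (fst p)) (W (snd p) (\<phi> (fst p)))" for p
  have uc: "continuous_on (?T \<times> ?I) u"
    unfolding u_def
  proof (rule continuous_on_coframe)
    show c: "continuous_on (?T \<times> ?I) (\<lambda>p. \<phi> (fst p))"
      by (rule continuous_on_compose2[OF \<phi>c]) (auto intro!: continuous_intros)
    have "continuous_on (?T \<times> ?I) (\<lambda>p. (\<lambda>(s, x). W s x) (snd p, \<phi> (fst p)))"
      by (rule continuous_on_compose2[OF W(1)]) (use \<phi>T in \<open>auto intro!: continuous_intros c\<close>)
    then show "continuous_on (?T \<times> ?I) (\<lambda>p. W (snd p) (\<phi> (fst p)))" by simp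
  qed (use \<phi>T W(2) in auto)
  have fu: "frame (\<phi> p) (u (p, s)) = W s (\<phi> p)" if "p \<in> ?T" "s \<in> ?I" for p s
    unfolding u_def using frame_coframe(3)[OF \<phi>T(1)] W(2) \<phi>T that by auto
  have u0: "u p \<noteq> 0" if "p \<in> ?T \<times> ?I" for p
  proof
    assume "u p = 0"
    then have "W (snd p) (\<phi> (fst p)) = 0" using fu[of "fst p" "snd p"] linear_0[OF frame_coframe(4)[OF \<phi>T(1)]] that by auto
    then show False using W(2) \<phi>T that by auto
  qed
  have u01: "u (p, 0) = u (p, 1)" if "p \<in> ?T" for p using W(3)[OF \<phi>T(3)[OF that]] by (simp add: u_def)
  have R0: "R \<ge> 0" using r by simp
  obtain U where U: "continuous_on ((?T \<times> ?I) \<times> ?I) U"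
    "\<forall>x s \<tau>. x \<in> ?T \<longrightarrow> s \<in> ?I \<longrightarrow> \<tau> \<in> ?I \<longrightarrow> U ((x, s), \<tau>) \<noteq> 0"
    "\<forall>x s. x \<in> ?T \<longrightarrow> s \<in> ?I \<longrightarrow> U ((x, s), 0) = u (x, s)"
    "\<forall>x s. x \<in> ?T \<longrightarrow> s \<in> ?I \<longrightarrow> U ((x, s), 1) = u (x, 0)"
    "\<forall>x s \<tau>. x \<in> ?T \<longrightarrow> s \<in> {0, 1} \<longrightarrow> \<tau> \<in> ?I \<longrightarrow> U ((x, s), \<tau>) = u (x, 0)"
  proof (rule solid_torus_vector_contraction[of R u, OF R0, folded solid_torus_def, OF uc u0 u01 degree[folded u_def]])
    fix U
    assume U: "continuous_on ((?T \<times> ?I) \<times> ?I) U" "\<And>x s \<tau>. x \<in> ?T \<Longrightarrow> s \<in> ?I \<Longrightarrow> \<tau> \<in> ?I \<Longrightarrow> U ((x, s), \<tau>) \<noteq> 0"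
      "\<And>x s. x \<in> ?T \<Longrightarrow> s \<in> ?I \<Longrightarrow> U ((x, s), 0) = u (x, s)" "\<And>x s. x \<in> ?T \<Longrightarrow> s \<in> ?I \<Longrightarrow> U ((x, s), 1) = u (x, 0)"
      "\<And>x s \<tau>. x \<in> ?T \<Longrightarrow> s \<in> {0, 1} \<Longrightarrow> \<tau> \<in> ?I \<Longrightarrow> U ((x, s), \<tau>) = u (x, 0)"
    show thesis by (rule that[OF U(1)]) (use U(2-5) in blast)+
  qed
  define R' where "R' = (r + R) / 2"
  have R': "r < R'" "R' < R" "R' \<le> 1" using r by (auto simp: R'_def)
  \<comment> \<open>The stage of the contraction: 1 up to radius \<open>R'\<close> and 0 at radius
    \<open>R\<close>. Since \<open>r < R'\<close>, the loop is fully contracted on a neighbourhood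
    of the boundary torus.\<close>
  define \<tau> where "\<tau> x = min 1 (max 0 ((R - norm (snd (\<psi> x))) / (R - R')))" for x
  have \<tau>I: "\<tau> x \<in> ?I" for x by (simp add: \<tau>_def)
  have tR: "\<psi> x \<in> ?T" "\<phi> (\<psi> x) = x" "x \<in> open_tube 1" if "x \<in> tube \<phi> R" for x
  proof -
    obtain p where p: "p \<in> ?T" "x = \<phi> p" using \<open>x \<in> tube \<phi> R\<close> by (auto simp: tube_eq)
    moreover have "\<psi> (\<phi> p) = p" using \<psi>_\<phi> T1(2) p(1) by blast
    ultimately show "\<psi> x \<in> ?T" "\<phi> (\<psi> x) = x" "x \<in> open_tube 1" using \<phi>T(1) by auto
  qed
  have tM: "tube \<phi> R \<subseteq> M" using tube_mono(1)[of R 1] tube_1_subset r by auto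
  define w1 where "w1 s x = frame x (U ((\<psi> x, s), \<tau> x))" for s x
  \<comment> \<open>Both pieces agree at radius \<open>R\<close>. The contraction fixes the ends of
    the loop at every stage, so the fields at \<open>s = 0\<close> and \<open>s = 1\<close> are
    unchanged.\<close>
  define w where "w s x = (if x \<in> tube \<phi> R then w1 s x else W s x)" for s x
  have outer: "w1 s x = W s x" if "x \<in> tube \<phi> R" "norm (snd (\<psi> x)) = R" "s \<in> ?I" for s x
    using U(3)[rule_format, OF tR(1)[OF that(1)] that(3)] fu[OF tR(1)[OF that(1)] that(3), unfolded tR(2)[OF that(1)]] tR(1)[OF that(1)] that(2,3) by (simp add: w1_def \<tau>_def)
  have inner: "w1 s x = W 0 x" if "x \<in> tube \<phi> R" "norm (snd (\<psi> x)) \<le> R'" "s \<in> ?I" for s x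
  proof -
    have "(R - norm (snd (\<psi> x))) / (R - R') \<ge> 1" using that(2) R'(2) by (simp add: field_simps)
    then have "\<tau> x = 1" by (simp add: \<tau>_def)
    then show ?thesis using U(4)[rule_format, OF tR(1)[OF that(1)] that(3)] fu[OF tR(1)[OF that(1)], of 0, unfolded tR(2)[OF that(1)]] tR(1)[OF that(1)] that(3) by (simp add: w1_def)
  qed
  have ends: "w1 0 x = W 0 x" "w1 1 x = W 1 x" if "x \<in> tube \<phi> R" for x
    using U(5)[rule_format, OF tR(1)[OF that] _ \<tau>I, of 0] U(5)[rule_format, OF tR(1)[OF that] _ \<tau>I, of 1] fu[OF tR(1)[OF that], of 0, unfolded tR(2)[OF that]] tR(1)[OF that] W(3)[OF that] \<tau>I by (simp_all add: w1_def)
  have w1T: "w1 s x \<in> tangent_space M x" "w1 s x \<noteq> 0" if "x \<in> tube \<phi> R" "s \<in> ?I" for s x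
  proof -
    note f = frame_coframe[OF tR(3)[OF that(1)]]
    show "w1 s x \<in> tangent_space M x" unfolding w1_def by (rule f(1))
    show "w1 s x \<noteq> 0"
    proof
      assume "w1 s x = 0"
      then have "U ((\<psi> x, s), \<tau> x) = 0" using f(2) linear_0[OF f(5)] unfolding w1_def by metis
      then show False using U(2) tR(1)[OF that(1)] that(2) \<tau>I by blast
    qed
  qed
  have \<psi>c: "continuous_on (tube \<phi> R) \<psi>"
    using smooth_map_on_continuous[OF diffeo_facts(2)] continuous_on_subset tube_mono(1)[of R 1] r by auto
  have w1c: "continuous_on (?I \<times> (?E \<inter> tube \<phi> R)) (\<lambda>p. w1 (fst p) (snd p))"
    unfolding w1_def
  proof (rule continuous_on_frame)
    have c: "continuous_on (?I \<times> (?E \<inter> tube \<phi> R)) (\<lambda>p. \<psi> (snd p))"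
      by (rule continuous_on_compose2[OF \<psi>c]) (auto intro!: continuous_intros)
    have "continuous_on (?I \<times> (?E \<inter> tube \<phi> R)) (\<lambda>p. \<tau> (snd p))"
      unfolding \<tau>_def using R'(2) by (intro continuous_intros c) auto
    then show "continuous_on (?I \<times> (?E \<inter> tube \<phi> R)) (\<lambda>p. U ((\<psi> (snd p), fst p), \<tau> (snd p)))"
      by (intro continuous_on_compose2[OF U(1)] continuous_intros c) (use tR(1) \<tau>I in auto)
  qed (use tR(3) in \<open>auto intro!: continuous_intros\<close>)
  have Wc: "continuous_on (?I \<times> (?E - open_tube R)) (\<lambda>p. W (fst p) (snd p))"
    using W(1) unfolding case_prod_beta by (rule continuous_on_subset) (use EM in auto)
  have "continuous_on (?I \<times> (?E \<inter> tube \<phi> R) \<union> ?I \<times> (?E - open_tube R))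
      (\<lambda>p. if snd p \<in> tube \<phi> R then w1 (fst p) (snd p) else W (fst p) (snd p))"
  proof (rule continuous_on_cases[OF _ _ w1c Wc])
    have cE: "compact ?E" unfolding exterior_def
      by (rule compact_closure[THEN iffD2]) (use closed_M(2) compact_imp_bounded bounded_subset in blast)
    show "closed (?I \<times> (?E \<inter> tube \<phi> R))"
      using cE compact_tube[of R] r by (intro closed_Times closed_Int compact_imp_closed) auto
    have "?E - open_tube R = exterior M \<phi> R"
      using EM exterior_eq[of R] r tube_mono(4)[of r R] by auto
    then show "closed (?I \<times> (?E - open_tube R))" unfolding exterior_def by (auto intro: closed_Times)
    show "\<forall>p. p \<in> ?I \<times> (?E \<inter> tube \<phi> R) \<and> snd p \<notin> tube \<phi> R \<or> p \<in> ?I \<times> (?E - open_tube R) \<and> snd p \<in> tube \<phi> R \<longrightarrow>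
        w1 (fst p) (snd p) = W (fst p) (snd p)"
    proof (intro allI impI)
      fix p assume "p \<in> ?I \<times> (?E \<inter> tube \<phi> R) \<and> snd p \<notin> tube \<phi> R \<or> p \<in> ?I \<times> (?E - open_tube R) \<and> snd p \<in> tube \<phi> R"
      then have p: "fst p \<in> ?I" "snd p \<in> tube \<phi> R" "snd p \<notin> open_tube R" by auto
      then have "norm (snd (\<psi> (snd p))) = R"
        using tR[OF p(2)] tube_iff(2)[of "\<psi> (snd p)" R] T1(2) r by (auto simp: solid_torus_def mem_Times_iff)
      then show "w1 (fst p) (snd p) = W (fst p) (snd p)" using outer p by blast
    qed
  qed
  moreover have "?I \<times> (?E \<inter> tube \<phi> R) \<union> ?I \<times> (?E - open_tube R) = ?I \<times> ?E" using tube_mono(3)[of R] by auto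
  ultimately have wc: "continuous_on (?I \<times> ?E) (\<lambda>(s, x). w s x)" by (simp add: w_def case_prod_beta)
  obtain N where N: "open N" "open_tube R' = M \<inter> N" using openin_open_tube[OF R'(3)] by (auto simp: openin_open)
  have NT: "x \<in> tube \<phi> R \<and> norm (snd (\<psi> x)) \<le> R'" if "x \<in> M \<inter> N" for x
  proof -
    have x: "x \<in> open_tube R'" using that N(2) by simp
    have "norm (snd (\<psi> x)) < R'" using \<psi>_open_tube(1)[OF x R'(3)] by (auto simp: open_solid_torus_def mem_Times_iff)
    moreover have "x \<in> tube \<phi> R" using x tube_mono(3)[of R'] tube_mono(1)[of R' R] R'(2) by auto
    ultimately show ?thesis by simp
  qed
  have "w s x \<in> tangent_space M x \<and> w s x \<noteq> 0" if "s \<in> ?I" "x \<in> ?E" for s x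
    using w1T W(2) that EM by (auto simp: w_def)
  moreover have "w 0 x = W 0 x \<and> w 1 x = W 1 x" for x using ends by (simp add: w_def)
  moreover have "boundary_torus M \<phi> r \<subseteq> N"
    using boundary_point(5)[OF r(1) r1] tube_mono(2)[OF R'(1)] N(2) by blast
  moreover have "w s x = w 0 x" if "s \<in> ?I" "x \<in> ?E \<inter> N" for s x
  proof -
    have "x \<in> M \<inter> N" using that EM by blast
    then show ?thesis using NT[of x] inner[of x s] inner[of x 0] that(1) by (simp add: w_def)
  qed
  ultimately show thesis using that[of w N] wc N(1) by blast
qed

text \<open>The homotopy starts at the push-forward, the restriction of \<open>V\<close>, and ends
  at \<open>v\<close>, because pulling the push-forward back along \<open>H 1\<close>, which is
  \<open>f\<close> on the exterior, returns \<open>v\<close>.\<close>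

lemma push_forward_homotopic:
  assumes r: "0 < r" "r < 1" and cc: "convex_contact r v'"
    and v': "continuous_on (tube \<phi> r) v'" "\<And>x. x \<in> tube \<phi> r \<Longrightarrow> v' x \<in> tangent_space M x" "\<And>x. x \<in> tube \<phi> r \<Longrightarrow> v' x \<noteq> 0"
    and Q: "\<And>a. smooth_map_on M (\<lambda>y. Q y a)" "\<And>y. linear (Q y)"
      "\<And>y a. y \<in> M \<Longrightarrow> Q y a \<in> tangent_space M y" "\<And>y u. u \<in> tangent_space M y \<Longrightarrow> Q y u = u"
    and vol: "continuous_on UNIV (\<lambda>(y, a, b, c). vol y a b c :: real)"
      "\<And>y. y \<in> M \<Longrightarrow> \<exists>\<kappa> C. \<kappa> > 0 \<and> linear C \<and> inj C \<and> range C = tangent_space M y \<and>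
         (\<forall>a b c. vol y (C a) (C b) (C c) = \<kappa> * det3 a b c)"
    and H2: "trivial_group (homology_group 2 (top_of_set M))"
    and f: "f \<in> G_diffeos M (exterior M \<phi> r) (boundary_torus M \<phi> r)"
    and v: "v \<in> pattern_fields M (exterior M \<phi> r) (boundary_torus M \<phi> r) (pattern_of M (exterior M \<phi> r) (boundary_torus M \<phi> r) v')"
  shows "push_forward (exterior M \<phi> r) f v \<in> pattern_fields M (exterior M \<phi> r) (boundary_torus M \<phi> r) (pattern_of M (exterior M \<phi> r) (boundary_torus M \<phi> r) v')"
    "homotopic_fields M (exterior M \<phi> r) (boundary_torus M \<phi> r) (pattern_of M (exterior M \<phi> r) (boundary_torus M \<phi> r) v')
      (push_forward (exterior M \<phi> r) f v) v"
proof -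
  let ?E = "exterior M \<phi> r" and ?B = "boundary_torus M \<phi> r"
  let ?P = "pattern_of M ?E ?B v'" and ?p = "push_forward ?E f v"
  obtain H N where H: "smooth_map_on ({0..1} \<times> M) (\<lambda>(s, x). H s x)" "\<forall>s\<in>{0..1::real}. diffeomorphism M M (H s)"
    "\<forall>x\<in>M. H 0 x = x" "\<forall>x\<in>?E. H 1 x = f x" "open N" "?B \<subseteq> N"
    "\<forall>x\<in>?E \<inter> N. f x = x" "openin (top_of_set M) (open_tube r \<union> M \<inter> N)"
    "tube \<phi> r \<subseteq> open_tube r \<union> M \<inter> N" "\<forall>x\<in>open_tube r \<union> M \<inter> N. H 1 x = x"
    using G_diffeo_isotopy[OF r f] by metis
  let ?S = "open_tube r \<union> M \<inter> N"
  have H1: "diffeomorphism M M (H 1)" using H(2) by simp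
  note p = push_forward_field[OF r f H1 H(4-7) v]
  show "?p \<in> pattern_fields M ?E ?B ?P" by (rule p(1))
  have EM: "?E = M - open_tube r" using exterior_eq[OF r] .
  have tM: "tube \<phi> r \<subseteq> M" using tube_mono(1)[of r 1] tube_1_subset r by auto
  have fields: "smooth_map_on ?E a" "\<And>x. x \<in> ?E \<Longrightarrow> a x \<in> tangent_space M x" "\<And>x. x \<in> ?E \<Longrightarrow> a x \<noteq> 0"
    if "a \<in> pattern_fields M ?E ?B ?P" for a
    using that unfolding pattern_fields_def field_on_def vector_field_along_def by auto
  have Qc: "continuous_on M (\<lambda>y. Q y a)" for a using smooth_map_on_continuous[OF Q(1)] .
  have cE: "compact ?E" unfolding exterior_def
    by (rule compact_closure[THEN iffD2]) (use closed_M(2) compact_imp_bounded bounded_subset in blast)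
  have cB: "compact ?B" unfolding boundary_torus_def using cE compact_tube[of r] r by (simp add: compact_Int)
  have MU: "M = ?E \<union> tube \<phi> r" using EM tM tube_mono(3)[of r] by blast
  have opp: "?p x \<noteq> - (k *\<^sub>R v' x)" if "x \<in> ?E \<inter> tube \<phi> r" "k > 0" for x k
    using pattern_field_not_opposite[OF r cc p(1) _ that(2)] that(1) by (simp add: boundary_torus_def)
  obtain V where V: "continuous_on M V" "\<And>x. x \<in> M \<Longrightarrow> V x \<in> tangent_space M x" "\<And>x. x \<in> M \<Longrightarrow> V x \<noteq> 0" "\<And>x. x \<in> ?E \<Longrightarrow> V x = ?p x"
    using extend_field[OF manifold Qc Q(2-4) MU compact_imp_closed[OF cE] compact_tube[OF less_imp_le[OF r(2)]]
        smooth_map_on_continuous[OF fields(1)[OF p(1)]] fields(2,3)[OF p(1)] v' opp] by metis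
  obtain W where W: "continuous_on ({0..1} \<times> M) (\<lambda>(s, x). W s x)"
    "\<forall>s\<in>{0..1}. \<forall>x\<in>M. W s x \<in> tangent_space M x \<and> W s x \<noteq> 0 \<and> dmap (H s) M x (W s x) = V (H s x)"
    "\<forall>s\<in>{0..1}. \<forall>x. \<forall>u\<in>tangent_space M x. dmap (H s) M x u = V (H s x) \<longrightarrow> W s x = u"
    "\<forall>s\<in>{0..1}. \<forall>x. \<forall>u\<in>tangent_space M x. dmap (H s) M x u = 0 \<longrightarrow> u = 0"
    "\<forall>x\<in>M. W 0 x = V x"
    by (rule pulled_back_fields[OF Q H(1-3) V(1-3)])
  have W1E: "W 1 x = v x" if x: "x \<in> ?E" for x
  proof -
    have "f x \<in> ?E" using f x unfolding G_diffeos_def diffeomorphism_def bij_betw_def by blast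
    then have "dmap (H 1) M x (v x) = V (H 1 x)" using p(2)[OF x] V(4) H(4) x by simp
    then show ?thesis using W(3)[rule_format, of 1] fields(2)[OF v x] by simp
  qed
  obtain S' where S': "open S'" "?S = M \<inter> S'" using H(8) by (auto simp: openin_open)
  \<comment> \<open>\<open>H 1\<close> is the identity near every point of \<open>?S\<close>, so
    pulling back changes nothing there. This makes \<open>W\<close> a loop on a tube slightly
    thicker than the given one.\<close>
  have W1S: "W 1 x = W 0 x" if x: "x \<in> ?S" for x
  proof -
    have xM: "x \<in> M" using x S'(2) by blast
    have "dmap (H 1) M x (V x) = dmap (\<lambda>x. x) M x (V x)"
      by (rule dmap_cong[OF diffeomorphism_inverse(1)[OF H1] smooth_map_on_ident V(2)[OF xM] V(2)[OF xM] S'(1)])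
        (use H(10) S'(2) x in auto)
    then have "dmap (H 1) M x (V x) = V (H 1 x)" using dmap_ident[OF V(2)[OF xM]] H(10) x by simp
    then show ?thesis using W(3)[rule_format, of 1] W(5) V(2)[OF xM] xM by simp
  qed
  obtain R where R: "r < R" "R < 1" "tube \<phi> R \<subseteq> ?S" using tube_thicken[OF less_imp_le[OF r(1)] r(2) H(8,9)] by blast
  have KS: "K \<subseteq> ?S" using K_subset[of r] r(1) H(9) by auto
  have deg: "core_degree_zero (\<lambda>p. coframe (\<phi> (fst p)) (W (snd p) (\<phi> (fst p))))"
    by (rule tube_degree[OF Q vol H2 H(1-3,8) KS H(10) W(4) V(1-3) W(2)])
  have WT: "W s x \<in> tangent_space M x \<and> W s x \<noteq> 0" if "s \<in> {0..1}" "x \<in> M" for s x using W(2) that by blast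
  have WR: "W 1 x = W 0 x" if "x \<in> tube \<phi> R" for x using W1S R(3) that by blast
  obtain w N1 where w: "continuous_on ({0..1::real} \<times> ?E) (\<lambda>(s, x). w s x)"
    "\<forall>s\<in>{0..1}. \<forall>x\<in>?E. w s x \<in> tangent_space M x \<and> w s x \<noteq> 0"
    "\<forall>x\<in>?E. w 0 x = W 0 x \<and> w 1 x = W 1 x"
    "open N1" "?B \<subseteq> N1" "\<forall>s\<in>{0..1}. \<forall>x\<in>?E \<inter> N1. w s x = w 0 x"
    by (rule contract_near_boundary[OF r(1) R(1,2) W(1) WT WR deg])
  have w0: "w 0 x = ?p x" and w1: "w 1 x = v x" if "x \<in> ?E" for x
    using w(3) W(5) V(4)[OF that] W1E[OF that] that EM by auto
  have ws: "smooth_map_on ?E (w 0)" "smooth_map_on ?E (w 1)"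
    using smooth_map_on_cong[OF fields(1)[OF p(1)]] smooth_map_on_cong[OF fields(1)[OF v]] w0 w1 by auto
  have EM': "?E \<subseteq> M" using EM by blast
  have wT: "w s x \<in> tangent_space M x" "w s x \<noteq> 0" if "s \<in> {0..1}" "x \<in> ?E" for s x using w(2) that by auto
  have wB: "w s x = w 0 x" if "s \<in> {0..1}" "x \<in> ?E \<inter> N1" for s x using w(6) that by blast
  obtain H' N' where H': "smooth_map_on ({0..1::real} \<times> ?E) (\<lambda>(s, x). H' s x)"
    "\<forall>s\<in>{0..1}. \<forall>x\<in>?E. H' s x \<in> tangent_space M x \<and> H' s x \<noteq> 0" "\<forall>x\<in>?E. H' 0 x = w 0 x \<and> H' 1 x = w 1 x"
    "open N'" "?B \<subseteq> N'" "\<forall>s\<in>{0..1}. \<forall>x\<in>?E \<inter> N'. H' s x = w 0 x"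
    by (rule smooth_field_homotopy[OF manifold Q cE EM' cB w(4,5,1) wT ws wB])
  \<comment> \<open>Near the boundary torus every stage equals the push-forward, so it satisfies the
    pattern conditions exactly.\<close>
  have "H' s \<in> pattern_fields M ?E ?B ?P" if s: "s \<in> {0..1}" for s
  proof (rule pattern_fields_cong[OF p(1) _ H'(4,5)])
    have "smooth_map_on ?E (\<lambda>x. (\<lambda>(s, x). H' s x) (s, x))"
      by (rule smooth_map_on_compose[OF H'(1)]) (use s in \<open>auto intro!: smooth_map_on_Pair smooth_map_on_ident\<close>)
    then show "field_on M ?E (H' s)" unfolding field_on_def vector_field_along_def using H'(2) s by simp
    show "H' s y = ?p y" if "y \<in> ?E \<inter> N'" for y using H'(6) s w0 that by simp
  qed (simp add: boundary_torus_def)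
  then show "homotopic_fields M ?E ?B ?P ?p v"
    unfolding homotopic_fields_def using H'(1,3) w0 w1 by (intro exI[of _ H']) auto
qed

end

lemma good_framed_knotI:
  fixes M :: "'a::euclidean_space set"
  assumes M: "oriented_atlas M \<A>" "integral_homology_3sphere M" and F: "framing M K F"
  shows "good_framed_knot M K F"
  unfolding good_framed_knot_def
proof (intro allI impI)
  fix \<phi> v assume a: "tubular_param M K \<phi> \<and> extends_framing M K F v"
  have closed: "closed_3manifold M" using M(2) by (simp add: integral_homology_3sphere_def)
  interpret tubular_neighbourhood M K \<phi> by unfold_locales (use closed a in auto)
  obtain N where N: "open N" "K \<subseteq> N" "field_on M (M \<inter> N) v" and vF: "\<forall>x\<in>K. v x = F x"
    using a unfolding extends_framing_def by blast
  have "v x \<notin> tangent_space K x" if "x \<in> K" for x using F vF that unfolding framing_def by auto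
  then obtain R where R: "0 < R" "R < 1" "tube \<phi> R \<subseteq> N" "\<forall>r. 0 < r \<longrightarrow> r \<le> R \<longrightarrow> convex_contact r v"
    using convex_contact_near_knot[OF N] by metis
  obtain Q where Q: "\<forall>a. smooth_map_on M (\<lambda>y. Q y a)" "\<forall>y. linear (Q y)"
    "\<forall>y a. y \<in> M \<longrightarrow> Q y a \<in> tangent_space M y" "\<forall>y u. u \<in> tangent_space M y \<longrightarrow> Q y u = u"
    using tangent_projection[OF closed] by metis
  obtain vol where vol: "continuous_on UNIV (\<lambda>(y, a, b, c). vol y a b c :: real)"
    "\<forall>y. y \<in> M \<longrightarrow> (\<exists>\<kappa> C. \<kappa> > 0 \<and> linear C \<and> inj C \<and> range C = tangent_space M y \<and>
       (\<forall>a b c. vol y (C a) (C b) (C c) = \<kappa> * det3 a b c))"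
    using volume_form[OF closed M(1)] by metis
  have "\<forall>g\<in>G_group M (exterior M \<phi> r) (boundary_torus M \<phi> r). \<forall>e\<in>Eul M (exterior M \<phi> r) (boundary_torus M \<phi> r) (pattern_of M (exterior M \<phi> r) (boundary_torus M \<phi> r) v).
      euler_action M (exterior M \<phi> r) (boundary_torus M \<phi> r) (pattern_of M (exterior M \<phi> r) (boundary_torus M \<phi> r) v) g e = e"
    if r: "0 < r" "r < R" for r
  proof (intro ballI, rule euler_action_trivial, assumption, assumption)
    have r1: "r < 1" using r R(2) by simp
    have tN: "tube \<phi> r \<subseteq> M \<inter> N" using tube_mono(1)[of r R] tube_mono(1)[of r 1] tube_1_subset r r1 R(3) by auto
    have vt: "continuous_on (tube \<phi> r) v" "\<And>x. x \<in> tube \<phi> r \<Longrightarrow> v x \<in> tangent_space M x" "\<And>x. x \<in> tube \<phi> r \<Longrightarrow> v x \<noteq> 0"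
      using N(3) tN continuous_on_subset[OF smooth_map_on_continuous tN] unfolding field_on_def vector_field_along_def by auto
    have cc: "convex_contact r v" using R(4) r by simp
    show "boundary_torus M \<phi> r \<subseteq> exterior M \<phi> r" by (simp add: boundary_torus_def)
    fix f u assume "f \<in> G_diffeos M (exterior M \<phi> r) (boundary_torus M \<phi> r)"
      "u \<in> pattern_fields M (exterior M \<phi> r) (boundary_torus M \<phi> r) (pattern_of M (exterior M \<phi> r) (boundary_torus M \<phi> r) v)"
    note push_forward_homotopic[OF r(1) r1 cc vt Q[rule_format] vol(1) vol(2)[rule_format] homology_sphere_trivial[OF M(2)] this]
    then show "push_forward (exterior M \<phi> r) f u \<in> pattern_fields M (exterior M \<phi> r) (boundary_torus M \<phi> r) (pattern_of M (exterior M \<phi> r) (boundary_torus M \<phi> r) v) \<and>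
      homotopic_fields M (exterior M \<phi> r) (boundary_torus M \<phi> r) (pattern_of M (exterior M \<phi> r) (boundary_torus M \<phi> r) v) (push_forward (exterior M \<phi> r) f u) u"
      by blast
  qed
  then show "\<forall>\<^sub>F r in at_right 0. let E = exterior M \<phi> r; B = boundary_torus M \<phi> r; P = pattern_of M E B v in
      \<forall>g\<in>G_group M E B. \<forall>e\<in>Eul M E B P. euler_action M E B P g e = e"
    unfolding Let_def eventually_at_right_field using R(1) by blast
qed

theorem theorem2p5:
  fixes M :: "'a::euclidean_space set"
    and \<A> :: "((real^3) set \<times> (real^3 \<Rightarrow> 'a)) set"
    and K :: "'a set"
  assumes "oriented_atlas M \<A>"
    and "integral_homology_3sphere M"
    and "knot M K"
  shows "good_knot M K"
  unfolding good_knot_def using good_framed_knotI[OF assms(1,2)] by blast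

end
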